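(* Let $p$ be a prime, let $0<v<1$ and $\frac1p<\alpha\le 1$ be constants, and let $G$ be a finite abelian $p$-group. For each $n\ge 1$ let $\vec G_\alpha(n,v)$ be the directed Erdős–Rényi random bipartite graph with vertex classes $V_1,V_2$ of sizes $|V_1|=n$, $|V_2|=\lceil \alpha n\rceil$ and edge probability $v$, let $S_{\vec G_\alpha(n,v)}$ be its sandpile group, and let $(S_{\vec G_\alpha(n,v)})_p$ be the Sylow $p$-subgroup of the sandpile group. Then $$\lim_{n\to\infty}\mathbb P\big[(S_{\vec G_\alpha(n,v)})_p\cong G\big]=P_{\infty,\frac1p}(G)=\frac{1}{|G|\,|\mathrm{Aut}(G)|}\prod_{j=0}^{\infty}\big(1-p^{-2-j}\big).$$
   Context: The random graph: given disjoint vertex sets $V_1,V_2$ of sizes $n_1,n_2$, each of the $2n_1n_2$ potential directed edges (from a vertex of $V_1$ to a vertex of $V_2$, or from a vertex of $V_2$ to a vertex of $V_1$) is included independently with probability $v$; there are no other edges. Sandpile group: for a loopless directed graph $\vec\Gamma$ on vertices $1,\dots,N$, let $\deg(i,j)$ be the number of directed edges $i\to j$ and $\deg(j)=\sum_{i\ne j}\deg(i,j)$ the in-degree of $j$. The Laplacian $L$ is the $N\times N$ integer matrix with $L_{ij}=\deg(i,j)$ for $i\neq j$ and $L_{jj}=-\deg(j)$; every column sums to $0$. Let $\mathbb Z_0^N\subseteq\mathbb Z^N$ be the subgroup of vectors with entries summing to $0$. Then $L:\mathbb Z^N\to\mathbb Z^N$ has image inside $\mathbb Z_0^N$ and the sandpile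 group is $S_{\vec\Gamma}:=\mathbb Z_0^N/\mathrm{im}(L)$. It is a finite abelian group whenever $\vec\Gamma$ is strongly connected. The event $(S)_p\cong G$ is read as: $S$ is finite and its Sylow $p$-subgroup is isomorphic to $G$. For $0<u<p$, $P_{\infty,u}$ is the measure on (isomorphism classes of) finite abelian $p$-groups given by $P_{\infty,u}(G)=\frac{|G|^{\log_p(u)}}{|\mathrm{Aut}(G)|}\prod_{j=0}^\infty\big(1-\tfrac{u}{p}p^{-j}\big)$. *)

theory Defs
  imports
    "HOL-Probability.Probability"
    "HOL-Algebra.Algebra"
    "Graph_Theory.Graph_Theory"
    "Jordan_Normal_Form.Matrix"
begin

section \<open>Sandpile groups\<close>

text \<open>
  Digraphs may have parallel arcs but are assumed loopless. A digraph on \<open>N\<close> vertices has vertex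
  set \<open>{0..<N}\<close>, so that its vertices are the row and column indices of the Laplacian.
\<close>

definition arc_count :: "('v, 'e) pre_digraph \<Rightarrow> 'v \<Rightarrow> 'v \<Rightarrow> nat" where
  "arc_count D i j = card {e \<in> arcs D. tail D e = i \<and> head D e = j}"

text \<open>The diagonal carries the negated in-degrees, so the columns of the Laplacian sum to 0.\<close>

definition laplacian :: "(nat, 'e) pre_digraph \<Rightarrow> int mat" where
  "laplacian D = (let N = card (verts D) in
     mat N N (\<lambda>(i, j). if i = j then - (\<Sum>k\<in>{0..<N} - {j}. int (arc_count D k j))
                       else int (arc_count D i j)))"

definition sum_zero_group :: "nat \<Rightarrow> int vec monoid" where
  "sum_zero_group N =
     (monoid_vec TYPE(int) N) \<lparr>carrier := {x \<in> carrier_vec N. (\<Sum>i<N. x $ i) = 0}\<rparr>"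

definition laplacian_image :: "(nat, 'e) pre_digraph \<Rightarrow> int vec set" where
  "laplacian_image D = (*\<^sub>v) (laplacian D) ` carrier_vec (card (verts D))"

definition sandpile_group :: "(nat, 'e) pre_digraph \<Rightarrow> int vec set monoid" where
  "sandpile_group D = sum_zero_group (card (verts D)) Mod laplacian_image D"

lemma comm_group_sum_zero_group: "comm_group (sum_zero_group N)"
proof (rule comm_groupI)
  fix x assume x: "x \<in> carrier (sum_zero_group N)"
  have "- x \<in> carrier (sum_zero_group N)" "- x \<otimes>\<^bsub>sum_zero_group N\<^esub> x = \<one>\<^bsub>sum_zero_group N\<^esub>"
    using x by (auto simp: sum_zero_group_def monoid_vec_def sum_negf)
  thus "\<exists>y\<in>carrier (sum_zero_group N). y \<otimes>\<^bsub>sum_zero_group N\<^esub> x = \<one>\<^bsub>sum_zero_group N\<^esub>" by blast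
qed (auto simp: sum_zero_group_def monoid_vec_def sum.distrib intro: assoc_add_vec comm_add_vec)

lemma laplacian_column_sum:
  assumes "j < card (verts D)"
  shows "(\<Sum>i<card (verts D). laplacian D $$ (i, j)) = 0"
proof -
  let ?N = "card (verts D)"
  have "(\<Sum>i<?N. laplacian D $$ (i, j)) =
      laplacian D $$ (j, j) + (\<Sum>i\<in>{0..<?N} - {j}. laplacian D $$ (i, j))"
    using assms by (subst sum.remove[of _ j]) (auto simp: lessThan_atLeast0)
  also have "(\<Sum>i\<in>{0..<?N} - {j}. laplacian D $$ (i, j)) =
      (\<Sum>i\<in>{0..<?N} - {j}. int (arc_count D i j))"
    using assms by (intro sum.cong) (auto simp: laplacian_def Let_def)
  finally show ?thesis using assms by (simp add: laplacian_def Let_def)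
qed

lemma laplacian_carrier: "laplacian D \<in> carrier_mat (card (verts D)) (card (verts D))"
  by (simp add: laplacian_def Let_def)

lemma laplacian_image_normal: "laplacian_image D \<lhd> sum_zero_group (card (verts D))"
proof -
  let ?N = "card (verts D)" and ?L = "laplacian D"
  interpret Z: comm_group "sum_zero_group ?N" by (rule comm_group_sum_zero_group)
  note L = laplacian_carrier[of D]
  have sub: "?L *\<^sub>v x \<in> carrier (sum_zero_group ?N)" if x: "x \<in> carrier_vec ?N" for x
  proof -
    have "(\<Sum>i<?N. (?L *\<^sub>v x) $ i) = (\<Sum>i<?N. \<Sum>j<?N. ?L $$ (i, j) * x $ j)"
      using L x by (intro sum.cong) (auto simp: scalar_prod_def lessThan_atLeast0)
    also have "\<dots> = (\<Sum>j<?N. (\<Sum>i<?N. ?L $$ (i, j)) * x $ j)"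
      by (subst sum.swap) (simp add: sum_distrib_right)
    also have "\<dots> = 0" by (simp add: laplacian_column_sum)
    finally show ?thesis using L x by (auto simp: sum_zero_group_def)
  qed
  have "subgroup (laplacian_image D) (sum_zero_group ?N)"
  proof (rule Z.subgroupI)
    show "laplacian_image D \<subseteq> carrier (sum_zero_group ?N)"
      using sub by (auto simp: laplacian_image_def)
    show "laplacian_image D \<noteq> {}"
      by (auto simp: laplacian_image_def intro: zero_carrier_vec)
  next
    fix a assume "a \<in> laplacian_image D"
    then obtain x where x: "x \<in> carrier_vec ?N" "a = ?L *\<^sub>v x" by (auto simp: laplacian_image_def)
    have a: "a = ?L *\<^sub>v x" "- a = ?L *\<^sub>v (- x)"
      using x L by (auto simp: uminus_mult_mat_vec)
    have "inv\<^bsub>sum_zero_group ?N\<^esub> a = - a"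
    proof (rule Z.inv_equality)
      show "a \<in> carrier (sum_zero_group ?N)" "- a \<in> carrier (sum_zero_group ?N)"
        using sub[of x] sub[of "- x"] x a by auto
      show "- a \<otimes>\<^bsub>sum_zero_group ?N\<^esub> a = \<one>\<^bsub>sum_zero_group ?N\<^esub>"
        using sub[of x] x by (auto simp: sum_zero_group_def monoid_vec_def)
    qed
    thus "inv\<^bsub>sum_zero_group ?N\<^esub> a \<in> laplacian_image D"
      using x a by (auto simp: laplacian_image_def)
  next
    fix a b assume "a \<in> laplacian_image D" "b \<in> laplacian_image D"
    then obtain x y where "x \<in> carrier_vec ?N" "a = ?L *\<^sub>v x" "y \<in> carrier_vec ?N" "b = ?L *\<^sub>v y"
      by (auto simp: laplacian_image_def)
    moreover from this have "a + b = ?L *\<^sub>v (x + y)"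
      using mult_add_distrib_mat_vec[OF L] by auto
    ultimately show "a \<otimes>\<^bsub>sum_zero_group ?N\<^esub> b \<in> laplacian_image D"
      by (auto simp: laplacian_image_def sum_zero_group_def monoid_vec_def)
  qed
  thus ?thesis by (rule Z.subgroup_imp_normal)
qed

lemma comm_group_sandpile_group: "comm_group (sandpile_group D)"
  unfolding sandpile_group_def
  using comm_group.abelian_FactGroup[OF comm_group_sum_zero_group]
    normal_imp_subgroup[OF laplacian_image_normal] by blast

section \<open>Sylow subgroups and the limiting measure\<close>

definition sylow_subgroup :: "nat \<Rightarrow> ('a, 'b) monoid_scheme \<Rightarrow> 'a set \<Rightarrow> bool" where
  "sylow_subgroup p S H \<longleftrightarrow>
     finite (carrier S) \<and> subgroup H S \<and> card H = p ^ multiplicity p (Coset.order S)"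

text \<open>
  A finite abelian group has exactly one Sylow \<open>p\<close>-subgroup, so the quantifier below only names it;
  the predicate is false for infinite \<open>S\<close>.
\<close>

definition sylow_part_iso ::
    "nat \<Rightarrow> ('a, 'b) monoid_scheme \<Rightarrow> ('c, 'd) monoid_scheme \<Rightarrow> bool" where
  "sylow_part_iso p S G \<longleftrightarrow> (\<exists>H. sylow_subgroup p S H \<and> S\<lparr>carrier := H\<rparr> \<cong> G)"

definition finite_abelian_p_group :: "nat \<Rightarrow> ('a, 'b) monoid_scheme \<Rightarrow> bool" where
  "finite_abelian_p_group p G \<longleftrightarrow>
     comm_group G \<and> finite (carrier G) \<and> (\<exists>k. Coset.order G = p ^ k)"

text \<open>The mass given to the isomorphism class of \<open>G\<close>, for \<open>0 < u < p\<close>.\<close>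

definition P_infinity :: "nat \<Rightarrow> real \<Rightarrow> ('a, 'b) monoid_scheme \<Rightarrow> real" where
  "P_infinity p u G =
     real (Coset.order G) powr log (real p) u / real (Coset.order (AutoGroup G))
       * prodinf (\<lambda>j. 1 - u / real p * real p powi (- int j))"

section \<open>Random bipartite digraphs\<close>

definition bipartite_arcs :: "nat \<Rightarrow> nat \<Rightarrow> (nat \<times> nat) set" where
  "bipartite_arcs n1 n2 =
     {0..<n1} \<times> {n1..<n1 + n2} \<union> {n1..<n1 + n2} \<times> {0..<n1}"

definition random_bipartite_digraph ::
    "nat \<Rightarrow> nat \<Rightarrow> real \<Rightarrow> (nat, nat \<times> nat) pre_digraph pmf" where
  "random_bipartite_digraph n1 n2 v =
     map_pmf
       (\<lambda>b. with_proj \<lparr>pverts = {0..<n1 + n2}, parcs = {e \<in> bipartite_arcs n1 n2. b e}\<rparr>)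
       (Pi_pmf (bipartite_arcs n1 n2) False (\<lambda>_. bernoulli_pmf v))"

end

theory Submission
  imports Defs "HOL-Number_Theory.Cong" "HOL-Combinatorics.Permutations" "Jordan_Normal_Form.Determinant"
begin

text \<open>
  The proof computes surjection moments and inverts them. Let \<open>Q\<close> be the quotient of the sandpile group by
  its \<open>p ^ Suc k\<close>-th powers, where \<open>p ^ k\<close> is the order of \<open>G\<close>. This quotient is finite, and the sandpile
  group has Sylow part \<open>G\<close> exactly when \<open>Q\<close> is isomorphic to \<open>G\<close>
  (\<open>sylow_part_iso_iff_power_quotient\<close>).

  Moments. A surjection from \<open>Q\<close> to a finite abelian group \<open>M\<close> is a labelling \<open>f\<close> of the vertices by elements of
  \<open>M\<close> with \<open>f 0 = 1\<close> whose values generate \<open>M\<close> and which satisfies, at each vertex \<open>j\<close>, the equation that the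
  product of \<open>f\<close> over the in-neighbours of \<open>j\<close> is \<open>f j\<close> to the power of the in-degree
  (\<open>card_surs_sandpile\<close>). Distinct vertices have independent in-neighbourhoods, so the probability that \<open>f\<close> is a
  solution is a product over the vertices. If every value in \<open>M\<close> is taken often by \<open>f\<close> on both sides, each
  factor is exponentially close to \<open>1 / |M|\<close>; such labellings contribute \<open>1 / |M|\<close> in total. All other
  labellings are grouped by their sets of frequent values on the two sides, and each group contributes an
  exponentially small amount (\<open>pattern_sum_different\<close>, \<open>pattern_sum_same\<close>). For this one has to discard a rare
  event: a labelling supported in few cosets on the larger side is too likely to be a solution when more than
  \<open>\<tau> n\<close> vertices of that side have in-degree divisible by \<open>p\<close>. The expected fraction of such vertices is \<open>1 / p\<close>, and
  the hypothesis \<open>1 / p < \<alpha>\<close> leaves room for a threshold \<open>\<tau>\<close> between \<open>1 / p\<close> and \<open>\<alpha>\<close>. The result is that the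
  truncated moment tends to \<open>1 / |M|\<close> for every \<open>M\<close> (\<open>moment_limit\<close>).

  Inversion. Automorphisms of \<open>G\<close> correspond to surjections \<open>\<pi>\<close> from \<open>Q\<close> onto \<open>G\<close> with trivial kernel. Triviality of
  the \<open>p\<close>-torsion of the kernel is detected by an alternating sum over surjections from the kernel onto
  elementary abelian groups, and truncating this sum gives upper and lower bounds in turn
  (\<open>surjection_bonferroni\<close>). A pair of a surjection onto \<open>G\<close> and a surjection of its kernel onto an elementary
  abelian group factors through a quotient of \<open>Q\<close> of known order, so the counts of pairs are finite combinations of
  surjection moments (\<open>card_labelled_quotients\<close>). Their limits can be evaluated because the same identity holds for
  quotients of free groups (\<open>sum_card_ext_pairs\<close>). The series of limits is Euler's expansion of the infinite
  product (\<open>euler_product\<close>). Since every truncation is a finite sum, no exchange of an infinite sum with the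
  limit occurs.
\<close>

section \<open>The Euler product\<close>

text \<open>
  Over a field with \<open>P\<close> elements, the Moebius function of an \<open>i\<close>-dimensional space divided by the number of its
  automorphisms.
\<close>

definition sgn_coeff :: "real => nat => real" where
  "sgn_coeff P i = (-1) ^ i / (\<Prod>j<i. P ^ Suc j - 1)"

text \<open>
  The partial sums telescope to a product, from which their zeros and their signs can be read off.
\<close>

lemma newton_series_eq_prod:
  fixes P z :: real
  assumes "P > 1"
  shows "(\<Sum>i\<le>k. \<Prod>j<i. (P ^ j - z) / (P ^ Suc j - 1)) = (\<Prod>j<k. (P ^ Suc j - z) / (P ^ Suc j - 1))"
proof (induction k)
  case (Suc k)
  let ?D = "\<lambda>k. \<Prod>j<k. (P ^ Suc j - 1)"
  have nz: "P ^ Suc j - 1 ~= 0" for j using one_less_power[OF assms, of "Suc j"] by simp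
  have D: "?D k ~= 0" for k using nz by simp
  have e: "(\<Prod>j<Suc k. (P ^ j - z)) = (1 - z) * (\<Prod>j<k. (P ^ Suc j - z))"
    by (subst prod.lessThan_Suc_shift) simp
  have "(\<Sum>i\<le>Suc k. \<Prod>j<i. (P ^ j - z) / (P ^ Suc j - 1)) =
     (\<Prod>j<k. P ^ Suc j - z) / ?D k + (1 - z) * (\<Prod>j<k. (P ^ Suc j - z)) / (?D k * (P ^ Suc k - 1))"
    unfolding sum.atMost_Suc Suc.IH by (simp only: prod_dividef e) (simp only: prod.lessThan_Suc)
  also have "\<dots> = (\<Prod>j<k. P ^ Suc j - z) * (P ^ Suc k - z) / (?D k * (P ^ Suc k - 1))"
    using D[of k] nz[of k] by (simp add: divide_simps) (simp add: algebra_simps)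
  finally show ?case by (simp only: prod_dividef prod.lessThan_Suc)
qed simp

lemma newton_series_power:
  fixes P :: real
  assumes "P > 1"
  shows "(\<Sum>i\<le>k. sgn_coeff P i * (\<Prod>j<i. P ^ r - P ^ j)) = (\<Prod>j<k. (P ^ Suc j - P ^ r) / (P ^ Suc j - 1))"
proof -
  have "sgn_coeff P i * (\<Prod>j<i. P ^ r - P ^ j) = (\<Prod>j<i. (P ^ j - P ^ r) / (P ^ Suc j - 1))" for i
  proof -
    have "(\<Prod>j<i. (P ^ j - P ^ r)) = (\<Prod>j<i. (-1) * (P ^ r - P ^ j))" by (intro prod.cong) auto
    also have "\<dots> = (-1)^i * (\<Prod>j<i. P ^ r - P ^ j)" by (subst prod.distrib) simp
    finally show ?thesis by (simp add: sgn_coeff_def prod_dividef)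
  qed
  thus ?thesis using newton_series_eq_prod[OF assms, of "P ^ r" k] by simp
qed

text \<open>
  In the product form, the factor with exponent \<open>r\<close> vanishes when \<open>1 <= r <= k\<close>, and for \<open>r > k\<close> all \<open>k\<close> factors are
  negative. This is the analogue of the Bonferroni inequalities for the lattice of subspaces.
\<close>

lemma bonferroni_power:
  fixes P :: real
  assumes P: "P > 1"
  shows "even k ==> of_bool (r = 0) <= (\<Sum>i\<le>k. sgn_coeff P i * (\<Prod>j<i. P ^ r - P ^ j))"
    and "odd k ==> (\<Sum>i\<le>k. sgn_coeff P i * (\<Prod>j<i. P ^ r - P ^ j)) <= of_bool (r = 0)"
proof -
  let ?S = "\<Prod>j<k. (P ^ Suc j - P ^ r) / (P ^ Suc j - 1)"
  have pos: "P ^ Suc j - 1 > 0" for j using one_less_power[OF P, of "Suc j"] by simp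
  have 1: "?S = 1" if "r = 0" using that pos by (intro prod.neutral) (metis divide_self_if less_irrefl power_0)
  have 2: "?S = 0" if "r > 0" "r <= k"
  proof (rule prod_zero)
    show "\<exists>a\<in>{..<k}. (P ^ Suc a - P ^ r) / (P ^ Suc a - 1) = 0"
      using that by (intro bexI[of _ "r - 1"]) auto
  qed simp
  have 3: "?S = (-1)^k * (\<Prod>j<k. (P ^ r - P ^ Suc j) / (P ^ Suc j - 1))" 
  proof -
    have "?S = (\<Prod>j<k. (-1) * ((P ^ r - P ^ Suc j) / (P ^ Suc j - 1)))"
      by (intro prod.cong) (auto simp: field_simps minus_divide_left simp flip: minus_divide_left)
    thus ?thesis by (subst (asm) prod.distrib) simp
  qed
  have 4: "(\<Prod>j<k. (P ^ r - P ^ Suc j) / (P ^ Suc j - 1)) \<ge> 0" if "r > k"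
  proof (intro prod_nonneg ballI divide_nonneg_pos)
    fix j assume "j \<in> {..<k}"
    thus "P ^ r - P ^ Suc j \<ge> 0" using that P by (simp add: power_increasing del: power_Suc)
  qed (use pos in auto)
  show "even k ==> of_bool (r = 0) <= (\<Sum>i\<le>k. sgn_coeff P i * (\<Prod>j<i. P ^ r - P ^ j))"
    unfolding newton_series_power[OF P] using 1 2 3 4 
    by (cases "r = 0"; cases "r <= k") (simp_all del: prod_zero_iff power_Suc)
  show "odd k ==> (\<Sum>i\<le>k. sgn_coeff P i * (\<Prod>j<i. P ^ r - P ^ j)) <= of_bool (r = 0)"
    unfolding newton_series_power[OF P] using 1 2 3 4
    by (cases "r = 0"; cases "r <= k") (simp_all del: prod_zero_iff power_Suc)
qed

lemma abs_sgn_coeff_le: 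
  fixes P :: real assumes "P \<ge> 2" shows "\<bar>sgn_coeff P i\<bar> <= 1"
proof -
  have ge: "P ^ Suc j - 1 \<ge> 1" for j 
  proof -
    have "(2::real) ^ 1 <= 2 ^ Suc j" by (intro power_increasing) auto
    also have "\<dots> <= P ^ Suc j" using assms by (intro power_mono) auto
    finally show ?thesis by simp
  qed
  have "(\<Prod>j<i. P ^ Suc j - 1) \<ge> 1" by (rule prod_ge_1) (use ge in auto)
  thus ?thesis by (simp add: sgn_coeff_def abs_mult power_abs divide_le_eq_1 del: power_Suc)
qed

text \<open>
  Euler's expansion of the infinite product of \<open>1 - y * P powi (- 1 - j)\<close>, at \<open>y = 1 / P\<close>.
\<close>

lemma euler_product:
  fixes P :: real
  assumes P: "P \<ge> 2"
  shows "(\<lambda>k. \<Sum>i\<le>k. sgn_coeff P i * (1 / P) ^ i) \<longlonglongrightarrow> prodinf (\<lambda>j. 1 - P powi (- 2 - int j))"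
proof -
  define F where "F x = suminf (\<lambda>i. sgn_coeff P i * x ^ i)" for x :: real
  have summ: "summable (\<lambda>i. sgn_coeff P i * x ^ i)" if "\<bar>x\<bar> < 1" for x
  proof (rule summable_comparison_test)
    show "\<exists>N. \<forall>n\<ge>N. norm (sgn_coeff P n * x ^ n) <= \<bar>x\<bar> ^ n"
    proof (intro exI allI impI)
      fix n show "norm (sgn_coeff P n * x ^ n) <= \<bar>x\<bar> ^ n"
        using mult_right_mono[OF abs_sgn_coeff_le[OF P, of n], of "\<bar>x\<bar>^n"] by (simp add: abs_mult power_abs)
    qed
    show "summable (\<lambda>n. \<bar>x\<bar> ^ n)" using that by (simp add: summable_geometric)
  qed
  have rec: "sgn_coeff P (Suc i) * (P ^ Suc i - 1) = - sgn_coeff P i" for i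
  proof -
    have "P ^ Suc i - 1 ~= 0" using one_less_power[of P "Suc i"] P by simp
    thus ?thesis by (simp add: sgn_coeff_def)
  qed
  have step: "F x = (1 - x / P) * F (x / P)" if x: "\<bar>x\<bar> < 1" for x
  proof -
    have "\<bar>x / P\<bar> <= \<bar>x\<bar>" using P by (simp add: divide_le_eq mult_le_cancel_left1)
    hence xP: "\<bar>x / P\<bar> < 1" using x by linarith
    have s1: "(\<lambda>i. sgn_coeff P i * x ^ i) sums F x" unfolding F_def using summ[OF x] by (rule summable_sums)
    have s2: "(\<lambda>i. sgn_coeff P i * (x / P) ^ i) sums F (x / P)" unfolding F_def using summ[OF xP] by (rule summable_sums)
    define g where "g i = sgn_coeff P i * x ^ i - sgn_coeff P i * (x / P) ^ i" for i
    have "g sums (F x - F (x / P))" unfolding g_def by (rule sums_diff[OF s1 s2])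
    hence "(\<lambda>i. g (Suc i)) sums (F x - F (x / P))" using sums_Suc_iff[of g "F x - F (x/P)"] by (simp add: g_def)
    moreover have "g (Suc i) = - (x / P) * (sgn_coeff P i * (x / P) ^ i)" for i
    proof -
      have "g (Suc i) = sgn_coeff P (Suc i) * (P ^ Suc i - 1) * (x / P) ^ Suc i"
        using P by (simp add: g_def power_divide field_simps)
      thus ?thesis unfolding rec by simp
    qed
    ultimately have "(\<lambda>i. - (x / P) * (sgn_coeff P i * (x / P) ^ i)) sums (F x - F (x / P))" by simp
    moreover have "(\<lambda>i. - (x / P) * (sgn_coeff P i * (x / P) ^ i)) sums (- (x / P) * F (x / P))"
      by (rule sums_mult[OF s2])
    ultimately have "F x - F (x / P) = - (x / P) * F (x / P)" by (rule sums_unique2)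
    thus ?thesis by (simp add: algebra_simps)
  qed
  have bd: "\<bar>(1 / P) ^ Suc m\<bar> < 1" for m using P power_Suc_less_one[of "1/P" m] by auto
  have prod: "F (1 / P) = (\<Prod>j<m. 1 - P powi (- 2 - int j)) * F ((1 / P) ^ Suc m)" for m
  proof (induction m)
    case (Suc m)
    have e: "1 - (1 / P) ^ Suc m / P = 1 - P powi (- 2 - int m)"
      using P by (simp add: power_int_diff power_int_minus field_simps power2_eq_square)
    have "F ((1 / P) ^ Suc m) = (1 - P powi (- 2 - int m)) * F ((1 / P) ^ Suc (Suc m))"
      using step[OF bd[of m]] unfolding e by simp
    thus ?case using Suc by simp
  qed simp
  have "F 0 = 1" unfolding F_def by (subst powser_zero) (simp add: sgn_coeff_def)
  moreover have "isCont F 0"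
  proof -
    have "isCont (\<lambda>x. suminf (\<lambda>n. sgn_coeff P n * x ^ n)) 0"
      by (rule isCont_powser[OF summ[of "1/2"]]) auto
    thus ?thesis unfolding F_def by simp
  qed
  moreover have "(\<lambda>m. (1 / P) ^ Suc m) \<longlonglongrightarrow> 0"
    using P by (intro LIMSEQ_Suc LIMSEQ_power_zero) auto
  ultimately have F1: "(\<lambda>m. F ((1 / P) ^ Suc m)) \<longlonglongrightarrow> 1"
    using isCont_tendsto_compose by fastforce
  have sp: "summable (\<lambda>j. \<bar>- (P powi (- 2 - int j))\<bar>)"
  proof -
    have "\<bar>- (P powi (- 2 - int j))\<bar> = (1/P)^2 * (1/P)^j" for j
      using P by (simp add: power_int_diff power_int_minus field_simps)
    thus ?thesis using P by (simp add: summable_mult summable_geometric)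
  qed
  have conv: "convergent_prod (\<lambda>j. 1 - P powi (- 2 - int j))"
  proof -
    have "P powi (- 2 - int j) < 1" for j
    proof -
      have "P powi (- 2 - int j) = (1 / P) ^ Suc (Suc j)"
        using P by (simp add: power_int_diff power_int_minus field_simps power2_eq_square)
      also have "\<dots> < 1" using bd[of "Suc j"] by linarith
      finally show ?thesis .
    qed
    hence "- (P powi (- 2 - int j)) ~= - 1" for j by (metis minus_minus less_irrefl)
    from summable_imp_convergent_prod_real[OF sp this] show ?thesis by simp
  qed
  have "(\<lambda>m. \<Prod>j<m. 1 - P powi (- 2 - int j)) \<longlonglongrightarrow> prodinf (\<lambda>j. 1 - P powi (- 2 - int j))"
    using convergent_prod_LIMSEQ[OF conv] LIMSEQ_lessThan_iff_atMost[of "\<lambda>S. prod (\<lambda>j. 1 - P powi (- 2 - int j)) S"]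
    by simp
  from tendsto_mult[OF this F1] have "(\<lambda>m. F (1 / P)) \<longlonglongrightarrow> prodinf (\<lambda>j. 1 - P powi (- 2 - int j))"
    unfolding prod[symmetric] by simp
  hence "F (1 / P) = prodinf (\<lambda>j. 1 - P powi (- 2 - int j))" by (simp add: LIMSEQ_const_iff)
  moreover have "(\<lambda>k. \<Sum>i\<le>k. sgn_coeff P i * (1 / P) ^ i) \<longlonglongrightarrow> F (1 / P)"
    using summable_LIMSEQ'[OF summ[of "1/P"]] P by (simp add: F_def)
  ultimately show ?thesis by simp
qed

section \<open>Random subsets\<close>

text \<open>
  The expectation of \<open>\<phi> S\<close> for a random subset \<open>S\<close> of \<open>V\<close> that contains each element independently with
  probability \<open>v\<close>. A finite sum is easier to factorise and reindex than an integral over a product measure.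
\<close>

definition sub_exp :: "real => 'i set => ('i set => real) => real" where
  "sub_exp v V \<phi> = (\<Sum>S\<in>Pow V. v ^ card S * (1 - v) ^ card (V - S) * \<phi> S)"

lemma sub_exp_empty [simp]: "sub_exp v {} \<phi> = \<phi> {}"
  by (simp add: sub_exp_def)

lemma sub_exp_insert:
  assumes "finite V" "i \<notin> V"
  shows "sub_exp v (insert i V) \<phi> = (1 - v) * sub_exp v V \<phi> + v * sub_exp v V (\<lambda>S. \<phi> (insert i S))"
proof -
  let ?w = "\<lambda>S. v ^ card S * (1 - v) ^ card (insert i V - S)"
  have inj: "inj_on (insert i) (Pow V)" using assms(2) by (intro inj_onI) (metis PowD insert_ident subsetD)
  have "sub_exp v (insert i V) \<phi> = (\<Sum>S\<in>Pow V. ?w S * \<phi> S) + (\<Sum>S\<in>insert i ` Pow V. ?w S * \<phi> S)"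
    unfolding sub_exp_def Pow_insert by (rule sum.union_disjoint) (use assms in auto)
  also have "(\<Sum>S\<in>insert i ` Pow V. ?w S * \<phi> S) = (\<Sum>S\<in>Pow V. ?w (insert i S) * \<phi> (insert i S))"
    by (subst sum.reindex[OF inj]) simp
  also have "\<dots> = v * sub_exp v V (\<lambda>S. \<phi> (insert i S))"
    unfolding sub_exp_def sum_distrib_left
  proof (rule sum.cong)
    fix S assume S: "S \<in> Pow V"
    hence "finite S" "i \<notin> S" using assms finite_subset by auto
    moreover have "insert i V - insert i S = V - S" using assms by auto
    ultimately show "?w (insert i S) * \<phi> (insert i S) = v * (v ^ card S * (1 - v) ^ card (V - S) * \<phi> (insert i S))"
      by simp
  qed simp
  also have "(\<Sum>S\<in>Pow V. ?w S * \<phi> S) = (1 - v) * sub_exp v V \<phi>"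
    unfolding sub_exp_def sum_distrib_left
  proof (rule sum.cong)
    fix S assume S: "S \<in> Pow V"
    hence "insert i V - S = insert i (V - S)" "i \<notin> V - S" "finite (V - S)" using assms by auto
    thus "?w S * \<phi> S = (1 - v) * (v ^ card S * (1 - v) ^ card (V - S) * \<phi> S)" by simp
  qed simp
  finally show ?thesis .
qed

lemma sub_exp_add: "sub_exp v V (\<lambda>S. \<phi> S + \<psi> S) = sub_exp v V \<phi> + sub_exp v V \<psi>"
  by (simp add: sub_exp_def algebra_simps sum.distrib)

lemma sub_exp_cmult: "sub_exp v V (\<lambda>S. c * \<phi> S) = c * sub_exp v V \<phi>"
  by (simp add: sub_exp_def algebra_simps sum_distrib_left)

lemma sub_exp_multc: "sub_exp v V (\<lambda>S. \<phi> S * c) = sub_exp v V \<phi> * c"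
  by (simp add: sub_exp_def algebra_simps sum_distrib_left)

lemma sub_exp_sum: "sub_exp v V (\<lambda>S. \<Sum>x\<in>A. \<phi> x S) = (\<Sum>x\<in>A. sub_exp v V (\<phi> x))"
  by (simp add: sub_exp_def sum_distrib_left) (rule sum.swap)

lemma sub_exp_cong: "(\<And>S. S \<subseteq> V ==> \<phi> S = \<psi> S) ==> sub_exp v V \<phi> = sub_exp v V \<psi>"
  by (auto simp: sub_exp_def intro!: sum.cong)

lemma sub_exp_const:
  assumes "finite V" shows "sub_exp v V (\<lambda>_. c) = c"
  using assms by (induction V) (simp_all add: sub_exp_insert algebra_simps)

lemma sub_exp_mono:
  assumes "0 <= v" "v <= 1" "\<And>S. S \<subseteq> V ==> \<phi> S <= \<psi> S"
  shows "sub_exp v V \<phi> <= sub_exp v V \<psi>"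
  unfolding sub_exp_def using assms by (intro sum_mono mult_left_mono) auto

lemma sub_exp_nonneg:
  assumes "0 <= v" "v <= 1" "\<And>S. S \<subseteq> V ==> 0 <= \<phi> S"
  shows "0 <= sub_exp v V \<phi>"
  unfolding sub_exp_def using assms by (intro sum_nonneg mult_nonneg_nonneg) auto

lemma sub_exp_abs_le:
  assumes "0 <= v" "v <= 1" "finite V" "\<And>S. S \<subseteq> V ==> \<bar>\<phi> S - \<psi> S\<bar> <= c"
  shows "\<bar>sub_exp v V \<phi> - sub_exp v V \<psi>\<bar> <= c"
proof -
  have "sub_exp v V \<phi> <= sub_exp v V (\<lambda>S. \<psi> S + c)"
    using assms(1,2) by (rule sub_exp_mono) (use assms(4) in \<open>auto simp: abs_le_iff algebra_simps\<close>)
  moreover have "sub_exp v V \<psi> <= sub_exp v V (\<lambda>S. \<phi> S + c)"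
    using assms(1,2) by (rule sub_exp_mono) (use assms(4) in \<open>auto simp: abs_le_iff algebra_simps\<close>)
  ultimately show ?thesis using assms(3) by (simp add: sub_exp_add sub_exp_const abs_le_iff)
qed

lemma sub_exp_Un:
  assumes "finite A" "finite B" "A \<inter> B = {}"
  shows "sub_exp v (A \<union> B) \<phi> = sub_exp v A (\<lambda>S. sub_exp v B (\<lambda>S'. \<phi> (S \<union> S')))"
  using assms(1,3)
proof (induction A arbitrary: \<phi>)
  case (insert i A)
  hence "sub_exp v (insert i (A \<union> B)) \<phi> = (1 - v) * sub_exp v (A \<union> B) \<phi> + v * sub_exp v (A \<union> B) (\<lambda>S. \<phi> (insert i S))"
    using assms(2) by (subst sub_exp_insert) auto
  thus ?case using insert by (simp add: sub_exp_insert)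
qed simp

lemma sub_exp_Un_mult:
  assumes "finite A" "finite B" "A \<inter> B = {}"
  shows "sub_exp v (A \<union> B) (\<lambda>S. \<phi> (S \<inter> A) * \<psi> (S \<inter> B)) = sub_exp v A \<phi> * sub_exp v B \<psi>"
proof -
  have "sub_exp v (A \<union> B) (\<lambda>S. \<phi> (S \<inter> A) * \<psi> (S \<inter> B)) = sub_exp v A (\<lambda>S. sub_exp v B (\<lambda>S'. \<phi> S * \<psi> S'))"
    unfolding sub_exp_Un[OF assms]
  proof (intro sub_exp_cong)
    fix S S' assume "S \<subseteq> A" "S' \<subseteq> B"
    hence "(S \<union> S') \<inter> A = S" "(S \<union> S') \<inter> B = S'" using assms(3) by auto
    thus "\<phi> ((S \<union> S') \<inter> A) * \<psi> ((S \<union> S') \<inter> B) = \<phi> S * \<psi> S'" by simp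
  qed
  thus ?thesis by (simp add: sub_exp_cmult sub_exp_multc)
qed

lemma sub_exp_prod_blocks:
  assumes "finite J" "\<And>j. j \<in> J ==> finite (B j)" "\<And>j k. j \<in> J ==> k \<in> J ==> j ~= k ==> B j \<inter> B k = {}"
  shows "sub_exp v (\<Union>j\<in>J. B j) (\<lambda>S. \<Prod>j\<in>J. \<phi> j (S \<inter> B j)) = (\<Prod>j\<in>J. sub_exp v (B j) (\<phi> j))"
  using assms
proof (induction J)
  case (insert j J)
  let ?U = "\<Union>j\<in>J. B j"
  have dis: "B j \<inter> ?U = {}" using insert.prems(2) insert.hyps(2) by fastforce
  have "sub_exp v (B j \<union> ?U) (\<lambda>S. \<phi> j (S \<inter> B j) * (\<Prod>k\<in>J. \<phi> k ((S \<inter> ?U) \<inter> B k))) =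
        sub_exp v (B j) (\<phi> j) * sub_exp v ?U (\<lambda>S. \<Prod>k\<in>J. \<phi> k (S \<inter> B k))"
    using sub_exp_Un_mult[of "B j" ?U v "\<phi> j" "\<lambda>S. \<Prod>k\<in>J. \<phi> k (S \<inter> B k)"] insert dis by auto
  moreover have "sub_exp v (B j \<union> ?U) (\<lambda>S. \<phi> j (S \<inter> B j) * (\<Prod>k\<in>J. \<phi> k ((S \<inter> ?U) \<inter> B k)))
     = sub_exp v (B j \<union> ?U) (\<lambda>S. \<Prod>k\<in>insert j J. \<phi> k (S \<inter> B k))"
  proof (rule sub_exp_cong)
    fix S
    have "(\<Prod>k\<in>J. \<phi> k ((S \<inter> ?U) \<inter> B k)) = (\<Prod>k\<in>J. \<phi> k (S \<inter> B k))"
      by (rule prod.cong) (auto intro!: arg_cong[where f = "\<phi> _"])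
    thus "\<phi> j (S \<inter> B j) * (\<Prod>k\<in>J. \<phi> k ((S \<inter> ?U) \<inter> B k)) = (\<Prod>k\<in>insert j J. \<phi> k (S \<inter> B k))"
      using insert.hyps by simp
  qed
  ultimately show ?case using insert by simp
qed simp

lemma sub_exp_reindex:
  assumes "inj_on g V"
  shows "sub_exp v (g ` V) \<phi> = sub_exp v V (\<lambda>S. \<phi> (g ` S))"
proof -
  have inj: "inj_on ((`) g) (Pow V)" using inj_on_image_Pow[OF assms] .
  show ?thesis unfolding sub_exp_def image_Pow_surj[OF refl, symmetric]
  proof (subst sum.reindex[OF inj], rule sum.cong)
    fix S assume S: "S \<in> Pow V"
    have e: "g ` V - g ` S = g ` (V - S)" using S inj_on_image_set_diff[OF assms, of V S] by auto
    have "card (g ` S) = card S" "card (g ` (V - S)) = card (V - S)"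
      using S inj_on_subset[OF assms] by (auto intro!: card_image)
    thus "((\<lambda>S. v ^ card S * (1 - v) ^ card (g ` V - S) * \<phi> S) \<circ> (`) g) S 
        = v ^ card S * (1 - v) ^ card (V - S) * \<phi> (g ` S)" using e by simp
  qed simp
qed

lemma prob_Pi_pmf_bernoulli:
  assumes "finite A" "0 <= v" "v <= 1"
  shows "measure_pmf.prob (Pi_pmf A False (\<lambda>_. bernoulli_pmf v)) {b. Q {e\<in>A. b e}} = sub_exp v A (\<lambda>S. of_bool (Q S))"
proof -
  let ?p = "Pi_pmf A False (\<lambda>_. bernoulli_pmf v)"
  let ?F = "\<lambda>S e. e \<in> S"
  let ?X = "{b. Q {e\<in>A. b e}}" and ?T = "(\<lambda>S e. e \<in> S) ` Pow A"
  have sub: "b \<in> ?T" if "b \<in> set_pmf ?p" for b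
  proof -
    have "\<forall>x. x \<notin> A --> \<not> b x" using that set_Pi_pmf_subset[OF assms(1), of False "\<lambda>_. bernoulli_pmf v"] by auto
    hence "b = ?F {e. b e}" "{e. b e} \<in> Pow A" by auto
    thus ?thesis by blast
  qed
  have fin: "finite ?T" using assms(1) by simp
  have inj: "inj_on ?F (Pow A)" by (rule inj_onI) (metis Collect_mem_eq)
  have "measure_pmf.prob ?p ?X = measure_pmf.prob ?p (?X \<inter> ?T)"
    using sub by (intro measure_prob_cong_0) (auto simp: set_pmf_iff)
  also have "\<dots> = sum (pmf ?p) (?X \<inter> ?T)" using fin by (intro measure_measure_pmf_finite) auto
  also have "\<dots> = (\<Sum>b\<in>?T. of_bool (b \<in> ?X) * pmf ?p b)"
  proof -
    have "sum (pmf ?p) (?X \<inter> ?T) = sum (pmf ?p) (?T \<inter> ?X)" by (simp only: Int_commute)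
    also have "\<dots> = (\<Sum>b\<in>?T. if b \<in> ?X then pmf ?p b else 0)" by (rule sum.inter_restrict[OF fin])
    also have "\<dots> = (\<Sum>b\<in>?T. of_bool (b \<in> ?X) * pmf ?p b)" by (rule sum.cong) simp_all
    finally show ?thesis .
  qed
  also have "\<dots> = (\<Sum>S\<in>Pow A. of_bool (?F S \<in> ?X) * pmf ?p (?F S))" by (subst sum.reindex[OF inj]) simp
  also have "\<dots> = sub_exp v A (\<lambda>S. of_bool (Q S))" unfolding sub_exp_def
  proof (rule sum.cong)
    fix S assume S: "S \<in> Pow A"
    hence "pmf ?p (?F S) = (\<Prod>x\<in>A. if x \<in> S then v else 1 - v)"
      using assms by (subst pmf_Pi') (auto intro!: prod.cong)
    also have "\<dots> = v ^ card S * (1 - v) ^ card (A - S)"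
      using S assms(1) by (simp add: prod.If_cases Int_absorb1 Diff_eq Collect_neg_eq)
    finally have "pmf ?p (?F S) = v ^ card S * (1 - v) ^ card (A - S)" .
    moreover have "{e \<in> A. e \<in> S} = S" using S by auto
    ultimately show "of_bool (?F S \<in> ?X) * pmf ?p (?F S) = v ^ card S * (1 - v) ^ card (A - S) * of_bool (Q S)"
      by simp
  qed simp
  finally show ?thesis .
qed

section \<open>Residues of binomial variables\<close>

fun binom_residue :: "nat => real => nat => int => real" where
  "binom_residue q v 0 e = of_bool (int q dvd e)"
| "binom_residue q v (Suc m) e = (1 - v) * binom_residue q v m e + v * binom_residue q v m (e - 1)"

lemma binom_residue_period: "binom_residue q v m (e + int q * t) = binom_residue q v m e"
proof (induction m arbitrary: e)
  case (Suc m)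
  have "e + int q * t - 1 = (e - 1) + int q * t" by simp
  hence "binom_residue q v m (e + int q * t - 1) = binom_residue q v m (e - 1)" using Suc by metis
  thus ?case using Suc by simp
next
  case 0
  have "int q dvd e + int q * t \<longleftrightarrow> int q dvd e" by (rule dvd_add_left_iff) simp
  thus ?case by simp
qed

lemma binom_residue_cong:
  assumes "[e = e'] (mod int q)"
  shows "binom_residue q v m e = binom_residue q v m e'"
proof -
  from assms obtain t where "e = e' + int q * t" by (metis cong_iff_lin cong_sym_eq)
  thus ?thesis using binom_residue_period by simp
qed

lemma sub_exp_card_residue:
  assumes "finite U"
  shows "sub_exp v U (\<lambda>S. of_bool ([int (card S) = e] (mod int q))) = binom_residue q v (card U) e"
  using assms
proof (induction U arbitrary: e)
  case empty
  show ?case by (simp add: cong_iff_dvd_diff)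
next
  case (insert i U)
  have "sub_exp v U (\<lambda>S. of_bool ([int (card (insert i S)) = e] (mod int q))) = sub_exp v U (\<lambda>S. of_bool ([int (card S) = e - 1] (mod int q)))"
  proof (rule sub_exp_cong)
    fix S assume "S \<subseteq> U"
    hence "card (insert i S) = Suc (card S)" using insert finite_subset[of S U] by (subst card_insert_disjoint) auto
    moreover have "[1 + int (card S) = e] (mod int q) \<longleftrightarrow> [int (card S) = e - 1] (mod int q)"
      by (simp add: cong_iff_dvd_diff algebra_simps)
    ultimately show "of_bool ([int (card (insert i S)) = e] (mod int q)) = (of_bool ([int (card S) = e - 1] (mod int q)) :: real)"
      by simp
  qed
  thus ?case using insert by (simp add: sub_exp_insert)
qed

lemma binom_residue_bounds:
  assumes v: "0 <= v" "v <= 1" and lo: "\<And>e. lo <= binom_residue q v m e"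
  shows "lo <= binom_residue q v (m + j) e"
proof (induction j arbitrary: e)
  case (Suc j)
  have "(1 - v) * lo + v * lo <= (1 - v) * binom_residue q v (m + j) e + v * binom_residue q v (m + j) (e - 1)"
    using Suc v by (intro add_mono mult_left_mono) auto
  thus ?case by (simp add: algebra_simps)
qed (use lo in simp)

lemma binom_residue_bounds_upper:
  assumes v: "0 <= v" "v <= 1" and hi: "\<And>e. binom_residue q v m e <= hi"
  shows "binom_residue q v (m + j) e <= hi"
proof (induction j arbitrary: e)
  case (Suc j)
  have "(1 - v) * hi + v * hi \<ge> (1 - v) * binom_residue q v (m + j) e + v * binom_residue q v (m + j) (e - 1)"
    using Suc v by (intro add_mono mult_left_mono) auto
  thus ?case by (simp add: algebra_simps)
qed (use hi in simp)

lemma binom_residue_spread: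
  assumes v: "0 < v" "v < 1" and lo: "\<And>e. lo <= binom_residue q v m e"
    and "i <= j"
  shows "lo + (min v (1 - v)) ^ j * (binom_residue q v m e - lo) <= binom_residue q v (m + j) (e + int i)"
  using assms(4)
proof (induction j arbitrary: i)
  case (Suc j)
  let ?c = "min v (1 - v)" and ?D = "binom_residue q v m e - lo"
  have D: "0 <= ?c ^ j * ?D" using v lo by (intro mult_nonneg_nonneg) auto
  have l: "lo <= binom_residue q v (m + j) e'" for e' using binom_residue_bounds[OF _ _ lo] v by simp
  show ?case
  proof (cases "i <= j")
    case True
    have "lo + ?c ^ Suc j * ?D = lo + ?c * (?c ^ j * ?D)" by simp
    also have "\<dots> <= lo + (1 - v) * (?c ^ j * ?D)" using D by (intro add_left_mono mult_right_mono) auto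
    also have "\<dots> = (1 - v) * (lo + ?c ^ j * ?D) + v * lo" by (simp add: algebra_simps)
    also have "\<dots> <= (1 - v) * binom_residue q v (m + j) (e + int i) + v * binom_residue q v (m + j) (e + int i - 1)"
      using Suc.IH[OF True] l v by (intro add_mono mult_left_mono) auto
    finally show ?thesis by simp
  next
    case False
    hence i: "i = Suc j" using Suc.prems by simp
    have "lo + ?c ^ Suc j * ?D = lo + ?c * (?c ^ j * ?D)" by simp
    also have "\<dots> <= lo + v * (?c ^ j * ?D)" using D by (intro add_left_mono mult_right_mono) auto
    also have "\<dots> = (1 - v) * lo + v * (lo + ?c ^ j * ?D)" by (simp add: algebra_simps)
    also have "\<dots> <= (1 - v) * binom_residue q v (m + j) (e + int i) + v * binom_residue q v (m + j) (e + int i - 1)"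
      using Suc.IH[of j] l v i by (intro add_mono mult_left_mono) auto
    finally show ?thesis by simp
  qed
qed simp

text \<open>
  A Doeblin argument: \<open>q\<close> further coin tosses move mass at least a fixed amount from any residue to any other, so each
  block of \<open>q\<close> tosses contracts the oscillation by a fixed factor.
\<close>

lemma binom_residue_osc:
  fixes v :: real
  assumes v: "0 < v" "v < 1" and q: "q > 0"
  shows "\<exists>\<rho>. 0 < \<rho> \<and> \<rho> < 1 \<and> (\<forall>m e e'. \<bar>binom_residue q v m e - binom_residue q v m e'\<bar> <= \<rho> ^ (m div q))"
proof -
  let ?b = "binom_residue q v" and ?c = "min v (1 - v)"
  define \<rho> where "\<rho> = 1 - ?c ^ q"
  have c: "0 < ?c" "?c < 1" using v by auto
  hence r: "0 < \<rho>" "\<rho> < 1" using q power_Suc_less_one[of ?c "q - 1"] by (auto simp: \<rho>_def)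
  have diff: "?b m e - ?b m e' <= \<rho> ^ n" if "m \<ge> q * n" for m n e e'
    using that
  proof (induction n arbitrary: m e e')
    case 0
    have "0 <= ?b (0 + m) e'" "?b (0 + m) e <= 1"
      using v by (intro binom_residue_bounds binom_residue_bounds_upper; simp)+
    thus ?case by simp
  next
    case (Suc n)
    define m' where "m' = m - q"
    have m: "m = m' + q" "m' \<ge> q * n" using Suc.prems by (auto simp: m'_def)
    let ?R = "?b m' ` {0..<int q}"
    have fin: "finite ?R" "?R ~= {}" using q by auto
    have mem: "?b m' x \<in> ?R" for x
    proof -
      have "?b m' x = ?b m' (x mod int q)" by (rule binom_residue_cong) (simp add: cong_def)
      thus ?thesis using q by auto
    qed
    obtain e0 where e0: "?b m' e0 = Max ?R" using Max_in[OF fin] by auto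
    obtain e1 where e1: "?b m' e1 = Min ?R" using Min_in[OF fin] by auto
    have up: "?b m' x <= ?b m' e0" for x using mem fin e0 by simp
    have lo: "?b m' e1 <= ?b m' x" for x using mem fin e1 by simp
    define i where "i = nat ((e' - e0) mod int q)"
    have i: "i <= q" "[e' = e0 + int i] (mod int q)"
      using q pos_mod_bound[of "int q" "e' - e0"] by (auto simp: i_def cong_def mod_simps algebra_simps less_imp_le nat_le_iff)
    have "?b m e' = ?b (m' + q) (e0 + int i)" unfolding m by (rule binom_residue_cong[OF i(2)])
    also have "\<dots> \<ge> ?b m' e1 + ?c ^ q * (?b m' e0 - ?b m' e1)"
      by (rule binom_residue_spread[OF v lo i(1)])
    finally have 1: "?b m e' \<ge> ?b m' e1 + ?c ^ q * (?b m' e0 - ?b m' e1)" .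
    have 2: "?b m e <= ?b m' e0" unfolding m using v up by (intro binom_residue_bounds_upper) auto
    have "?b m e - ?b m e' <= \<rho> * (?b m' e0 - ?b m' e1)" using 1 2 by (simp add: \<rho>_def algebra_simps)
    also have "\<dots> <= \<rho> * \<rho> ^ n" using r Suc.IH[OF m(2)] by (intro mult_left_mono) auto
    finally show ?case by simp
  qed
  have "\<bar>?b m e - ?b m e'\<bar> <= \<rho> ^ (m div q)" for m e e'
    using diff[of "m div q" m e e'] diff[of "m div q" m e' e] by (simp add: abs_le_iff)
  thus ?thesis using r by blast
qed

section \<open>Random products in a finite abelian group\<close>

text \<open>
  The joint law of the size modulo \<open>q\<close> and of the product of the labels of a random vertex subset.
\<close>

definition nu :: "real => nat => ('a, 'b) monoid_scheme => ('i => 'a) => 'i set => int => 'a => real" where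
  "nu v q G f V d h = sub_exp v V (\<lambda>S. of_bool ([int (card S) = d] (mod int q) \<and> finprod G f S = h))"

lemma nu_nonneg: "0 <= v ==> v <= 1 ==> 0 <= nu v q G f V d h"
  unfolding nu_def by (rule sub_exp_nonneg) auto

lemma (in group) pow_in_subgroup:
  assumes "subgroup H G" "x \<in> H"
  shows "x [^] (n :: nat) \<in> H"
  using assms by (induction n) (auto simp: subgroup.one_closed subgroup.m_closed)

lemma (in group) int_pow_cong:
  assumes "x \<in> carrier G" "x [^] q = \<one>" "[a = b] (mod int q)"
  shows "x [^] a = x [^] (b :: int)"
proof -
  obtain t where "a = b + int q * t" using assms(3) by (metis cong_iff_lin cong_sym_eq)
  hence "x [^] a = x [^] b \<otimes> (x [^] int q) [^] t"
    using assms(1) by (simp add: int_pow_mult int_pow_pow)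
  thus ?thesis using assms by (simp add: int_pow_int)
qed

text \<open>
  Condition on the subset outside \<open>U\<close>. On \<open>U\<close> the label is constant, so only the number of chosen elements of \<open>U\<close>
  matters; its residue is almost uniform, and one more chosen element shifts \<open>(d, h)\<close> to \<open>(d + 1, h \<otimes> l)\<close>.
\<close>

lemma (in comm_group) nu_shift:
  assumes v: "0 <= v" "v <= 1" and f: "f \<in> V \<rightarrow> carrier G" and V: "finite V" "U \<subseteq> V"
    and U: "\<And>i. i \<in> U ==> f i = l" and l: "l \<in> carrier G" and h: "h \<in> carrier G" and q: "l [^] q = \<one>"
    and osc: "\<And>e e'. \<bar>binom_residue q v (card U) e - binom_residue q v (card U) e'\<bar> <= \<eta>"
  shows "\<bar>nu v q G f V d h - nu v q G f V (d + 1) (h \<otimes> l)\<bar> <= \<eta>"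
proof -
  have finU: "finite U" using V finite_subset by blast
  let ?b = "binom_residue q v (card U)"
  have form: "nu v q G f V d h = sub_exp v (V - U) (\<lambda>S. of_bool (finprod G f S \<otimes> l [^] (d - int (card S)) = h) * ?b (d - int (card S)))"
    if h: "h \<in> carrier G" for d h
  proof -
    have "nu v q G f V d h = sub_exp v ((V - U) \<union> U) (\<lambda>S. of_bool ([int (card S) = d] (mod int q) \<and> finprod G f S = h))"
      using V(2) by (simp add: nu_def Un_absorb2)
    also have "\<dots> = sub_exp v (V - U) (\<lambda>S. sub_exp v U (\<lambda>S'. of_bool ([int (card (S \<union> S')) = d] (mod int q) \<and> finprod G f (S \<union> S') = h)))"
      using V finU by (intro sub_exp_Un) auto
    also have "\<dots> = sub_exp v (V - U) (\<lambda>S. of_bool (finprod G f S \<otimes> l [^] (d - int (card S)) = h) * ?b (d - int (card S)))"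
    proof (rule sub_exp_cong)
      fix S assume S: "S \<subseteq> V - U"
      have "sub_exp v U (\<lambda>S'. of_bool ([int (card (S \<union> S')) = d] (mod int q) \<and> finprod G f (S \<union> S') = h))
         = sub_exp v U (\<lambda>S'. of_bool (finprod G f S \<otimes> l [^] (d - int (card S)) = h) * of_bool ([int (card S') = d - int (card S)] (mod int q)))"
      proof (rule sub_exp_cong)
        fix S' assume S': "S' \<subseteq> U"
        have fin: "finite S" "finite S'" using S S' V finU finite_subset by (meson Diff_subset finite_subset order_trans, blast intro: finite_subset)
        have dis: "S \<inter> S' = {}" using S S' by auto
        have fS: "f \<in> S \<rightarrow> carrier G" "f \<in> S' \<rightarrow> carrier G" using S S' V f by auto
        have c: "int (card (S \<union> S')) = int (card S) + int (card S')" using fin dis by (simp add: card_Un_disjoint)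
        have "finprod G f S' = finprod G (\<lambda>_. l) S'"
          using S' U l by (intro finprod_cong') auto
        also have "\<dots> = l [^] int (card S')" using l by (simp add: finprod_const int_pow_int)
        finally have p: "finprod G f (S \<union> S') = finprod G f S \<otimes> l [^] int (card S')"
          using fin dis fS by (subst finprod_Un_disjoint) auto
        have eq: "[int (card (S \<union> S')) = d] (mod int q) \<longleftrightarrow> [int (card S') = d - int (card S)] (mod int q)"
          unfolding c by (simp add: cong_iff_dvd_diff algebra_simps)
        have "l [^] int (card S') = l [^] (d - int (card S))" if "[int (card S') = d - int (card S)] (mod int q)"
          using int_pow_cong[OF l q that] .
        thus "of_bool ([int (card (S \<union> S')) = d] (mod int q) \<and> finprod G f (S \<union> S') = h) =
          (of_bool (finprod G f S \<otimes> l [^] (d - int (card S)) = h) * of_bool ([int (card S') = d - int (card S)] (mod int q)) :: real)"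
          unfolding eq p by auto
      qed
      also have "\<dots> = of_bool (finprod G f S \<otimes> l [^] (d - int (card S)) = h) * ?b (d - int (card S))"
        by (simp add: sub_exp_cmult sub_exp_card_residue[OF finU])
      finally show "sub_exp v U (\<lambda>S'. of_bool ([int (card (S \<union> S')) = d] (mod int q) \<and> finprod G f (S \<union> S') = h)) = \<dots>" .
    qed
    finally show ?thesis .
  qed
  show ?thesis unfolding form[OF h] form[OF m_closed[OF h l]]
  proof (rule sub_exp_abs_le)
    fix S assume S: "S \<subseteq> V - U"
    hence fS: "finprod G f S \<in> carrier G" using f by (intro finprod_closed) auto
    have "l [^] (d + 1 - int (card S)) = l [^] (d - int (card S)) \<otimes> l"
    proof -
      have "d + 1 - int (card S) = (d - int (card S)) + 1" by simp
      thus ?thesis using l by (simp only: int_pow_mult int_pow_1)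
    qed
    hence "finprod G f S \<otimes> l [^] (d + 1 - int (card S)) = h \<otimes> l \<longleftrightarrow> finprod G f S \<otimes> l [^] (d - int (card S)) = h"
      using fS l h by (simp add: m_assoc[symmetric])
    thus "\<bar>of_bool (finprod G f S \<otimes> l [^] (d - int (card S)) = h) * ?b (d - int (card S)) -
          of_bool (finprod G f S \<otimes> l [^] (d + 1 - int (card S)) = h \<otimes> l) * ?b (d + 1 - int (card S))\<bar> <= \<eta>"
      using osc[of "d - int (card S)" "d + 1 - int (card S)"] order_trans[OF abs_ge_zero osc[of 0 0]]
      by (cases "finprod G f S \<otimes> l [^] (d - int (card S)) = h") (simp_all only: of_bool_def if_True if_False mult_1_left mult_zero_left diff_self abs_zero simp_thms)
  qed (use v V in auto)
qed

definition difference_group :: "('a, 'b) monoid_scheme => 'a set => 'a set" where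
  "difference_group G L = generate G {l \<otimes>\<^bsub>G\<^esub> inv\<^bsub>G\<^esub> l' |l l'. l \<in> L \<and> l' \<in> L}"

lemma (in group) subgroup_difference_group:
  "L \<subseteq> carrier G ==> subgroup (difference_group G L) G"
  unfolding difference_group_def by (rule generate_is_subgroup) auto

lemma (in comm_group) shift_invariant_generate:
  assumes L: "L \<subseteq> carrier G" and k: "k \<in> difference_group G L"
  shows "\<exists>C\<ge>0. \<forall>F \<eta>. (\<forall>d. \<forall>h\<in>carrier G. \<forall>l\<in>L. \<bar>F d h - F (d + 1) (h \<otimes> l)\<bar> <= \<eta>) -->
     (\<forall>d :: int. \<forall>h\<in>carrier G. \<bar>F d h - F d (h \<otimes> k)\<bar> <= C * (\<eta> :: real))"
proof -
  let ?inv = "\<lambda>C k. \<forall>F \<eta>. (\<forall>d :: int. \<forall>h\<in>carrier G. \<forall>l\<in>L. \<bar>F d h - F (d + 1) (h \<otimes> l)\<bar> <= \<eta>) -->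
     (\<forall>d :: int. \<forall>h\<in>carrier G. \<bar>F d h - F d (h \<otimes> k)\<bar> <= C * (\<eta> :: real))"
  have base: "?inv 2 (l \<otimes> inv l')" if l: "l \<in> L" "l' \<in> L" for l l'
  proof (intro allI impI ballI)
    fix F :: "int => 'a => real" and \<eta> d h
    assume H: "\<forall>d. \<forall>h\<in>carrier G. \<forall>l\<in>L. \<bar>F d h - F (d + 1) (h \<otimes> l)\<bar> <= \<eta>" and h: "h \<in> carrier G"
    have lc: "l \<in> carrier G" "l' \<in> carrier G" using l L by auto
    let ?g = "h \<otimes> inv l'"
    have g: "?g \<in> carrier G" using h lc by auto
    have "?g \<otimes> l' = h" "?g \<otimes> l = h \<otimes> (l \<otimes> inv l')" using h lc m_comm[of "inv l'" l] by (simp_all add: m_assoc)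
    hence "\<bar>F (d - 1) ?g - F d h\<bar> <= \<eta>" "\<bar>F (d - 1) ?g - F d (h \<otimes> (l \<otimes> inv l'))\<bar> <= \<eta>"
      using H[rule_format, OF g l(2), of "d - 1"] H[rule_format, OF g l(1), of "d - 1"] by auto
    thus "\<bar>F d h - F d (h \<otimes> (l \<otimes> inv l'))\<bar> <= 2 * \<eta>" by linarith
  qed
  show ?thesis using k unfolding difference_group_def
  proof (induction rule: generate.induct)
    case one
    show ?case by (rule exI[of _ 0]) auto
  next
    case (incl h)
    thus ?case using base by (intro exI[of _ 2]) auto
  next
    case (inv h)
    then obtain l l' where l: "l \<in> L" "l' \<in> L" "h = l \<otimes> inv l'" by auto
    hence "inv h = l' \<otimes> inv l" using L by (auto simp: inv_mult_group subset_iff)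
    thus ?case using base[OF l(2,1)] by (intro exI[of _ 2]) auto
  next
    case (eng h1 h2)
    then obtain C1 C2 where C: "C1 \<ge> 0" "?inv C1 h1" "C2 \<ge> 0" "?inv C2 h2" by blast
    have hc: "h1 \<in> carrier G" "h2 \<in> carrier G"
      using eng.hyps generate_in_carrier[of "{l \<otimes> inv l' |l l'. l \<in> L \<and> l' \<in> L}"] L by blast+
    have "?inv (C1 + C2) (h1 \<otimes> h2)"
    proof (intro allI impI ballI)
      fix F :: "int => 'a => real" and \<eta> d h
      assume H: "\<forall>d. \<forall>h\<in>carrier G. \<forall>l\<in>L. \<bar>F d h - F (d + 1) (h \<otimes> l)\<bar> <= \<eta>" and h: "h \<in> carrier G"
      have "\<bar>F d h - F d (h \<otimes> h1)\<bar> <= C1 * \<eta>" using C(2) H h by blast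
      moreover have "\<bar>F d (h \<otimes> h1) - F d (h \<otimes> h1 \<otimes> h2)\<bar> <= C2 * \<eta>" using C(4) H h hc by blast
      ultimately show "\<bar>F d h - F d (h \<otimes> (h1 \<otimes> h2))\<bar> <= (C1 + C2) * \<eta>"
        using h hc by (simp add: m_assoc[symmetric] algebra_simps)
    qed
    thus ?case using C by (intro exI[of _ "C1 + C2"]) auto
  qed
qed

text \<open>
  Shifts by two elements \<open>l\<close> and \<open>l'\<close> of \<open>L\<close> raise \<open>d\<close> equally, so their quotient fixes \<open>d\<close>. Finitely many such
  steps reach each element of the generated subgroup, which bounds the constant independently of \<open>F\<close>.
\<close>

lemma (in comm_group) average_over_difference_group:
  assumes fin: "finite (carrier G)" and L: "L \<subseteq> carrier G"
  shows "\<exists>C\<ge>0. \<forall>F \<eta>. \<eta> \<ge> 0 --> (\<forall>d. \<forall>h\<in>carrier G. \<forall>l\<in>L. \<bar>F d h - F (d + 1) (h \<otimes> l)\<bar> <= \<eta>) -->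
     (\<forall>d :: int. \<forall>h\<in>carrier G. \<bar>F d h - (\<Sum>k\<in>difference_group G L. F d (h \<otimes> k)) / real (card (difference_group G L))\<bar> <= C * (\<eta> :: real))"
proof -
  let ?K = "difference_group G L"
  interpret K: subgroup ?K G by (rule subgroup_difference_group[OF L])
  have finK: "finite ?K" using fin K.subset finite_subset by blast
  have posK: "card ?K > 0" using finK K.one_closed card_gt_0_iff by blast
  let ?P = "\<lambda>k C. C \<ge> 0 \<and> (\<forall>F \<eta>. (\<forall>d :: int. \<forall>h\<in>carrier G. \<forall>l\<in>L. \<bar>F d h - F (d + 1) (h \<otimes> l)\<bar> <= \<eta>) -->
     (\<forall>d. \<forall>h\<in>carrier G. \<bar>F d h - F d (h \<otimes> k)\<bar> <= C * (\<eta> :: real)))"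
  have "\<forall>k\<in>?K. \<exists>C. ?P k C" using shift_invariant_generate[OF L] by blast
  then obtain C where CP: "\<forall>k\<in>?K. ?P k (C k)" by (rule bchoice[THEN exE])
  have C: "\<And>k. k \<in> ?K ==> C k \<ge> 0" 
     "\<And>k (F :: int => 'a => real) \<eta> d h. k \<in> ?K ==> (\<forall>d. \<forall>h\<in>carrier G. \<forall>l\<in>L. \<bar>F d h - F (d + 1) (h \<otimes> l)\<bar> <= \<eta>) ==> 
       h \<in> carrier G ==> \<bar>F d h - F d (h \<otimes> k)\<bar> <= C k * \<eta>"
    using CP by blast+
  show ?thesis
  proof (intro exI[of _ "sum C ?K"] conjI allI impI ballI)
    show "sum C ?K \<ge> 0" using C(1) by (rule sum_nonneg)
    fix F :: "int => 'a => real" and \<eta> d h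
    assume \<eta>: "\<eta> \<ge> 0" and H: "\<forall>d. \<forall>h\<in>carrier G. \<forall>l\<in>L. \<bar>F d h - F (d + 1) (h \<otimes> l)\<bar> <= \<eta>" and h: "h \<in> carrier G"
    have each: "\<bar>F d h - F d (h \<otimes> k)\<bar> <= sum C ?K * \<eta>" if k: "k \<in> ?K" for k
    proof -
      have "C k <= sum C ?K" using k finK C(1) by (intro member_le_sum) auto
      thus ?thesis using C(2)[OF k H h, of d] \<eta> by (meson mult_right_mono order_trans)
    qed
    have "F d h - (\<Sum>k\<in>?K. F d (h \<otimes> k)) / card ?K = (\<Sum>k\<in>?K. F d h - F d (h \<otimes> k)) / card ?K"
      using posK by (simp add: sum_subtractf diff_divide_distrib)
    also have "\<bar>\<dots>\<bar> <= (\<Sum>k\<in>?K. sum C ?K * \<eta>) / card ?K"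
      unfolding abs_divide using each by (intro divide_mono order_trans[OF sum_abs] sum_mono) (use posK in auto)
    also have "\<dots> = sum C ?K * \<eta>" using posK by simp
    finally show "\<bar>F d h - (\<Sum>k\<in>?K. F d (h \<otimes> k)) / real (card ?K)\<bar> <= sum C ?K * \<eta>" .
  qed
qed

text \<open>
  For a vertex with label \<open>y\<close> whose potential in-neighbours \<open>V\<close> carry the labels \<open>f\<close>: the probability that its equation
  holds, with an extra weight \<open>s\<close> on the event that its in-degree is divisible by \<open>p\<close>.
\<close>

definition wt :: "real => nat => ('a, 'b) monoid_scheme => ('i => 'a) => 'i set => real => 'a => real" where
  "wt v p G f V s y = sub_exp v V (\<lambda>S. of_bool (finprod G f S = y [^]\<^bsub>G\<^esub> card S) * (if p dvd card S then s else 1))"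

lemma wt_nonneg: "0 <= v ==> v <= 1 ==> 0 <= s ==> 0 <= wt v p G f V s y"
  unfolding wt_def by (rule sub_exp_nonneg) auto

lemma wt_le_1:
  assumes "0 <= v" "v <= 1" "finite V" "0 <= s" "s <= 1"
  shows "wt v p G f V s y <= 1"
proof -
  have "wt v p G f V s y <= sub_exp v V (\<lambda>_. 1)"
    unfolding wt_def using assms by (intro sub_exp_mono) auto
  thus ?thesis using assms by (simp add: sub_exp_const)
qed

lemma sum_residues:
  assumes "q > 0"
  shows "(\<Sum>d<q. of_bool ([int m = int d] (mod int q)) * g d) = (g (m mod q) :: real)"
proof -
  have "[int m = int d] (mod int q) \<longleftrightarrow> d = m mod q" if "d < q" for d
    using that unfolding cong_int_iff by (auto simp: cong_def)
  hence "(\<Sum>d<q. of_bool ([int m = int d] (mod int q)) * g d) = (\<Sum>d<q. if d = m mod q then g d else 0)"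
    by (intro sum.cong) simp_all
  thus ?thesis using assms by simp
qed

context comm_group
begin

lemma cancel_quotient:
  assumes "a \<in> carrier G" "b \<in> carrier G" "d \<in> carrier G"
  shows "a \<otimes> b \<otimes> (inv a \<otimes> d) = b \<otimes> d"
proof -
  have "a \<otimes> b \<otimes> (inv a \<otimes> d) = (a \<otimes> inv a) \<otimes> (b \<otimes> d)"
    using assms inv_closed[OF assms(1)] by (simp only: m_ac m_closed)
  thus ?thesis using assms by simp
qed

lemma wt_eq_sum_nu:
  fixes f :: "'i => 'a"
  assumes y: "y \<in> carrier G" "y [^] q = \<one>" and q: "q > 0" "p dvd q"
  shows "wt v p G f V s y = (\<Sum>d<q. (if p dvd d then s else 1) * nu v q G f V (int d) (y [^] d))"
proof -
  have "(\<Sum>d<q. (if p dvd d then s else 1) * nu v q G f V (int d) (y [^] d)) =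
     sub_exp v V (\<lambda>S. \<Sum>d<q. of_bool ([int (card S) = int d] (mod int q)) * (of_bool (finprod G f S = y [^] d) * (if p dvd d then s else 1)))"
    unfolding sub_exp_sum nu_def by (simp add: sub_exp_cmult[symmetric] of_bool_conj mult_ac del: sum_of_bool_mult_eq)
  also have "\<dots> = wt v p G f V s y"
    unfolding wt_def
  proof (rule sub_exp_cong)
    fix S :: "'i set"
    have "y [^] (card S mod q) = y [^] card S"
    proof -
      have "y [^] int (card S mod q) = y [^] int (card S)"
        using y by (intro int_pow_cong) (auto simp: cong_def zmod_int)
      thus ?thesis by (simp add: int_pow_int)
    qed
    moreover have "p dvd card S mod q \<longleftrightarrow> p dvd card S" using q(2) by (rule dvd_mod_iff)
    ultimately show "(\<Sum>d<q. of_bool ([int (card S) = int d] (mod int q)) * (of_bool (finprod G f S = y [^] d) * (if p dvd d then s else 1)))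
      = of_bool (finprod G f S = y [^] card S) * (if p dvd card S then s else 1)"
      by (subst sum_residues[OF q(1)]) simp
  qed
  finally show ?thesis ..
qed

lemma sum_nu_carrier:
  assumes fin: "finite (carrier G)" and f: "f \<in> V \<rightarrow> carrier G" and q: "q > 0"
  shows "(\<Sum>d<q. g d * (\<Sum>h\<in>carrier G. nu v q G f V (int d) h)) = sub_exp v V (\<lambda>S. g (card S mod q))"
proof -
  have "(\<Sum>d<q. g d * (\<Sum>h\<in>carrier G. nu v q G f V (int d) h)) = 
     sub_exp v V (\<lambda>S. \<Sum>d<q. of_bool ([int (card S) = int d] (mod int q)) * (g d * (\<Sum>h\<in>carrier G. of_bool (finprod G f S = h))))"
    unfolding nu_def sub_exp_sum[symmetric] sub_exp_cmult[symmetric]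
    by (rule sub_exp_cong) (simp add: sum_distrib_left of_bool_conj mult_ac del: sum_of_bool_mult_eq)
  also have "\<dots> = sub_exp v V (\<lambda>S. g (card S mod q))"
  proof (rule sub_exp_cong)
    fix S assume S: "S \<subseteq> V"
    hence "finprod G f S \<in> carrier G" using f by (intro finprod_closed) auto
    hence "(\<Sum>h\<in>carrier G. of_bool (finprod G f S = h)) = (1 :: real)"
      using fin by (simp add: of_bool_def)
    thus "(\<Sum>d<q. of_bool ([int (card S) = int d] (mod int q)) * (g d * (\<Sum>h\<in>carrier G. of_bool (finprod G f S = h)))) = g (card S mod q)"
      by (subst sum_residues[OF q]) simp
  qed
  finally show ?thesis .
qed

text \<open>Below, \<open>approx\<close> says that the law of the product is nearly invariant under \<open>K\<close>.\<close>

definition near_invariant :: "'a set => real => (int => 'a => real) => bool" where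
  "near_invariant K \<eta> F \<longleftrightarrow> (\<forall>d. \<forall>h\<in>carrier G. \<bar>F d h - (\<Sum>k\<in>K. F d (h \<otimes> k)) / real (card K)\<bar> <= \<eta>)"

lemma near_invariantD:
  "near_invariant K \<eta> F ==> h \<in> carrier G ==> \<bar>F d h - (\<Sum>k\<in>K. F d (h \<otimes> k)) / real (card K)\<bar> <= \<eta>"
  by (simp add: near_invariant_def)

text \<open>
  If \<open>p\<close> does not divide \<open>d\<close>, then taking \<open>d\<close>-th powers permutes \<open>K'\<close>, so for a given coset of \<open>K\<close> at most
  \<open>card (K \<inter> K')\<close> labels \<open>y\<close> can solve the equation. If \<open>p\<close> divides \<open>d\<close>, all \<open>card K'\<close> labels may solve it, and the
  weight \<open>s\<close> compensates for this.
\<close>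

lemma sum_wt_coset_le:
  fixes s \<eta> :: real
  assumes fin: "finite (carrier G)" and v: "0 <= v" "v <= 1" and V: "finite V" and f: "f \<in> V \<rightarrow> carrier G"
    and p: "Factorial_Ring.prime p" and q: "q = p ^ e" "e > 0" "\<And>x. x \<in> carrier G ==> x [^] q = \<one>"
    and K: "subgroup K G" and K': "subgroup K' G" and c: "c \<in> carrier G" and s: "0 <= s" "s <= 1"
    and inv: "near_invariant K \<eta> (nu v q G f V)" and \<eta>: "\<eta> \<ge> 0"
  shows "(\<Sum>y\<in>(\<lambda>k. c \<otimes> k) ` K'. wt v p G f V s y) \<le>
     max (s * card K') (card (K \<inter> K')) / card K + q * order G * \<eta>"
proof -
  interpret K: subgroup K G by fact
  interpret K': subgroup K' G by fact
  let ?C = "(\<lambda>k. c \<otimes> k) ` K'" and ?nu = "nu v q G f V"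
  let ?s = "\<lambda>d. if p dvd d then s else 1"
  define m where "m = max (s * card K') (card (K \<inter> K'))"
  have q0: "q > 0" "p dvd q" using p q by (auto simp: prime_gt_0_nat)
  have finK: "finite K" "finite K'" using fin K.subset K'.subset finite_subset by auto
  have posK: "card K > 0" using finK K.one_closed card_gt_0_iff by blast
  have C: "?C \<subseteq> carrier G" "finite ?C" using c K'.subset finK by auto
  have cardC: "card ?C = card K'"
    using c K'.subset by (intro card_image inj_onI) auto
  have count: "?s d * real (card {yk \<in> ?C \<times> K. fst yk [^] d \<otimes> snd yk = h}) <= m" if h: "h \<in> carrier G" for d :: nat and h
  proof -
    let ?P = "{yk \<in> ?C \<times> K. fst yk [^] d \<otimes> snd yk = h}"
    have inj: "inj_on fst ?P"
    proof (rule inj_onI)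
      fix a b assume ab: "a \<in> ?P" "b \<in> ?P" "fst a = fst b"
      hence m: "fst a \<in> ?C" "snd a \<in> K" "snd b \<in> K" by (simp_all add: mem_Times_iff)
      have "fst a \<in> carrier G" "snd a \<in> carrier G" "snd b \<in> carrier G"
        using subsetD[OF C(1) m(1)] subsetD[OF K.subset m(2)] subsetD[OF K.subset m(3)] .
      moreover have "fst a [^] d \<otimes> snd a = fst a [^] d \<otimes> snd b" using ab by auto
      ultimately have "snd a = snd b" by simp
      thus "a = b" using ab by (simp add: prod_eq_iff)
    qed
    have fP: "finite ?P" by (rule finite_subset[of _ "?C \<times> K"]) (use C(2) finK(1) in auto)
    have sub: "fst ` ?P \<subseteq> ?C" by auto
    have le1: "card ?P <= card K'"
      using card_mono[OF C(2) sub] card_image[OF inj] cardC by simp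
    show ?thesis
    proof (cases "p dvd d")
      case True
      have "s * real (card ?P) <= s * real (card K')" using le1 s by (intro mult_left_mono) auto
      thus ?thesis using True by (simp add: m_def)
    next
      case False
      have "card ?P <= card (K \<inter> K')"
      proof (cases "?P = {}")
        case True thus ?thesis by (metis card.empty le0)
      next
        case nonempty: False
        then obtain y0 k0 where y0: "y0 \<in> ?C" "k0 \<in> K" "y0 [^] d \<otimes> k0 = h" by auto
        have y0c: "y0 \<in> carrier G" "k0 \<in> carrier G" using subsetD[OF C(1) y0(1)] subsetD[OF K.subset y0(2)] .
        have "(\<lambda>yk. fst yk \<otimes> inv y0) ` ?P \<subseteq> K \<inter> K'"
        proof (rule image_subsetI)
          fix a assume a: "a \<in> ?P"
          then obtain y k where yk: "a = (y, k)" "y \<in> ?C" "k \<in> K" "y [^] d \<otimes> k = h" by auto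
          have ykc: "y \<in> carrier G" "k \<in> carrier G" using subsetD[OF C(1) yk(2)] subsetD[OF K.subset yk(3)] .
          let ?z = "y \<otimes> inv y0"
          have zc: "?z \<in> carrier G" using ykc y0c by simp
          obtain k1 k2 where k12: "k1 \<in> K'" "k2 \<in> K'" "y = c \<otimes> k1" "y0 = c \<otimes> k2" using yk y0 by auto
          have kc: "k1 \<in> carrier G" "k2 \<in> carrier G" using k12 K'.subset by auto
          have "?z = k1 \<otimes> inv k2"
            unfolding k12(3,4) using cancel_quotient[OF c kc(1) inv_closed[OF kc(2)]] c kc by (simp add: inv_mult)
          hence zK': "?z \<in> K'" using k12 by simp
          have "?z [^] d = y [^] d \<otimes> inv (y0 [^] d)" using ykc y0c by (simp add: nat_pow_distrib nat_pow_inv)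
          also have "y [^] d = h \<otimes> inv k" using yk ykc y0c h by (metis inv_solve_right nat_pow_closed)
          also have "y0 [^] d = h \<otimes> inv k0" using y0 ykc y0c h by (metis inv_solve_right nat_pow_closed)
          also have "h \<otimes> inv k \<otimes> inv (h \<otimes> inv k0) = inv k \<otimes> k0"
            using cancel_quotient[OF h inv_closed[OF ykc(2)] y0c(2)] h ykc y0c by (simp add: inv_mult)
          finally have zd: "?z [^] d \<in> K" using yk y0 by simp
          have "coprime d q" using False p unfolding q(1) by (metis coprime_commute coprime_power_right_iff prime_imp_coprime)
          then obtain u where u: "[d * u = 1] (mod q)" using cong_solve_coprime_nat unfolding One_nat_def by blast
          have "(?z [^] d) [^] u = ?z"
          proof -
            have "(?z [^] d) [^] u = ?z [^] int (d * u)" using zc by (simp add: nat_pow_pow int_pow_int del: of_nat_mult)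
            also have "\<dots> = ?z [^] (1 :: int)"
              using zc q(3)[OF zc] u by (intro int_pow_cong) (auto simp: cong_int_iff[symmetric] simp del: of_nat_mult)
            finally show ?thesis using zc by simp
          qed
          moreover have "(?z [^] d) [^] u \<in> K" using pow_in_subgroup[OF K zd] .
          ultimately have "?z \<in> K" by simp
          with zK' show "fst a \<otimes> inv y0 \<in> K \<inter> K'" using yk by simp
        qed
        moreover have "inj_on (\<lambda>yk. fst yk \<otimes> inv y0) ?P"
        proof (rule inj_onI)
          fix a b assume ab: "a \<in> ?P" "b \<in> ?P" "fst a \<otimes> inv y0 = fst b \<otimes> inv y0"
          hence m: "fst a \<in> ?C" "fst b \<in> ?C" by (simp_all add: mem_Times_iff)
          have "fst a \<in> carrier G" "fst b \<in> carrier G" using subsetD[OF C(1) m(1)] subsetD[OF C(1) m(2)] .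
          hence "fst a = fst b" using ab(3) y0c by simp
          thus "a = b" using inj ab by (meson inj_onD)
        qed
        ultimately show ?thesis using finK by (metis (no_types, lifting) card_inj_on_le finite_Int)
      qed
      thus ?thesis using False by (simp add: m_def)
    qed
  qed
  have "(\<Sum>y\<in>?C. wt v p G f V s y) = (\<Sum>y\<in>?C. \<Sum>d<q. ?s d * ?nu (int d) (y [^] d))"
    using C q q0 by (intro sum.cong wt_eq_sum_nu) auto
  also have "\<dots> <= (\<Sum>y\<in>?C. \<Sum>d<q. ?s d * ((\<Sum>k\<in>K. ?nu (int d) (y [^] d \<otimes> k)) / card K) + \<eta>)"
  proof (intro sum_mono)
    fix y and d :: nat assume y: "y \<in> ?C"
    have yc: "y [^] d \<in> carrier G" using nat_pow_closed[OF subsetD[OF C(1) y]] .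
    have "?nu (int d) (y [^] d) <= (\<Sum>k\<in>K. ?nu (int d) (y [^] d \<otimes> k)) / card K + \<eta>"
      using near_invariantD[OF inv yc, of "int d"] by linarith
    hence "?s d * ?nu (int d) (y [^] d) <= ?s d * ((\<Sum>k\<in>K. ?nu (int d) (y [^] d \<otimes> k)) / card K + \<eta>)"
      using s by (intro mult_left_mono) auto
    also have "\<dots> = ?s d * ((\<Sum>k\<in>K. ?nu (int d) (y [^] d \<otimes> k)) / card K) + ?s d * \<eta>" by (simp add: algebra_simps)
    also have "?s d * \<eta> <= 1 * \<eta>" using s \<eta> by (intro mult_right_mono) auto
    finally show "?s d * ?nu (int d) (y [^] d) <= ?s d * ((\<Sum>k\<in>K. ?nu (int d) (y [^] d \<otimes> k)) / card K) + \<eta>" by simp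
  qed
  also have "\<dots> = (\<Sum>y\<in>?C. \<Sum>d<q. ?s d * ((\<Sum>k\<in>K. ?nu (int d) (y [^] d \<otimes> k)) / card K)) + card K' * q * \<eta>"
    using cardC by (simp add: sum.distrib)
  also have "(\<Sum>y\<in>?C. \<Sum>d<q. ?s d * ((\<Sum>k\<in>K. ?nu (int d) (y [^] d \<otimes> k)) / card K)) = 
      (\<Sum>d<q. ?s d * (\<Sum>y\<in>?C. \<Sum>k\<in>K. ?nu (int d) (y [^] d \<otimes> k))) / card K"
    by (subst sum.swap) (simp add: sum_distrib_left sum_divide_distrib)
  also have "\<dots> <= (\<Sum>d<q. m * (\<Sum>h\<in>carrier G. ?nu (int d) h)) / card K"
  proof (intro divide_right_mono sum_mono)
    fix d :: nat
    have "(\<Sum>y\<in>?C. \<Sum>k\<in>K. ?nu (int d) (y [^] d \<otimes> k)) = (\<Sum>yk\<in>?C \<times> K. ?nu (int d) (fst yk [^] d \<otimes> snd yk))"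
      by (subst sum.cartesian_product) (simp add: case_prod_beta)
    also have "\<dots> = (\<Sum>h\<in>carrier G. \<Sum>yk\<in>{yk \<in> ?C \<times> K. fst yk [^] d \<otimes> snd yk = h}. ?nu (int d) (fst yk [^] d \<otimes> snd yk))"
      using C finK fin K.subset by (intro sum.group[symmetric]) auto
    also have "\<dots> = (\<Sum>h\<in>carrier G. real (card {yk \<in> ?C \<times> K. fst yk [^] d \<otimes> snd yk = h}) * ?nu (int d) h)"
      by (rule sum.cong) auto
    finally have e: "?s d * (\<Sum>y\<in>?C. \<Sum>k\<in>K. ?nu (int d) (y [^] d \<otimes> k)) =
       (\<Sum>h\<in>carrier G. ?s d * real (card {yk \<in> ?C \<times> K. fst yk [^] d \<otimes> snd yk = h}) * ?nu (int d) h)"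
      by (simp add: sum_distrib_left mult.assoc)
    show "?s d * (\<Sum>y\<in>?C. \<Sum>k\<in>K. ?nu (int d) (y [^] d \<otimes> k)) <= m * (\<Sum>h\<in>carrier G. ?nu (int d) h)"
      unfolding e unfolding sum_distrib_left by (intro sum_mono mult_right_mono count nu_nonneg v)
  qed simp
  also have "\<dots> = m / card K"
    using sum_nu_carrier[OF fin f q0(1), of "\<lambda>_. m" v] V by (simp add: sub_exp_const)
  also have "card K' * q * \<eta> <= q * order G * \<eta>"
  proof -
    have "card K' <= order G" using fin K'.subset by (simp add: order_def card_mono)
    thus ?thesis using \<eta> by (intro mult_right_mono) (simp_all add: mult.commute flip: of_nat_mult)
  qed
  finally show ?thesis by (simp add: m_def)
qed

lemma wt_le_coset_prob:
  fixes \<eta> :: real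
  assumes fin: "finite (carrier G)" and v: "0 <= v" "v <= 1" and V: "finite V" and f: "f \<in> V \<rightarrow> carrier G"
    and q: "q > 0" "p dvd q" "\<And>x. x \<in> carrier G ==> x [^] q = \<one>"
    and K: "subgroup K G" and y: "y \<in> carrier G"
    and inv: "near_invariant K \<eta> (nu v q G f V)"
  shows "wt v p G f V 1 y <= sub_exp v V (\<lambda>S. of_bool (finprod G f S \<otimes> inv (y [^] card S) \<in> K)) / card K + q * \<eta>"
proof -
  interpret K: subgroup K G by fact
  let ?nu = "nu v q G f V"
  have finK: "finite K" using fin K.subset finite_subset by auto
  have "wt v p G f V 1 y = (\<Sum>d<q. ?nu (int d) (y [^] d))"
    using wt_eq_sum_nu[OF y q(3)[OF y] q(1,2), of v f V 1] by simp
  also have "\<dots> <= (\<Sum>d<q. (\<Sum>k\<in>K. ?nu (int d) (y [^] d \<otimes> k)) / card K + \<eta>)"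
  proof (intro sum_mono)
    fix d :: nat
    show "?nu (int d) (y [^] d) <= (\<Sum>k\<in>K. ?nu (int d) (y [^] d \<otimes> k)) / card K + \<eta>"
      using near_invariantD[OF inv nat_pow_closed[OF y], of "int d" d] by linarith
  qed
  also have "\<dots> = (\<Sum>d<q. \<Sum>k\<in>K. ?nu (int d) (y [^] d \<otimes> k)) / card K + q * \<eta>"
    by (simp add: sum.distrib sum_divide_distrib)
  also have "(\<Sum>d<q. \<Sum>k\<in>K. ?nu (int d) (y [^] d \<otimes> k)) = 
     sub_exp v V (\<lambda>S. \<Sum>d<q. of_bool ([int (card S) = int d] (mod int q)) * (\<Sum>k\<in>K. of_bool (finprod G f S = y [^] d \<otimes> k)))"
    unfolding nu_def sub_exp_sum[symmetric]
    by (rule sub_exp_cong) (simp add: sum_distrib_left of_bool_conj del: sum_of_bool_mult_eq)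
  also have "\<dots> = sub_exp v V (\<lambda>S. of_bool (finprod G f S \<otimes> inv (y [^] card S) \<in> K))"
  proof (rule sub_exp_cong)
    fix S assume S: "S \<subseteq> V"
    let ?x = "finprod G f S"
    have x: "?x \<in> carrier G" using S f by (intro finprod_closed) auto
    have ym: "y [^] (card S mod q) = y [^] card S"
    proof -
      have "y [^] int (card S mod q) = y [^] int (card S)"
        using y q by (intro int_pow_cong) (auto simp: cong_def zmod_int)
      thus ?thesis by (simp add: int_pow_int)
    qed
    have iff: "?x = y [^] card S \<otimes> k \<longleftrightarrow> k = ?x \<otimes> inv (y [^] card S)" if "k \<in> K" for k
    proof -
      have k: "k \<in> carrier G" "y [^] card S \<in> carrier G" using that K.subset y by auto
      thus ?thesis using x by (metis inv_solve_right m_closed m_comm)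
    qed
    have "(\<Sum>k\<in>K. of_bool (?x = y [^] card S \<otimes> k)) = (\<Sum>k\<in>K. if k = ?x \<otimes> inv (y [^] card S) then 1 else (0 :: real))"
      by (rule sum.cong) (auto simp: iff)
    also have "\<dots> = of_bool (?x \<otimes> inv (y [^] card S) \<in> K)" using finK by simp
    finally show "(\<Sum>d<q. of_bool ([int (card S) = int d] (mod int q)) * (\<Sum>k\<in>K. of_bool (?x = y [^] d \<otimes> k))) =
       (of_bool (?x \<otimes> inv (y [^] card S) \<in> K) :: real)"
      by (subst sum_residues[OF q(1)]) (simp add: ym)
  qed
  finally show ?thesis .
qed

text \<open>
  Whatever the choices at the other vertices are, at most one of the two choices at \<open>i\<close> leads into the given coset.
\<close>

lemma coset_prob_le_max:
  assumes v: "0 <= v" "v <= 1" and V: "finite V" and f: "f \<in> V \<rightarrow> carrier G"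
    and K: "subgroup K G" and y: "y \<in> carrier G" and i: "i \<in> V" "f i \<otimes> inv y \<notin> K"
  shows "sub_exp v V (\<lambda>S. of_bool (finprod G f S \<otimes> inv (y [^] card S) \<in> K)) <= max v (1 - v)"
proof -
  interpret K: subgroup K G by fact
  define W where "W = V - {i}"
  have W: "finite W" "i \<notin> W" "V = insert i W" using i V by (auto simp: W_def)
  let ?A = "\<lambda>S. finprod G f S \<otimes> inv (y [^] card S)"
  let ?th = "max v (1 - v)"
  have "sub_exp v V (\<lambda>S. of_bool (?A S \<in> K)) = sub_exp v W (\<lambda>S. (1 - v) * of_bool (?A S \<in> K) + v * of_bool (?A (insert i S) \<in> K))"
    unfolding W(3) using W by (simp add: sub_exp_insert sub_exp_add sub_exp_cmult)
  also have "\<dots> <= sub_exp v W (\<lambda>_. ?th)"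
  proof (rule sub_exp_mono[OF v])
    fix S assume S: "S \<subseteq> W"
    have fS: "finite S" "i \<notin> S" "f \<in> S \<rightarrow> carrier G" "f i \<in> carrier G" using S W f finite_subset by auto
    have x: "finprod G f S \<in> carrier G" using fS by (intro finprod_closed)
    have "?A (insert i S) = (f i \<otimes> inv y) \<otimes> ?A S"
    proof -
      let ?w = "inv (y [^] card S)" and ?u = "inv y"
      have c: "?w \<in> carrier G" "?u \<in> carrier G" using y by auto
      have "?A (insert i S) = (f i \<otimes> finprod G f S) \<otimes> (?u \<otimes> ?w)"
        using fS x y by (simp add: inv_mult_group)
      also have "\<dots> = (f i \<otimes> ?u) \<otimes> (finprod G f S \<otimes> ?w)"
        using fS(4) x c by (simp only: m_ac m_closed)
      finally show ?thesis .
    qed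
    hence "\<not> (?A S \<in> K \<and> ?A (insert i S) \<in> K)"
    proof -
      have A: "?A S \<in> carrier G" using x y by simp
      have "f i \<otimes> inv y = ?A (insert i S) \<otimes> inv (?A S)"
        using \<open>?A (insert i S) = (f i \<otimes> inv y) \<otimes> ?A S\<close> A fS y by (simp add: m_assoc)
      thus ?thesis using i(2) K.m_closed K.m_inv_closed by auto
    qed
    thus "(1 - v) * of_bool (?A S \<in> K) + v * of_bool (?A (insert i S) \<in> K) <= ?th" using v by auto
  qed
  also have "\<dots> = ?th" using W by (simp add: sub_exp_const)
  finally show ?thesis .
qed

lemma wt_near_uniform:
  fixes s \<eta> :: real
  assumes fin: "finite (carrier G)" and v: "0 <= v" "v <= 1" and V: "finite V" and f: "f \<in> V \<rightarrow> carrier G"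
    and q: "q > 0" "p dvd q" "\<And>x. x \<in> carrier G ==> x [^] q = \<one>" and y: "y \<in> carrier G" and s: "0 <= s"
    and inv: "near_invariant (carrier G) \<eta> (nu v q G f V)"
  shows "\<bar>wt v p G f V s y - sub_exp v V (\<lambda>S. if p dvd card S then s else 1) / order G\<bar> <= q * max 1 s * \<eta>"
proof -
  let ?nu = "nu v q G f V"
  let ?s = "\<lambda>d. if p dvd d then s else 1"
  have "sub_exp v V (\<lambda>S. ?s (card S)) = sub_exp v V (\<lambda>S. ?s (card S mod q))"
    using q(2) by (intro sub_exp_cong) (simp add: dvd_mod_iff)
  also have "\<dots> = (\<Sum>d<q. ?s d * (\<Sum>h\<in>carrier G. ?nu (int d) h))"
    by (rule sum_nu_carrier[OF fin f q(1), symmetric])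
  finally have E0: "sub_exp v V (\<lambda>S. ?s (card S)) = (\<Sum>d<q. ?s d * (\<Sum>h\<in>carrier G. ?nu (int d) h))" .
  have E: "sub_exp v V (\<lambda>S. ?s (card S)) / order G = (\<Sum>d<q. ?s d * ((\<Sum>h\<in>carrier G. ?nu (int d) h) / order G))"
    unfolding E0 sum_divide_distrib[of _ "{..<q}"] by simp
  have trans: "(\<Sum>k\<in>carrier G. ?nu d (x \<otimes> k)) = (\<Sum>h\<in>carrier G. ?nu d h)" if x: "x \<in> carrier G" for x d
    using x by (intro sum.reindex_bij_witness[of _ "\<lambda>h. inv x \<otimes> h" "\<lambda>k. x \<otimes> k"]) (auto simp: m_assoc[symmetric])
  have "wt v p G f V s y - sub_exp v V (\<lambda>S. ?s (card S)) / order G = 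
     (\<Sum>d<q. ?s d * (?nu (int d) (y [^] d) - (\<Sum>k\<in>carrier G. ?nu (int d) (y [^] d \<otimes> k)) / card (carrier G)))"
    unfolding E wt_eq_sum_nu[OF y q(3)[OF y] q(1,2)] using y trans
    by (simp add: sum_subtractf[symmetric] right_diff_distrib order_def)
  also have "\<bar>\<dots>\<bar> <= (\<Sum>d<q. max 1 s * \<eta>)"
  proof (intro order_trans[OF sum_abs] sum_mono)
    fix d :: nat
    show "\<bar>?s d * (?nu (int d) (y [^] d) - (\<Sum>k\<in>carrier G. ?nu (int d) (y [^] d \<otimes> k)) / card (carrier G))\<bar> <= max 1 s * \<eta>"
      unfolding abs_mult using near_invariantD[OF inv nat_pow_closed[OF y], of "int d" d] s
      by (intro mult_mono) auto
  qed
  finally show ?thesis by simp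
qed

end

section \<open>Counting homomorphisms and surjections\<close>

definition homs :: "('a, 'c) monoid_scheme => ('b, 'd) monoid_scheme => ('a => 'b) set" where
  "homs Y M = {f \<in> hom Y M. f \<in> extensional (carrier Y)}"

definition surs :: "('a, 'c) monoid_scheme => ('b, 'd) monoid_scheme => ('a => 'b) set" where
  "surs Y M = {f \<in> homs Y M. f ` carrier Y = carrier M}"

lemma homsI:
  assumes "\<And>x. x \<in> carrier Y ==> f x \<in> carrier M"
    "\<And>x y. x \<in> carrier Y ==> y \<in> carrier Y ==> f (x \<otimes>\<^bsub>Y\<^esub> y) = f x \<otimes>\<^bsub>M\<^esub> f y"
    "\<And>x. x \<notin> carrier Y ==> f x = undefined"
  shows "f \<in> homs Y M"
  using assms by (auto simp: homs_def hom_def extensional_def)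

lemma homsD:
  assumes "f \<in> homs Y M"
  shows "x \<in> carrier Y ==> f x \<in> carrier M"
    and "x \<in> carrier Y ==> y \<in> carrier Y ==> f (x \<otimes>\<^bsub>Y\<^esub> y) = f x \<otimes>\<^bsub>M\<^esub> f y"
    and "x \<notin> carrier Y ==> f x = undefined"
  using assms by (auto simp: homs_def hom_def extensional_def)

lemma homs_group_hom: "group Y ==> group M ==> f \<in> homs Y M ==> group_hom Y M f"
  by (simp add: group_hom_def group_hom_axioms_def homs_def)

lemma homs_ext:
  assumes "f \<in> homs Y M" "g \<in> homs Y M" "\<And>x. x \<in> carrier Y ==> f x = g x"
  shows "f = g"
  using assms by (auto simp: homs_def intro: extensionalityI)

lemma homs_subset_PiE: "homs Y M \<subseteq> carrier Y \<rightarrow>\<^sub>E carrier M"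
  by (auto simp: homs_def hom_def PiE_def)

lemma finite_homs: "finite (carrier Y) ==> finite (carrier M) ==> finite (homs Y M)"
  by (rule finite_subset[OF homs_subset_PiE]) (rule finite_PiE, auto)

lemma surs_subset_homs: "surs Y M \<subseteq> homs Y M" by (auto simp: surs_def)

lemma finite_surs: "finite (carrier Y) ==> finite (carrier M) ==> finite (surs Y M)"
  using finite_subset[OF surs_subset_homs finite_homs] .

lemma surs_image: "f \<in> surs Y M ==> f ` carrier Y = carrier M" by (simp add: surs_def)

lemma homs_eq_iff_kernel:
  assumes "group Y" "group M" "f \<in> homs Y M" "x \<in> carrier Y" "y \<in> carrier Y"
  shows "f x = f y \<longleftrightarrow> x \<otimes>\<^bsub>Y\<^esub> inv\<^bsub>Y\<^esub> y \<in> kernel Y M f"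
proof -
  interpret Y: group Y by fact
  interpret M: group M by fact
  interpret h: group_hom Y M f using assms by (intro homs_group_hom)
  have c: "f x \<in> carrier M" "f y \<in> carrier M" using assms by auto
  have "x \<otimes>\<^bsub>Y\<^esub> inv\<^bsub>Y\<^esub> y \<in> kernel Y M f \<longleftrightarrow> f x \<otimes>\<^bsub>M\<^esub> inv\<^bsub>M\<^esub> (f y) = \<one>\<^bsub>M\<^esub>"
    using assms by (simp add: kernel_def)
  also have "\<dots> \<longleftrightarrow> f x = f y" using c by (metis M.inv_equality M.inv_inv M.r_inv M.inv_closed)
  finally show ?thesis by simp
qed

lemma bij_betw_homs_factor:
  assumes Y: "group Y" and E: "group E" and M: "group M" and \<Psi>: "\<Psi> \<in> surs Y E"
  shows "bij_betw (\<lambda>\<kappa>. restrict (\<kappa> \<circ> \<Psi>) (carrier Y)) (homs E M) {\<psi> \<in> homs Y M. kernel Y E \<Psi> \<subseteq> kernel Y M \<psi>}"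
proof -
  let ?F = "\<lambda>\<kappa>. restrict (\<kappa> \<circ> \<Psi>) (carrier Y)"
  interpret Y: group Y by fact
  interpret E: group E by fact
  interpret M: group M by fact
  have \<Psi>h: "\<Psi> \<in> homs Y E" and im: "\<Psi> ` carrier Y = carrier E" using \<Psi> by (auto simp: surs_def)
  note \<Psi>D = homsD[OF \<Psi>h]
  show ?thesis
  proof (rule bij_betwI')
    fix \<kappa> \<kappa>' assume c: "\<kappa> \<in> homs E M" "\<kappa>' \<in> homs E M"
    show "?F \<kappa> = ?F \<kappa>' \<longleftrightarrow> \<kappa> = \<kappa>'"
    proof
      assume eq: "?F \<kappa> = ?F \<kappa>'"
      show "\<kappa> = \<kappa>'"
      proof (rule homs_ext[OF c])
        fix e assume "e \<in> carrier E"
        then obtain x where x: "x \<in> carrier Y" "e = \<Psi> x" using im by auto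
        thus "\<kappa> e = \<kappa>' e" using fun_cong[OF eq, of x] by simp
      qed
    qed simp
  next
    fix \<kappa> assume c: "\<kappa> \<in> homs E M"
    interpret c: group_hom E M \<kappa> using c E M by (intro homs_group_hom)
    have "?F \<kappa> \<in> homs Y M"
      by (rule homsI) (auto simp: \<Psi>D homsD[OF c])
    moreover have "kernel Y E \<Psi> \<subseteq> kernel Y M (?F \<kappa>)" by (auto simp: kernel_def)
    ultimately show "?F \<kappa> \<in> {\<psi> \<in> homs Y M. kernel Y E \<Psi> \<subseteq> kernel Y M \<psi>}" by simp
  next
    fix \<psi> assume "\<psi> \<in> {\<psi> \<in> homs Y M. kernel Y E \<Psi> \<subseteq> kernel Y M \<psi>}"
    hence \<psi>: "\<psi> \<in> homs Y M" "kernel Y E \<Psi> \<subseteq> kernel Y M \<psi>" by auto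
    define r where "r e = (SOME x. x \<in> carrier Y \<and> \<Psi> x = e)" for e
    have r: "r e \<in> carrier Y \<and> \<Psi> (r e) = e" if "e \<in> carrier E" for e
      unfolding r_def by (rule someI_ex) (metis that im imageE)
    have wd: "\<psi> x = \<psi> y" if "x \<in> carrier Y" "y \<in> carrier Y" "\<Psi> x = \<Psi> y" for x y
    proof -
      have "x \<otimes>\<^bsub>Y\<^esub> inv\<^bsub>Y\<^esub> y \<in> kernel Y E \<Psi>" using homs_eq_iff_kernel[OF Y E \<Psi>h that(1,2)] that(3) by simp
      from subsetD[OF \<psi>(2) this] show ?thesis using homs_eq_iff_kernel[OF Y M \<psi>(1) that(1,2)] by simp
    qed
    let ?c = "\<lambda>e\<in>carrier E. \<psi> (r e)"
    have "?c \<in> homs E M"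
    proof (rule homsI)
      fix x y assume xy: "x \<in> carrier E" "y \<in> carrier E"
      have "\<psi> (r (x \<otimes>\<^bsub>E\<^esub> y)) = \<psi> (r x \<otimes>\<^bsub>Y\<^esub> r y)"
        using xy r by (intro wd) (auto simp: \<Psi>D)
      thus "?c (x \<otimes>\<^bsub>E\<^esub> y) = ?c x \<otimes>\<^bsub>M\<^esub> ?c y" using xy r by (simp add: homsD[OF \<psi>(1)])
    qed (use r homsD[OF \<psi>(1)] in auto)
    moreover have "\<psi> = ?F ?c"
    proof
      fix x show "\<psi> x = ?F ?c x"
      proof (cases "x \<in> carrier Y")
        case True
        thus ?thesis using r[of "\<Psi> x"] \<Psi>D(1)[OF True] wd[of x "r (\<Psi> x)"] by simp
      qed (simp add: homsD[OF \<psi>(1)])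
    qed
    ultimately show "\<exists>\<kappa>\<in>homs E M. \<psi> = ?F \<kappa>" by blast
  qed
qed

lemma bij_betw_surs_factor:
  assumes Y: "group Y" and E: "group E" and M: "group M" and \<Psi>: "\<Psi> \<in> surs Y E"
  shows "bij_betw (\<lambda>\<kappa>. restrict (\<kappa> \<circ> \<Psi>) (carrier Y)) (surs E M) {\<psi> \<in> surs Y M. kernel Y E \<Psi> \<subseteq> kernel Y M \<psi>}"
proof -
  let ?F = "\<lambda>\<kappa>. restrict (\<kappa> \<circ> \<Psi>) (carrier Y)"
  note b = bij_betw_homs_factor[OF assms]
  have im: "?F \<kappa> ` carrier Y = \<kappa> ` carrier E" for \<kappa> :: "_ => 'e"
    using surs_image[OF \<Psi>] by (metis image_comp image_restrict_eq)
  have Fim: "?F ` homs E M = {\<psi> \<in> homs Y M. kernel Y E \<Psi> \<subseteq> kernel Y M \<psi>}" using b by (rule bij_betw_imp_surj_on)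
  have "?F ` surs E M = {\<psi> \<in> surs Y M. kernel Y E \<Psi> \<subseteq> kernel Y M \<psi>}"
  proof (intro equalityI subsetI)
    fix \<psi> assume "\<psi> \<in> ?F ` surs E M"
    then obtain \<kappa> where k: "\<kappa> \<in> surs E M" "\<psi> = ?F \<kappa>" by blast
    hence "\<psi> \<in> ?F ` homs E M" using surs_subset_homs by blast
    thus "\<psi> \<in> {\<psi> \<in> surs Y M. kernel Y E \<Psi> \<subseteq> kernel Y M \<psi>}"
      unfolding Fim using im[of \<kappa>] k by (simp add: surs_def)
  next
    fix \<psi> assume p: "\<psi> \<in> {\<psi> \<in> surs Y M. kernel Y E \<Psi> \<subseteq> kernel Y M \<psi>}"
    hence "\<psi> \<in> ?F ` homs E M" unfolding Fim using surs_subset_homs by blast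
    then obtain \<kappa> where k: "\<kappa> \<in> homs E M" "\<psi> = ?F \<kappa>" by blast
    hence "\<kappa> \<in> surs E M" using im[of \<kappa>] p by (simp add: surs_def)
    thus "\<psi> \<in> ?F ` surs E M" using k by blast
  qed
  moreover have "inj_on ?F (surs E M)" using inj_on_subset[OF bij_betw_imp_inj_on[OF b] surs_subset_homs] .
  ultimately show ?thesis by (simp add: bij_betw_def)
qed

lemma card_image_times_kernel:
  assumes "group_hom Y M h" "finite (carrier Y)"
  shows "card (h ` carrier Y) * card (kernel Y M h) = card (carrier Y)"
proof -
  interpret group_hom Y M h by fact
  have "card {x \<in> carrier Y. h x = m} = card (kernel Y M h)" if m: "m \<in> h ` carrier Y" for m
  proof -
    obtain x0 where x0: "x0 \<in> carrier Y" "m = h x0" using m by auto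
    have "bij_betw (\<lambda>x. x0 \<otimes>\<^bsub>Y\<^esub> x) (kernel Y M h) {x \<in> carrier Y. h x = m}"
      using x0 by (intro bij_betw_byWitness[of _ "\<lambda>x. inv\<^bsub>Y\<^esub> x0 \<otimes>\<^bsub>Y\<^esub> x"])
        (auto simp: kernel_def G.m_assoc[symmetric])
    thus ?thesis by (simp add: bij_betw_same_card)
  qed
  hence "(\<Sum>m\<in>h ` carrier Y. card {x \<in> carrier Y. h x = m}) = (\<Sum>m\<in>h ` carrier Y. card (kernel Y M h))"
    by (rule sum.cong[OF refl])
  moreover have "card (carrier Y) = (\<Sum>m\<in>h ` carrier Y. card {x \<in> carrier Y. h x = m})"
    using sum.image_gen[OF assms(2), of "\<lambda>_. 1 :: nat" h] by (simp only: card_eq_sum)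
  ultimately show ?thesis by simp
qed

section \<open>Elementary abelian groups\<close>

abbreviation Zp :: "nat => int monoid" where "Zp \<equiv> integer_mod_group"

lemma carrier_Zp: "p > 0 ==> carrier (Zp p) = {0..<int p}"
  by (simp add: carrier_integer_mod_group)

lemma homs_Zp_pow:
  assumes "group Y" "f \<in> homs Y (Zp p)" "x \<in> carrier Y"
  shows "f (x [^]\<^bsub>Y\<^esub> (n :: nat)) = (int n * f x) mod int p"
proof -
  interpret group_hom Y "Zp p" f using assms by (intro homs_group_hom) auto
  show ?thesis using assms by (simp add: hom_nat_pow)
qed

lemma (in comm_group) adjoin_element:
  assumes fin: "finite (carrier G)" and p: "Factorial_Ring.prime p" and exp: "\<And>x. x \<in> carrier G ==> x [^] p = \<one>"
    and A: "subgroup A G" and x: "x \<in> carrier G" "x \<notin> A"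
  defines "B \<equiv> (\<lambda>(a, t). a \<otimes> x [^] t) ` (A \<times> {..<p})"
  shows "subgroup B G" "card B = p * card A"
    "card (homs (G\<lparr>carrier := B\<rparr>) (Zp p)) = p * card (homs (G\<lparr>carrier := A\<rparr>) (Zp p))"
proof -
  interpret A: subgroup A G by fact
  have p0: "p > 0" "p > 1" using prime_gt_0_nat[OF p] prime_gt_1_nat[OF p] by auto
  let ?m = "\<lambda>(a, t). a \<otimes> x [^] (t :: nat)"
  have Ac: "a \<in> carrier G" if "a \<in> A" for a using that A.subset by auto
  have xmod: "x [^] (t mod p) = x [^] t" for t :: nat
  proof -
    have "x [^] t = x [^] (p * (t div p) + t mod p)" by simp
    also have "\<dots> = x [^] (t mod p)" using x exp by (simp only: nat_pow_mult[symmetric] nat_pow_pow[symmetric]) simp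
    finally show ?thesis ..
  qed
  have aux: "t = t'" if "a \<in> A" "a' \<in> A" "t < p" "t' < p" "t <= t'" "a \<otimes> x [^] t = a' \<otimes> x [^] t'" for a a' t t'
  proof (rule ccontr)
    assume "t ~= t'"
    let ?d = "t' - t"
    have d: "0 < ?d" "?d < p" using that \<open>t ~= t'\<close> by auto
    have "a \<otimes> x [^] t = (a' \<otimes> x [^] ?d) \<otimes> x [^] t"
      using that x Ac by (simp add: m_assoc nat_pow_mult)
    hence "a = a' \<otimes> x [^] ?d" using that x Ac by simp
    hence "x [^] ?d = inv a' \<otimes> a" using that x Ac by (metis inv_solve_left nat_pow_closed)
    hence xd: "x [^] ?d \<in> A" using that by simp
    have "coprime ?d p" using d p by (metis coprime_commute dvd_imp_le leD prime_imp_coprime)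
    then obtain u where u: "[?d * u = 1] (mod p)" using cong_solve_coprime_nat unfolding One_nat_def by blast
    have "(x [^] ?d) [^] u = x [^] ((?d * u) mod p)" using x by (simp add: nat_pow_pow xmod)
    also have "(?d * u) mod p = 1" using u p0 by (simp add: cong_def)
    finally have "(x [^] ?d) [^] u = x" using x by simp
    moreover have "(x [^] ?d) [^] u \<in> A" using pow_in_subgroup[OF A xd] .
    ultimately show False using x by simp
  qed
  have inj: "inj_on ?m (A \<times> {..<p})"
  proof (rule inj_onI)
    fix u w assume uw: "u \<in> A \<times> {..<p}" "w \<in> A \<times> {..<p}" "?m u = ?m w"
    obtain a t a' t' where e: "u = (a, t)" "w = (a', t')" by (cases u, cases w)
    have *: "a \<in> A" "t \<in> {..<p}" "a' \<in> A" "t' \<in> {..<p}" "a \<otimes> x [^] t = a' \<otimes> x [^] t'"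
      using uw e by simp_all
    have t: "t = t'"
    proof (cases "t <= t'")
      case True
      show ?thesis by (rule aux[OF *(1,3) _ _ True *(5)]) (use *(2,4) in simp_all)
    next
      case False
      have "t' = t" by (rule aux[OF *(3,1) _ _ _ *(5)[symmetric]]) (use *(2,4) False in simp_all)
      thus ?thesis ..
    qed
    moreover have "a = a'" using *(5) Ac[OF *(1)] Ac[OF *(3)] x unfolding t by simp
    ultimately show "u = w" using e by simp
  qed
  show cardB: "card B = p * card A" unfolding B_def using inj by (subst card_image) (simp_all add: card_cartesian_product mult.commute)
  have mult: "?m (a, t) \<otimes> ?m (a', t') = ?m (a \<otimes> a', (t + t') mod p)" if "a \<in> A" "a' \<in> A" for a a' t t'
  proof -
    have "?m (a, t) \<otimes> ?m (a', t') = (a \<otimes> a') \<otimes> (x [^] t \<otimes> x [^] t')"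
      using that x Ac by (simp only: m_ac m_closed nat_pow_closed prod.case)
    thus ?thesis using x by (simp add: nat_pow_mult xmod)
  qed
  have memB: "?m (a, t) \<in> B" if "a \<in> A" "t < p" for a t using that by (auto simp: B_def)
  show subB: "subgroup B G"
  proof (rule subgroupI)
    show "B \<subseteq> carrier G" using Ac x by (auto simp: B_def)
    show "B ~= {}" using memB[OF A.one_closed, of 0] p0 by blast
  next
    fix b b' assume "b \<in> B" "b' \<in> B"
    then obtain a t a' t' where "a \<in> A" "t < p" "a' \<in> A" "t' < p" "b = ?m (a, t)" "b' = ?m (a', t')" by (auto simp: B_def)
    thus "b \<otimes> b' \<in> B" using mult[of a a' t t'] memB[of "a \<otimes> a'" "(t + t') mod p"] p0 by auto
  next
    fix b assume "b \<in> B"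
    then obtain a t where b: "a \<in> A" "t < p" "b = ?m (a, t)" by (auto simp: B_def)
    let ?t = "(p - t) mod p"
    have t0: "(?t + t) mod p = 0" using b by (cases "t = 0") auto
    have "inv b = ?m (inv a, ?t)"
    proof (rule inv_equality)
      have "?m (inv a, ?t) \<otimes> b = ?m (inv a \<otimes> a, (?t + t) mod p)" using b mult by auto
      thus "?m (inv a, ?t) \<otimes> b = \<one>" using b Ac t0 by simp
    qed (use b Ac x in auto)
    thus "inv b \<in> B" using b memB[of "inv a" ?t] p0 by simp
  qed
  have AB: "A \<subseteq> B" and xB: "x \<in> B"
  proof -
    show "A \<subseteq> B" using memB[of _ 0] p0 Ac by force
    show "x \<in> B" using memB[of \<one> 1] p0 x by simp
  qed
  define g where "g = the_inv_into (A \<times> {..<p}) ?m"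
  have g: "g (?m (a, t)) = (a, t)" if "a \<in> A" "t < p" for a t
    unfolding g_def using that by (intro the_inv_into_f_f[OF inj]) auto
  let ?GA = "G\<lparr>carrier := A\<rparr>" and ?GB = "G\<lparr>carrier := B\<rparr>"
  have grp: "group ?GA" "group ?GB" using A subB subgroup.subgroup_is_group is_group by blast+
  have pow_eq: "y [^]\<^bsub>?GB\<^esub> (t :: nat) = y [^] t" for y t by (simp add: nat_pow_def)
  let ?R = "\<lambda>\<psi>. (restrict \<psi> A, \<psi> x)"
  have "bij_betw ?R (homs ?GB (Zp p)) (homs ?GA (Zp p) \<times> {0..<int p})"
  proof (rule bij_betwI')
    fix \<psi> \<psi>' assume h: "\<psi> \<in> homs ?GB (Zp p)" "\<psi>' \<in> homs ?GB (Zp p)"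
    show "?R \<psi> = ?R \<psi>' \<longleftrightarrow> \<psi> = \<psi>'"
    proof
      assume eq: "?R \<psi> = ?R \<psi>'"
      show "\<psi> = \<psi>'"
      proof (rule homs_ext[OF h])
        fix b assume "b \<in> carrier ?GB"
        then obtain a t where b: "a \<in> A" "t < p" "b = a \<otimes> x [^] t" by (auto simp: B_def)
        have val: "\<phi> b = (\<phi> a + (int t * \<phi> x) mod int p) mod int p" if \<phi>: "\<phi> \<in> homs ?GB (Zp p)" for \<phi>
        proof -
          have xt: "x [^] t \<in> B" using pow_in_subgroup[OF subB xB] .
          have "\<phi> (x [^] t) = (int t * \<phi> x) mod int p"
            using homs_Zp_pow[OF grp(2) \<phi>, of x t] xB by (simp add: pow_eq)
          thus ?thesis using homsD(2)[OF \<phi>, of a "x [^] t"] b AB xt by auto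
        qed
        have "\<psi> a = \<psi>' a" "\<psi> x = \<psi>' x" using eq b(1) by (auto dest: fun_cong[of _ _ a])
        thus "\<psi> b = \<psi>' b" using val[OF h(1)] val[OF h(2)] by simp
      qed
    qed simp
  next
    fix \<psi> assume h: "\<psi> \<in> homs ?GB (Zp p)"
    have "restrict \<psi> A \<in> homs ?GA (Zp p)"
      by (rule homsI) (use subsetD[OF AB] homsD[OF h] in auto)
    moreover have "\<psi> x \<in> {0..<int p}" using homsD(1)[OF h, of x] xB p0 by (simp add: carrier_Zp)
    ultimately show "?R \<psi> \<in> homs ?GA (Zp p) \<times> {0..<int p}" by simp
  next
    fix y assume "y \<in> homs ?GA (Zp p) \<times> {0..<int p}"
    then obtain \<kappa> c where y: "y = (\<kappa>, c)" "\<kappa> \<in> homs ?GA (Zp p)" "0 <= c" "c < int p" by auto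
    define \<psi> where "\<psi> = (\<lambda>b\<in>B. (\<kappa> (fst (g b)) + c * int (snd (g b))) mod int p)"
    have \<psi>: "\<psi> (?m (a, t)) = (\<kappa> a + c * int t) mod int p" if "a \<in> A" "t < p" for a t
      using memB[OF that] g[OF that] by (simp add: \<psi>_def)
    have \<kappa>range: "0 <= \<kappa> a" "\<kappa> a < int p" if "a \<in> A" for a
      using homsD(1)[OF y(2), of a] that p0 by (auto simp: carrier_Zp)
    have "\<psi> \<in> homs ?GB (Zp p)"
    proof (rule homsI)
      fix b b' assume "b \<in> carrier ?GB" "b' \<in> carrier ?GB"
      then obtain a t a' t' where b: "a \<in> A" "t < p" "a' \<in> A" "t' < p" "b = ?m (a, t)" "b' = ?m (a', t')" by (auto simp: B_def)
      have "\<psi> (b \<otimes> b') = (\<kappa> (a \<otimes> a') + c * int ((t + t') mod p)) mod int p"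
        unfolding b(5,6) mult[OF b(1,3)] using b p0 by (intro \<psi>) auto
      also have "\<kappa> (a \<otimes> a') = (\<kappa> a + \<kappa> a') mod int p" using homsD(2)[OF y(2), of a a'] b by simp
      also have "((\<kappa> a + \<kappa> a') mod int p + c * int ((t + t') mod p)) mod int p
          = ((\<kappa> a + c * int t) mod int p + (\<kappa> a' + c * int t') mod int p) mod int p"
      proof -
        have "((\<kappa> a + \<kappa> a') mod int p + c * int ((t + t') mod p)) mod int p
          = ((\<kappa> a + \<kappa> a') + c * (int t + int t')) mod int p"
          unfolding zmod_int of_nat_add by (simp only: mod_add_left_eq mod_add_right_eq mod_mult_right_eq) (metis mod_add_right_eq mod_mult_right_eq)
        also have "(\<kappa> a + \<kappa> a') + c * (int t + int t') = (\<kappa> a + c * int t) + (\<kappa> a' + c * int t')"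
          by (simp add: algebra_simps)
        finally show ?thesis by (simp only: mod_add_eq)
      qed
      also have "\<dots> = \<psi> b \<otimes>\<^bsub>Zp p\<^esub> \<psi> b'" using \<psi>[OF b(1,2)] \<psi>[OF b(3,4)] b(5,6) by simp
      finally show "\<psi> (b \<otimes>\<^bsub>?GB\<^esub> b') = \<psi> b \<otimes>\<^bsub>Zp p\<^esub> \<psi> b'" by simp
    qed (auto simp: \<psi>_def carrier_Zp p0)
    moreover have "restrict \<psi> A = \<kappa>"
    proof
      fix a show "restrict \<psi> A a = \<kappa> a"
        using \<psi>[of a 0] p0 Ac \<kappa>range homsD(3)[OF y(2), of a] by (cases "a \<in> A") auto
    qed
    moreover have "\<psi> x = c"
    proof -
      have "\<kappa> \<one> = 0"
        using group_hom.hom_one[OF homs_group_hom[OF grp(1) _ y(2)]] by simp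
      thus ?thesis using \<psi>[of \<one> 1] p0 x y by simp
    qed
    ultimately show "\<exists>\<psi>\<in>homs ?GB (Zp p). y = ?R \<psi>" using y by auto
  qed
  from bij_betw_same_card[OF this] show "card (homs ?GB (Zp p)) = p * card (homs ?GA (Zp p))"
    by (simp add: card_cartesian_product mult.commute)
qed

lemma (in comm_group) card_homs_elementary:
  assumes fin: "finite (carrier G)" and p: "Factorial_Ring.prime p" and exp: "\<And>x. x \<in> carrier G ==> x [^] p = \<one>"
  shows "card (homs G (Zp p)) = card (carrier G) \<and> (\<exists>s. card (carrier G) = p ^ s)"
proof -
  let ?P = "\<lambda>A. subgroup A G \<and> card (homs (G\<lparr>carrier := A\<rparr>) (Zp p)) = card A \<and> (\<exists>s. card A = p ^ s)"
  have p0: "p > 0" "p > 1" using prime_gt_0_nat[OF p] prime_gt_1_nat[OF p] by auto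
  have sub: "A \<subseteq> carrier G" if "?P A" for A using that subgroup.subset by blast
  have one: "?P {\<one>}"
  proof -
    have "homs (G\<lparr>carrier := {\<one>}\<rparr>) (Zp p) = {\<lambda>x\<in>{\<one>}. 0}"
    proof (intro equalityI subsetI)
      fix f assume f: "f \<in> homs (G\<lparr>carrier := {\<one>}\<rparr>) (Zp p)"
      have "group (G\<lparr>carrier := {\<one>}\<rparr>)" using triv_subgroup subgroup.subgroup_is_group is_group by blast
      hence "f \<one> = 0" using group_hom.hom_one[OF homs_group_hom[OF _ _ f]] by simp
      thus "f \<in> {\<lambda>x\<in>{\<one>}. 0}" using homsD(3)[OF f] by auto
    next
      fix f assume "f \<in> {\<lambda>x\<in>{\<one>}. 0 :: int}"
      thus "f \<in> homs (G\<lparr>carrier := {\<one>}\<rparr>) (Zp p)" by (intro homsI) auto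
    qed
    thus ?thesis using triv_subgroup by (auto intro: exI[of _ 0])
  qed
  let ?S = "{A. ?P A}"
  have finS: "finite ?S" by (rule finite_subset[of _ "Pow (carrier G)"]) (use sub fin in auto)
  have ne: "?S ~= {}" using one by blast
  have "Max (card ` ?S) \<in> card ` ?S" using finS ne by (intro Max_in) simp_all
  then obtain A where A0: "Max (card ` ?S) = card A" "A \<in> ?S" by (rule imageE)
  have A: "?P A" "\<And>B. ?P B ==> card B <= card A"
  proof -
    show "?P A" using A0(2) by (rule CollectD)
    fix B assume "?P B"
    hence "B \<in> ?S" by (rule CollectI)
    thus "card B <= card A" unfolding A0(1)[symmetric] using finS by (intro Max_ge) simp_all
  qed
  have "A = carrier G"
  proof (rule ccontr)
    assume "A ~= carrier G"
    then obtain x where x: "x \<in> carrier G" "x \<notin> A" using sub[OF A(1)] by auto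
    define B where "B = (\<lambda>(a, t). a \<otimes> x [^] (t::nat)) ` (A \<times> {..<p})"
    have adj: "subgroup B G" "card B = p * card A"
        "card (homs (G\<lparr>carrier := B\<rparr>) (Zp p)) = p * card (homs (G\<lparr>carrier := A\<rparr>) (Zp p))"
      unfolding B_def using adjoin_element[OF fin p exp _ x] A(1) by blast+
    have "?P B" using adj A(1) by (auto intro: exI[of _ "Suc _"])
    hence "p * card A <= card A" using A(2)[of B] adj by simp
    moreover have "card A > 0" using A(1) p0 by auto
    ultimately show False using p0 by simp
  qed
  thus ?thesis using A(1) by simp
qed

lemma mem_kernel: "x \<in> kernel G M h \<longleftrightarrow> x \<in> carrier G \<and> h x = \<one>\<^bsub>M\<^esub>"
  by (simp add: kernel_def)

lemma (in normal) quotient_map_surs: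
  "(\<lambda>x\<in>carrier G. H #> x) \<in> surs G (G Mod H)"
  "kernel G (G Mod H) (\<lambda>x\<in>carrier G. H #> x) = H"
proof -
  have "(\<lambda>x\<in>carrier G. H #> x) \<in> homs G (G Mod H)"
    by (rule homsI) (auto simp: FactGroup_def RCOSETS_def rcos_sum)
  thus "(\<lambda>x\<in>carrier G. H #> x) \<in> surs G (G Mod H)"
    by (auto simp: surs_def FactGroup_def RCOSETS_def)
  show "kernel G (G Mod H) (\<lambda>x\<in>carrier G. H #> x) = H"
  proof -
    have "x \<in> carrier G \<and> H #> x = H \<longleftrightarrow> x \<in> H" for x
      using coset_join1[of H x] coset_join2[of x H] is_subgroup subset by blast
    thus ?thesis by (auto simp: kernel_def FactGroup_def)
  qed
qed

lemma (in comm_group) card_homs_torsion: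
  assumes fin: "finite (carrier G)" and p: "Factorial_Ring.prime p"
  shows "card (homs G (Zp p)) = card {x \<in> carrier G. x [^] p = \<one>} \<and> (\<exists>s. card {x \<in> carrier G. x [^] p = \<one>} = p ^ s)"
proof -
  let ?h = "\<lambda>x. x [^] p"
  let ?N = "?h ` carrier G" and ?T = "{x \<in> carrier G. x [^] p = \<one>}"
  have p0: "p > 0" using prime_gt_0_nat[OF p] .
  have hh: "group_hom G G ?h"
    by (simp add: group_hom_def group_hom_axioms_def hom_def nat_pow_distrib)
  interpret h: group_hom G G ?h by (rule hh)
  have N: "subgroup ?N G" by (rule h.img_is_subgroup)
  interpret N: normal ?N G by (rule subgroup_imp_normal[OF N])
  have ker: "kernel G G ?h = ?T" by (simp add: kernel_def)
  have c1: "card ?N * card ?T = card (carrier G)" using card_image_times_kernel[OF hh fin] ker by simp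
  let ?E = "G Mod ?N" and ?q = "\<lambda>x\<in>carrier G. ?N #> x"
  have E: "comm_group ?E" by (rule abelian_FactGroup[OF N])
  interpret E: comm_group ?E by (rule E)
  note q = N.quotient_map_surs
  have qh: "?q \<in> homs G ?E" using q(1) surs_subset_homs by blast
  have "card (?q ` carrier G) * card (kernel G ?E ?q) = card (carrier G)"
    by (rule card_image_times_kernel[OF homs_group_hom[OF is_group E.is_group qh] fin])
  hence c2: "card (carrier ?E) * card ?N = card (carrier G)" using surs_image[OF q(1)] q(2) by simp
  have N0: "card ?N > 0" using fin one_closed by (auto simp: card_gt_0_iff)
  have "card ?N * card (carrier ?E) = card ?N * card ?T" using c1 c2 by (simp add: mult.commute)
  hence cE: "card (carrier ?E) = card ?T" using N0 by simp
  have finE: "finite (carrier ?E)" using surs_image[OF q(1)] fin by (metis finite_imageI)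
  have expE: "e [^]\<^bsub>?E\<^esub> p = \<one>\<^bsub>?E\<^esub>" if "e \<in> carrier ?E" for e
  proof -
    have "e \<in> ?q ` carrier G" using that by (simp only: surs_image[OF q(1)])
    then obtain x where x': "e = ?q x" "x \<in> carrier G" by (rule imageE)
    note x = x'(2,1)
    interpret qm: group_hom G ?E ?q by (rule homs_group_hom[OF is_group E.is_group qh])
    have "e [^]\<^bsub>?E\<^esub> p = ?q (x [^] p)" unfolding x(2) using x(1) by (subst qm.hom_nat_pow) simp_all
    also have "\<dots> = \<one>\<^bsub>?E\<^esub>"
    proof -
      have "x [^] p \<in> kernel G ?E ?q" unfolding q(2) using x(1) by blast
      thus ?thesis unfolding mem_kernel by (rule conjunct2)
    qed
    finally show ?thesis .
  qed
  have all: "{\<psi> \<in> homs G (Zp p). kernel G ?E ?q \<subseteq> kernel G (Zp p) \<psi>} = homs G (Zp p)"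
  proof -
    have "?N \<subseteq> kernel G (Zp p) \<psi>" if \<psi>: "\<psi> \<in> homs G (Zp p)" for \<psi>
      using homs_Zp_pow[OF is_group \<psi>] by (auto simp: kernel_def)
    thus ?thesis unfolding q(2) set_eq_iff mem_Collect_eq by metis
  qed
  have "card (homs ?E (Zp p)) = card (homs G (Zp p))"
    using bij_betw_same_card[OF bij_betw_homs_factor[OF is_group E.is_group group_integer_mod_group q(1)], of p]
    unfolding all .
  thus ?thesis using E.card_homs_elementary[OF finE p expE] cE by auto
qed

definition Elem :: "nat => nat => (nat => int) monoid" where
  "Elem p i = product_group {..<i} (\<lambda>_. Zp p)"

lemma Elem_simps [simp]:
  "carrier (Elem p i) = ({..<i} \<rightarrow>\<^sub>E carrier (Zp p))" "\<one>\<^bsub>Elem p i\<^esub> = (\<lambda>j\<in>{..<i}. 0)"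
  "x \<otimes>\<^bsub>Elem p i\<^esub> y = (\<lambda>j\<in>{..<i}. (x j + y j) mod int p)"
  by (simp_all add: Elem_def)

lemma comm_group_Elem: "comm_group (Elem p i)"
proof -
  have "group (Elem p i)" unfolding Elem_def by (rule product_group) simp
  thus ?thesis by (rule group.group_comm_groupI) (simp add: add.commute)
qed

lemma finite_Elem: "p > 0 ==> finite (carrier (Elem p i))"
  by (auto simp: carrier_Zp intro: finite_PiE)

lemma card_Elem: "p > 0 ==> card (carrier (Elem p i)) = p ^ i"
  by (simp add: card_PiE carrier_Zp)

lemma Elem_pow:
  assumes "x \<in> carrier (Elem p i)"
  shows "x [^]\<^bsub>Elem p i\<^esub> (n :: nat) = (\<lambda>j\<in>{..<i}. (int n * x j) mod int p)"
proof (induction n)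
  case (Suc n)
  have "x [^]\<^bsub>Elem p i\<^esub> Suc n = x [^]\<^bsub>Elem p i\<^esub> n \<otimes>\<^bsub>Elem p i\<^esub> x" by (simp add: nat_pow_def)
  also have "\<dots> = (\<lambda>j\<in>{..<i}. (int (Suc n) * x j) mod int p)"
    unfolding Suc by (auto simp: mod_simps algebra_simps)
  finally show ?case .
qed (simp add: nat_pow_def)

lemma Elem_exponent: "x \<in> carrier (Elem p i) ==> x [^]\<^bsub>Elem p i\<^esub> p = \<one>\<^bsub>Elem p i\<^esub>"
  by (subst Elem_pow) auto

lemma (in comm_group) card_surs_Elem_Suc:
  assumes fin: "finite (carrier G)" and p: "Factorial_Ring.prime p"
  shows "real (card (surs G (Elem p (Suc i)))) = real (card (surs G (Elem p i))) * (real (card (homs G (Zp p))) - real p ^ i)"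
proof -
  have p0: "p > 0" "p > 1" using prime_gt_0_nat[OF p] prime_gt_1_nat[OF p] by auto
  let ?E = "Elem p i" and ?E' = "Elem p (Suc i)" and ?Z = "Zp p"
  interpret E: comm_group ?E by (rule comm_group_Elem)
  have grp: "group G" "group ?E" "group ?E'" "group ?Z" using is_group E.is_group comm_group_Elem comm_group.axioms(2) by (blast, blast, blast, simp)
  let ?B = "\<lambda>\<Psi>. {\<psi> \<in> homs G ?Z. \<not> kernel G ?E \<Psi> \<subseteq> kernel G ?Z \<psi>}"
  let ?F = "\<lambda>\<Phi>. (\<lambda>x\<in>carrier G. restrict (\<Phi> x) {..<i}, \<lambda>x\<in>carrier G. \<Phi> x i)"
  have finZ: "finite (carrier ?Z)" using p0 by (simp add: carrier_Zp)
  have "bij_betw ?F (surs G ?E') (Sigma (surs G ?E) ?B)"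
  proof (rule bij_betwI')
    fix \<Phi> \<Phi>' assume s: "\<Phi> \<in> surs G ?E'" "\<Phi>' \<in> surs G ?E'"
    hence h: "\<Phi> \<in> homs G ?E'" "\<Phi>' \<in> homs G ?E'" using surs_subset_homs by blast+
    show "?F \<Phi> = ?F \<Phi>' \<longleftrightarrow> \<Phi> = \<Phi>'"
    proof
      assume eq: "?F \<Phi> = ?F \<Phi>'"
      show "\<Phi> = \<Phi>'"
      proof (rule homs_ext[OF h])
        fix x assume x: "x \<in> carrier G"
        have r: "restrict (\<Phi> x) {..<i} = restrict (\<Phi>' x) {..<i}" using arg_cong[OF eq, of "\<lambda>w. fst w x"] x by simp
        have r': "\<Phi> x i = \<Phi>' x i" using arg_cong[OF eq, of "\<lambda>w. snd w x"] x by simp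
        have e: "\<Phi> x j = \<Phi>' x j" if "j < Suc i" for j
          using that fun_cong[OF r, of j] r' by (cases "j = i") simp_all
        have "\<Phi> x \<in> carrier ?E'" "\<Phi>' x \<in> carrier ?E'" using homsD(1)[OF h(1) x] homsD(1)[OF h(2) x] .
        thus "\<Phi> x = \<Phi>' x" using e by (auto intro: PiE_ext)
      qed
    qed simp
  next
    fix \<Phi> assume s: "\<Phi> \<in> surs G ?E'"
    hence h: "\<Phi> \<in> homs G ?E'" using surs_subset_homs by blast
    note D = homsD[OF h]
    let ?\<Psi> = "\<lambda>x\<in>carrier G. restrict (\<Phi> x) {..<i}" and ?\<psi> = "\<lambda>x\<in>carrier G. \<Phi> x i"
    have \<Psi>h: "?\<Psi> \<in> homs G ?E"
    proof (rule homsI)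
      fix x assume x: "x \<in> carrier G"
      show "?\<Psi> x \<in> carrier ?E" using D(1)[OF x] x by (auto simp: PiE_iff)
    qed (auto simp: D(2))
    have \<psi>h: "?\<psi> \<in> homs G ?Z"
    proof (rule homsI)
      fix x assume x: "x \<in> carrier G"
      show "?\<psi> x \<in> carrier ?Z" using D(1)[OF x] x by (auto simp: PiE_iff)
    qed (auto simp: D(2))
    have "carrier ?E \<subseteq> ?\<Psi> ` carrier G"
    proof
      fix u assume u: "u \<in> carrier ?E"
      let ?u = "\<lambda>j\<in>{..<Suc i}. if j < i then u j else 0"
      have "?u \<in> carrier ?E'" using u p0 by (auto simp: PiE_iff carrier_Zp)
      then have "?u \<in> \<Phi> ` carrier G" by (simp only: surs_image[OF s])
      then obtain x where x': "?u = \<Phi> x" "x \<in> carrier G" by (rule imageE)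
      note x = x'(2) x'(1)[symmetric]
      have "?\<Psi> x = u"
      proof
        fix j show "?\<Psi> x j = u j" using x PiE_arb[of u "{..<i}" "\<lambda>_. carrier ?Z" j] u by (cases "j < i") simp_all
      qed
      thus "u \<in> ?\<Psi> ` carrier G" using x(1) by blast
    qed
    moreover have "?\<Psi> ` carrier G \<subseteq> carrier ?E" using homsD(1)[OF \<Psi>h] by (rule image_subsetI)
    ultimately have "?\<Psi> \<in> surs G ?E" using \<Psi>h unfolding surs_def by (intro CollectI conjI equalityI)
    moreover have "?\<psi> \<in> ?B ?\<Psi>"
    proof -
      let ?u = "\<lambda>j\<in>{..<Suc i}. if j < i then 0 else 1 :: int"
      have "?u \<in> carrier ?E'" using p0 by (auto simp: PiE_iff carrier_Zp)
      then have "?u \<in> \<Phi> ` carrier G" by (simp only: surs_image[OF s])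
      then obtain x where x': "?u = \<Phi> x" "x \<in> carrier G" by (rule imageE)
      note x = x'(2) x'(1)[symmetric]
      have "x \<in> kernel G ?E ?\<Psi>" using x by (auto simp: kernel_def)
      moreover have "x \<notin> kernel G ?Z ?\<psi>" using x by (auto simp: kernel_def)
      ultimately show ?thesis using \<psi>h by blast
    qed
    ultimately show "?F \<Phi> \<in> Sigma (surs G ?E) ?B" by blast
  next
    fix w assume "w \<in> Sigma (surs G ?E) ?B"
    then obtain \<Psi> \<psi> where w: "w = (\<Psi>, \<psi>)" "\<Psi> \<in> surs G ?E" "\<psi> \<in> homs G ?Z" "\<not> kernel G ?E \<Psi> \<subseteq> kernel G ?Z \<psi>" by blast
    have \<Psi>h: "\<Psi> \<in> homs G ?E" using w surs_subset_homs by blast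
    note D = homsD[OF \<Psi>h] and d = homsD[OF w(3)]
    interpret \<psi>m: group_hom G ?Z \<psi> by (rule homs_group_hom[OF grp(1,4) w(3)])
    interpret \<Psi>m: group_hom G ?E \<Psi> by (rule homs_group_hom[OF grp(1,2) \<Psi>h])
    let ?\<Phi> = "\<lambda>x\<in>carrier G. \<lambda>j\<in>{..<Suc i}. if j < i then \<Psi> x j else \<psi> x"
    have ext: "\<Psi> x j = undefined" if "x \<in> carrier G" "\<not> j < i" for x j
      using D(1)[OF that(1)] that(2) by (auto simp: PiE_iff extensional_def)
    have \<Phi>h: "?\<Phi> \<in> homs G ?E'"
    proof (rule homsI)
      fix x assume x: "x \<in> carrier G"
      show "?\<Phi> x \<in> carrier ?E'" using D(1)[OF x] d(1)[OF x] x by (auto simp: PiE_iff)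
    next
      fix x y assume xy: "x \<in> carrier G" "y \<in> carrier G"
      show "?\<Phi> (x \<otimes> y) = ?\<Phi> x \<otimes>\<^bsub>?E'\<^esub> ?\<Phi> y"
        using xy by (auto simp: D(2) d(2))
    qed auto
    obtain k where k: "k \<in> carrier G" "\<Psi> k = \<one>\<^bsub>?E\<^esub>" "\<psi> k ~= 0" using w(4) by (auto simp: kernel_def)
    have kr: "0 < \<psi> k" "\<psi> k < int p" using d(1)[OF k(1)] k(3) p0 by (auto simp: carrier_Zp)
    have "coprime (\<psi> k) (int p)"
    proof -
      have "\<not> int p dvd \<psi> k" using kr zdvd_not_zless by blast
      thus ?thesis using p by (metis coprime_commute prime_imp_coprime prime_nat_int_transfer)
    qed
    then obtain c where c: "[\<psi> k * c = 1] (mod int p)" using cong_solve_coprime_int by blast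
    have "carrier ?E' \<subseteq> ?\<Phi> ` carrier G"
    proof
      fix u assume u: "u \<in> carrier ?E'"
      have "restrict u {..<i} \<in> carrier ?E" using u by (auto simp: PiE_iff)
      then have "restrict u {..<i} \<in> \<Psi> ` carrier G" by (simp only: surs_image[OF w(2)])
      then obtain x where x': "restrict u {..<i} = \<Psi> x" "x \<in> carrier G" by (rule imageE)
      note x = x'(2) x'(1)[symmetric]
      define t where "t = nat (((u i - \<psi> x) * c) mod int p)"
      have t: "[int t = (u i - \<psi> x) * c] (mod int p)" using p0 by (simp add: t_def cong_def)
      let ?y = "x \<otimes> k [^] t"
      have y: "?y \<in> carrier G" using x k by simp
      have "\<Psi> ?y = \<Psi> x"
      proof -
        have "\<Psi> (k [^] t) = \<one>\<^bsub>?E\<^esub>" using k(1) by (simp only: \<Psi>m.hom_nat_pow k(2) E.nat_pow_one)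
        hence "\<Psi> ?y = \<Psi> x \<otimes>\<^bsub>?E\<^esub> \<one>\<^bsub>?E\<^esub>" using D(2)[OF x(1) nat_pow_closed[OF k(1), of t]] by simp
        thus ?thesis using E.r_one[OF D(1)[OF x(1)]] by simp
      qed
      moreover have "\<psi> ?y = u i"
      proof -
        have ui: "0 <= u i" "u i < int p" using u p0 by (auto simp: PiE_iff carrier_Zp)
        have "\<psi> ?y = (\<psi> x + (int t * \<psi> k) mod int p) mod int p"
          using d(2)[OF x(1) nat_pow_closed[OF k(1), of t]] homs_Zp_pow[OF grp(1) w(3) k(1), of t] by simp
        moreover have "[\<psi> x + (int t * \<psi> k) mod int p = u i] (mod int p)"
        proof -
          have "[\<psi> x + (int t * \<psi> k) mod int p = \<psi> x + ((u i - \<psi> x) * c) * \<psi> k] (mod int p)"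
            using t by (intro cong_add cong_refl) (simp add: cong_def mod_simps, metis mod_mult_left_eq)
          also have "((u i - \<psi> x) * c) * \<psi> k = (u i - \<psi> x) * (\<psi> k * c)" by simp
          also have "[\<psi> x + (u i - \<psi> x) * (\<psi> k * c) = \<psi> x + (u i - \<psi> x) * 1] (mod int p)"
            using c by (intro cong_add cong_refl cong_mult)
          finally show ?thesis by simp
        qed
        ultimately show ?thesis using ui by (simp add: cong_def)
      qed
      ultimately have "?\<Phi> ?y j = u j" for j
        using x y PiE_arb[of u "{..<Suc i}" "\<lambda>_. carrier ?Z" j] u by (cases "j < i"; cases "j = i") simp_all
      hence "u = ?\<Phi> ?y" by auto
      thus "u \<in> ?\<Phi> ` carrier G" using y by (rule image_eqI)
    qed
    moreover have "?\<Phi> ` carrier G \<subseteq> carrier ?E'" using homsD(1)[OF \<Phi>h] by (rule image_subsetI)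
    ultimately have "?\<Phi> \<in> surs G ?E'" using \<Phi>h unfolding surs_def by (intro CollectI conjI equalityI)
    moreover have "w = ?F ?\<Phi>"
    proof -
      have "\<Psi> = (\<lambda>x\<in>carrier G. restrict (?\<Phi> x) {..<i})"
      proof
        fix x show "\<Psi> x = (\<lambda>x\<in>carrier G. restrict (?\<Phi> x) {..<i}) x"
          by (cases "x \<in> carrier G") (auto simp: D(3) ext restrict_def)
      qed
      moreover have "\<psi> = (\<lambda>x\<in>carrier G. ?\<Phi> x i)" by (auto simp: d(3) restrict_def)
      ultimately show ?thesis using w(1) by simp
    qed
    ultimately show "\<exists>\<Phi>\<in>surs G ?E'. w = ?F \<Phi>" by blast
  qed
  hence "card (surs G ?E') = card (Sigma (surs G ?E) ?B)" by (rule bij_betw_same_card)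
  also have "\<dots> = (\<Sum>\<Psi>\<in>surs G ?E. card (?B \<Psi>))"
    using finite_surs[OF fin finite_Elem[OF p0(1)]] finite_homs[OF fin finZ] by (intro card_SigmaI) auto
  finally have "real (card (surs G ?E')) = (\<Sum>\<Psi>\<in>surs G ?E. real (card (?B \<Psi>)))" by simp
  also have "\<dots> = (\<Sum>\<Psi>\<in>surs G ?E. real (card (homs G ?Z)) - real p ^ i)"
  proof (rule sum.cong[OF refl])
    fix \<Psi> assume \<Psi>: "\<Psi> \<in> surs G ?E"
    let ?C = "{\<psi> \<in> homs G ?Z. kernel G ?E \<Psi> \<subseteq> kernel G ?Z \<psi>}"
    have "card ?C = card (homs ?E ?Z)"
      using bij_betw_same_card[OF bij_betw_homs_factor[OF grp(1,2,4) \<Psi>]] by simp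
    also have "\<dots> = p ^ i"
      using E.card_homs_elementary[OF finite_Elem[OF p0(1)] p Elem_exponent] card_Elem[OF p0(1)] by simp
    finally have "card ?C = p ^ i" .
    moreover have "card (homs G ?Z) = card (?B \<Psi>) + card ?C"
    proof -
      have "homs G ?Z = ?B \<Psi> \<union> ?C" "?B \<Psi> \<inter> ?C = {}" by auto
      thus ?thesis using finite_homs[OF fin finZ] by (metis (no_types, lifting) card_Un_disjoint finite_Un)
    qed
    ultimately show "real (card (?B \<Psi>)) = real (card (homs G ?Z)) - real p ^ i" by simp
  qed
  finally show ?thesis by simp
qed

text \<open>
  A homomorphism to \<open>Z_p ^ i\<close> is onto exactly when its components are linearly independent. The homomorphisms to \<open>Z_p\<close> form a
  vector space with as many elements as the \<open>p\<close>-torsion subgroup.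
\<close>

lemma (in comm_group) card_surs_Elem:
  assumes fin: "finite (carrier G)" and p: "Factorial_Ring.prime p"
  shows "real (card (surs G (Elem p i))) = (\<Prod>j<i. real (card {x \<in> carrier G. x [^] p = \<one>}) - real p ^ j)"
proof (induction i)
  case 0
  have "surs G (Elem p 0) = {\<lambda>x\<in>carrier G. \<lambda>_. undefined}"
  proof (intro equalityI subsetI)
    fix f assume "f \<in> surs G (Elem p 0)"
    hence "f \<in> homs G (Elem p 0)" using surs_subset_homs by blast
    from homsD(1)[OF this] homsD(3)[OF this] show "f \<in> {\<lambda>x\<in>carrier G. \<lambda>_. undefined}" by (auto simp: restrict_def)
  next
    fix f assume f: "f \<in> {\<lambda>x\<in>carrier G. \<lambda>_ :: nat. undefined :: int}"
    have "f \<in> homs G (Elem p 0)" using f by (intro homsI) auto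
    thus "f \<in> surs G (Elem p 0)" using f by (auto simp: surs_def intro!: image_eqI[of _ _ \<one>])
  qed
  thus ?case by simp
next
  case (Suc i)
  thus ?case using card_surs_Elem_Suc[OF fin p, of i] card_homs_torsion[OF fin p] by (simp add: mult.commute)
qed

section \<open>Surjections onto labelled groups\<close>

text \<open>
  A member of this set has as its joint kernel the kernel of the second map, with quotient of order
  \<open>|G| |E|\<close>.
\<close>

definition ext_pairs :: "('b, 'c) monoid_scheme => ('e, 'f) monoid_scheme => ('a, 'd) monoid_scheme => (('a => 'b) \<times> ('a => 'e)) set" where
  "ext_pairs G E Y = (SIGMA \<pi> : surs Y G. surs (Y\<lparr>carrier := kernel Y G \<pi>\<rparr>) E)"

text \<open>
  Groups on the fixed carrier \<open>{..<h}\<close> are representatives with multiplicity of all isomorphism classes of order \<open>h\<close>; a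
  group \<open>M\<close> occurs \<open>h! / |Aut M|\<close> times, the usual groupoid weight. The condition outside the carrier makes the set finite.
\<close>

definition labelled_groups :: "nat => nat monoid set" where
  "labelled_groups h = {M. comm_group M \<and> carrier M = {..<h} \<and> (\<forall>a b. \<not> (a < h \<and> b < h) --> a \<otimes>\<^bsub>M\<^esub> b = 0)}"

lemma finite_labelled_groups: "finite (labelled_groups h)"
proof -
  let ?T = "(\<lambda>(t, e). \<lparr>carrier = {..<h}, monoid.mult = (\<lambda>a b. if a < h \<and> b < h then t (a, b) else 0), one = e\<rparr>) ` 
     ((({..<h} \<times> {..<h}) \<rightarrow>\<^sub>E {..<h}) \<times> {..<h})"
  have "labelled_groups h \<subseteq> ?T"
  proof
    fix M assume "M \<in> labelled_groups h"
    hence M: "comm_group M" "carrier M = {..<h}" "\<And>a b. \<not> (a < h \<and> b < h) ==> a \<otimes>\<^bsub>M\<^esub> b = 0"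
      by (auto simp: labelled_groups_def)
    interpret M: comm_group M by (rule M(1))
    let ?t = "\<lambda>ab\<in>{..<h} \<times> {..<h}. fst ab \<otimes>\<^bsub>M\<^esub> snd ab"
    have t: "?t \<in> ({..<h} \<times> {..<h}) \<rightarrow>\<^sub>E {..<h}"
      using M.m_closed unfolding M(2) by auto
    have o: "\<one>\<^bsub>M\<^esub> \<in> {..<h}" using M.one_closed unfolding M(2) .
    have "M = \<lparr>carrier = {..<h}, monoid.mult = (\<lambda>a b. if a < h \<and> b < h then ?t (a, b) else 0), one = \<one>\<^bsub>M\<^esub>\<rparr>"
      by (rule monoid.equality) (auto simp: M(2,3) fun_eq_iff)
    thus "M \<in> ?T" using t o by (intro image_eqI[of _ _ "(?t, \<one>\<^bsub>M\<^esub>)"]) auto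
  qed
  moreover have "finite ?T" by (intro finite_imageI finite_cartesian_product finite_PiE) auto
  ultimately show ?thesis by (rule finite_subset)
qed

lemma card_labellings:
  assumes fin: "finite A" and h: "card (c ` A) = h"
  shows "card {f \<in> A \<rightarrow>\<^sub>E {..<h}. f ` A = {..<h} \<and> (\<forall>x\<in>A. \<forall>y\<in>A. f x = f y \<longleftrightarrow> c x = c y)} = fact h"
proof -
  let ?L = "{f \<in> A \<rightarrow>\<^sub>E {..<h}. f ` A = {..<h} \<and> (\<forall>x\<in>A. \<forall>y\<in>A. f x = f y \<longleftrightarrow> c x = c y)}"
  obtain g where g: "bij_betw g (c ` A) {..<h}"
    using finite_same_card_bij[of "c ` A" "{..<h}"] fin h by auto
  define k where "k x = g (c x)" for x
  have k: "k x < h" if "x \<in> A" for x using bij_betwE[OF g] that by (auto simp: k_def)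
  have kim: "k ` A = {..<h}" using bij_betw_imp_surj_on[OF g] by (auto simp: k_def image_image)
  have keq: "k x = k y \<longleftrightarrow> c x = c y" if "x \<in> A" "y \<in> A" for x y
    using bij_betw_imp_inj_on[OF g] that by (auto simp: k_def inj_on_def)
  have "bij_betw (\<lambda>\<sigma>. \<lambda>x\<in>A. \<sigma> (k x)) {\<sigma>. \<sigma> permutes {..<h}} ?L"
  proof (rule bij_betwI')
    fix \<sigma> \<sigma>' assume s: "\<sigma> \<in> {\<sigma>. \<sigma> permutes {..<h}}" "\<sigma>' \<in> {\<sigma>. \<sigma> permutes {..<h}}"
    show "(\<lambda>x\<in>A. \<sigma> (k x)) = (\<lambda>x\<in>A. \<sigma>' (k x)) \<longleftrightarrow> \<sigma> = \<sigma>'"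
    proof
      assume eq: "(\<lambda>x\<in>A. \<sigma> (k x)) = (\<lambda>x\<in>A. \<sigma>' (k x))"
      show "\<sigma> = \<sigma>'"
      proof
        fix a show "\<sigma> a = \<sigma>' a"
        proof (cases "a < h")
          case True
          hence "a \<in> k ` A" unfolding kim by simp
          then obtain x where x: "a = k x" "x \<in> A" by (rule imageE)
          thus ?thesis using fun_cong[OF eq, of x] by simp
        next
          case False
          thus ?thesis using s by (simp add: permutes_not_in)
        qed
      qed
    qed simp
  next
    fix \<sigma> assume "\<sigma> \<in> {\<sigma>. \<sigma> permutes {..<h}}"
    hence s: "\<sigma> permutes {..<h}" by simp
    have "(\<lambda>x\<in>A. \<sigma> (k x)) ` A = \<sigma> ` k ` A" by (auto simp: image_image)
    also have "\<dots> = {..<h}" unfolding kim by (rule permutes_image[OF s])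
    finally have "(\<lambda>x\<in>A. \<sigma> (k x)) ` A = {..<h}" .
    moreover have "\<sigma> (k x) = \<sigma> (k y) \<longleftrightarrow> c x = c y" if "x \<in> A" "y \<in> A" for x y
      using keq[OF that] permutes_inj[OF s] by (metis injD)
    ultimately show "(\<lambda>x\<in>A. \<sigma> (k x)) \<in> ?L" by (auto simp: PiE_iff)
  next
    fix f assume "f \<in> ?L"
    hence f: "f \<in> A \<rightarrow>\<^sub>E {..<h}" "f ` A = {..<h}" "\<And>x y. x \<in> A ==> y \<in> A ==> f x = f y \<longleftrightarrow> c x = c y" by blast+
    define r where "r a = (SOME x. x \<in> A \<and> k x = a)" for a
    have r: "r a \<in> A \<and> k (r a) = a" if "a < h" for a
      unfolding r_def by (rule someI_ex) (use that kim in \<open>metis imageE lessThan_iff\<close>)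
    define \<sigma> where "\<sigma> a = (if a < h then f (r a) else a)" for a
    have sk: "\<sigma> (k x) = f x" if "x \<in> A" for x
    proof -
      have kx: "k x < h" by (rule k[OF that])
      have "k (r (k x)) = k x" using r[OF kx] by simp
      hence "c (r (k x)) = c x" using keq r[OF kx] that by blast
      hence "f (r (k x)) = f x" using f(3) r[OF kx] that by blast
      thus ?thesis using kx by (simp add: \<sigma>_def)
    qed
    have "\<sigma> ` {..<h} = \<sigma> ` k ` A" unfolding kim ..
    also have "\<dots> = f ` A" unfolding image_image by (rule image_cong) (simp_all add: sk)
    finally have im: "\<sigma> ` {..<h} = {..<h}" using f(2) by simp
    hence "bij_betw \<sigma> {..<h} {..<h}" by (simp add: bij_betw_def eq_card_imp_inj_on)
    hence "\<sigma> permutes {..<h}" by (rule bij_imp_permutes) (simp add: \<sigma>_def)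
    moreover have "f = (\<lambda>x\<in>A. \<sigma> (k x))"
    proof
      fix x show "f x = (\<lambda>x\<in>A. \<sigma> (k x)) x" using sk f(1) by (cases "x \<in> A") (auto simp: PiE_iff extensional_def)
    qed
    ultimately show "\<exists>\<sigma>\<in>{\<sigma>. \<sigma> permutes {..<h}}. f = (\<lambda>x\<in>A. \<sigma> (k x))" by blast
  qed
  from bij_betw_same_card[OF this] show ?thesis by (simp add: card_permutations)
qed

lemma labelled_groups_D:
  assumes "M \<in> labelled_groups h"
  shows "comm_group M" "carrier M = {..<h}" "\<not> (a < h \<and> b < h) ==> a \<otimes>\<^bsub>M\<^esub> b = 0"
  using assms by (auto simp: labelled_groups_def)

lemma surs_restrict_kernel:
  assumes Y: "group Y" and M: "group M" and G: "group G" and f: "f \<in> surs Y M" and \<pi>': "\<pi>' \<in> homs M G"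
    and \<pi>: "\<pi> = restrict (\<pi>' \<circ> f) (carrier Y)"
  shows "restrict f (kernel Y G \<pi>) \<in> surs (Y\<lparr>carrier := kernel Y G \<pi>\<rparr>) (M\<lparr>carrier := kernel M G \<pi>'\<rparr>)"
proof -
  have fh: "f \<in> homs Y M" using f surs_subset_homs by blast
  note D = homsD[OF fh]
  have "restrict f (kernel Y G \<pi>) \<in> homs (Y\<lparr>carrier := kernel Y G \<pi>\<rparr>) (M\<lparr>carrier := kernel M G \<pi>'\<rparr>)"
  proof (rule homsI)
    fix x y assume xy: "x \<in> carrier (Y\<lparr>carrier := kernel Y G \<pi>\<rparr>)" "y \<in> carrier (Y\<lparr>carrier := kernel Y G \<pi>\<rparr>)"
    interpret p: group_hom Y G "restrict (\<pi>' \<circ> f) (carrier Y)"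
    proof (rule homs_group_hom[OF Y G])
      show "restrict (\<pi>' \<circ> f) (carrier Y) \<in> homs Y G"
        using group.is_monoid[OF Y] by (intro homsI) (auto simp: D homsD[OF \<pi>'] monoid.m_closed)
    qed
    have k: "x \<in> kernel Y G \<pi>" "y \<in> kernel Y G \<pi>" using xy by simp_all
    have "x \<otimes>\<^bsub>Y\<^esub> y \<in> kernel Y G \<pi>" using p.subgroup_kernel k unfolding \<pi> by (simp add: subgroup.m_closed)
    thus "restrict f (kernel Y G \<pi>) (x \<otimes>\<^bsub>Y\<lparr>carrier := kernel Y G \<pi>\<rparr>\<^esub> y) =
       restrict f (kernel Y G \<pi>) x \<otimes>\<^bsub>M\<lparr>carrier := kernel M G \<pi>'\<rparr>\<^esub> restrict f (kernel Y G \<pi>) y"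
      using k D(2)[of x y] by (simp add: mem_kernel)
  qed (auto simp: mem_kernel \<pi> D)
  moreover have "restrict f (kernel Y G \<pi>) ` kernel Y G \<pi> = kernel M G \<pi>'"
  proof (intro equalityI subsetI)
    fix m assume "m \<in> restrict f (kernel Y G \<pi>) ` kernel Y G \<pi>"
    thus "m \<in> kernel M G \<pi>'" by (auto simp: mem_kernel \<pi> D)
  next
    fix m assume m: "m \<in> kernel M G \<pi>'"
    hence "m \<in> f ` carrier Y" unfolding surs_image[OF f] by (simp add: mem_kernel)
    then obtain y where y: "m = f y" "y \<in> carrier Y" by (rule imageE)
    hence "y \<in> kernel Y G \<pi>" using m by (simp add: mem_kernel \<pi>)
    thus "m \<in> restrict f (kernel Y G \<pi>) ` kernel Y G \<pi>" using y by (intro image_eqI[of _ _ y]) auto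
  qed
  ultimately show ?thesis by (simp add: surs_def)
qed

lemma group_kernel:
  assumes "group Y" "group G" "\<pi> \<in> homs Y G"
  shows "subgroup (kernel Y G \<pi>) Y" "group (Y\<lparr>carrier := kernel Y G \<pi>\<rparr>)"
proof -
  show s: "subgroup (kernel Y G \<pi>) Y" using group_hom.subgroup_kernel[OF homs_group_hom[OF assms]] .
  show "group (Y\<lparr>carrier := kernel Y G \<pi>\<rparr>)" using subgroup.subgroup_is_group[OF s assms(1)] .
qed

lemma comm_group_kernel:
  assumes "comm_group Y" "group G" "\<pi> \<in> homs Y G"
  shows "comm_group (Y\<lparr>carrier := kernel Y G \<pi>\<rparr>)"
proof (rule group.group_comm_groupI)
  show "group (Y\<lparr>carrier := kernel Y G \<pi>\<rparr>)" using group_kernel(2)[OF comm_group.axioms(2)[OF assms(1)] assms(2,3)] .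
  fix x y assume "x \<in> carrier (Y\<lparr>carrier := kernel Y G \<pi>\<rparr>)" "y \<in> carrier (Y\<lparr>carrier := kernel Y G \<pi>\<rparr>)"
  thus "x \<otimes>\<^bsub>Y\<lparr>carrier := kernel Y G \<pi>\<rparr>\<^esub> y = y \<otimes>\<^bsub>Y\<lparr>carrier := kernel Y G \<pi>\<rparr>\<^esub> x"
    using comm_monoid.m_comm[OF comm_group.axioms(1)[OF assms(1)]] by (simp add: mem_kernel)
qed

lemma card_surs_kernel:
  assumes "group Y" "group G" "\<pi> \<in> surs Y G" "finite (carrier Y)"
  shows "card (carrier G) * card (kernel Y G \<pi>) = card (carrier Y)"
proof -
  have "\<pi> \<in> homs Y G" using assms surs_subset_homs by blast
  from card_image_times_kernel[OF homs_group_hom[OF assms(1,2) this] assms(4)] show ?thesis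
    by (simp add: surs_image[OF assms(3)])
qed

text \<open>
  Both sides count pairs on \<open>Y\<close> together with a labelling of the quotient of \<open>Y\<close> by the joint kernel. On the left the
  labelled quotient is chosen first and the pair is pulled back along the surjection onto it.
\<close>

lemma card_labelled_quotients:
  fixes Y :: "('a, 'd) monoid_scheme" and G :: "('b, 'c) monoid_scheme" and E :: "('e, 'f) monoid_scheme"
  assumes Y: "comm_group Y" "finite (carrier Y)" and G: "comm_group G" "finite (carrier G)"
    and E: "comm_group E" "finite (carrier E)"
  defines "h \<equiv> card (carrier G) * card (carrier E)"
  shows "(\<Sum>M\<in>labelled_groups h. card (ext_pairs G E M) * card (surs Y M)) = fact h * card (ext_pairs G E Y)"
proof -
  interpret Y: comm_group Y by (rule Y(1))
  interpret G: comm_group G by (rule G(1))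
  interpret E: comm_group E by (rule E(1))
  have posG: "card (carrier G) > 0" using G(2) G.one_closed by (auto simp: card_gt_0_iff)
  have posE: "card (carrier E) > 0" using E(2) E.one_closed by (auto simp: card_gt_0_iff)
  let ?P = "ext_pairs G E Y"
  let ?Q = "SIGMA M : labelled_groups h. surs Y M \<times> ext_pairs G E M"
  define \<Phi> where "\<Phi> = (\<lambda>(M :: nat monoid, f :: 'a => nat, \<pi>' :: nat => 'b, \<Psi>' :: nat => 'e).
     (restrict (\<pi>' \<circ> f) (carrier Y), restrict (\<Psi>' \<circ> f) (kernel Y G (restrict (\<pi>' \<circ> f) (carrier Y)))))"
  have finpairs: "finite (ext_pairs G E M)" if "finite (carrier M)" for M :: "('g, 'k) monoid_scheme"
    unfolding ext_pairs_def
    by (intro finite_SigmaI finite_surs that G(2) E(2)) (auto simp: kernel_def that)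
  have finQ: "finite ?Q"
    by (intro finite_SigmaI finite_labelled_groups finite_cartesian_product finpairs finite_surs Y(2))
       (auto simp: labelled_groups_D)
  have inQ: "M \<in> labelled_groups h" "f \<in> surs Y M" "\<pi>' \<in> surs M G" "\<Psi>' \<in> surs (M\<lparr>carrier := kernel M G \<pi>'\<rparr>) E"
    if "(M, f, \<pi>', \<Psi>') \<in> ?Q" for M f \<pi>' \<Psi>'
    using that by (auto simp: ext_pairs_def)
  have \<pi>_surs: "restrict (\<pi>' \<circ> f) (carrier Y) \<in> surs Y G" if "M \<in> labelled_groups h" "f \<in> surs Y M" "\<pi>' \<in> surs M G" for M f \<pi>'
  proof -
    have "group M" using labelled_groups_D(1)[OF that(1)] by (rule comm_group.axioms(2))
    from bij_betw_surs_factor[OF Y.is_group this G.is_group that(2)] that(3) show ?thesis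
      by (auto dest!: bij_betwE)
  qed
  have \<Phi>P: "\<Phi> ` ?Q \<subseteq> ?P"
  proof (rule image_subsetI)
    fix w assume w: "w \<in> ?Q"
    obtain M f \<pi>' \<Psi>' where we: "w = (M, f, \<pi>', \<Psi>')" by (metis prod.exhaust)
    note q = inQ[OF w[unfolded we]]
    have gM: "group M" using labelled_groups_D(1)[OF q(1)] by (rule comm_group.axioms(2))
    have \<pi>'h: "\<pi>' \<in> homs M G" using q(3) surs_subset_homs by blast
    define \<pi> where "\<pi> = restrict (\<pi>' \<circ> f) (carrier Y)"
    have \<pi>s: "\<pi> \<in> surs Y G" unfolding \<pi>_def using \<pi>_surs[OF q(1-3)] .
    hence \<pi>h: "\<pi> \<in> homs Y G" using surs_subset_homs by blast
    note rk = surs_restrict_kernel[OF Y.is_group gM G.is_group q(2) \<pi>'h \<pi>_def]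
    from bij_betw_surs_factor[OF group_kernel(2)[OF Y.is_group G.is_group \<pi>h] group_kernel(2)[OF gM G.is_group \<pi>'h] E.is_group rk] q(4)
    have "restrict (\<Psi>' \<circ> restrict f (kernel Y G \<pi>)) (kernel Y G \<pi>) \<in> surs (Y\<lparr>carrier := kernel Y G \<pi>\<rparr>) E"
      by (auto dest!: bij_betwE)
    moreover have "restrict (\<Psi>' \<circ> restrict f (kernel Y G \<pi>)) (kernel Y G \<pi>) = restrict (\<Psi>' \<circ> f) (kernel Y G \<pi>)"
      by (rule restrict_ext) simp
    ultimately show "\<Phi> w \<in> ?P" using \<pi>s by (simp add: we \<Phi>_def ext_pairs_def \<pi>_def)
  qed
  have fiber: "card {w \<in> ?Q. \<Phi> w = pp} = fact h" if pp: "pp \<in> ?P" for pp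
  proof -
    obtain \<pi> \<Psi> where pe: "pp = (\<pi>, \<Psi>)" and \<pi>: "\<pi> \<in> surs Y G" and \<Psi>: "\<Psi> \<in> surs (Y\<lparr>carrier := kernel Y G \<pi>\<rparr>) E"
      using pp by (auto simp: ext_pairs_def)
    have \<pi>h: "\<pi> \<in> homs Y G" using \<pi> surs_subset_homs by blast
    have \<Psi>h: "\<Psi> \<in> homs (Y\<lparr>carrier := kernel Y G \<pi>\<rparr>) E" using \<Psi> surs_subset_homs by blast
    let ?K = "kernel Y G \<pi>"
    note K = group_kernel[OF Y.is_group G.is_group \<pi>h]
    interpret K: subgroup ?K Y by (rule K(1))
    define R where "R = kernel (Y\<lparr>carrier := ?K\<rparr>) E \<Psi>"
    have R: "x \<in> R \<longleftrightarrow> x \<in> carrier Y \<and> \<pi> x = \<one>\<^bsub>G\<^esub> \<and> \<Psi> x = \<one>\<^bsub>E\<^esub>" for x by (simp add: R_def mem_kernel)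
    have subR: "subgroup R Y"
      using group.incl_subgroup[OF Y.is_group K(1)] group_kernel(1)[OF K(2) E.is_group \<Psi>h] unfolding R_def by blast
    interpret R: normal R Y by (rule Y.subgroup_imp_normal[OF subR])
    have cardh: "h * card R = card (carrier Y)"
    proof -
      have "card (carrier E) * card R = card ?K"
        using card_surs_kernel[OF K(2) E.is_group \<Psi>] Y(2) finite_subset[OF K.subset] by (simp add: R_def)
      thus ?thesis using card_surs_kernel[OF Y.is_group G.is_group \<pi> Y(2)] by (simp add: h_def mult.assoc)
    qed
    let ?c = "\<lambda>x. R #>\<^bsub>Y\<^esub> x"
    have ch: "card (?c ` carrier Y) = h"
    proof -
      have "card (rcosets\<^bsub>Y\<^esub> R) * card R = h * card R" using Y.lagrange[OF subR] cardh by (simp add: order_def)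
      moreover have "card R > 0"
      proof -
        have "R ~= {}" using subgroup.one_closed[OF subR] by blast
        thus ?thesis using finite_subset[OF subgroup.subset[OF subR] Y(2)] by (simp add: card_gt_0_iff)
      qed
      moreover have "rcosets\<^bsub>Y\<^esub> R = ?c ` carrier Y" by (auto simp: RCOSETS_def)
      ultimately show ?thesis by simp
    qed
    have ceq: "?c x = ?c y \<longleftrightarrow> x \<otimes>\<^bsub>Y\<^esub> inv\<^bsub>Y\<^esub> y \<in> R" if "x \<in> carrier Y" "y \<in> carrier Y" for x y
      using homs_eq_iff_kernel[OF Y.is_group R.factorgroup_is_group subsetD[OF surs_subset_homs R.quotient_map_surs(1)] that]
        R.quotient_map_surs(2) that by simp
    let ?L = "{f \<in> carrier Y \<rightarrow>\<^sub>E {..<h}. f ` carrier Y = {..<h} \<and> (\<forall>x\<in>carrier Y. \<forall>y\<in>carrier Y. f x = f y \<longleftrightarrow> ?c x = ?c y)}"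
    let ?F = "{w \<in> ?Q. \<Phi> w = pp}"
    have val: "\<pi>' (f x) = \<pi> x" "y \<in> ?K ==> \<Psi>' (f y) = \<Psi> y" 
      if "\<Phi> (M, f, \<pi>', \<Psi>') = pp" "x \<in> carrier Y" for M f \<pi>' \<Psi>' x y
    proof -
      have a: "\<pi> = restrict (\<pi>' \<circ> f) (carrier Y)" "\<Psi> = restrict (\<Psi>' \<circ> f) ?K" using that(1) by (auto simp: \<Phi>_def pe)
      show "\<pi>' (f x) = \<pi> x" using that(2) by (subst a(1)) simp
      show "y \<in> ?K ==> \<Psi>' (f y) = \<Psi> y" by (subst a(2)) simp
    qed
    have "bij_betw (\<lambda>w. fst (snd w)) ?F ?L"
    proof (rule bij_betwI')
      fix w w' assume w: "w \<in> ?F" and w': "w' \<in> ?F"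
      obtain M f \<pi>' \<Psi>' where we: "w = (M, f, \<pi>', \<Psi>')" by (metis prod.exhaust)
      obtain M2 f2 \<pi>2 \<Psi>2 where we': "w' = (M2, f2, \<pi>2, \<Psi>2)" by (metis prod.exhaust)
      have wQ: "(M, f, \<pi>', \<Psi>') \<in> ?Q" "\<Phi> (M, f, \<pi>', \<Psi>') = pp" using w we by blast+
      have wQ': "(M2, f2, \<pi>2, \<Psi>2) \<in> ?Q" "\<Phi> (M2, f2, \<pi>2, \<Psi>2) = pp" using w' we' by blast+
      note q = inQ[OF wQ(1)] and q' = inQ[OF wQ'(1)]
      note v = val[OF wQ(2)] and v' = val[OF wQ'(2)]
      show "fst (snd w) = fst (snd w') \<longleftrightarrow> w = w'"
      proof
        assume "fst (snd w) = fst (snd w')"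
        hence ff: "f2 = f" using we we' by simp
        note L = labelled_groups_D[OF q(1)] and L' = labelled_groups_D[OF q'(1)]
        have fh: "f \<in> homs Y M" "f \<in> homs Y M2" using q(2) q'(2) ff surs_subset_homs by blast+
        have gM: "group M" "group M2" using L(1) L'(1) by (auto intro: comm_group.axioms(2))
        have rep: "\<exists>x\<in>carrier Y. a = f x" if "a < h" for a
          using surs_image[OF q(2)] that unfolding L(2) by (metis imageE lessThan_iff)
        have "M = M2"
        proof (rule monoid.equality)
          show "monoid.mult M = monoid.mult M2"
          proof (intro ext)
            fix a b show "a \<otimes>\<^bsub>M\<^esub> b = a \<otimes>\<^bsub>M2\<^esub> b"
            proof (cases "a < h \<and> b < h")
              case True
              obtain x where x: "x \<in> carrier Y" "a = f x" using rep True by blast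
              obtain y where y: "y \<in> carrier Y" "b = f y" using rep True by blast
              show ?thesis unfolding x(2) y(2) using homsD(2)[OF fh(1) x(1) y(1)] homsD(2)[OF fh(2) x(1) y(1)] by simp
            qed (simp add: L(3) L'(3))
          qed
          show "\<one>\<^bsub>M\<^esub> = \<one>\<^bsub>M2\<^esub>"
            using group_hom.hom_one[OF homs_group_hom[OF Y.is_group gM(1) fh(1)]] group_hom.hom_one[OF homs_group_hom[OF Y.is_group gM(2) fh(2)]] by simp
        qed (simp_all add: L(2) L'(2))
        note MM = this
        have "\<pi>' = \<pi>2"
        proof (rule homs_ext[OF subsetD[OF surs_subset_homs q(3)]])
          show "\<pi>2 \<in> homs M G" using q'(3) surs_subset_homs unfolding MM by blast
          fix a assume "a \<in> carrier M"
          then obtain x where x: "x \<in> carrier Y" "a = f x" using rep L(2) by auto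
          show "\<pi>' a = \<pi>2 a" unfolding x(2) using v(1)[OF x(1)] v'(1)[OF x(1)] ff by simp
        qed
        note pp' = this
        have "\<Psi>' = \<Psi>2"
        proof (rule homs_ext[OF subsetD[OF surs_subset_homs q(4)]])
          show "\<Psi>2 \<in> homs (M\<lparr>carrier := kernel M G \<pi>'\<rparr>) E" using q'(4) surs_subset_homs unfolding MM pp' by blast
          fix a assume "a \<in> carrier (M\<lparr>carrier := kernel M G \<pi>'\<rparr>)"
          hence a: "a \<in> carrier M" "\<pi>' a = \<one>\<^bsub>G\<^esub>" by (simp_all add: mem_kernel)
          then obtain x where x: "x \<in> carrier Y" "a = f x" using rep L(2) by auto
          have "x \<in> ?K" using v(1)[OF x(1)] a x by (simp add: mem_kernel)
          thus "\<Psi>' a = \<Psi>2 a" unfolding x(2) using v(2)[OF x(1)] v'(2)[OF x(1)] ff by simp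
        qed
        thus "w = w'" using we we' MM pp' ff by simp
      qed simp
    next
      fix w assume w: "w \<in> ?F"
      obtain M f \<pi>' \<Psi>' where we: "w = (M, f, \<pi>', \<Psi>')" by (metis prod.exhaust)
      have wQ: "(M, f, \<pi>', \<Psi>') \<in> ?Q" "\<Phi> (M, f, \<pi>', \<Psi>') = pp" using w we by blast+
      note q = inQ[OF wQ(1)]
      note v = val[OF wQ(2)]
      note L = labelled_groups_D[OF q(1)]
      have gM: "group M" using L(1) by (rule comm_group.axioms(2))
      have fh: "f \<in> homs Y M" using q(2) surs_subset_homs by blast
      have \<pi>'h: "\<pi>' \<in> homs M G" using q(3) surs_subset_homs by blast
      have \<Psi>'h: "\<Psi>' \<in> homs (M\<lparr>carrier := kernel M G \<pi>'\<rparr>) E" using q(4) surs_subset_homs by blast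
      interpret f: group_hom Y M f by (rule homs_group_hom[OF Y.is_group gM fh])
      interpret p: group_hom M G \<pi>' by (rule homs_group_hom[OF gM G.is_group \<pi>'h])
      note KM = group_kernel[OF gM G.is_group \<pi>'h]
      interpret P: group_hom "M\<lparr>carrier := kernel M G \<pi>'\<rparr>" E \<Psi>' by (rule homs_group_hom[OF KM(2) E.is_group \<Psi>'h])
      have finM: "finite (carrier M)" unfolding L(2) by simp
      have inj: "inj_on \<Psi>' (kernel M G \<pi>')"
      proof (rule eq_card_imp_inj_on)
        show "finite (kernel M G \<pi>')" using finM by (simp add: kernel_def)
        have "card (carrier G) * card (kernel M G \<pi>') = card (carrier G) * card (carrier E)"
          using card_surs_kernel[OF gM G.is_group q(3) finM] L(2) by (simp add: h_def)
        hence "card (kernel M G \<pi>') = card (carrier E)" using posG by simp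
        thus "card (\<Psi>' ` kernel M G \<pi>') = card (kernel M G \<pi>')" using surs_image[OF q(4)] by simp
      qed
      have kerf: "f z = \<one>\<^bsub>M\<^esub> \<longleftrightarrow> z \<in> R" if z: "z \<in> carrier Y" for z
      proof
        assume fz: "f z = \<one>\<^bsub>M\<^esub>"
        have "\<pi> z = \<one>\<^bsub>G\<^esub>" using v(1)[OF z] fz by simp
        moreover from this have "\<Psi> z = \<one>\<^bsub>E\<^esub>" using v(2)[OF z, of z] fz z P.hom_one by (simp add: mem_kernel)
        ultimately show "z \<in> R" unfolding R using z by (intro conjI)
      next
        assume zR: "z \<in> R"
        hence zp: "\<pi> z = \<one>\<^bsub>G\<^esub>" "\<Psi> z = \<one>\<^bsub>E\<^esub>" using zR[unfolded R] by blast+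
        have zK: "z \<in> ?K" unfolding mem_kernel using z zp(1) by (rule conjI)
        have "f z \<in> kernel M G \<pi>'" unfolding mem_kernel using zp(1) v(1)[OF z] homsD(1)[OF fh z] by simp
        moreover have "\<one>\<^bsub>M\<^esub> \<in> kernel M G \<pi>'" by (simp add: mem_kernel)
        moreover have "\<Psi>' (f z) = \<Psi>' \<one>\<^bsub>M\<^esub>" using v(2)[OF z zK] zp(2) P.hom_one by simp
        ultimately show "f z = \<one>\<^bsub>M\<^esub>" using inj by (meson inj_onD)
      qed
      have "f x = f y \<longleftrightarrow> ?c x = ?c y" if xy: "x \<in> carrier Y" "y \<in> carrier Y" for x y
        using homs_eq_iff_kernel[OF Y.is_group gM fh xy] kerf[of "x \<otimes>\<^bsub>Y\<^esub> inv\<^bsub>Y\<^esub> y"] ceq[OF xy] xy by (simp add: mem_kernel)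
      moreover have "f \<in> carrier Y \<rightarrow>\<^sub>E {..<h}" using subsetD[OF homs_subset_PiE fh] L(2) by simp
      ultimately show "fst (snd w) \<in> ?L" using surs_image[OF q(2)] we L(2) by simp
    next
      fix f assume "f \<in> ?L"
      hence fL: "f \<in> carrier Y \<rightarrow>\<^sub>E {..<h} \<and> f ` carrier Y = {..<h} \<and> (\<forall>x\<in>carrier Y. \<forall>y\<in>carrier Y. f x = f y \<longleftrightarrow> ?c x = ?c y)"
        by (rule CollectD)
      note f = fL[THEN conjunct1] fL[THEN conjunct2, THEN conjunct1]
      have fe: "f x = f y \<longleftrightarrow> ?c x = ?c y" if "x \<in> carrier Y" "y \<in> carrier Y" for x y
        using bspec[OF bspec[OF fL[THEN conjunct2, THEN conjunct2] that(1)] that(2)] .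
      define r where "r a = (SOME x. x \<in> carrier Y \<and> f x = a)" for a
      have r: "r a \<in> carrier Y \<and> f (r a) = a" if "a < h" for a
        unfolding r_def by (rule someI_ex) (use that f(2) in \<open>metis imageE lessThan_iff\<close>)
      have fl: "f x < h" if "x \<in> carrier Y" for x using f(1) that by (auto simp: PiE_iff)
      define M :: "nat monoid" where "M = \<lparr>carrier = {..<h}, monoid.mult = (\<lambda>a b. if a < h \<and> b < h then f (r a \<otimes>\<^bsub>Y\<^esub> r b) else 0), one = f \<one>\<^bsub>Y\<^esub>\<rparr>"
      have cr: "?c (r (f x)) = ?c x" if x: "x \<in> carrier Y" for x
        using fe[of "r (f x)" x] r[OF fl[OF x]] x by blast
      have mult: "f (x \<otimes>\<^bsub>Y\<^esub> y) = f x \<otimes>\<^bsub>M\<^esub> f y" if xy: "x \<in> carrier Y" "y \<in> carrier Y" for x y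
      proof -
        have rr: "r (f x) \<in> carrier Y" "r (f y) \<in> carrier Y" using r fl xy by auto
        have "?c (x \<otimes>\<^bsub>Y\<^esub> y) = ?c (r (f x) \<otimes>\<^bsub>Y\<^esub> r (f y))"
          using R.rcos_sum[OF xy] R.rcos_sum[OF rr] cr[OF xy(1)] cr[OF xy(2)] by simp
        hence "f (x \<otimes>\<^bsub>Y\<^esub> y) = f (r (f x) \<otimes>\<^bsub>Y\<^esub> r (f y))" using fe[of "x \<otimes>\<^bsub>Y\<^esub> y" "r (f x) \<otimes>\<^bsub>Y\<^esub> r (f y)"] xy rr by simp
        thus ?thesis using fl xy by (simp add: M_def)
      qed
      have cM: "carrier M = {..<h}" by (simp add: M_def)
      have fhom: "f \<in> hom Y M" using mult fl by (auto simp: hom_def cM)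
      have "comm_group (M\<lparr>carrier := f ` carrier Y, one := f \<one>\<^bsub>Y\<^esub>\<rparr>)" by (rule Y.hom_imp_img_comm_group[OF fhom])
      moreover have "M\<lparr>carrier := f ` carrier Y, one := f \<one>\<^bsub>Y\<^esub>\<rparr> = M" unfolding f(2) by (simp add: M_def)
      ultimately have cgM: "comm_group M" by simp
      hence gM: "group M" by (rule comm_group.axioms(2))
      have Ml: "M \<in> labelled_groups h" using cgM by (simp add: labelled_groups_def M_def)
      have fhs: "f \<in> homs Y M" using mult fl PiE_arb[OF f(1)] by (intro homsI) (auto simp: cM)
      hence fs: "f \<in> surs Y M" using f(2) by (simp add: surs_def cM)
      have kerf: "kernel Y M f = R"
      proof -
        have "z \<in> kernel Y M f \<longleftrightarrow> z \<in> R" for z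
        proof (cases "z \<in> carrier Y")
          case True
          have "f z = f \<one>\<^bsub>Y\<^esub> \<longleftrightarrow> z \<in> R" using fe[OF True Y.one_closed] ceq[OF True Y.one_closed] True by simp
          thus ?thesis using True by (simp add: mem_kernel M_def)
        next
          case False
          thus ?thesis unfolding R mem_kernel by simp
        qed
        thus ?thesis by blast
      qed
      have "\<pi> \<in> {\<psi> \<in> surs Y G. kernel Y M f \<subseteq> kernel Y G \<psi>}"
      proof (intro CollectI conjI \<pi> subsetI)
        fix x assume "x \<in> kernel Y M f"
        thus "x \<in> kernel Y G \<pi>" unfolding kerf R mem_kernel by (elim conjE, intro conjI)
      qed
      then obtain \<pi>' where \<pi>': "\<pi>' \<in> surs M G" "restrict (\<pi>' \<circ> f) (carrier Y) = \<pi>"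
        using bij_betw_imp_surj_on[OF bij_betw_surs_factor[OF Y.is_group gM G.is_group fs]] by (metis (no_types, lifting) imageE)
      have \<pi>'h: "\<pi>' \<in> homs M G" using \<pi>'(1) surs_subset_homs by blast
      note rk = surs_restrict_kernel[OF Y.is_group gM G.is_group fs \<pi>'h \<pi>'(2)[symmetric]]
      let ?KY = "Y\<lparr>carrier := ?K\<rparr>" and ?KM = "M\<lparr>carrier := kernel M G \<pi>'\<rparr>"
      have "kernel ?KY ?KM (restrict f ?K) \<subseteq> kernel ?KY E \<Psi>"
      proof
        fix z assume "z \<in> kernel ?KY ?KM (restrict f ?K)"
        hence "z \<in> ?K" "f z = \<one>\<^bsub>M\<^esub>" by (simp_all add: mem_kernel split: if_splits)
        hence "z \<in> R" unfolding kerf[symmetric] by (simp add: mem_kernel)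
        thus "z \<in> kernel ?KY E \<Psi>" unfolding R_def .
      qed
      hence "\<Psi> \<in> {\<psi> \<in> surs ?KY E. kernel ?KY ?KM (restrict f ?K) \<subseteq> kernel ?KY E \<psi>}" using \<Psi> by blast
      hence "\<Psi> \<in> (\<lambda>\<kappa>. restrict (\<kappa> \<circ> restrict f ?K) (carrier ?KY)) ` surs ?KM E"
        by (simp only: bij_betw_imp_surj_on[OF bij_betw_surs_factor[OF K(2) group_kernel(2)[OF gM G.is_group \<pi>'h] E.is_group rk]])
      then obtain \<Psi>' where P': "\<Psi> = restrict (\<Psi>' \<circ> restrict f ?K) (carrier ?KY)" "\<Psi>' \<in> surs ?KM E" by (rule imageE)
      note \<Psi>' = P'(2) P'(1)[symmetric]
      have e2: "restrict (\<Psi>' \<circ> f) ?K = \<Psi>"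
      proof -
        have "restrict (\<Psi>' \<circ> f) ?K = restrict (\<Psi>' \<circ> restrict f ?K) (carrier ?KY)" by (rule ext) simp
        thus ?thesis using \<Psi>'(2) by simp
      qed
      let ?w = "(M, f, \<pi>', \<Psi>')"
      have "?w \<in> ?Q" using Ml fs \<pi>'(1) \<Psi>'(1) by (simp add: ext_pairs_def)
      moreover have "\<Phi> ?w = pp" using e2 \<pi>'(2) by (simp add: \<Phi>_def pe)
      ultimately have "?w \<in> ?F" by blast
      thus "\<exists>w\<in>?F. f = fst (snd w)" by (intro bexI[of _ ?w]) simp_all
    qed
    hence "card ?F = card ?L" by (rule bij_betw_same_card)
    also have "\<dots> = fact h" by (rule card_labellings[OF Y(2) ch])
    finally show ?thesis .
  qed
  have "(\<Sum>M\<in>labelled_groups h. card (ext_pairs G E M) * card (surs Y M)) = card ?Q"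
  proof -
    have "card ?Q = (\<Sum>M\<in>labelled_groups h. card (surs Y M \<times> ext_pairs G E M))"
      by (intro card_SigmaI finite_labelled_groups ballI finite_cartesian_product finpairs finite_surs Y(2)) (auto simp: labelled_groups_D)
    thus ?thesis by (simp add: card_cartesian_product mult.commute)
  qed
  also have "\<dots> = (\<Sum>pp\<in>?P. card {w \<in> ?Q. \<Phi> w = pp})"
  proof -
    have "(\<Sum>pp\<in>?P. \<Sum>w\<in>{w \<in> ?Q. \<Phi> w = pp}. 1) = (\<Sum>w\<in>?Q. 1 :: nat)"
      by (rule sum.group[OF finQ finpairs[OF Y(2)] \<Phi>P])
    thus ?thesis by simp
  qed
  also have "\<dots> = (\<Sum>pp\<in>?P. fact h)" by (rule sum.cong) (simp_all add: fiber)
  also have "\<dots> = fact h * card ?P" by simp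
  finally show ?thesis .
qed

section \<open>Power quotients\<close>

definition power_quotient :: "('a, 'b) monoid_scheme => nat => 'a set monoid" where
  "power_quotient S q = S Mod ((\<lambda>x. x [^]\<^bsub>S\<^esub> q) ` carrier S)"

context comm_group
begin

lemma int_pow_in_subgroup:
  assumes "subgroup H G" "x \<in> H"
  shows "x [^] (n :: int) \<in> H"
  unfolding int_pow_def2 using pow_in_subgroup[OF assms] subgroup.m_inv_closed[OF assms(1) pow_in_subgroup[OF assms]]
  by (cases "n < 0") (simp_all only: if_True if_False)

lemma subgroup_powers: "subgroup ((\<lambda>x. x [^] (q :: nat)) ` carrier G) G"
proof -
  have "group_hom G G (\<lambda>x. x [^] q)"
    by (simp add: group_hom_def group_hom_axioms_def hom_def nat_pow_distrib)
  thus ?thesis by (rule group_hom.img_is_subgroup)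
qed

lemma normal_powers: "((\<lambda>x. x [^] (q :: nat)) ` carrier G) \<lhd> G"
  by (rule subgroup_imp_normal[OF subgroup_powers])

lemma comm_group_power_quotient: "comm_group (power_quotient G q)"
  unfolding power_quotient_def by (rule abelian_FactGroup[OF subgroup_powers])

lemma power_quotient_map:
  fixes q :: nat
  shows "(\<lambda>x\<in>carrier G. (\<lambda>x. x [^] q) ` carrier G #> x) \<in> surs G (power_quotient G q)"
    "kernel G (power_quotient G q) (\<lambda>x\<in>carrier G. (\<lambda>x. x [^] q) ` carrier G #> x) = (\<lambda>x. x [^] q) ` carrier G"
  using normal.quotient_map_surs[OF normal_powers[of q]] by (simp_all add: power_quotient_def)

lemma card_surs_power_quotient:
  assumes M: "comm_group M" "\<And>m. m \<in> carrier M ==> m [^]\<^bsub>M\<^esub> q = \<one>\<^bsub>M\<^esub>"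
  shows "card (surs (power_quotient G q) M) = card (surs G M)"
proof -
  let ?\<pi> = "(\<lambda>x\<in>carrier G. (\<lambda>x. x [^] q) ` carrier G #> x)"
  have gM: "group M" using M(1) by (rule comm_group.axioms(2))
  have gq: "group (power_quotient G q)" using comm_group_power_quotient by (rule comm_group.axioms(2))
  have "{\<psi> \<in> surs G M. kernel G (power_quotient G q) ?\<pi> \<subseteq> kernel G M \<psi>} = surs G M"
  proof (intro equalityI subsetI CollectI conjI)
    fix \<psi> y assume \<psi>: "\<psi> \<in> surs G M" and y: "y \<in> kernel G (power_quotient G q) ?\<pi>"
    have h: "\<psi> \<in> homs G M" using \<psi> surs_subset_homs by blast
    interpret h: group_hom G M \<psi> by (rule homs_group_hom[OF is_group gM h])
    from y[unfolded power_quotient_map(2)] obtain x where "y = x [^] q" "x \<in> carrier G" by (rule imageE)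
    thus "y \<in> kernel G M \<psi>" using M(2)[of "\<psi> x"] by (simp add: mem_kernel h.hom_nat_pow)
  qed blast+
  thus ?thesis using bij_betw_same_card[OF bij_betw_surs_factor[OF is_group gq gM power_quotient_map(1)[of q]]] by simp
qed

lemma power_quotient_exponent:
  assumes "e \<in> carrier (power_quotient G q)"
  shows "e [^]\<^bsub>power_quotient G q\<^esub> q = \<one>\<^bsub>power_quotient G q\<^esub>"
proof -
  let ?\<pi> = "(\<lambda>x\<in>carrier G. (\<lambda>x. x [^] q) ` carrier G #> x)"
  have gq: "group (power_quotient G q)" using comm_group_power_quotient by (rule comm_group.axioms(2))
  have h: "?\<pi> \<in> homs G (power_quotient G q)" using power_quotient_map(1) surs_subset_homs by blast
  interpret h: group_hom G "power_quotient G q" ?\<pi> by (rule homs_group_hom[OF is_group gq h])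
  have "e \<in> ?\<pi> ` carrier G" using assms by (simp only: surs_image[OF power_quotient_map(1)])
  then obtain x where x: "e = ?\<pi> x" "x \<in> carrier G" by (rule imageE)
  have "x [^] q \<in> kernel G (power_quotient G q) ?\<pi>" unfolding power_quotient_map(2) using x(2) by (rule imageI)
  hence "?\<pi> (x [^] q) = \<one>\<^bsub>power_quotient G q\<^esub>" unfolding mem_kernel by (rule conjunct2)
  thus ?thesis unfolding x(1) using h.hom_nat_pow[OF x(2), of q] by simp
qed

lemma finprod_int_pow:
  assumes "finite A" "f \<in> A \<rightarrow> carrier G"
  shows "finprod G f A [^] (n :: int) = finprod G (\<lambda>i. f i [^] n) A"
  using assms by (induction A) (auto simp: int_pow_distrib Pi_iff)

lemma finprod_swap_pow:
  assumes "finite I" "finite J" "t \<in> J \<rightarrow> carrier G"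
  shows "finprod G (\<lambda>i. finprod G (\<lambda>j. t j [^] (a i j :: int)) J [^] (c i :: int)) I = finprod G (\<lambda>j. t j [^] (\<Sum>i\<in>I. c i * a i j)) J"
  using assms(1)
proof (induction I)
  case (insert i I)
  have tc: "\<And>j. j \<in> J ==> t j \<in> carrier G" using assms(3) by auto
  have "finprod G (\<lambda>i. finprod G (\<lambda>j. t j [^] a i j) J [^] c i) (insert i I) =
     finprod G (\<lambda>j. t j [^] a i j) J [^] c i \<otimes> finprod G (\<lambda>i. finprod G (\<lambda>j. t j [^] a i j) J [^] c i) I"
    using insert tc by (intro finprod_insert) (auto intro!: finprod_closed int_pow_closed)
  also have "finprod G (\<lambda>j. t j [^] a i j) J [^] c i = finprod G (\<lambda>j. t j [^] (c i * a i j)) J"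
    using assms(2) tc by (subst finprod_int_pow) (auto intro!: finprod_cong simp: int_pow_pow mult.commute Pi_iff)
  also have "finprod G (\<lambda>j. t j [^] (c i * a i j)) J \<otimes> finprod G (\<lambda>i. finprod G (\<lambda>j. t j [^] a i j) J [^] c i) I =
     finprod G (\<lambda>j. t j [^] (c i * a i j) \<otimes> t j [^] (\<Sum>i\<in>I. c i * a i j)) J"
    unfolding insert.IH using tc by (intro finprod_multf[symmetric]) auto
  also have "\<dots> = finprod G (\<lambda>j. t j [^] (\<Sum>i\<in>insert i I. c i * a i j)) J"
    using insert tc by (intro finprod_cong) (auto simp: int_pow_mult)
  finally show ?case .
qed (simp add: finprod_one_eqI)

lemma finite_if_generators_torsion:
  fixes R :: nat
  assumes gen: "\<And>x. x \<in> carrier G ==> \<exists>c. x = finprod G (\<lambda>i. s i [^] (c i :: int)) {..<N :: nat}"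
    and s: "s \<in> {..<N} \<rightarrow> carrier G" and R: "R > 0" "\<And>i. i < N ==> s i [^] R = \<one>"
  shows "finite (carrier G)"
proof -
  let ?T = "(\<lambda>c. finprod G (\<lambda>i. s i [^] (c i :: int)) {..<N}) ` ({..<N} \<rightarrow>\<^sub>E {0..<int R})"
  have "carrier G \<subseteq> ?T"
  proof
    fix x assume "x \<in> carrier G"
    then obtain c where c: "x = finprod G (\<lambda>i. s i [^] (c i :: int)) {..<N}" using gen by blast
    let ?c = "\<lambda>i\<in>{..<N}. c i mod int R"
    have "s i [^] c i = s i [^] (?c i)" if "i < N" for i
    proof -
      have si: "s i \<in> carrier G" using s that by auto
      have "s i [^] c i = s i [^] (int R * (c i div int R) + c i mod int R)" by simp
      also have "\<dots> = s i [^] (int R * (c i div int R)) \<otimes> s i [^] (c i mod int R)" by (rule int_pow_mult[OF si])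
      also have "s i [^] (int R * (c i div int R)) = (s i [^] int R) [^] (c i div int R)" using si by (simp add: int_pow_pow)
      also have "s i [^] int R = \<one>" using R(2)[OF that] by (simp add: int_pow_int)
      finally show ?thesis using si that by simp
    qed
    hence "x = finprod G (\<lambda>i. s i [^] (?c i)) {..<N}" unfolding c using s by (intro finprod_cong') auto
    moreover have "?c \<in> {..<N} \<rightarrow>\<^sub>E {0..<int R}" using R(1) by auto
    ultimately show "x \<in> ?T" by (rule image_eqI)
  qed
  moreover have "finite ?T" by (intro finite_imageI finite_PiE) auto
  ultimately show ?thesis by (rule finite_subset)
qed

lemma det_one_minus_multiple:
  fixes B :: "nat => nat => int"
  assumes "p > 1"
  shows "det (mat N N (\<lambda>(i, j). of_bool (i = j) - p * B i j)) ~= 0"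
proof -
  let ?A = "mat N N (\<lambda>(i, j). of_bool (i = j) - p * B i j)" and ?I = "1\<^sub>m N :: int mat"
  have "[det ?A = det ?I] (mod p)"
    unfolding det_def
  proof (simp, intro cong_sum cong_mult cong_refl cong_prod)
    fix \<pi> :: "nat => nat" and i :: nat
    show "[of_bool (i = \<pi> i) - p * B i (\<pi> i) = (if i = \<pi> i then 1 else 0)] (mod p)" by (simp add: cong_iff_dvd_diff)
  qed
  hence c: "[det ?A = 1] (mod p)" by (simp add: det_one)
  show ?thesis
  proof
    assume "det ?A = 0"
    hence "[0 = 1] (mod p)" using c by (simp only:)
    thus False using assms by (simp add: cong_def)
  qed
qed

text \<open>
  If all \<open>p ^ k\<close>-th powers are \<open>p ^ Suc k\<close>-th powers, they are annihilated by the determinant of a matrix \<open>1 - p B\<close>, which is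
  not zero modulo \<open>p\<close>.
\<close>

lemma finite_if_powers_divisible:
  assumes gen: "\<And>x. x \<in> carrier G ==> \<exists>c. x = finprod G (\<lambda>i. s i [^] (c i :: int)) {..<N :: nat}"
    and s: "s \<in> {..<N} \<rightarrow> carrier G" and r: "r > 0" and p: "p > 1"
    and dvd: "\<And>x. x \<in> carrier G ==> \<exists>y\<in>carrier G. x [^] (r :: nat) = y [^] (p * r :: nat)"
  shows "finite (carrier G)"
proof -
  define t where "t i = s i [^] r" for i
  have sc: "s i \<in> carrier G" if "i < N" for i using s that by auto
  have tc: "t i \<in> carrier G" if "i < N" for i using sc[OF that] by (simp add: t_def)
  have "\<exists>b. t i = finprod G (\<lambda>j. t j [^] (int p * b j)) {..<N}" if i: "i < N" for i
  proof -
    obtain y where y: "y \<in> carrier G" "t i = y [^] (p * r)" using dvd[OF sc[OF i]] unfolding t_def by blast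
    obtain b where b: "y = finprod G (\<lambda>j. s j [^] (b j :: int)) {..<N}" using gen[OF y(1)] by blast
    have "t i = y [^] int (p * r)" using y(2) by (simp add: int_pow_int del: of_nat_mult)
    also have "\<dots> = finprod G (\<lambda>j. (s j [^] b j) [^] int (p * r)) {..<N}"
      unfolding b by (rule finprod_int_pow) (auto simp: sc)
    also have "\<dots> = finprod G (\<lambda>j. t j [^] (int p * b j)) {..<N}"
    proof (rule finprod_cong')
      fix j assume "j \<in> {..<N}"
      hence j: "s j \<in> carrier G" by (simp add: sc)
      have "(s j [^] b j) [^] int (p * r) = s j [^] (int r * (int p * b j))" using j by (simp add: int_pow_pow mult_ac)
      also have "\<dots> = (s j [^] int r) [^] (int p * b j)" using j by (simp add: int_pow_pow)
      also have "s j [^] int r = t j" by (simp add: t_def int_pow_int)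
      finally show "(s j [^] b j) [^] int (p * r) = t j [^] (int p * b j)" .
    qed (auto simp: tc)
    finally show ?thesis by blast
  qed
  then obtain B where B: "\<And>i. i < N ==> t i = finprod G (\<lambda>j. t j [^] (int p * B i j)) {..<N}" by metis
  define A where "A = mat N N (\<lambda>(i, j). of_bool (i = j) - int p * B i j)"
  have A: "A \<in> carrier_mat N N" by (simp add: A_def)
  define D where "D = det A"
  have D: "D ~= 0" unfolding D_def A_def using p by (intro det_one_minus_multiple) simp
  note adj = adj_mat[OF A]
  have row: "finprod G (\<lambda>j. t j [^] (A $$ (i, j))) {..<N} = \<one>" if i: "i < N" for i
  proof -
    have "finprod G (\<lambda>j. t j [^] (A $$ (i, j))) {..<N} = 
       finprod G (\<lambda>j. (if i = j then t j else \<one>) \<otimes> (t j [^] (int p * B i j)) [^] (-1 :: int)) {..<N}"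
    proof (rule finprod_cong')
      fix j assume "j \<in> {..<N}"
      hence j: "j < N" "t j \<in> carrier G" by (simp_all add: tc)
      have "t j [^] (of_bool (i = j) - int p * B i j) = t j [^] (of_bool (i = j) :: int) \<otimes> t j [^] ((int p * B i j) * (-1))"
        using j by (subst int_pow_mult[symmetric]) auto
      also have "t j [^] ((int p * B i j) * (-1)) = (t j [^] (int p * B i j)) [^] (-1 :: int)" using j by (simp only: int_pow_pow)
      finally have tj: "t j [^] (of_bool (i = j) - int p * B i j) = t j [^] (of_bool (i = j) :: int) \<otimes> (t j [^] (int p * B i j)) [^] (-1 :: int)" .
      show "t j [^] (A $$ (i, j)) = (if i = j then t j else \<one>) \<otimes> (t j [^] (int p * B i j)) [^] (-1 :: int)"
      proof -
        have "A $$ (i, j) = of_bool (i = j) - int p * B i j" unfolding A_def using i j(1) by (subst index_mat) simp_all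
        moreover have "t j [^] (of_bool (i = j) :: int) = (if i = j then t j else \<one>)" using j(2) by simp
        ultimately show ?thesis using tj by (simp only:)
      qed
    qed (auto simp: tc)
    also have "\<dots> = finprod G (\<lambda>j. if i = j then t j else \<one>) {..<N} \<otimes> finprod G (\<lambda>j. (t j [^] (int p * B i j)) [^] (-1 :: int)) {..<N}"
      by (rule finprod_multf) (auto simp: tc)
    also have "finprod G (\<lambda>j. if i = j then t j else \<one>) {..<N} = t i"
      using i by (intro finprod_singleton) (auto simp: tc)
    also have "finprod G (\<lambda>j. (t j [^] (int p * B i j)) [^] (-1 :: int)) {..<N} = finprod G (\<lambda>j. t j [^] (int p * B i j)) {..<N} [^] (-1 :: int)"
      by (rule finprod_int_pow[symmetric]) (auto simp: tc)
    also have "finprod G (\<lambda>j. t j [^] (int p * B i j)) {..<N} = t i" using B[OF i] ..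
    finally show ?thesis using tc[OF i] by (simp add: int_pow_neg)
  qed
  have "t k [^] D = \<one>" if k: "k < N" for k
  proof -
    let ?c = "\<lambda>i. adj_mat A $$ (k, i)"
    have "finprod G (\<lambda>i. finprod G (\<lambda>j. t j [^] (A $$ (i, j))) {..<N} [^] ?c i) {..<N} = 
       finprod G (\<lambda>j. t j [^] (\<Sum>i<N. ?c i * A $$ (i, j))) {..<N}"
      by (rule finprod_swap_pow) (auto simp: tc)
    also have "\<dots> = finprod G (\<lambda>j. if k = j then t j [^] D else \<one>) {..<N}"
    proof (rule finprod_cong')
      fix j assume "j \<in> {..<N}"
      hence j: "j < N" by simp
      have "(\<Sum>i<N. ?c i * A $$ (i, j)) = (adj_mat A * A) $$ (k, j)"
        using k j A adj(1) by (simp add: scalar_prod_def lessThan_atLeast0)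
      also have "\<dots> = of_bool (k = j) * D" using k j unfolding adj(3) by (simp add: D_def)
      finally show "t j [^] (\<Sum>i<N. ?c i * A $$ (i, j)) = (if k = j then t j [^] D else \<one>)" by simp
    qed (auto simp: tc)
    also have "\<dots> = t k [^] D" using k by (intro finprod_singleton) (auto simp: tc)
    finally have e: "finprod G (\<lambda>i. finprod G (\<lambda>j. t j [^] (A $$ (i, j))) {..<N} [^] ?c i) {..<N} = t k [^] D" .
    have "finprod G (\<lambda>i. finprod G (\<lambda>j. t j [^] (A $$ (i, j))) {..<N} [^] ?c i) {..<N} = \<one>"
      by (rule finprod_one_eqI) (simp add: row)
    thus ?thesis using e by simp
  qed
  note tk = this
  have tD: "s k [^] (r * nat \<bar>D\<bar>) = \<one>" if "k < N" for k
  proof -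
    have "\<bar>D\<bar> = D * sgn D" by (rule abs_sgn)
    moreover have "int (r * nat \<bar>D\<bar>) = int r * \<bar>D\<bar>" by simp
    ultimately have "int (r * nat \<bar>D\<bar>) = int r * (D * sgn D)" by (simp only:)
    hence "s k [^] (r * nat \<bar>D\<bar>) = s k [^] (int r * (D * sgn D))" by (metis int_pow_int)
    also have "\<dots> = ((s k [^] int r) [^] D) [^] sgn D" using sc[OF that] by (simp only: int_pow_pow int_pow_closed mult.assoc)
    also have "s k [^] int r = t k" by (simp add: t_def int_pow_int)
    finally show ?thesis using tk[OF that] by simp
  qed
  show ?thesis
    by (rule finite_if_generators_torsion[OF gen s _ tD]) (use r D in auto)
qed

lemma sylow_iso_power_quotient:
  assumes fin: "finite (carrier G)" and p: "Factorial_Ring.prime p" and H: "subgroup H G" "card H = p ^ a"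
    and ord: "Coset.order G = p ^ a * b" "\<not> p dvd b" and e: "a <= e"
  shows "G\<lparr>carrier := H\<rparr> \<cong> power_quotient G (p ^ e)"
proof -
  let ?q = "p ^ e" and ?P = "power_quotient G (p ^ e)"
  let ?N = "(\<lambda>x. x [^] ?q) ` carrier G"
  let ?\<pi> = "(\<lambda>x\<in>carrier G. ?N #> x)"
  interpret H: subgroup H G by (rule H(1))
  have gq: "group ?P" using comm_group_power_quotient by (rule comm_group.axioms(2))
  have \<pi>h: "?\<pi> \<in> homs G ?P" using power_quotient_map(1) surs_subset_homs by blast
  interpret \<pi>: group_hom G ?P ?\<pi> by (rule homs_group_hom[OF is_group gq \<pi>h])
  have gH: "group (G\<lparr>carrier := H\<rparr>)" by (rule H.subgroup_is_group[OF is_group])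
  have cop: "coprime b (p ^ n)" for n
    using ord(2) p by (metis coprime_commute coprime_power_right_iff prime_imp_coprime)
  have Hpow: "h [^] (p ^ a) = \<one>" if "h \<in> H" for h
  proof -
    have "h [^]\<^bsub>G\<lparr>carrier := H\<rparr>\<^esub> Coset.order (G\<lparr>carrier := H\<rparr>) = \<one>\<^bsub>G\<lparr>carrier := H\<rparr>\<^esub>"
      using that by (intro group.pow_order_eq_1[OF gH]) simp
    thus ?thesis using H(2) by (simp add: nat_pow_def order_def)
  qed
  have split: "\<exists>u w. x = (x [^] b) [^] (u :: int) \<otimes> (x [^] (p ^ n)) [^] (w :: int)" if x: "x \<in> carrier G" for x n
  proof -
    obtain u w where uw: "u * int b + w * int (p ^ n) = 1"
      using cop[of n] bezout_int[of "int b" "int (p ^ n)"] by (auto simp: coprime_int_iff)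
    have "x = x [^] (int b * u + int (p ^ n) * w)" using uw x by (simp add: mult.commute)
    also have "\<dots> = (x [^] int b) [^] u \<otimes> (x [^] int (p ^ n)) [^] w" using x by (simp only: int_pow_mult int_pow_pow)
    finally show ?thesis unfolding int_pow_int by blast
  qed
  have bH: "x [^] b \<in> H" if x: "x \<in> carrier G" for x
  proof -
    interpret HN: normal H G by (rule subgroup_imp_normal[OF H(1)])
    interpret Q: group "G Mod H" by (rule HN.factorgroup_is_group)
    let ?\<rho> = "\<lambda>x\<in>carrier G. H #> x"
    have \<rho>h: "?\<rho> \<in> homs G (G Mod H)" using HN.quotient_map_surs(1) surs_subset_homs by blast
    interpret \<rho>: group_hom G "G Mod H" ?\<rho> by (rule homs_group_hom[OF is_group Q.is_group \<rho>h])
    have "card (rcosets H) * card H = b * card H" using lagrange[OF H(1)] ord(1) H(2) by (simp add: mult.commute)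
    moreover have "card H > 0" using H(2) prime_gt_0_nat[OF p] by simp
    ultimately have "Coset.order (G Mod H) = b" by (simp add: order_def FactGroup_def)
    hence "?\<rho> (x [^] b) = \<one>\<^bsub>G Mod H\<^esub>" using Q.pow_order_eq_1[of "?\<rho> x"] \<rho>.hom_nat_pow[OF x, of b] homsD(1)[OF \<rho>h x] by metis
    hence "x [^] b \<in> kernel G (G Mod H) ?\<rho>" unfolding mem_kernel using x by blast
    thus ?thesis unfolding HN.quotient_map_surs(2) .
  qed
  have inj: "inj_on ?\<pi> H"
  proof (rule inj_onI)
    fix h h' assume hh: "h \<in> H" "h' \<in> H" "?\<pi> h = ?\<pi> h'"
    let ?z = "h \<otimes> inv h'"
    have c: "h \<in> carrier G" "h' \<in> carrier G" using hh H.subset by auto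
    have zH: "?z \<in> H" using hh by simp
    have "?z \<in> ?N" using hh(3) homs_eq_iff_kernel[OF is_group gq \<pi>h c] power_quotient_map(2) by blast
    then obtain x where x: "?z = x [^] ?q" "x \<in> carrier G" by (rule imageE)
    have zc: "?z \<in> carrier G" using c by simp
    have "?z [^] b = (x [^] (p ^ a * b)) [^] (p ^ (e - a))"
    proof -
      have "?q * b = (p ^ a * b) * p ^ (e - a)" using e by (simp add: power_add[symmetric])
      thus ?thesis unfolding x(1) using x(2) by (simp only: nat_pow_pow)
    qed
    also have "x [^] (p ^ a * b) = \<one>" using pow_order_eq_1[OF x(2)] ord(1) by simp
    finally have "?z [^] b = \<one>" by simp
    moreover have "?z [^] (p ^ a) = \<one>" by (rule Hpow[OF zH])
    moreover obtain u w where "?z = (?z [^] b) [^] (u :: int) \<otimes> (?z [^] (p ^ a)) [^] (w :: int)" using split[OF zc] by blast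
    ultimately have "?z = \<one>" by simp
    thus "h = h'" using c by (metis inv_equality inv_inv inv_closed)
  qed
  have surj: "?\<pi> ` H = carrier ?P"
  proof (intro equalityI subsetI)
    fix y assume "y \<in> ?\<pi> ` H" thus "y \<in> carrier ?P" using H.subset homsD(1)[OF \<pi>h] by blast
  next
    fix y assume "y \<in> carrier ?P"
    hence "y \<in> ?\<pi> ` carrier G" by (simp only: surs_image[OF power_quotient_map(1)])
    then obtain x where x: "y = ?\<pi> x" "x \<in> carrier G" by (rule imageE)
    obtain u w where uw: "x = (x [^] b) [^] (u :: int) \<otimes> (x [^] ?q) [^] (w :: int)" using split[OF x(2)] by blast
    let ?h = "(x [^] b) [^] (u :: int)"
    have hH: "?h \<in> H" using int_pow_in_subgroup[OF H(1) bH[OF x(2)]] .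
    have hc: "?h \<in> carrier G" using hH H.subset by blast
    have "(x [^] ?q) [^] w = (x [^] w) [^] ?q" using x(2) by (simp add: int_pow_pow int_pow_int[symmetric] mult.commute)
    hence "(x [^] ?q) [^] w \<in> kernel G ?P ?\<pi>" unfolding power_quotient_map(2) using x(2) by (intro image_eqI[of _ _ "x [^] w"]) auto
    hence k: "?\<pi> ((x [^] ?q) [^] w) = \<one>\<^bsub>?P\<^esub>" "(x [^] ?q) [^] w \<in> carrier G" unfolding mem_kernel by blast+
    have "?\<pi> x = ?\<pi> (?h \<otimes> (x [^] ?q) [^] w)" using uw by (rule arg_cong)
    also have "\<dots> = ?\<pi> ?h \<otimes>\<^bsub>?P\<^esub> ?\<pi> ((x [^] ?q) [^] w)" by (rule homsD(2)[OF \<pi>h hc k(2)])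
    also have "\<dots> = ?\<pi> ?h" using k(1) group.is_monoid[OF gq] homsD(1)[OF \<pi>h hc] by (simp add: monoid.r_one)
    finally show "y \<in> ?\<pi> ` H" using hH x(1) by blast
  qed
  have "?\<pi> \<in> iso (G\<lparr>carrier := H\<rparr>) ?P"
    unfolding iso_def
  proof (intro CollectI conjI)
    show "?\<pi> \<in> hom (G\<lparr>carrier := H\<rparr>) ?P"
      using homsD(1,2)[OF \<pi>h] H.subset by (auto simp: hom_def simp del: restrict_apply)
    show "bij_betw ?\<pi> (carrier (G\<lparr>carrier := H\<rparr>)) (carrier ?P)" using inj surj by (simp add: bij_betw_def)
  qed
  thus ?thesis by (rule is_isoI)
qed

text \<open>
  A finite power quotient of order \<open>p ^ k\<close> already stabilises at exponent \<open>p ^ k\<close>, hence the group is finite and the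
  quotient is isomorphic to its Sylow part. The exponent \<open>Suc k\<close> is needed to see the stabilisation.
\<close>

lemma sylow_part_iso_iff_power_quotient:
  assumes gen: "\<And>x. x \<in> carrier G ==> \<exists>c. x = finprod G (\<lambda>i. s i [^] (c i :: int)) {..<N :: nat}"
    and s: "s \<in> {..<N} \<rightarrow> carrier G" and p: "Factorial_Ring.prime p"
    and A: "group A" "finite (carrier A)" "Coset.order A = p ^ k"
  shows "sylow_part_iso p G A \<longleftrightarrow> power_quotient G (p ^ Suc k) \<cong> A"
proof -
  have p1: "p > 1" using prime_gt_1_nat[OF p] .
  let ?P = "\<lambda>e. power_quotient G (p ^ e)"
  have gq: "group (?P e)" for e using comm_group_power_quotient by (rule comm_group.axioms(2))
  have decomp: "\<exists>b. Coset.order G = p ^ multiplicity p (Coset.order G) * b \<and> \<not> p dvd b" if "finite (carrier G)"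
  proof -
    have "Coset.order G ~= 0" using that one_closed by (auto simp: order_def)
    then obtain b where "Coset.order G = p ^ multiplicity p (Coset.order G) * b" "\<not> p dvd b"
      using multiplicity_decompose'[of "Coset.order G" p] p1 by auto
    thus ?thesis by blast
  qed
  show ?thesis
  proof
    assume "sylow_part_iso p G A"
    then obtain H where H: "finite (carrier G)" "subgroup H G" "card H = p ^ multiplicity p (Coset.order G)" and iso: "G\<lparr>carrier := H\<rparr> \<cong> A"
      by (auto simp: sylow_part_iso_def sylow_subgroup_def)
    have gH: "group (G\<lparr>carrier := H\<rparr>)" by (rule subgroup.subgroup_is_group[OF H(2) is_group])
    have "p ^ multiplicity p (Coset.order G) = p ^ k" using iso_same_card[OF iso] H(3) A(3) by (simp add: order_def)
    hence m: "multiplicity p (Coset.order G) = k" using p1 by simp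
    obtain b where b': "Coset.order G = p ^ k * b \<and> \<not> p dvd b" using decomp[OF H(1), unfolded m] by (rule exE)
    note b = b'[THEN conjunct1] b'[THEN conjunct2]
    have "card H = p ^ k" using H(3) unfolding m .
    note sylow_iso_power_quotient[OF H(1) p H(2) this b le_SucI[OF order_refl]]
    hence "G\<lparr>carrier := H\<rparr> \<cong> ?P (Suc k)" .
    thus "?P (Suc k) \<cong> A" using iso group.iso_sym[OF gH] iso_trans by blast
  next
    assume iso: "?P (Suc k) \<cong> A"
    let ?\<pi> = "(\<lambda>x\<in>carrier G. (\<lambda>x. x [^] (p ^ Suc k)) ` carrier G #> x)"
    have \<pi>h: "?\<pi> \<in> homs G (?P (Suc k))" using power_quotient_map(1) surs_subset_homs by blast
    interpret \<pi>: group_hom G "?P (Suc k)" ?\<pi> by (rule homs_group_hom[OF is_group gq \<pi>h])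
    have ordP: "Coset.order (?P (Suc k)) = p ^ k" using iso_same_card[OF iso] A(3) by (simp add: order_def)
    have step: "\<exists>y\<in>carrier G. x [^] (p ^ k) = y [^] (p * p ^ k)" if x: "x \<in> carrier G" for x
    proof -
      have "?\<pi> (x [^] (p ^ k)) = \<one>\<^bsub>?P (Suc k)\<^esub>"
        using group.pow_order_eq_1[OF gq homsD(1)[OF \<pi>h x]] \<pi>.hom_nat_pow[OF x, of "p ^ k"] unfolding ordP by metis
      hence "x [^] (p ^ k) \<in> kernel G (?P (Suc k)) ?\<pi>" unfolding mem_kernel using x by blast
      thus ?thesis unfolding power_quotient_map(2) by auto
    qed
    have fin: "finite (carrier G)"
    proof (rule finite_if_powers_divisible[where s = s and N = N and r = "p ^ k" and p = p])
      show "\<exists>c. x = finprod G (\<lambda>i. s i [^] (c i :: int)) {..<N}" if "x \<in> carrier G" for x using gen[OF that] .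
      show "\<exists>y\<in>carrier G. x [^] (p ^ k) = y [^] (p * p ^ k)" if "x \<in> carrier G" for x using step[OF that] .
    qed (use s p1 in simp_all)
    define a where "a = multiplicity p (Coset.order G)"
    obtain b where b': "Coset.order G = p ^ a * b \<and> \<not> p dvd b" using decomp[OF fin, folded a_def] by (rule exE)
    note b = b'[THEN conjunct1] b'[THEN conjunct2]
    obtain H where H: "subgroup H G" "card H = p ^ a"
      using sylow_thm[OF p is_group b(1) fin] by blast
    have steps: "\<exists>y\<in>carrier G. x [^] (p ^ k) = y [^] (p ^ (k + j))" if x: "x \<in> carrier G" for x j
      using x
    proof (induction j arbitrary: x)
      case (Suc j)
      obtain y where y: "y \<in> carrier G" "x [^] (p ^ k) = y [^] (p ^ (k + j))" using Suc by blast
      obtain z where z: "z \<in> carrier G" "y [^] (p ^ k) = z [^] (p * p ^ k)" using step[OF y(1)] by blast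
      have "x [^] (p ^ k) = (y [^] (p ^ k)) [^] (p ^ j)" using y by (simp add: nat_pow_pow power_add)
      also have "\<dots> = z [^] (p ^ (k + Suc j))" unfolding z(2) using z(1) by (simp add: nat_pow_pow power_add mult_ac)
      finally show ?case using z(1) by blast
    qed auto
    let ?e = "k + Suc a"
    have "(\<lambda>x. x [^] (p ^ Suc k)) ` carrier G = (\<lambda>x. x [^] (p ^ ?e)) ` carrier G"
    proof (intro equalityI subsetI)
      fix y assume "y \<in> (\<lambda>x. x [^] (p ^ Suc k)) ` carrier G"
      then obtain x where x: "y = x [^] (p ^ Suc k)" "x \<in> carrier G" by (rule imageE)
      have "y = (x [^] p) [^] (p ^ k)" using x by (simp add: nat_pow_pow)
      moreover obtain z where "z \<in> carrier G" "(x [^] p) [^] (p ^ k) = z [^] (p ^ ?e)" using steps[of "x [^] p" "Suc a"] x(2) by blast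
      ultimately show "y \<in> (\<lambda>x. x [^] (p ^ ?e)) ` carrier G" by auto
    next
      fix y assume "y \<in> (\<lambda>x. x [^] (p ^ ?e)) ` carrier G"
      then obtain x where x: "y = x [^] (p ^ ?e)" "x \<in> carrier G" by (rule imageE)
      have "y = (x [^] (p ^ a)) [^] (p ^ Suc k)" using x by (simp add: nat_pow_pow power_add mult_ac)
      thus "y \<in> (\<lambda>x. x [^] (p ^ Suc k)) ` carrier G" using x(2) by auto
    qed
    hence eq: "?P (Suc k) = ?P ?e" by (simp only: power_quotient_def)
    have "G\<lparr>carrier := H\<rparr> \<cong> ?P ?e" by (rule sylow_iso_power_quotient[OF fin p H b]) simp
    hence "G\<lparr>carrier := H\<rparr> \<cong> A" using iso iso_trans unfolding eq by blast
    thus "sylow_part_iso p G A" using fin H by (auto simp: sylow_part_iso_def sylow_subgroup_def a_def)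
  qed
qed

end

section \<open>Homomorphisms from the sandpile group\<close>

lemma hom_finprod:
  assumes "comm_group G" "comm_group M" "\<phi> \<in> homs G M" "finite A" "g \<in> A \<rightarrow> carrier G"
  shows "\<phi> (finprod G g A) = finprod M (\<lambda>i. \<phi> (g i)) A"
  using assms(4,5)
proof (induction A)
  interpret G: comm_group G by fact
  interpret M: comm_group M by fact
  {
    case empty
    show ?case using group_hom.hom_one[OF homs_group_hom[OF G.is_group M.is_group assms(3)]] by simp
  next
    case (insert i A)
    have g: "g i \<in> carrier G" "g \<in> A \<rightarrow> carrier G" using insert.prems by auto
    have "\<phi> (finprod G g (insert i A)) = \<phi> (g i \<otimes>\<^bsub>G\<^esub> finprod G g A)" using insert g by (subst G.finprod_insert) auto
    also have "\<dots> = \<phi> (g i) \<otimes>\<^bsub>M\<^esub> \<phi> (finprod G g A)" using g by (intro homsD(2)[OF assms(3)]) auto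
    also have "\<dots> = finprod M (\<lambda>i. \<phi> (g i)) (insert i A)"
      unfolding insert.IH[OF g(2)] using insert g homsD(1)[OF assms(3)] by (intro M.finprod_insert[symmetric]) auto
    finally show ?case .
  }
qed

lemma szg_simps:
  "x \<in> carrier (sum_zero_group N) \<longleftrightarrow> x \<in> carrier_vec N \<and> (\<Sum>i<N. x $ i) = 0"
  "x \<otimes>\<^bsub>sum_zero_group N\<^esub> y = x + y" "\<one>\<^bsub>sum_zero_group N\<^esub> = 0\<^sub>v N"
  by (auto simp: sum_zero_group_def monoid_vec_def)

lemma szg_dim: "x \<in> carrier (sum_zero_group N) ==> dim_vec x = N"
  by (simp add: szg_simps)

lemma szg_nat_pow:
  assumes "x \<in> carrier_vec N"
  shows "x [^]\<^bsub>sum_zero_group N\<^esub> (n :: nat) = int n \<cdot>\<^sub>v x"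
proof (induction n)
  case 0
  show ?case using assms by (auto simp: nat_pow_def szg_simps)
next
  case (Suc n)
  have "x [^]\<^bsub>sum_zero_group N\<^esub> Suc n = x [^]\<^bsub>sum_zero_group N\<^esub> n \<otimes>\<^bsub>sum_zero_group N\<^esub> x" by (simp add: nat_pow_def)
  also have "\<dots> = int n \<cdot>\<^sub>v x + x" unfolding Suc szg_simps ..
  also have "\<dots> = int (Suc n) \<cdot>\<^sub>v x" using assms by (intro eq_vecI) (auto simp: algebra_simps)
  finally show ?case .
qed

lemma szg_int_pow:
  assumes "x \<in> carrier (sum_zero_group N)"
  shows "x [^]\<^bsub>sum_zero_group N\<^esub> (n :: int) = n \<cdot>\<^sub>v x"
proof -
  interpret Z: comm_group "sum_zero_group N" by (rule comm_group_sum_zero_group)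
  have x: "x \<in> carrier_vec N" "(\<Sum>i<N. x $ i) = 0" using assms by (simp_all add: szg_simps)
  show ?thesis
  proof (cases "n < 0")
    case True
    let ?m = "nat (- n)"
    have "inv\<^bsub>sum_zero_group N\<^esub> (x [^]\<^bsub>sum_zero_group N\<^esub> ?m) = n \<cdot>\<^sub>v x"
    proof (rule Z.inv_equality)
      show "n \<cdot>\<^sub>v x \<otimes>\<^bsub>sum_zero_group N\<^esub> x [^]\<^bsub>sum_zero_group N\<^esub> ?m = \<one>\<^bsub>sum_zero_group N\<^esub>"
        unfolding szg_nat_pow[OF x(1)] szg_simps using True x by (intro eq_vecI) auto
      show "n \<cdot>\<^sub>v x \<in> carrier (sum_zero_group N)" using x by (auto simp: szg_simps sum_distrib_left[symmetric])
    qed (use assms in simp)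
    thus ?thesis unfolding int_pow_def2 using True by simp
  next
    case False
    thus ?thesis unfolding int_pow_def2 szg_nat_pow[OF x(1)] by simp
  qed
qed

lemma szg_finprod_index:
  assumes "finite A" "g \<in> A \<rightarrow> carrier (sum_zero_group N)" "k < N"
  shows "finprod (sum_zero_group N) g A $ k = (\<Sum>i\<in>A. g i $ k)"
  using assms(1,2)
proof (induction A)
  interpret Z: comm_group "sum_zero_group N" by (rule comm_group_sum_zero_group)
  {
    case empty
    show ?case using assms(3) by (simp add: szg_simps)
  next
    case (insert i A)
    have g: "g i \<in> carrier (sum_zero_group N)" "g \<in> A \<rightarrow> carrier (sum_zero_group N)" using insert.prems by auto
    have fc: "finprod (sum_zero_group N) g A \<in> carrier (sum_zero_group N)" using g by simp
    have "finprod (sum_zero_group N) g (insert i A) = g i + finprod (sum_zero_group N) g A"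
      using insert g by (subst Z.finprod_insert) (auto simp: szg_simps(2))
    thus ?case using insert.IH[OF g(2)] insert.hyps szg_dim[OF g(1)] szg_dim[OF fc] assms(3) by simp
  }
qed

definition basis_diff :: "nat => nat => int vec" where
  "basis_diff N i = unit_vec N i - unit_vec N 0"

lemma basis_diff_index: "i < N ==> k < N ==> basis_diff N i $ k = of_bool (k = i) - of_bool (k = 0)"
  by (simp add: basis_diff_def)

lemma basis_diff_carrier:
  assumes "i < N" shows "basis_diff N i \<in> carrier (sum_zero_group N)"
proof -
  have "basis_diff N i \<in> carrier_vec N" by (simp add: basis_diff_def)
  moreover have "(\<Sum>k<N. basis_diff N i $ k) = (\<Sum>k<N. of_bool (k = i) - of_bool (k = 0))"
    using assms by (intro sum.cong) (auto simp: basis_diff_index)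
  moreover have "(\<Sum>k<N. of_bool (k = i) - of_bool (k = 0) :: int) = 0"
  proof -
    have "(\<Sum>k<N. of_bool (k = j) :: int) = 1" if "j < N" for j using that by (simp add: of_bool_def)
    thus ?thesis using assms by (simp add: sum_subtractf)
  qed
  ultimately show ?thesis by (simp add: szg_simps)
qed

lemma szg_generators:
  assumes x: "x \<in> carrier (sum_zero_group N)" and N: "N > 0"
  shows "x = finprod (sum_zero_group N) (\<lambda>i. basis_diff N i [^]\<^bsub>sum_zero_group N\<^esub> (x $ i)) {..<N}"
proof -
  interpret Z: comm_group "sum_zero_group N" by (rule comm_group_sum_zero_group)
  let ?g = "\<lambda>i. basis_diff N i [^]\<^bsub>sum_zero_group N\<^esub> (x $ i)"
  have g: "?g \<in> {..<N} \<rightarrow> carrier (sum_zero_group N)" using basis_diff_carrier by auto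
  have fc: "finprod (sum_zero_group N) ?g {..<N} \<in> carrier (sum_zero_group N)" using g by (rule Z.finprod_closed)
  have xN: "x \<in> carrier_vec N" "(\<Sum>i<N. x $ i) = 0" using x by (simp_all add: szg_simps)
  show ?thesis
  proof (rule eq_vecI)
    show "dim_vec x = dim_vec (finprod (sum_zero_group N) ?g {..<N})" using szg_dim[OF fc] szg_dim[OF x] by simp
    fix k assume "k < dim_vec (finprod (sum_zero_group N) ?g {..<N})"
    hence k: "k < N" using szg_dim[OF fc] by simp
    have "finprod (sum_zero_group N) ?g {..<N} $ k = (\<Sum>i<N. ?g i $ k)" by (rule szg_finprod_index[OF _ g k]) simp
    also have "\<dots> = (\<Sum>i<N. x $ i * (of_bool (k = i) - of_bool (k = 0)))"
    proof (rule sum.cong[OF refl])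
      fix i assume "i \<in> {..<N}"
      hence i: "i < N" by simp
      have "dim_vec (basis_diff N i) = N" by (simp add: basis_diff_def)
      thus "?g i $ k = x $ i * (of_bool (k = i) - of_bool (k = 0))"
        using i k by (simp add: szg_int_pow[OF basis_diff_carrier[OF i]] basis_diff_index)
    qed
    also have "\<dots> = (\<Sum>i<N. (if k = i then x $ i else 0) - of_bool (k = 0) * (x $ i))"
      by (rule sum.cong) auto
    also have "\<dots> = (\<Sum>i<N. if k = i then x $ i else 0) - of_bool (k = 0) * (\<Sum>i<N. x $ i)"
      by (simp only: sum_subtractf sum_distrib_left)
    also have "\<dots> = x $ k" using k xN(2) by simp
    finally show "x $ k = finprod (sum_zero_group N) ?g {..<N} $ k" ..
  qed
qed

definition vec_hom :: "('a, 'b) monoid_scheme => nat => (nat => 'a) => int vec => 'a" where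
  "vec_hom M N f = (\<lambda>x\<in>carrier (sum_zero_group N). finprod M (\<lambda>i. f i [^]\<^bsub>M\<^esub> (x $ i)) {..<N})"

definition normalized_maps :: "('a, 'b) monoid_scheme => nat => (nat => 'a) set" where
  "normalized_maps M N = {f \<in> {..<N} \<rightarrow>\<^sub>E carrier M. f 0 = \<one>\<^bsub>M\<^esub>}"

definition generates :: "('a, 'b) monoid_scheme => 'a set => bool" where
  "generates M A \<longleftrightarrow> (\<forall>K. subgroup K M \<and> A \<subseteq> K --> K = carrier M)"

context comm_group
begin

lemma vec_hom_homs:
  assumes f: "f \<in> {..<N} \<rightarrow> carrier G"
  shows "vec_hom G N f \<in> homs (sum_zero_group N) G"
proof (rule homsI)
  interpret Z: comm_group "sum_zero_group N" by (rule comm_group_sum_zero_group)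
  have fc: "f i \<in> carrier G" if "i < N" for i using f that by auto
  fix x assume x: "x \<in> carrier (sum_zero_group N)"
  show "vec_hom G N f x \<in> carrier G" using x fc by (auto simp: vec_hom_def intro!: finprod_closed)
  fix y assume y: "y \<in> carrier (sum_zero_group N)"
  have xy: "x + y \<in> carrier (sum_zero_group N)" using Z.m_closed[OF x y] by (simp add: szg_simps(2))
  have "finprod G (\<lambda>i. f i [^] ((x + y) $ i)) {..<N} = finprod G (\<lambda>i. f i [^] (x $ i) \<otimes> f i [^] (y $ i)) {..<N}"
    using x y fc by (intro finprod_cong') (auto simp: szg_simps int_pow_mult)
  also have "\<dots> = finprod G (\<lambda>i. f i [^] (x $ i)) {..<N} \<otimes> finprod G (\<lambda>i. f i [^] (y $ i)) {..<N}"
    using fc by (intro finprod_multf) auto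
  finally show "vec_hom G N f (x \<otimes>\<^bsub>sum_zero_group N\<^esub> y) = vec_hom G N f x \<otimes> vec_hom G N f y"
    using x y xy by (simp add: vec_hom_def szg_simps(2))
next
  fix x assume "x \<notin> carrier (sum_zero_group N)"
  thus "vec_hom G N f x = undefined" by (simp add: vec_hom_def)
qed

lemma vec_hom_basis:
  assumes f: "f \<in> normalized_maps G N" and j: "j < N"
  shows "vec_hom G N f (basis_diff N j) = f j"
proof -
  have fc: "f i \<in> carrier G" if "i < N" for i using f that by (auto simp: normalized_maps_def)
  have f0: "f 0 = \<one>" using f by (simp add: normalized_maps_def)
  have "vec_hom G N f (basis_diff N j) = finprod G (\<lambda>i. f i [^] (basis_diff N j $ i)) {..<N}"
    using basis_diff_carrier[OF j] by (simp add: vec_hom_def)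
  also have "\<dots> = finprod G (\<lambda>i. if j = i then f i else \<one>) {..<N}"
    using fc f0 j by (intro finprod_cong') (auto simp: basis_diff_index)
  also have "\<dots> = f j" using j fc by (intro finprod_singleton) auto
  finally show ?thesis .
qed

lemma hom_eq_vec_hom:
  assumes \<phi>: "\<phi> \<in> homs (sum_zero_group N) G" and N: "N > 0"
  defines "f \<equiv> \<lambda>i\<in>{..<N}. \<phi> (basis_diff N i)"
  shows "f \<in> normalized_maps G N" "vec_hom G N f = \<phi>"
proof -
  interpret Z: comm_group "sum_zero_group N" by (rule comm_group_sum_zero_group)
  interpret h: group_hom "sum_zero_group N" G \<phi> by (rule homs_group_hom[OF Z.is_group is_group \<phi>])
  have "basis_diff N 0 = \<one>\<^bsub>sum_zero_group N\<^esub>" by (auto simp: basis_diff_def szg_simps)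
  hence "f 0 = \<one>" using N h.hom_one by (simp add: f_def)
  thus fn: "f \<in> normalized_maps G N"
    using basis_diff_carrier homsD(1)[OF \<phi>] by (auto simp: normalized_maps_def f_def)
  have fc: "f \<in> {..<N} \<rightarrow> carrier G" using fn by (auto simp: normalized_maps_def)
  show "vec_hom G N f = \<phi>"
  proof (rule homs_ext[OF vec_hom_homs[OF fc] \<phi>])
    fix x assume x: "x \<in> carrier (sum_zero_group N)"
    have "\<phi> x = \<phi> (finprod (sum_zero_group N) (\<lambda>i. basis_diff N i [^]\<^bsub>sum_zero_group N\<^esub> (x $ i)) {..<N})"
      by (simp only: szg_generators[OF x N, symmetric])
    also have "\<dots> = finprod G (\<lambda>i. \<phi> (basis_diff N i [^]\<^bsub>sum_zero_group N\<^esub> (vec_index x i))) {..<N}"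
      by (rule hom_finprod[OF comm_group_sum_zero_group comm_group_axioms \<phi>]) (auto simp: basis_diff_carrier)
    also have "\<dots> = finprod G (\<lambda>i. f i [^] (x $ i)) {..<N}"
      using fc basis_diff_carrier by (intro finprod_cong') (auto simp: f_def h.hom_int_pow)
    finally show "vec_hom G N f x = \<phi> x" using x by (simp add: vec_hom_def)
  qed
qed

lemma bij_betw_vec_hom:
  assumes N: "N > 0"
  shows "bij_betw (vec_hom G N) (normalized_maps G N) (homs (sum_zero_group N) G)"
proof (rule bij_betwI')
  fix f f' assume f: "f \<in> normalized_maps G N" "f' \<in> normalized_maps G N"
  show "vec_hom G N f = vec_hom G N f' \<longleftrightarrow> f = f'"
  proof
    assume e: "vec_hom G N f = vec_hom G N f'"
    have "f i = f' i" if "i < N" for i using vec_hom_basis[OF f(1) that] vec_hom_basis[OF f(2) that] e by simp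
    thus "f = f'" using f by (auto simp: normalized_maps_def intro: PiE_ext)
  qed simp
next
  fix f assume "f \<in> normalized_maps G N"
  hence "f \<in> {..<N} \<rightarrow> carrier G" by (auto simp: normalized_maps_def)
  thus "vec_hom G N f \<in> homs (sum_zero_group N) G" by (rule vec_hom_homs)
next
  fix \<phi> assume "\<phi> \<in> homs (sum_zero_group N) G"
  from hom_eq_vec_hom[OF this N] show "\<exists>f\<in>normalized_maps G N. \<phi> = vec_hom G N f" by (metis)
qed

lemma vec_hom_surj_iff:
  assumes f: "f \<in> normalized_maps G N"
  shows "vec_hom G N f \<in> surs (sum_zero_group N) G \<longleftrightarrow> generates G (f ` {..<N})"
proof -
  interpret Z: comm_group "sum_zero_group N" by (rule comm_group_sum_zero_group)
  have fc: "f \<in> {..<N} \<rightarrow> carrier G" using f by (auto simp: normalized_maps_def)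
  note h = vec_hom_homs[OF fc]
  let ?I = "vec_hom G N f ` carrier (sum_zero_group N)"
  have sub: "subgroup ?I G" using group_hom.img_is_subgroup[OF homs_group_hom[OF Z.is_group is_group h]] .
  have fI: "f ` {..<N} \<subseteq> ?I"
  proof (rule image_subsetI)
    fix i assume "i \<in> {..<N}"
    hence i: "i < N" by simp
    show "f i \<in> ?I" by (rule image_eqI[of _ _ "basis_diff N i"]) (simp_all add: vec_hom_basis[OF f i] basis_diff_carrier[OF i])
  qed
  have IK: "?I \<subseteq> K" if K: "subgroup K G" "f ` {..<N} \<subseteq> K" for K
  proof (rule image_subsetI)
    fix x assume x: "x \<in> carrier (sum_zero_group N)"
    have Kc: "K \<subseteq> carrier G" using K(1) by (rule subgroup.subset)
    have "finprod G (\<lambda>i. f i [^] (x $ i)) A \<in> K" if "finite A" "A \<subseteq> {..<N}" for A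
      using that
    proof (induction A)
      case empty
      show ?case using subgroup.one_closed[OF K(1)] by simp
    next
      case (insert i A)
      have m: "f j [^] (x $ j) \<in> K" if "j < N" for j using int_pow_in_subgroup[OF K(1)] K(2) that by blast
      have "finprod G (\<lambda>i. f i [^] (x $ i)) (insert i A) = f i [^] (x $ i) \<otimes> finprod G (\<lambda>i. f i [^] (x $ i)) A"
        using insert m Kc by (intro finprod_insert) auto
      thus ?case using insert m subgroup.m_closed[OF K(1)] by simp
    qed
    thus "vec_hom G N f x \<in> K" using x by (simp add: vec_hom_def)
  qed
  show ?thesis
  proof
    assume "vec_hom G N f \<in> surs (sum_zero_group N) G"
    hence "?I = carrier G" by (rule surs_image)
    thus "generates G (f ` {..<N})" unfolding generates_def using IK subgroup.subset by blast
  next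
    assume "generates G (f ` {..<N})"
    hence "?I = carrier G" unfolding generates_def using sub fI by blast
    thus "vec_hom G N f \<in> surs (sum_zero_group N) G" using h by (simp add: surs_def)
  qed
qed

lemma finite_power_quotient:
  assumes gen: "\<And>x. x \<in> carrier G ==> \<exists>c. x = finprod G (\<lambda>i. s i [^] (c i :: int)) {..<N :: nat}"
    and s: "s \<in> {..<N} \<rightarrow> carrier G" and q: "q > 0"
  shows "finite (carrier (power_quotient G q))"
proof -
  let ?P = "power_quotient G q"
  define \<pi> where "\<pi> = (\<lambda>x\<in>carrier G. (\<lambda>x. x [^] q) ` carrier G #> x)"
  have \<pi>s: "\<pi> \<in> surs G ?P" unfolding \<pi>_def by (rule power_quotient_map(1))
  have \<pi>h: "\<pi> \<in> homs G ?P" using \<pi>s surs_subset_homs by blast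
  interpret P: comm_group ?P by (rule comm_group_power_quotient)
  interpret \<pi>: group_hom G ?P \<pi> by (rule homs_group_hom[OF is_group P.is_group \<pi>h])
  have sc: "s i \<in> carrier G" if "i < N" for i using s that by auto
  show ?thesis
  proof (rule P.finite_if_generators_torsion[where s = "\<lambda>i. \<pi> (s i)" and N = N and R = q])
    fix y assume "y \<in> carrier ?P"
    hence "y \<in> \<pi> ` carrier G" by (simp only: surs_image[OF \<pi>s])
    then obtain x where x: "y = \<pi> x" "x \<in> carrier G" by (rule imageE)
    obtain c where c: "x = finprod G (\<lambda>i. s i [^] (c i :: int)) {..<N}" using gen[OF x(2)] by blast
    have "y = finprod ?P (\<lambda>i. \<pi> (s i [^] c i)) {..<N}"
      unfolding x(1) c by (rule hom_finprod[OF comm_group_axioms P.comm_group_axioms \<pi>h]) (use s in auto)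
    also have "\<dots> = finprod ?P (\<lambda>i. \<pi> (s i) [^]\<^bsub>?P\<^esub> c i) {..<N}"
    proof (rule P.finprod_cong')
      fix i assume "i \<in> {..<N}"
      hence "s i \<in> carrier G" using s by auto
      thus "\<pi> (s i [^] c i) = \<pi> (s i) [^]\<^bsub>?P\<^esub> c i" by (rule \<pi>.hom_int_pow)
    qed (auto simp: sc)
    finally show "\<exists>c. y = finprod ?P (\<lambda>i. \<pi> (s i) [^]\<^bsub>?P\<^esub> (c i :: int)) {..<N}" by blast
  next
    fix i assume "i < N"
    hence "\<pi> (s i) \<in> carrier ?P" by (intro \<pi>.hom_closed sc)
    thus "\<pi> (s i) [^]\<^bsub>?P\<^esub> q = \<one>\<^bsub>?P\<^esub>" by (rule power_quotient_exponent)
  qed (use q sc in auto)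
qed

end

lemma (in group) inv_mult_eq_one_iff:
  assumes "b \<in> carrier G" "a \<in> carrier G"
  shows "inv a \<otimes> b = \<one> \<longleftrightarrow> b = a"
proof
  assume e: "inv a \<otimes> b = \<one>"
  have "b = a \<otimes> (inv a \<otimes> b)" using assms by (simp add: m_assoc[symmetric])
  thus "b = a" unfolding e using assms by simp
qed (use assms in simp)

lemma vec_hom_laplacian_column:
  assumes M: "comm_group M" and N: "N = card (verts D)" and j: "j < N" and f: "f \<in> {..<N} \<rightarrow> carrier M"
    and S: "S \<subseteq> {..<N} - {j}" "\<And>i. i < N ==> i ~= j ==> arc_count D i j = of_bool (i \<in> S)"
  shows "col (laplacian D) j \<in> carrier (sum_zero_group N)"
    "vec_hom M N f (col (laplacian D) j) = \<one>\<^bsub>M\<^esub> \<longleftrightarrow> finprod M f S = f j [^]\<^bsub>M\<^esub> card S"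
proof -
  interpret M: comm_group M by fact
  have L: "laplacian D \<in> carrier_mat N N" unfolding N by (rule laplacian_carrier)
  have idx: "col (laplacian D) j $ i = laplacian D $$ (i, j)" if "i < N" for i using L j that by simp
  show c: "col (laplacian D) j \<in> carrier (sum_zero_group N)"
    using laplacian_column_sum[of j D] j L by (auto simp: szg_simps N[symmetric] idx)
  have finS: "finite S" using S(1) finite_subset by blast
  have fc: "f i \<in> carrier M" if "i < N" for i using f that by auto
  have fS: "f \<in> S \<rightarrow> carrier M" using S(1) fc by auto
  have off: "laplacian D $$ (i, j) = of_bool (i \<in> S)" if "i < N" "i ~= j" for i
    using that j S(2)[OF that] by (simp add: laplacian_def Let_def N[symmetric])
  have diag: "laplacian D $$ (j, j) = - int (card S)"
  proof -
    have "(\<Sum>k\<in>{0..<N} - {j}. int (arc_count D k j)) = (\<Sum>k\<in>{0..<N} - {j}. if k \<in> S then 1 else 0)"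
      using S(2) by (intro sum.cong) auto
    also have "\<dots> = int (card S)" using S(1) finS by (simp add: sum.If_cases Int_absorb1 lessThan_atLeast0)
    finally show ?thesis using j by (simp add: laplacian_def Let_def N[symmetric])
  qed
  have split: "{..<N} = insert j ({..<N} - {j})" using j by auto
  have "vec_hom M N f (col (laplacian D) j) = finprod M (\<lambda>i. f i [^]\<^bsub>M\<^esub> (laplacian D $$ (i, j))) {..<N}"
    unfolding vec_hom_def using c by (simp, intro M.finprod_cong') (auto simp: idx fc simp del: index_col)
  also have "\<dots> = f j [^]\<^bsub>M\<^esub> (laplacian D $$ (j, j)) \<otimes>\<^bsub>M\<^esub> finprod M (\<lambda>i. f i [^]\<^bsub>M\<^esub> (laplacian D $$ (i, j))) ({..<N} - {j})"
    by (subst split, rule M.finprod_insert) (auto simp: fc j)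
  also have "finprod M (\<lambda>i. f i [^]\<^bsub>M\<^esub> (laplacian D $$ (i, j))) ({..<N} - {j}) = finprod M f S"
  proof (rule M.finprod_mono_neutral_cong_left[symmetric])
    fix i assume "i \<in> S"
    hence "i < N" "i ~= j" "i \<in> S" using S(1) by auto
    thus "f i = f i [^]\<^bsub>M\<^esub> (laplacian D $$ (i, j))" using off fc by simp
  qed (use S(1) in \<open>auto simp: fc off\<close>)
  also have "f j [^]\<^bsub>M\<^esub> (laplacian D $$ (j, j)) = inv\<^bsub>M\<^esub> (f j [^]\<^bsub>M\<^esub> card S)"
    unfolding diag using fc[OF j] by (simp add: M.int_pow_neg int_pow_int)
  finally have e: "vec_hom M N f (col (laplacian D) j) = inv\<^bsub>M\<^esub> (f j [^]\<^bsub>M\<^esub> card S) \<otimes>\<^bsub>M\<^esub> finprod M f S" .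
  have "finprod M f S \<in> carrier M" "f j [^]\<^bsub>M\<^esub> card S \<in> carrier M" using fS fc[OF j] by auto
  thus "vec_hom M N f (col (laplacian D) j) = \<one>\<^bsub>M\<^esub> \<longleftrightarrow> finprod M f S = f j [^]\<^bsub>M\<^esub> card S"
    unfolding e by (intro M.inv_mult_eq_one_iff)
qed

lemma hom_kills_laplacian_image_iff:
  assumes M: "comm_group M" and N: "N = card (verts D)" and \<phi>: "\<phi> \<in> homs (sum_zero_group N) M"
  shows "laplacian_image D \<subseteq> kernel (sum_zero_group N) M \<phi> \<longleftrightarrow> (\<forall>j<N. \<phi> (col (laplacian D) j) = \<one>\<^bsub>M\<^esub>)"
proof -
  interpret M: comm_group M by fact
  interpret Z: comm_group "sum_zero_group N" by (rule comm_group_sum_zero_group)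
  interpret h: group_hom "sum_zero_group N" M \<phi> by (rule homs_group_hom[OF Z.is_group M.is_group \<phi>])
  let ?L = "laplacian D"
  have L: "?L \<in> carrier_mat N N" unfolding N by (rule laplacian_carrier)
  have cc: "col ?L j \<in> carrier (sum_zero_group N)" if "j < N" for j
    using laplacian_column_sum[of j D] that L by (auto simp: szg_simps N[symmetric])
  show ?thesis
  proof
    assume sub: "laplacian_image D \<subseteq> kernel (sum_zero_group N) M \<phi>"
    show "\<forall>j<N. \<phi> (col ?L j) = \<one>\<^bsub>M\<^esub>"
    proof (intro allI impI)
      fix j assume j: "j < N"
      have "col ?L j = ?L *\<^sub>v unit_vec N j" using L j by (intro eq_vecI) auto
      hence "col ?L j \<in> laplacian_image D" unfolding laplacian_image_def N[symmetric] by (rule image_eqI) simp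
      thus "\<phi> (col ?L j) = \<one>\<^bsub>M\<^esub>" using sub by (auto simp: mem_kernel)
    qed
  next
    assume k: "\<forall>j<N. \<phi> (col ?L j) = \<one>\<^bsub>M\<^esub>"
    show "laplacian_image D \<subseteq> kernel (sum_zero_group N) M \<phi>"
    proof
      fix y assume "y \<in> laplacian_image D"
      then obtain c where c: "y = ?L *\<^sub>v c" "c \<in> carrier_vec N" unfolding laplacian_image_def N[symmetric] by (rule imageE)
      let ?g = "\<lambda>j. col ?L j [^]\<^bsub>sum_zero_group N\<^esub> (c $ j)"
      have g: "?g \<in> {..<N} \<rightarrow> carrier (sum_zero_group N)" using cc by auto
      have fc: "finprod (sum_zero_group N) ?g {..<N} \<in> carrier (sum_zero_group N)" using g by (rule Z.finprod_closed)
      have y: "y = finprod (sum_zero_group N) ?g {..<N}"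
      proof (rule eq_vecI)
        show "dim_vec y = dim_vec (finprod (sum_zero_group N) ?g {..<N})" using szg_dim[OF fc] c L by simp
        fix i assume "i < dim_vec (finprod (sum_zero_group N) ?g {..<N})"
        hence i: "i < N" using szg_dim[OF fc] by simp
        have "finprod (sum_zero_group N) ?g {..<N} $ i = (\<Sum>j<N. ?g j $ i)" by (rule szg_finprod_index[OF _ g i]) simp
        also have "\<dots> = (\<Sum>j<N. ?L $$ (i, j) * c $ j)"
          using i L by (intro sum.cong) (auto simp: szg_int_pow[OF cc])
        also have "\<dots> = y $ i" using i L c by (simp add: scalar_prod_def lessThan_atLeast0)
        finally show "y $ i = finprod (sum_zero_group N) ?g {..<N} $ i" ..
      qed
      have "\<phi> y = finprod M (\<lambda>j. \<phi> (?g j)) {..<N}"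
        unfolding y by (rule hom_finprod[OF comm_group_sum_zero_group M \<phi> _ g]) simp
      also have "\<dots> = \<one>\<^bsub>M\<^esub>" using k cc by (intro M.finprod_one_eqI) (simp add: h.hom_int_pow)
      finally show "y \<in> kernel (sum_zero_group N) M \<phi>" using fc y by (simp add: mem_kernel)
    qed
  qed
qed

definition bip_digraph :: "nat => (nat \<times> nat) set => (nat, nat \<times> nat) pre_digraph" where
  "bip_digraph N B = with_proj \<lparr>pverts = {0..<N}, parcs = B\<rparr>"

lemma bip_digraph_simps: "verts (bip_digraph N B) = {0..<N}" "arcs (bip_digraph N B) = B"
  "tail (bip_digraph N B) = fst" "head (bip_digraph N B) = snd"
  by (simp_all add: bip_digraph_def with_proj_def)

text \<open>
  A homomorphism from the sum-zero lattice is determined by the values on differences of basis vectors, that is by a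
  labelling up to translation, normalised at the vertex 0. It kills the image of the Laplacian exactly when it kills each
  column.
\<close>

lemma card_surs_sandpile:
  assumes M: "comm_group M" "\<And>m. m \<in> carrier M ==> m [^]\<^bsub>M\<^esub> q = \<one>\<^bsub>M\<^esub>"
    and N: "N > 0" and B: "B \<subseteq> {..<N} \<times> {..<N}" "\<And>i. (i, i) \<notin> B"
  shows "card (surs (power_quotient (sandpile_group (bip_digraph N B)) q) M) =
     card {f \<in> normalized_maps M N. generates M (f ` {..<N}) \<and> (\<forall>j<N. finprod M f {i. (i, j) \<in> B} = f j [^]\<^bsub>M\<^esub> card {i. (i, j) \<in> B})}"
proof -
  let ?D = "bip_digraph N B" and ?Z = "sum_zero_group N"
  let ?C = "\<lambda>f. \<forall>j<N. finprod M f {i. (i, j) \<in> B} = f j [^]\<^bsub>M\<^esub> card {i. (i, j) \<in> B}"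
  interpret M: comm_group M by fact
  interpret S: comm_group "sandpile_group ?D" by (rule comm_group_sandpile_group)
  have N': "N = card (verts ?D)" by (simp add: bip_digraph_simps)
  interpret nrm: normal "laplacian_image ?D" ?Z using laplacian_image_normal[of ?D] N' by simp
  have Sd: "sandpile_group ?D = ?Z Mod laplacian_image ?D" using N' by (simp add: sandpile_group_def)
  have ac: "arc_count ?D i j = of_bool ((i, j) \<in> B)" for i j
  proof -
    have "{e \<in> B. fst e = i \<and> snd e = j} = (if (i, j) \<in> B then {(i, j)} else {})" by auto
    thus ?thesis by (simp add: arc_count_def bip_digraph_simps)
  qed
  have "card (surs (power_quotient (sandpile_group ?D) q) M) = card (surs (sandpile_group ?D) M)"
    by (rule S.card_surs_power_quotient[OF M])
  also have "\<dots> = card {\<psi> \<in> surs ?Z M. laplacian_image ?D \<subseteq> kernel ?Z M \<psi>}"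
    using bij_betw_same_card[OF bij_betw_surs_factor[OF nrm.is_group nrm.factorgroup_is_group M.is_group nrm.quotient_map_surs(1)]]
    unfolding nrm.quotient_map_surs(2) Sd .
  also have "{\<psi> \<in> surs ?Z M. laplacian_image ?D \<subseteq> kernel ?Z M \<psi>} = vec_hom M N ` {f \<in> normalized_maps M N. generates M (f ` {..<N}) \<and> ?C f}"
  proof -
    have iff: "laplacian_image ?D \<subseteq> kernel ?Z M (vec_hom M N f) \<longleftrightarrow> ?C f" if f: "f \<in> normalized_maps M N" for f
    proof -
      have fc: "f \<in> {..<N} \<rightarrow> carrier M" using f by (auto simp: normalized_maps_def)
      have "vec_hom M N f (col (laplacian ?D) j) = \<one>\<^bsub>M\<^esub> \<longleftrightarrow> finprod M f {i. (i, j) \<in> B} = f j [^]\<^bsub>M\<^esub> card {i. (i, j) \<in> B}" if "j < N" for j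
        using B by (intro vec_hom_laplacian_column(2)[OF M(1) N' that fc]) (auto simp: ac)
      thus ?thesis unfolding hom_kills_laplacian_image_iff[OF M(1) N' M.vec_hom_homs[OF fc]] by simp
    qed
    show ?thesis
    proof (intro equalityI subsetI)
      fix \<psi> assume p: "\<psi> \<in> {\<psi> \<in> surs ?Z M. laplacian_image ?D \<subseteq> kernel ?Z M \<psi>}"
      hence "\<psi> \<in> homs ?Z M" using surs_subset_homs by blast
      hence "\<psi> \<in> vec_hom M N ` normalized_maps M N" using bij_betw_imp_surj_on[OF M.bij_betw_vec_hom[OF N]] by simp
      then obtain f where f: "\<psi> = vec_hom M N f" "f \<in> normalized_maps M N" by (rule imageE)
      thus "\<psi> \<in> vec_hom M N ` {f \<in> normalized_maps M N. generates M (f ` {..<N}) \<and> ?C f}"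
        using p iff[OF f(2)] M.vec_hom_surj_iff[OF f(2)] by blast
    next
      fix \<psi> assume "\<psi> \<in> vec_hom M N ` {f \<in> normalized_maps M N. generates M (f ` {..<N}) \<and> ?C f}"
      then obtain f where f: "\<psi> = vec_hom M N f" "f \<in> {f \<in> normalized_maps M N. generates M (f ` {..<N}) \<and> ?C f}" by (rule imageE)
      hence f2: "f \<in> normalized_maps M N" "generates M (f ` {..<N})" "?C f" by blast+
      show "\<psi> \<in> {\<psi> \<in> surs ?Z M. laplacian_image ?D \<subseteq> kernel ?Z M \<psi>}"
        unfolding f(1) using f2(2,3) iff[OF f2(1)] M.vec_hom_surj_iff[OF f2(1)] by simp
    qed
  qed
  also have "card \<dots> = card {f \<in> normalized_maps M N. generates M (f ` {..<N}) \<and> ?C f}"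
    by (rule card_image) (rule inj_on_subset[OF bij_betw_imp_inj_on[OF M.bij_betw_vec_hom[OF N]]], auto)
  finally show ?thesis .
qed

lemma sandpile_generators:
  assumes N: "N > 0" and D: "card (verts D) = N"
  defines "s \<equiv> \<lambda>i. laplacian_image D #>\<^bsub>sum_zero_group N\<^esub> basis_diff N i"
  shows "s \<in> {..<N} \<rightarrow> carrier (sandpile_group D)"
    "x \<in> carrier (sandpile_group D) ==> \<exists>c. x = finprod (sandpile_group D) (\<lambda>i. s i [^]\<^bsub>sandpile_group D\<^esub> (c i :: int)) {..<N}"
proof -
  let ?Z = "sum_zero_group N" and ?S = "sandpile_group D"
  interpret S: comm_group ?S by (rule comm_group_sandpile_group)
  interpret nrm: normal "laplacian_image D" ?Z using laplacian_image_normal[of D] D by simp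
  have Sd: "?S = ?Z Mod laplacian_image D" using D by (simp add: sandpile_group_def)
  let ?q = "\<lambda>x\<in>carrier ?Z. laplacian_image D #>\<^bsub>?Z\<^esub> x"
  have qs: "?q \<in> surs ?Z ?S" unfolding Sd by (rule nrm.quotient_map_surs(1))
  have qh: "?q \<in> homs ?Z ?S" using qs surs_subset_homs by blast
  interpret q: group_hom ?Z ?S ?q by (rule homs_group_hom[OF nrm.is_group S.is_group qh])
  have sq: "s i = ?q (basis_diff N i)" if "i < N" for i using basis_diff_carrier[OF that] by (simp add: s_def)
  show sc: "s \<in> {..<N} \<rightarrow> carrier ?S"
    using homsD(1)[OF qh basis_diff_carrier] sq by auto
  assume "x \<in> carrier ?S"
  hence "x \<in> ?q ` carrier ?Z" by (simp only: surs_image[OF qs])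
  then obtain z where z: "x = ?q z" "z \<in> carrier ?Z" by (rule imageE)
  have "x = ?q (finprod ?Z (\<lambda>i. basis_diff N i [^]\<^bsub>?Z\<^esub> (z $ i)) {..<N})"
    using z(1) by (simp only: szg_generators[OF z(2) N, symmetric])
  also have "\<dots> = finprod ?S (\<lambda>i. ?q (basis_diff N i [^]\<^bsub>?Z\<^esub> (z $ i))) {..<N}"
    by (rule hom_finprod[OF comm_group_sum_zero_group S.comm_group_axioms qh]) (auto simp: basis_diff_carrier intro!: group.int_pow_closed[OF nrm.is_group])
  also have "\<dots> = finprod ?S (\<lambda>i. s i [^]\<^bsub>?S\<^esub> (z $ i)) {..<N}"
  proof (rule S.finprod_cong')
    fix i assume "i \<in> {..<N}"
    hence i: "i < N" by simp
    show "?q (basis_diff N i [^]\<^bsub>?Z\<^esub> (z $ i)) = s i [^]\<^bsub>?S\<^esub> (z $ i)"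
      unfolding sq[OF i] by (rule q.hom_int_pow[OF basis_diff_carrier[OF i]])
  qed (use sc in auto)
  finally show "\<exists>c. x = finprod ?S (\<lambda>i. s i [^]\<^bsub>?S\<^esub> (c i :: int)) {..<N}" by blast
qed

section \<open>Detecting an isomorphism by counting surjections\<close>

lemma (in group) pow_subgroup_eq: "x [^]\<^bsub>G\<lparr>carrier := K\<rparr>\<^esub> (n :: nat) = x [^] n"
  by (simp add: nat_pow_def)

lemma (in comm_group) torsion_trivial_iff:
  fixes p :: nat
  assumes fin: "finite (carrier G)" and p: "Factorial_Ring.prime p" and exp: "\<And>x. x \<in> carrier G ==> x [^] (p ^ e) = \<one>"
  shows "card {x \<in> carrier G. x [^] p = \<one>} = 1 \<longleftrightarrow> carrier G = {\<one>}"
proof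
  let ?T = "{x \<in> carrier G. x [^] p = \<one>}"
  assume "card ?T = 1"
  then obtain t where t: "?T = {t}" by (rule card_1_singletonE)
  have one: "\<one> \<in> ?T" by simp
  have T: "x = \<one>" if "x \<in> carrier G" "x [^] p = \<one>" for x
  proof -
    have "x \<in> ?T" using that by simp
    thus ?thesis using one unfolding t by simp
  qed
  have "x = \<one>" if "x \<in> carrier G" "x [^] (p ^ j) = \<one>" for x j
    using that
  proof (induction j arbitrary: x)
    case (Suc j)
    have "(x [^] (p ^ j)) [^] p = \<one>" using Suc.prems by (simp add: nat_pow_pow mult.commute)
    hence "x [^] (p ^ j) = \<one>" using T Suc.prems(1) by simp
    thus ?case using Suc by blast
  qed simp
  thus "carrier G = {\<one>}" using exp one_closed by blast
next
  assume "carrier G = {\<one>}"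
  hence "{x \<in> carrier G. x [^] p = \<one>} = {\<one>}" by auto
  thus "card {x \<in> carrier G. x [^] p = \<one>} = 1" by simp
qed

lemma card_ext_pairs_Elem:
  assumes Y: "comm_group Y" "finite (carrier Y)" and G: "comm_group G" "finite (carrier G)" and p: "Factorial_Ring.prime p"
  shows "real (card (ext_pairs G (Elem p i) Y)) =
    (\<Sum>\<pi>\<in>surs Y G. \<Prod>j<i. real (card {x \<in> kernel Y G \<pi>. x [^]\<^bsub>Y\<^esub> p = \<one>\<^bsub>Y\<^esub>}) - real p ^ j)"
proof -
  have gY: "group Y" and gG: "group G" using Y(1) G(1) by (auto intro: comm_group.axioms(2))
  have p0: "p > 0" using prime_gt_0_nat[OF p] .
  have "card (ext_pairs G (Elem p i) Y) = (\<Sum>\<pi>\<in>surs Y G. card (surs (Y\<lparr>carrier := kernel Y G \<pi>\<rparr>) (Elem p i)))"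
    unfolding ext_pairs_def
    by (intro card_SigmaI finite_surs Y(2) G(2) ballI finite_Elem[OF p0]) (simp add: kernel_def Y(2))
  also have "real \<dots> = (\<Sum>\<pi>\<in>surs Y G. \<Prod>j<i. real (card {x \<in> kernel Y G \<pi>. x [^]\<^bsub>Y\<^esub> p = \<one>\<^bsub>Y\<^esub>}) - real p ^ j)"
    unfolding of_nat_sum
  proof (rule sum.cong[OF refl])
    fix \<pi> assume "\<pi> \<in> surs Y G"
    hence h: "\<pi> \<in> homs Y G" using surs_subset_homs by blast
    interpret K: comm_group "Y\<lparr>carrier := kernel Y G \<pi>\<rparr>" by (rule comm_group_kernel[OF Y(1) gG h])
    have "finite (carrier (Y\<lparr>carrier := kernel Y G \<pi>\<rparr>))" using Y(2) by (simp add: kernel_def)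
    from K.card_surs_Elem[OF this p, of i]
    show "real (card (surs (Y\<lparr>carrier := kernel Y G \<pi>\<rparr>) (Elem p i))) =
      (\<Prod>j<i. real (card {x \<in> kernel Y G \<pi>. x [^]\<^bsub>Y\<^esub> p = \<one>\<^bsub>Y\<^esub>}) - real p ^ j)"
      by (simp add: group.pow_subgroup_eq[OF gY])
  qed
  finally show ?thesis .
qed

text \<open>
  For each surjection \<open>\<pi>\<close>, apply the inequalities for powers of \<open>p\<close> to the \<open>p\<close>-torsion of its kernel, which is trivial
  exactly when the kernel is.
\<close>

lemma surjection_bonferroni:
  assumes Y: "comm_group Y" "finite (carrier Y)" and G: "comm_group G" "finite (carrier G)" and p: "Factorial_Ring.prime p"
    and exp: "\<And>y. y \<in> carrier Y ==> y [^]\<^bsub>Y\<^esub> (p ^ e) = \<one>\<^bsub>Y\<^esub>"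
  defines "B \<equiv> \<lambda>k. \<Sum>i\<le>k. sgn_coeff (real p) i * real (card (ext_pairs G (Elem p i) Y))"
  shows "even k ==> real (card {\<pi> \<in> surs Y G. kernel Y G \<pi> = {\<one>\<^bsub>Y\<^esub>}}) <= B k"
    "odd k ==> B k <= real (card {\<pi> \<in> surs Y G. kernel Y G \<pi> = {\<one>\<^bsub>Y\<^esub>}})"
proof -
  have gY: "group Y" and gG: "group G" using Y(1) G(1) by (auto intro: comm_group.axioms(2))
  have P: "real p > 1" using prime_gt_1_nat[OF p] by simp
  let ?t = "\<lambda>\<pi>. real (card {x \<in> kernel Y G \<pi>. x [^]\<^bsub>Y\<^esub> p = \<one>\<^bsub>Y\<^esub>})"
  let ?s = "\<lambda>\<pi>. \<Sum>i\<le>k. sgn_coeff (real p) i * (\<Prod>j<i. ?t \<pi> - real p ^ j)"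
  have Bk: "B k = (\<Sum>\<pi>\<in>surs Y G. ?s \<pi>)"
    unfolding B_def card_ext_pairs_Elem[OF Y G p] sum_distrib_left by (rule sum.swap)
  have N: "real (card {\<pi> \<in> surs Y G. kernel Y G \<pi> = {\<one>\<^bsub>Y\<^esub>}}) = (\<Sum>\<pi>\<in>surs Y G. of_bool (kernel Y G \<pi> = {\<one>\<^bsub>Y\<^esub>}))"
    using finite_surs[OF Y(2) G(2)] by (simp add: sum.If_cases of_bool_def Int_def)
  have pw: "\<exists>r. ?t \<pi> = real p ^ r \<and> (r = 0 \<longleftrightarrow> kernel Y G \<pi> = {\<one>\<^bsub>Y\<^esub>})" if "\<pi> \<in> surs Y G" for \<pi>
  proof -
    have h: "\<pi> \<in> homs Y G" using that surs_subset_homs by blast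
    let ?K = "Y\<lparr>carrier := kernel Y G \<pi>\<rparr>"
    interpret K: comm_group ?K by (rule comm_group_kernel[OF Y(1) gG h])
    have finK: "finite (carrier ?K)" using Y(2) by (simp add: kernel_def)
    have expK: "y [^]\<^bsub>?K\<^esub> (p ^ e) = \<one>\<^bsub>?K\<^esub>" if "y \<in> carrier ?K" for y
      using exp that by (simp add: group.pow_subgroup_eq[OF gY] mem_kernel)
    obtain r where r: "card {x \<in> carrier ?K. x [^]\<^bsub>?K\<^esub> p = \<one>\<^bsub>?K\<^esub>} = p ^ r" using K.card_homs_torsion[OF finK p] by blast
    have "r = 0 \<longleftrightarrow> p ^ r = 1" using prime_gt_1_nat[OF p] by simp
    also have "\<dots> \<longleftrightarrow> carrier ?K = {\<one>\<^bsub>?K\<^esub>}" using K.torsion_trivial_iff[OF finK p expK] r by simp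
    finally have "r = 0 \<longleftrightarrow> kernel Y G \<pi> = {\<one>\<^bsub>Y\<^esub>}" by simp
    moreover have "?t \<pi> = real p ^ r" using r by (simp add: group.pow_subgroup_eq[OF gY])
    ultimately show ?thesis by blast
  qed
  show "even k ==> real (card {\<pi> \<in> surs Y G. kernel Y G \<pi> = {\<one>\<^bsub>Y\<^esub>}}) <= B k"
    unfolding Bk N
  proof (intro sum_mono)
    fix \<pi> assume k: "even k" and "\<pi> \<in> surs Y G"
    then obtain r where r: "?t \<pi> = real p ^ r" "r = 0 \<longleftrightarrow> kernel Y G \<pi> = {\<one>\<^bsub>Y\<^esub>}" using pw by blast
    show "of_bool (kernel Y G \<pi> = {\<one>\<^bsub>Y\<^esub>}) <= ?s \<pi>" unfolding r(1) r(2)[symmetric] by (rule bonferroni_power(1)[OF P k])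
  qed
  show "odd k ==> B k <= real (card {\<pi> \<in> surs Y G. kernel Y G \<pi> = {\<one>\<^bsub>Y\<^esub>}})"
    unfolding Bk N
  proof (intro sum_mono)
    fix \<pi> assume k: "odd k" and "\<pi> \<in> surs Y G"
    then obtain r where r: "?t \<pi> = real p ^ r" "r = 0 \<longleftrightarrow> kernel Y G \<pi> = {\<one>\<^bsub>Y\<^esub>}" using pw by blast
    show "?s \<pi> <= of_bool (kernel Y G \<pi> = {\<one>\<^bsub>Y\<^esub>})" unfolding r(1) r(2)[symmetric] by (rule bonferroni_power(2)[OF P k])
  qed
qed

lemma surs_self_eq_auto:
  assumes "group G" "finite (carrier G)"
  shows "surs G G = auto G"
proof (intro equalityI subsetI)
  fix f assume f: "f \<in> surs G G"
  hence "bij_betw f (carrier G) (carrier G)"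
    using eq_card_imp_inj_on[OF assms(2), of f] by (auto simp: surs_def bij_betw_def)
  thus "f \<in> auto G" using f by (auto simp: auto_def Bij_def surs_def homs_def)
next
  fix f assume "f \<in> auto G"
  thus "f \<in> surs G G" by (auto simp: auto_def Bij_def surs_def homs_def bij_betw_def)
qed

lemma card_injective_surs:
  assumes Y: "group Y" "finite (carrier Y)" and G: "group G" "finite (carrier G)"
  shows "card {\<pi> \<in> surs Y G. kernel Y G \<pi> = {\<one>\<^bsub>Y\<^esub>}} = of_bool (Y \<cong> G) * Coset.order (AutoGroup G)"
proof -
  have inj: "inj_on \<pi> (carrier Y) \<longleftrightarrow> kernel Y G \<pi> = {\<one>\<^bsub>Y\<^esub>}" if "\<pi> \<in> surs Y G" for \<pi>
  proof -
    have "\<pi> \<in> homs Y G" using that surs_subset_homs by blast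
    then interpret group_hom Y G \<pi> by (rule homs_group_hom[OF Y(1) G(1)])
    show ?thesis using inj_iff_trivial_ker by blast
  qed
  show ?thesis
  proof (cases "Y \<cong> G")
    case True
    then obtain \<phi> where \<phi>: "\<phi> \<in> hom Y G" "bij_betw \<phi> (carrier Y) (carrier G)" by (auto simp: is_iso_def iso_def)
    let ?\<phi> = "restrict \<phi> (carrier Y)"
    have s: "?\<phi> \<in> surs Y G"
    proof -
      have "?\<phi> \<in> homs Y G" using \<phi>(1) group.is_monoid[OF Y(1)] by (intro homsI) (auto simp: hom_def monoid.m_closed)
      moreover have "?\<phi> ` carrier Y = carrier G" using bij_betw_imp_surj_on[OF \<phi>(2)] by simp
      ultimately show ?thesis by (simp add: surs_def)
    qed
    have card: "card (carrier Y) = card (carrier G)" using bij_betw_same_card[OF \<phi>(2)] .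
    have triv: "kernel Y G \<pi> = {\<one>\<^bsub>Y\<^esub>}" if "\<pi> \<in> surs Y G" for \<pi>
      using inj[OF that] eq_card_imp_inj_on[OF Y(2), of \<pi>] surs_image[OF that] card by simp
    have "{\<psi> \<in> surs Y G. kernel Y G ?\<phi> \<subseteq> kernel Y G \<psi>} = {\<pi> \<in> surs Y G. kernel Y G \<pi> = {\<one>\<^bsub>Y\<^esub>}}"
      using triv s by auto
    hence "card {\<pi> \<in> surs Y G. kernel Y G \<pi> = {\<one>\<^bsub>Y\<^esub>}} = card (surs G G)"
      using bij_betw_same_card[OF bij_betw_surs_factor[OF Y(1) G(1) G(1) s]] by simp
    also have "\<dots> = Coset.order (AutoGroup G)"
      unfolding surs_self_eq_auto[OF G] by (simp add: order_def AutoGroup_def)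
    finally show ?thesis using True by simp
  next
    case False
    have "{\<pi> \<in> surs Y G. kernel Y G \<pi> = {\<one>\<^bsub>Y\<^esub>}} = {}"
    proof (rule ccontr)
      assume "{\<pi> \<in> surs Y G. kernel Y G \<pi> = {\<one>\<^bsub>Y\<^esub>}} ~= {}"
      then obtain \<pi> where \<pi>: "\<pi> \<in> surs Y G" "kernel Y G \<pi> = {\<one>\<^bsub>Y\<^esub>}" by blast
      hence "\<pi> \<in> iso Y G" using inj[OF \<pi>(1)] by (auto simp: iso_def bij_betw_def surs_def homs_def)
      thus False using False by (auto simp: is_iso_def)
    qed
    hence "card {\<pi> \<in> surs Y G. kernel Y G \<pi> = {\<one>\<^bsub>Y\<^esub>}} = 0" by (simp only: card.empty)
    thus ?thesis using False by simp
  qed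
qed

section \<open>The weights of the labelled groups\<close>

lemma card_normalized_maps_avoiding:
  assumes "finite A"
  shows "card {f \<in> {..<Suc m} \<rightarrow>\<^sub>E insert c A. f 0 = c \<and> (\<forall>i\<in>{1..<Suc m}. f i \<in> A)} = card A ^ m"
proof -
  have "{f \<in> {..<Suc m} \<rightarrow>\<^sub>E insert c A. f 0 = c \<and> (\<forall>i\<in>{1..<Suc m}. f i \<in> A)} = (\<Pi>\<^sub>E i\<in>{..<Suc m}. if i = 0 then {c} else A)"
    (is "?L = ?R")
  proof (intro equalityI subsetI)
    fix f assume f: "f \<in> ?L"
    show "f \<in> ?R" by (rule PiE_I) (use f in \<open>auto simp: PiE_def extensional_def\<close>)
  next
    fix f assume f: "f \<in> ?R"
    have v: "f i \<in> (if i = 0 then {c} else A)" if "i < Suc m" for i using PiE_mem[OF f, of i] that by simp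
    have "f \<in> {..<Suc m} \<rightarrow>\<^sub>E insert c A"
    proof (rule PiE_I)
      fix i assume "i \<in> {..<Suc m}" thus "f i \<in> insert c A" using v[of i] by (cases "i = 0") auto
    next
      fix i assume "i \<notin> {..<Suc m}" thus "f i = undefined" using PiE_arb[OF f] by simp
    qed
    moreover have "f 0 = c" using v[of 0] by simp
    moreover have "f i \<in> A" if "i \<in> {1..<Suc m}" for i using v[of i] that by simp
    ultimately show "f \<in> ?L" by blast
  qed
  also have "card \<dots> = (\<Prod>i<Suc m. card (if i = 0 then {c} else A))" by (rule card_PiE) simp
  also have "\<dots> = card A ^ m" by (subst prod.lessThan_Suc_shift) simp
  finally show ?thesis .
qed

lemma card_normalized_maps:
  assumes "group M" "finite (carrier M)"
  shows "card (normalized_maps M (Suc m)) = card (carrier M) ^ m"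
proof -
  have "normalized_maps M (Suc m) = {f \<in> {..<Suc m} \<rightarrow>\<^sub>E insert \<one>\<^bsub>M\<^esub> (carrier M). f 0 = \<one>\<^bsub>M\<^esub> \<and> (\<forall>i\<in>{1..<Suc m}. f i \<in> carrier M)}"
  proof -
    have i: "insert \<one>\<^bsub>M\<^esub> (carrier M) = carrier M" using monoid.one_closed[OF group.is_monoid[OF assms(1)]] by blast
    show ?thesis unfolding i normalized_maps_def by (rule Collect_cong) (fastforce dest: PiE_mem)
  qed
  thus ?thesis using card_normalized_maps_avoiding[OF assms(2)] by simp
qed

lemma finite_normalized_maps: "finite (carrier M) ==> finite (normalized_maps M N)"
  unfolding normalized_maps_def by (rule finite_subset[of _ "{..<N} \<rightarrow>\<^sub>E carrier M"]) (auto intro: finite_PiE)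

text \<open>
  Almost every map is surjective, since a given value is avoided with exponentially small probability.
\<close>

lemma generating_maps_limit:
  assumes M: "group M" "finite (carrier M)"
  shows "(\<lambda>m. real (card {f \<in> normalized_maps M (Suc m). generates M (f ` {..<Suc m})}) / real (card (carrier M)) ^ m) \<longlonglongrightarrow> 1"
proof -
  interpret M: group M by fact
  define h where "h = card (carrier M)"
  have h: "h > 0" unfolding h_def by (subst card_gt_0_iff) (use M(2) M.one_closed in force)
  let ?gen = "\<lambda>m. {f \<in> normalized_maps M (Suc m). generates M (f ` {..<Suc m})}"
  let ?miss = "\<lambda>m a. {f \<in> {..<Suc m} \<rightarrow>\<^sub>E insert \<one>\<^bsub>M\<^esub> (carrier M - {a}). f 0 = \<one>\<^bsub>M\<^esub> \<and> (\<forall>i\<in>{1..<Suc m}. f i \<in> carrier M - {a})}"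
  have lower: "real h ^ m - real h * real (h - 1) ^ m <= real (card (?gen m))" for m
  proof -
    have "normalized_maps M (Suc m) \<subseteq> ?gen m \<union> (\<Union>a\<in>carrier M. ?miss m a)"
    proof
      fix f assume f: "f \<in> normalized_maps M (Suc m)"
      show "f \<in> ?gen m \<union> (\<Union>a\<in>carrier M. ?miss m a)"
      proof (cases "carrier M \<subseteq> f ` {..<Suc m}")
        case True
        hence "generates M (f ` {..<Suc m})" unfolding generates_def by (metis subgroup.subset order.trans subset_antisym)
        thus ?thesis using f by simp
      next
        case False
        then obtain a where a: "a \<in> carrier M" "a \<notin> f ` {..<Suc m}" by blast
        have "f i ~= a" if "i < Suc m" for i using a(2) that by blast
        moreover have "f i \<in> carrier M" if "i < Suc m" for i using f that by (auto simp: normalized_maps_def PiE_iff)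
        moreover have "f 0 = \<one>\<^bsub>M\<^esub>" "f \<in> extensional {..<Suc m}" using f by (auto simp: normalized_maps_def PiE_def)
        ultimately have "f \<in> ?miss m a" by (auto simp: PiE_iff)
        thus ?thesis by (intro UnI2 UN_I[OF a(1)])
      qed
    qed
    hence "card (normalized_maps M (Suc m)) <= card (?gen m \<union> (\<Union>a\<in>carrier M. ?miss m a))"
    proof (intro card_mono finite_UnI finite_UN_I M(2))
      show "finite (?gen m)" by (rule finite_subset[OF _ finite_normalized_maps[OF M(2)]]) blast
      fix a show "finite (?miss m a)"
        by (rule finite_subset[of _ "{..<Suc m} \<rightarrow>\<^sub>E insert \<one>\<^bsub>M\<^esub> (carrier M - {a})"]) (use M(2) in \<open>auto intro: finite_PiE\<close>)
    qed
    also have "\<dots> <= card (?gen m) + card (\<Union>a\<in>carrier M. ?miss m a)" by (rule card_Un_le)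
    also have "card (\<Union>a\<in>carrier M. ?miss m a) <= (\<Sum>a\<in>carrier M. card (?miss m a))" by (rule card_UN_le[OF M(2)])
    also have "\<dots> = (\<Sum>a\<in>carrier M. (h - 1) ^ m)"
    proof (rule sum.cong[OF refl])
      fix a assume a: "a \<in> carrier M"
      have "card (?miss m a) = card (carrier M - {a}) ^ m" by (rule card_normalized_maps_avoiding) (simp add: M(2))
      also have "card (carrier M - {a}) = h - 1" using a M(2) by (simp add: h_def)
      finally show "card (?miss m a) = (h - 1) ^ m" .
    qed
    also have "\<dots> = h * (h - 1) ^ m" by (simp add: h_def)
    finally have "h ^ m <= card (?gen m) + h * (h - 1) ^ m" unfolding card_normalized_maps[OF M] h_def by simp
    hence "real (h ^ m) <= real (card (?gen m) + h * (h - 1) ^ m)" by (simp only: of_nat_le_iff)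
    thus ?thesis by simp
  qed
  have upper: "real (card (?gen m)) <= real h ^ m" for m
  proof -
    have "card (?gen m) <= card (normalized_maps M (Suc m))" by (intro card_mono finite_normalized_maps M(2)) auto
    thus ?thesis unfolding card_normalized_maps[OF M] h_def by (metis of_nat_le_iff of_nat_power)
  qed
  show ?thesis unfolding h_def[symmetric]
  proof (rule tendsto_sandwich)
    show "\<forall>\<^sub>F m in sequentially. 1 - real h * (real (h - 1) / real h) ^ m <= real (card (?gen m)) / real h ^ m"
    proof (rule always_eventually, rule allI)
      fix m show "1 - real h * (real (h - 1) / real h) ^ m <= real (card (?gen m)) / real h ^ m"
      proof -
        have "(real h ^ m - real h * real (h - 1) ^ m) / real h ^ m = 1 - real h * (real (h - 1) / real h) ^ m"
          using h by (simp add: diff_divide_distrib power_divide del: of_nat_diff)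
        thus ?thesis using divide_right_mono[OF lower[of m], of "real h ^ m"] by simp
      qed
    qed
    show "\<forall>\<^sub>F m in sequentially. real (card (?gen m)) / real h ^ m <= 1"
    proof (rule always_eventually, rule allI)
      fix m show "real (card (?gen m)) / real h ^ m <= 1" using divide_right_mono[OF upper[of m], of "real h ^ m"] h by simp
    qed
    have "\<bar>real (h - 1) / real h\<bar> < 1" using h by simp
    hence "(\<lambda>m. (real (h - 1) / real h) ^ m) \<longlonglongrightarrow> 0" by (intro LIMSEQ_power_zero) simp
    from tendsto_diff[OF tendsto_const[of 1] tendsto_mult[OF tendsto_const[of "real h"] this]]
    show "(\<lambda>m. 1 - real h * (real (h - 1) / real h) ^ m) \<longlonglongrightarrow> 1" by simp
  qed simp
qed

lemma (in comm_group) card_homs_power_quotient: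
  assumes M: "comm_group M" "\<And>m. m \<in> carrier M ==> m [^]\<^bsub>M\<^esub> q = \<one>\<^bsub>M\<^esub>"
  shows "card (homs (power_quotient G q) M) = card (homs G M)"
proof -
  let ?\<pi> = "(\<lambda>x\<in>carrier G. (\<lambda>x. x [^] q) ` carrier G #> x)"
  have gM: "group M" using M(1) by (rule comm_group.axioms(2))
  have gq: "group (power_quotient G q)" using comm_group_power_quotient by (rule comm_group.axioms(2))
  have "{\<psi> \<in> homs G M. kernel G (power_quotient G q) ?\<pi> \<subseteq> kernel G M \<psi>} = homs G M"
  proof (intro equalityI subsetI CollectI conjI)
    fix \<psi> y assume h: "\<psi> \<in> homs G M" and y: "y \<in> kernel G (power_quotient G q) ?\<pi>"
    interpret h: group_hom G M \<psi> by (rule homs_group_hom[OF is_group gM h])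
    from y[unfolded power_quotient_map(2)] obtain x where "y = x [^] q" "x \<in> carrier G" by (rule imageE)
    thus "y \<in> kernel G M \<psi>" using M(2)[of "\<psi> x"] by (simp add: mem_kernel h.hom_nat_pow)
  qed blast+
  thus ?thesis using bij_betw_same_card[OF bij_betw_homs_factor[OF is_group gq gM power_quotient_map(1)[of q]]] by simp
qed

text \<open>
  A power \<open>p ^ k\<close> moves any element into the kernel of the first map, which the second map embeds into an elementary
  abelian group.
\<close>

lemma labelled_group_exponent:
  fixes p k i :: nat
  assumes G: "comm_group G" "finite (carrier G)" "Coset.order G = p ^ k" and p: "Factorial_Ring.prime p"
    and M: "M \<in> labelled_groups (card (carrier G) * card (carrier (Elem p i)))" "ext_pairs G (Elem p i) M ~= {}" and x: "x \<in> carrier M"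
  shows "x [^]\<^bsub>M\<^esub> (p ^ Suc k) = \<one>\<^bsub>M\<^esub>"
proof -
  interpret G: comm_group G by fact
  have p0: "p > 0" using prime_gt_0_nat[OF p] .
  let ?E = "Elem p i"
  define h where "h = card (carrier G) * card (carrier ?E)"
  interpret E: comm_group ?E by (rule comm_group_Elem)
  have Gk: "g [^]\<^bsub>G\<^esub> (p ^ k) = \<one>\<^bsub>G\<^esub>" if "g \<in> carrier G" for g using G.pow_order_eq_1[OF that] G(3) by simp
  note L = labelled_groups_D[OF M(1)[folded h_def]]
  interpret M: comm_group M by (rule L(1))
  have finM: "finite (carrier M)" unfolding L(2) by simp
  obtain \<pi> \<Psi> where P: "\<pi> \<in> surs M G" "\<Psi> \<in> surs (M\<lparr>carrier := kernel M G \<pi>\<rparr>) ?E" using M(2) by (auto simp: ext_pairs_def)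
  have h: "\<pi> \<in> homs M G" "\<Psi> \<in> homs (M\<lparr>carrier := kernel M G \<pi>\<rparr>) ?E" using P surs_subset_homs by blast+
  interpret \<pi>: group_hom M G \<pi> by (rule homs_group_hom[OF M.is_group G.is_group h(1)])
  note K = group_kernel[OF M.is_group G.is_group h(1)]
  interpret \<Psi>: group_hom "M\<lparr>carrier := kernel M G \<pi>\<rparr>" ?E \<Psi> by (rule homs_group_hom[OF K(2) E.is_group h(2)])
  have finK: "finite (kernel M G \<pi>)" using finM by (simp add: kernel_def)
  have cK: "card (kernel M G \<pi>) = card (carrier ?E)"
  proof -
    have "card (carrier G) * card (kernel M G \<pi>) = card (carrier G) * card (carrier ?E)"
      using card_surs_kernel[OF M.is_group G.is_group P(1) finM] unfolding L(2) h_def by simp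
    moreover have "card (carrier G) > 0" using G(3) p0 by (simp add: order_def)
    ultimately show ?thesis by simp
  qed
  have inj: "inj_on \<Psi> (kernel M G \<pi>)"
    by (rule eq_card_imp_inj_on[OF finK]) (use surs_image[OF P(2)] cK in simp)
  let ?x = "x [^]\<^bsub>M\<^esub> (p ^ k)"
  have "\<pi> ?x = \<one>\<^bsub>G\<^esub>" using \<pi>.hom_nat_pow[OF x] Gk[OF \<pi>.hom_closed[OF x]] by simp
  hence xK: "?x \<in> kernel M G \<pi>" using x by (simp add: mem_kernel)
  have "\<Psi> (?x [^]\<^bsub>M\<^esub> p) = \<Psi> ?x [^]\<^bsub>?E\<^esub> p"
    using \<Psi>.hom_nat_pow[of ?x p] xK unfolding M.pow_subgroup_eq by simp
  also have "\<dots> = \<one>\<^bsub>?E\<^esub>" by (rule Elem_exponent, rule homsD(1)[OF h(2)]) (simp add: xK)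
  also have "\<dots> = \<Psi> \<one>\<^bsub>M\<^esub>" using \<Psi>.hom_one by simp
  finally have "?x [^]\<^bsub>M\<^esub> p = \<one>\<^bsub>M\<^esub>"
    by (rule inj_onD[OF inj]) (use M.pow_in_subgroup[OF K(1) xK] subgroup.one_closed[OF K(1)] in auto)
  thus ?thesis using x by (simp add: M.nat_pow_pow mult.commute)
qed

text \<open>
  Apply the labelled counting identity to the quotients of the sum-zero lattices of growing rank \<open>m\<close>. Almost all labellings are
  surjections, so the left side tends to the sum, and the right side is explicit because the torsion of every kernel has
  order \<open>p ^ m\<close>.
\<close>

lemma sum_card_ext_pairs:
  fixes p k i :: nat
  assumes G: "comm_group G" "finite (carrier G)" "Coset.order G = p ^ k" and p: "Factorial_Ring.prime p"
  defines "h \<equiv> card (carrier G) * card (carrier (Elem p i))"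
  shows "(\<Sum>M\<in>labelled_groups h. card (ext_pairs G (Elem p i) M)) = fact h"
proof -
  interpret G: comm_group G by fact
  have p0: "p > 0" "p > 1" using prime_gt_0_nat[OF p] prime_gt_1_nat[OF p] by auto
  let ?E = "Elem p i" and ?q = "p ^ Suc k"
  interpret E: comm_group ?E by (rule comm_group_Elem)
  let ?Z = "\<lambda>m. sum_zero_group (Suc m)"
  let ?Y = "\<lambda>m. power_quotient (?Z m) ?q"
  have hE: "h = p ^ k * p ^ i" using G(3) card_Elem[OF p0(1)] by (simp add: h_def order_def)
  have cgY: "comm_group (?Y m)" for m by (rule comm_group.comm_group_power_quotient[OF comm_group_sum_zero_group])
  have gZ: "group (?Z m)" for m using comm_group_sum_zero_group by (rule comm_group.axioms(2))
  have finY: "finite (carrier (?Y m))" for m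
  proof (rule comm_group.finite_power_quotient[OF comm_group_sum_zero_group, where s = "basis_diff (Suc m)" and N = "Suc m"])
    show "\<exists>c. x = finprod (?Z m) (\<lambda>i. basis_diff (Suc m) i [^]\<^bsub>?Z m\<^esub> (c i :: int)) {..<Suc m}" if "x \<in> carrier (?Z m)" for x
      using szg_generators[OF that] by blast
  qed (use p0 basis_diff_carrier in auto)
  have Gk: "g [^]\<^bsub>G\<^esub> (p ^ k) = \<one>\<^bsub>G\<^esub>" if "g \<in> carrier G" for g using G.pow_order_eq_1[OF that] G(3) by simp
  have Gq: "g [^]\<^bsub>G\<^esub> ?q = \<one>\<^bsub>G\<^esub>" if "g \<in> carrier G" for g
    using Gk[OF that] that by (simp add: mult.commute[of p] flip: G.nat_pow_pow)
  have surs_count: "card (surs (?Y m) M) = card {f \<in> normalized_maps M (Suc m). generates M (f ` {..<Suc m})}"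
    if M: "comm_group M" "\<And>x. x \<in> carrier M ==> x [^]\<^bsub>M\<^esub> ?q = \<one>\<^bsub>M\<^esub>" for M :: "('x, 'y) monoid_scheme" and m
  proof -
    have "card (surs (?Y m) M) = card (surs (?Z m) M)" by (rule comm_group.card_surs_power_quotient[OF comm_group_sum_zero_group M])
    also have "surs (?Z m) M = vec_hom M (Suc m) ` {f \<in> normalized_maps M (Suc m). generates M (f ` {..<Suc m})}"
    proof -
      have im: "vec_hom M (Suc m) ` normalized_maps M (Suc m) = homs (?Z m) M"
        by (rule bij_betw_imp_surj_on[OF comm_group.bij_betw_vec_hom[OF M(1)]]) simp
      show ?thesis
      proof (intro equalityI subsetI)
        fix \<psi> assume s: "\<psi> \<in> surs (?Z m) M"
        hence "\<psi> \<in> vec_hom M (Suc m) ` normalized_maps M (Suc m)" unfolding im using surs_subset_homs by blast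
        then obtain f where "\<psi> = vec_hom M (Suc m) f" "f \<in> normalized_maps M (Suc m)" by (rule imageE)
        thus "\<psi> \<in> vec_hom M (Suc m) ` {f \<in> normalized_maps M (Suc m). generates M (f ` {..<Suc m})}"
          using s comm_group.vec_hom_surj_iff[OF M(1)] by blast
      next
        fix \<psi> assume "\<psi> \<in> vec_hom M (Suc m) ` {f \<in> normalized_maps M (Suc m). generates M (f ` {..<Suc m})}"
        thus "\<psi> \<in> surs (?Z m) M" using comm_group.vec_hom_surj_iff[OF M(1)] by blast
      qed
    qed
    also have "card \<dots> = card {f \<in> normalized_maps M (Suc m). generates M (f ` {..<Suc m})}"
      by (rule card_image) (rule inj_on_subset[OF bij_betw_imp_inj_on[OF comm_group.bij_betw_vec_hom[OF M(1)]]], auto)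
    finally show ?thesis .
  qed
  have torsion: "card {x \<in> kernel (?Y m) G \<pi>. x [^]\<^bsub>?Y m\<^esub> p = \<one>\<^bsub>?Y m\<^esub>} = p ^ m" if \<pi>: "\<pi> \<in> surs (?Y m) G" for m \<pi>
  proof -
    interpret Z: comm_group "?Z m" by (rule comm_group_sum_zero_group)
    interpret Y: comm_group "?Y m" by (rule cgY)
    have \<pi>h: "\<pi> \<in> homs (?Y m) G" using \<pi> surs_subset_homs by blast
    interpret \<pi>: group_hom "?Y m" G \<pi> by (rule homs_group_hom[OF Y.is_group G.is_group \<pi>h])
    define \<rho> where "\<rho> = (\<lambda>x\<in>carrier (?Z m). (\<lambda>x. x [^]\<^bsub>?Z m\<^esub> ?q) ` carrier (?Z m) #>\<^bsub>?Z m\<^esub> x)"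
    have \<rho>s: "\<rho> \<in> surs (?Z m) (?Y m)" and \<rho>k: "kernel (?Z m) (?Y m) \<rho> = (\<lambda>x. x [^]\<^bsub>?Z m\<^esub> ?q) ` carrier (?Z m)"
      unfolding \<rho>_def by (rule Z.power_quotient_map)+
    have \<rho>h: "\<rho> \<in> homs (?Z m) (?Y m)" using \<rho>s surs_subset_homs by blast
    interpret \<rho>: group_hom "?Z m" "?Y m" \<rho> by (rule homs_group_hom[OF gZ Y.is_group \<rho>h])
    let ?T = "{x \<in> carrier (?Y m). x [^]\<^bsub>?Y m\<^esub> p = \<one>\<^bsub>?Y m\<^esub>}"
    have sub: "x \<in> kernel (?Y m) G \<pi>" if x: "x \<in> carrier (?Y m)" "x [^]\<^bsub>?Y m\<^esub> p = \<one>\<^bsub>?Y m\<^esub>" for x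
    proof -
      have "x \<in> \<rho> ` carrier (?Z m)" using x(1) by (simp only: surs_image[OF \<rho>s])
      then obtain z where z: "x = \<rho> z" "z \<in> carrier (?Z m)" by (rule imageE)
      have "\<rho> (z [^]\<^bsub>?Z m\<^esub> p) = \<one>\<^bsub>?Y m\<^esub>" using x(2) unfolding z(1) \<rho>.hom_nat_pow[OF z(2)] .
      hence "z [^]\<^bsub>?Z m\<^esub> p \<in> kernel (?Z m) (?Y m) \<rho>" using z(2) by (simp add: mem_kernel)
      then obtain y where y: "z [^]\<^bsub>?Z m\<^esub> p = y [^]\<^bsub>?Z m\<^esub> ?q" "y \<in> carrier (?Z m)" unfolding \<rho>k by (rule imageE)
      have zc: "z \<in> carrier_vec (Suc m)" "y \<in> carrier_vec (Suc m)" using z(2) y(2) by (simp_all add: szg_simps)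
      have e: "int p \<cdot>\<^sub>v z = int ?q \<cdot>\<^sub>v y" using y(1) unfolding szg_nat_pow[OF zc(1)] szg_nat_pow[OF zc(2)] .
      have "z = int (p ^ k) \<cdot>\<^sub>v y"
      proof (rule eq_vecI)
        show "dim_vec z = dim_vec (int (p ^ k) \<cdot>\<^sub>v y)" using zc by simp
        fix a assume "a < dim_vec (int (p ^ k) \<cdot>\<^sub>v y)"
        hence a: "a < Suc m" using zc by simp
        have "(int p \<cdot>\<^sub>v z) $ a = (int ?q \<cdot>\<^sub>v y) $ a" using e by simp
        hence "int p * (vec_index z a) = int p * (int (p ^ k) * vec_index y a)" using a zc by (simp add: mult.assoc)
        thus "vec_index z a = vec_index (int (p ^ k) \<cdot>\<^sub>v y) a" using p0 a zc by simp
      qed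
      hence "z = y [^]\<^bsub>?Z m\<^esub> (p ^ k)" unfolding szg_nat_pow[OF zc(2)] .
      hence "x = \<rho> y [^]\<^bsub>?Y m\<^esub> (p ^ k)" using z(1) \<rho>.hom_nat_pow[OF y(2)] by simp
      hence "\<pi> x = \<pi> (\<rho> y) [^]\<^bsub>G\<^esub> (p ^ k)" using \<pi>.hom_nat_pow[OF \<rho>.hom_closed[OF y(2)]] by simp
      also have "\<dots> = \<one>\<^bsub>G\<^esub>" by (rule Gk) (use \<rho>.hom_closed[OF y(2)] in simp)
      finally show ?thesis using x(1) by (simp add: mem_kernel)
    qed
    have "{x \<in> kernel (?Y m) G \<pi>. x [^]\<^bsub>?Y m\<^esub> p = \<one>\<^bsub>?Y m\<^esub>} = ?T" using sub by (auto simp: mem_kernel)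
    also have "card ?T = card (homs (?Y m) (Zp p))" using Y.card_homs_torsion[OF finY p] by simp
    also have "\<dots> = card (homs (?Z m) (Zp p))"
      by (rule Z.card_homs_power_quotient) simp_all
    also have "\<dots> = card (normalized_maps (Zp p) (Suc m))"
      using bij_betw_same_card[OF comm_group.bij_betw_vec_hom[OF abelian_integer_mod_group, of "Suc m" p]] by simp
    also have "\<dots> = p ^ m" using p0 by (subst card_normalized_maps) (simp_all add: carrier_Zp)
    finally show ?thesis .
  qed
  have Mexp: "x [^]\<^bsub>M\<^esub> ?q = \<one>\<^bsub>M\<^esub>" if "M \<in> labelled_groups h" "ext_pairs G ?E M ~= {}" "x \<in> carrier M" for M x
    using labelled_group_exponent[OF G p] that unfolding h_def by blast
  let ?c = "\<lambda>M. card (ext_pairs G ?E M)"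
  let ?g = "\<lambda>M m. card {f \<in> normalized_maps M (Suc m). generates M (f ` {..<Suc m})}"
  have key: "(\<Sum>M\<in>labelled_groups h. real (?c M) * (real (?g M m) / real h ^ m)) =
     fact h * (real (?g G m) / real (card (carrier G)) ^ m * (\<Prod>j<i. (real p ^ m - real p ^ j) / real p ^ m))" for m
  proof -
    have "(\<Sum>M\<in>labelled_groups h. ?c M * ?g M m) = (\<Sum>M\<in>labelled_groups h. ?c M * card (surs (?Y m) M))"
    proof (rule sum.cong[OF refl])
      fix M assume M: "M \<in> labelled_groups h"
      show "?c M * ?g M m = ?c M * card (surs (?Y m) M)"
      proof (cases "ext_pairs G ?E M = {}")
        case False
        show ?thesis using surs_count[OF labelled_groups_D(1)[OF M] Mexp[OF M False]] by simp
      qed simp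
    qed
    also have "\<dots> = fact h * card (ext_pairs G ?E (?Y m))"
      unfolding h_def by (rule card_labelled_quotients[OF cgY finY G(1,2) E.comm_group_axioms finite_Elem[OF p0(1)]])
    finally have "real (\<Sum>M\<in>labelled_groups h. ?c M * ?g M m) = real (fact h * card (ext_pairs G ?E (?Y m)))" by simp
    hence "(\<Sum>M\<in>labelled_groups h. real (?c M) * real (?g M m)) = fact h * real (card (ext_pairs G ?E (?Y m)))" by simp
    also have "real (card (ext_pairs G ?E (?Y m))) = (\<Sum>\<pi>\<in>surs (?Y m) G. \<Prod>j<i. real p ^ m - real p ^ j)"
      unfolding card_ext_pairs_Elem[OF cgY finY G(1,2) p] by (rule sum.cong[OF refl]) (simp only: torsion of_nat_power)
    also have "\<dots> = real (?g G m) * (\<Prod>j<i. real p ^ m - real p ^ j)"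
      by (simp only: sum_constant surs_count[OF G(1) Gq])
    finally have "(\<Sum>M\<in>labelled_groups h. real (?c M) * real (?g M m)) / real h ^ m =
       fact h * (real (?g G m) * (\<Prod>j<i. real p ^ m - real p ^ j)) / real h ^ m" by simp
    moreover have "real h ^ m = real (card (carrier G)) ^ m * (real p ^ m) ^ i"
      using G(3) unfolding hE order_def by (simp add: power_mult_distrib power_mult[symmetric] mult.commute)
    ultimately show ?thesis
      by (simp add: sum_divide_distrib prod_dividef)
  qed
  have lim1: "(\<lambda>m. \<Sum>M\<in>labelled_groups h. real (?c M) * (real (?g M m) / real h ^ m)) \<longlonglongrightarrow> (\<Sum>M\<in>labelled_groups h. real (?c M) * 1)"
  proof (intro tendsto_sum tendsto_mult tendsto_const)
    fix M assume M: "M \<in> labelled_groups h"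
    note L = labelled_groups_D[OF M]
    have "group M" "finite (carrier M)" using L(1) unfolding L(2) by (auto intro: comm_group.axioms(2))
    from generating_maps_limit[OF this] show "(\<lambda>m. real (?g M m) / real h ^ m) \<longlonglongrightarrow> 1" unfolding L(2) by simp
  qed
  have "(\<lambda>m. (\<Prod>j<i. (real p ^ m - real p ^ j) / real p ^ m)) \<longlonglongrightarrow> (\<Prod>j<i. 1)"
  proof (intro tendsto_prod)
    fix j
    have "(\<lambda>m. 1 - real p ^ j * (1 / real p) ^ m) \<longlonglongrightarrow> 1 - real p ^ j * 0"
      using p0 by (intro tendsto_intros LIMSEQ_power_zero) auto
    moreover have "1 - real p ^ j * (1 / real p) ^ m = (real p ^ m - real p ^ j) / real p ^ m" for m
      using p0 by (simp add: field_simps)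
    ultimately show "(\<lambda>m. (real p ^ m - real p ^ j) / real p ^ m) \<longlonglongrightarrow> 1" by simp
  qed
  from tendsto_mult[OF tendsto_const[of "fact h"] tendsto_mult[OF generating_maps_limit[OF G.is_group G(2)] this]]
  have "(\<lambda>m. \<Sum>M\<in>labelled_groups h. real (?c M) * (real (?g M m) / real h ^ m)) \<longlonglongrightarrow> fact h * (1 * (\<Prod>j<i. 1))"
    unfolding key by simp
  from LIMSEQ_unique[OF lim1 this] have "(\<Sum>M\<in>labelled_groups h. real (?c M)) = fact h" by simp
  hence "real (\<Sum>M\<in>labelled_groups h. ?c M) = real (fact h)" by simp
  thus ?thesis by (simp only: of_nat_eq_iff)
qed

section \<open>Summing over maps with few exceptional values\<close>

text \<open>
  Every exceptional value costs a factor \<open>t\<close> in the weighted sum over all maps. With at most \<open>r\<close> exceptions the total cost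
  is at most the factor \<open>t powr r\<close>, and the weighted sum factorises.
\<close>

lemma tilted_sum_le:
  fixes g :: "'b => real" and t r :: real
  assumes V: "finite V" and H: "finite H" and C: "C \<subseteq> H" and g: "\<And>y. y \<in> H ==> 0 <= g y" and t: "0 < t" "t <= 1"
  shows "(\<Sum>f | f \<in> V \<rightarrow>\<^sub>E H \<and> real (card {j \<in> V. f j \<notin> C}) <= r. \<Prod>j\<in>V. g (f j)) \<le>
     t powr (- r) * ((\<Sum>y\<in>C. g y) + t * (\<Sum>y\<in>H - C. g y)) ^ card V"
proof -
  let ?w = "\<lambda>y. g y * (if y \<in> C then 1 else t)"
  let ?F = "{f. f \<in> V \<rightarrow>\<^sub>E H \<and> real (card {j \<in> V. f j \<notin> C}) <= r}"
  have finP: "finite (V \<rightarrow>\<^sub>E H)" using V H by (auto intro: finite_PiE)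
  have w: "0 <= ?w y" if "y \<in> H" for y using g[OF that] t by auto
  have "(\<Sum>f\<in>?F. \<Prod>j\<in>V. g (f j)) <= (\<Sum>f\<in>?F. t powr (- r) * (\<Prod>j\<in>V. ?w (f j)))"
  proof (rule sum_mono)
    fix f assume f: "f \<in> ?F"
    let ?k = "card {j \<in> V. f j \<notin> C}"
    have nn: "0 <= (\<Prod>j\<in>V. g (f j))" using f g by (intro prod_nonneg) (auto simp: PiE_iff)
    have "(\<Prod>j\<in>V. if f j \<in> C then 1 else t) = t ^ ?k"
      using V by (simp add: prod.If_cases Int_def conj_commute)
    hence e: "(\<Prod>j\<in>V. ?w (f j)) = (\<Prod>j\<in>V. g (f j)) * t ^ ?k" by (simp add: prod.distrib)
    have "1 = t powr (- r) * t powr r" using t by (simp add: powr_add[symmetric])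
    also have "\<dots> <= t powr (- r) * t ^ ?k"
    proof (rule mult_left_mono)
      have "t powr r <= t powr real ?k" using f t by (intro powr_mono') auto
      thus "t powr r <= t ^ ?k" using t by (simp add: powr_realpow)
    qed simp
    finally have "1 <= t powr (- r) * t ^ ?k" .
    hence "(\<Prod>j\<in>V. g (f j)) * 1 <= (\<Prod>j\<in>V. g (f j)) * (t powr (- r) * t ^ ?k)" using nn by (rule mult_left_mono)
    thus "(\<Prod>j\<in>V. g (f j)) <= t powr (- r) * (\<Prod>j\<in>V. ?w (f j))" unfolding e by (simp add: mult_ac)
  qed
  also have "\<dots> <= (\<Sum>f\<in>V \<rightarrow>\<^sub>E H. t powr (- r) * (\<Prod>j\<in>V. ?w (f j)))"
  proof (rule sum_mono2[OF finP])
    fix f assume "f \<in> (V \<rightarrow>\<^sub>E H) - ?F"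
    hence "f j \<in> H" if "j \<in> V" for j using PiE_mem[of f V "\<lambda>_. H", OF _ that] by blast
    thus "0 <= t powr (- r) * (\<Prod>j\<in>V. ?w (f j))" by (intro mult_nonneg_nonneg prod_nonneg w) auto
  qed blast
  also have "\<dots> = t powr (- r) * (\<Prod>j\<in>V. \<Sum>y\<in>H. ?w y)"
    unfolding sum_distrib_left[symmetric] by (subst prod_sum_PiE[OF V H]) (rule refl)
  also have "(\<Prod>j\<in>V. \<Sum>y\<in>H. ?w y) = (\<Sum>y\<in>H. ?w y) ^ card V" by simp
  also have "(\<Sum>y\<in>H. ?w y) = (\<Sum>y\<in>C. g y) + t * (\<Sum>y\<in>H - C. g y)"
  proof -
    have "(\<Sum>y\<in>H. ?w y) = (\<Sum>y\<in>C. ?w y) + (\<Sum>y\<in>H - C. ?w y)" using sum.subset_diff[OF C H, of ?w] by simp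
    also have "(\<Sum>y\<in>C. ?w y) = (\<Sum>y\<in>C. g y)" by (rule sum.cong) auto
    also have "(\<Sum>y\<in>H - C. ?w y) = t * (\<Sum>y\<in>H - C. g y)" unfolding sum_distrib_left by (rule sum.cong) auto
    finally show ?thesis .
  qed
  finally show ?thesis .
qed

text \<open>
  For fixed \<open>f2\<close> the sum over \<open>f1\<close> is bounded uniformly; only then is the bound for \<open>B\<close>, which does not
  involve \<open>f1\<close>, summed over \<open>f2\<close>.
\<close>

lemma double_tilted_sum_le:
  fixes A B :: "('i => 'b) => ('i => 'b) => real" and t r :: real
  assumes V: "finite V1" "finite V2" and H: "finite H" and C: "C1 \<subseteq> H" "C2 \<subseteq> H" and t: "0 < t" "t <= 1"
    and P1: "\<And>f. f \<in> F1 ==> f \<in> V1 \<rightarrow>\<^sub>E H \<and> real (card {j \<in> V1. f j \<notin> C1}) <= r"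
    and P2: "\<And>f. f \<in> F2 ==> f \<in> V2 \<rightarrow>\<^sub>E H \<and> real (card {j \<in> V2. f j \<notin> C2}) <= r"
    and A: "\<And>f1 f2. f1 \<in> F1 ==> f2 \<in> F2 ==> 0 <= A f1 f2 \<and> A f1 f2 <= (\<Prod>j\<in>V1. g1 f2 (f1 j))"
    and B: "\<And>f1 f2. f1 \<in> F1 ==> f2 \<in> F2 ==> 0 <= B f1 f2 \<and> B f1 f2 <= (\<Prod>j\<in>V2. g2 (f2 j))"
    and g1: "\<And>f2 y. f2 \<in> F2 ==> y \<in> H ==> 0 <= g1 f2 y" and g2: "\<And>y. y \<in> H ==> 0 <= g2 y"
    and s1: "\<And>f2. f2 \<in> F2 ==> (\<Sum>y\<in>C1. g1 f2 y) + t * (\<Sum>y\<in>H - C1. g1 f2 y) <= a1"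
    and s2: "(\<Sum>y\<in>C2. g2 y) + t * (\<Sum>y\<in>H - C2. g2 y) <= a2" and a1: "0 <= a1"
  shows "(\<Sum>f1\<in>F1. \<Sum>f2\<in>F2. A f1 f2 * B f1 f2) <= (t powr (- r))\<^sup>2 * a1 ^ card V1 * a2 ^ card V2"
proof -
  let ?E1 = "{f. f \<in> V1 \<rightarrow>\<^sub>E H \<and> real (card {j \<in> V1. f j \<notin> C1}) <= r}"
  let ?E2 = "{f. f \<in> V2 \<rightarrow>\<^sub>E H \<and> real (card {j \<in> V2. f j \<notin> C2}) <= r}"
  have fin: "finite ?E1" "finite ?E2"
    by (rule finite_subset[of _ "V1 \<rightarrow>\<^sub>E H"]; use V H in \<open>auto intro: finite_PiE\<close>)
       (rule finite_subset[of _ "V2 \<rightarrow>\<^sub>E H"]; use V H in \<open>auto intro: finite_PiE\<close>)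
  have sub: "F1 \<subseteq> ?E1" "F2 \<subseteq> ?E2" using P1 P2 by blast+
  have finF: "finite F1" "finite F2" using sub fin finite_subset by blast+
  let ?T = "t powr (- r)"
  have tp: "0 <= ?T" by simp
  have n1: "0 <= (\<Sum>y\<in>C1. g1 f2 y) + t * (\<Sum>y\<in>H - C1. g1 f2 y)" if "f2 \<in> F2" for f2
    using g1[OF that] C t by (intro add_nonneg_nonneg mult_nonneg_nonneg sum_nonneg) auto
  have n2: "0 <= (\<Sum>y\<in>C2. g2 y) + t * (\<Sum>y\<in>H - C2. g2 y)"
    using g2 C t by (intro add_nonneg_nonneg mult_nonneg_nonneg sum_nonneg) auto
  have inner: "(\<Sum>f1\<in>F1. A f1 f2 * B f1 f2) <= ?T * a1 ^ card V1 * (\<Prod>j\<in>V2. g2 (f2 j))" if f2: "f2 \<in> F2" for f2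
  proof -
    have q2: "0 <= (\<Prod>j\<in>V2. g2 (f2 j))" using P2[OF f2] g2 by (intro prod_nonneg) (auto simp: PiE_iff)
    have "(\<Sum>f1\<in>F1. A f1 f2 * B f1 f2) <= (\<Sum>f1\<in>F1. (\<Prod>j\<in>V1. g1 f2 (f1 j)) * (\<Prod>j\<in>V2. g2 (f2 j)))"
    proof (intro sum_mono mult_mono)
      fix f1 assume f1: "f1 \<in> F1"
      show "A f1 f2 <= (\<Prod>j\<in>V1. g1 f2 (f1 j))" "B f1 f2 <= (\<Prod>j\<in>V2. g2 (f2 j))" "0 <= B f1 f2"
        using A[OF f1 f2] B[OF f1 f2] by auto
      show "0 <= (\<Prod>j\<in>V1. g1 f2 (f1 j))" using A[OF f1 f2] by linarith
    qed
    also have "\<dots> = (\<Sum>f1\<in>F1. \<Prod>j\<in>V1. g1 f2 (f1 j)) * (\<Prod>j\<in>V2. g2 (f2 j))" by (simp add: sum_distrib_right)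
    also have "\<dots> <= (?T * a1 ^ card V1) * (\<Prod>j\<in>V2. g2 (f2 j))"
    proof (rule mult_right_mono[OF _ q2])
      have "(\<Sum>f1\<in>F1. \<Prod>j\<in>V1. g1 f2 (f1 j)) <= (\<Sum>f1\<in>?E1. \<Prod>j\<in>V1. g1 f2 (f1 j))"
      proof (rule sum_mono2[OF fin(1) sub(1)])
        fix f assume "f \<in> ?E1 - F1"
        hence "f j \<in> H" if "j \<in> V1" for j using PiE_mem[of f V1 "\<lambda>_. H", OF _ that] by blast
        thus "0 <= (\<Prod>j\<in>V1. g1 f2 (f j))" by (intro prod_nonneg g1[OF f2]) auto
      qed
      also have "\<dots> <= ?T * ((\<Sum>y\<in>C1. g1 f2 y) + t * (\<Sum>y\<in>H - C1. g1 f2 y)) ^ card V1"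
        by (rule tilted_sum_le[OF V(1) H C(1) g1[OF f2] t])
      also have "\<dots> <= ?T * a1 ^ card V1" using n1[OF f2] s1[OF f2] by (intro mult_left_mono power_mono tp)
      finally show "(\<Sum>f1\<in>F1. \<Prod>j\<in>V1. g1 f2 (f1 j)) <= ?T * a1 ^ card V1" .
    qed
    finally show ?thesis .
  qed
  show ?thesis
  proof (cases "F2 = {}")
    case True
    have "0 <= a2" using n2 s2 by linarith
    thus ?thesis using True a1 by simp
  next
    case False
    have "(\<Sum>f1\<in>F1. \<Sum>f2\<in>F2. A f1 f2 * B f1 f2) = (\<Sum>f2\<in>F2. \<Sum>f1\<in>F1. A f1 f2 * B f1 f2)" by (rule sum.swap)
    also have "\<dots> <= (\<Sum>f2\<in>F2. ?T * a1 ^ card V1 * (\<Prod>j\<in>V2. g2 (f2 j)))" by (rule sum_mono) (rule inner)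
    also have "\<dots> <= (\<Sum>f2\<in>?E2. ?T * a1 ^ card V1 * (\<Prod>j\<in>V2. g2 (f2 j)))"
    proof (rule sum_mono2[OF fin(2) sub(2)])
      fix f assume "f \<in> ?E2 - F2"
      hence "f j \<in> H" if "j \<in> V2" for j using PiE_mem[of f V2 "\<lambda>_. H", OF _ that] by blast
      hence "0 <= (\<Prod>j\<in>V2. g2 (f j))" by (intro prod_nonneg g2) auto
      thus "0 <= ?T * a1 ^ card V1 * (\<Prod>j\<in>V2. g2 (f j))" using a1 by simp
    qed
    also have "\<dots> = ?T * a1 ^ card V1 * (\<Sum>f2\<in>?E2. \<Prod>j\<in>V2. g2 (f2 j))" by (simp add: sum_distrib_left)
    also have "\<dots> <= ?T * a1 ^ card V1 * (?T * a2 ^ card V2)"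
    proof (rule mult_left_mono)
      have "(\<Sum>f2\<in>?E2. \<Prod>j\<in>V2. g2 (f2 j)) <= ?T * ((\<Sum>y\<in>C2. g2 y) + t * (\<Sum>y\<in>H - C2. g2 y)) ^ card V2"
        by (rule tilted_sum_le[OF V(2) H C(2) g2 t])
      also have "\<dots> <= ?T * a2 ^ card V2" using n2 s2 by (intro mult_left_mono power_mono tp)
      finally show "(\<Sum>f2\<in>?E2. \<Prod>j\<in>V2. g2 (f2 j)) <= ?T * a2 ^ card V2" .
    qed (use a1 in simp)
    finally show ?thesis by (simp add: power2_eq_square mult_ac)
  qed
qed

section \<open>Frequent values force near-invariance\<close>

definition frequent :: "('a, 'b) monoid_scheme => real => ('i => 'a) => 'i set => 'a set" where
  "frequent G b f V = {l \<in> carrier G. b <= real (card {i \<in> V. f i = l})}"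

lemma frequent_subset: "frequent G b f V \<subseteq> carrier G"
  by (auto simp: frequent_def)

context comm_group begin

lemma near_invariant_mono: "near_invariant K \<eta> F ==> \<eta> <= \<eta>' ==> near_invariant K \<eta>' F"
  unfolding near_invariant_def by (meson order.trans)

text \<open>
  The constants must not depend on \<open>V\<close> and \<open>f\<close>; since there are only finitely many sets of frequent values, the constants
  for these sets can be added up.
\<close>

lemma near_invariant_frequent:
  fixes v \<delta> :: real
  assumes fin: "finite (carrier G)" and v: "0 < v" "v < 1" and q: "q > 0" "\<And>x. x \<in> carrier G ==> x [^] q = \<one>" and \<delta>: "\<delta> > 0"
  shows "\<exists>C r. 0 <= C \<and> 0 < r \<and> r < 1 \<and> (\<forall>n (V :: 'i set) f. finite V --> f \<in> V \<rightarrow> carrier G -->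
    near_invariant (difference_group G (frequent G (\<delta> * real n) f V)) (C * r ^ n) (nu v q G f V))"
proof -
  obtain \<rho> where \<rho>: "0 < \<rho>" "\<rho> < 1" "\<And>m e e'. \<bar>binom_residue q v m e - binom_residue q v m e'\<bar> <= \<rho> ^ (m div q)"
    using binom_residue_osc[OF v q(1)] by blast
  let ?P = "\<lambda>L C. C \<ge> 0 \<and> (\<forall>F \<eta>. \<eta> \<ge> 0 --> (\<forall>d. \<forall>h\<in>carrier G. \<forall>l\<in>L. \<bar>F d h - F (d + 1) (h \<otimes> l)\<bar> <= \<eta>) -->
     (\<forall>d :: int. \<forall>h\<in>carrier G. \<bar>F d h - (\<Sum>k\<in>difference_group G L. F d (h \<otimes> k)) / real (card (difference_group G L))\<bar> <= C * (\<eta> :: real)))"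
  have "\<forall>L\<in>Pow (carrier G). \<exists>C. ?P L C"
  proof
    fix L assume "L \<in> Pow (carrier G)"
    hence "L \<subseteq> carrier G" by simp
    from average_over_difference_group[OF fin this] show "\<exists>C. ?P L C" by blast
  qed
  then obtain C where C: "\<forall>L\<in>Pow (carrier G). ?P L (C L)" by (rule bchoice[THEN exE])
  let ?C = "\<Sum>L\<in>Pow (carrier G). C L"
  have C0: "0 <= ?C" using C by (intro sum_nonneg) blast
  have CL: "C L <= ?C" if "L \<subseteq> carrier G" for L
    using C that fin by (intro member_le_sum) auto
  let ?r = "\<rho> powr (\<delta> / q)"
  have r: "0 < ?r" "?r < 1"
    using \<rho> \<delta> q(1) powr_less_mono'[of \<rho> 0 "\<delta> / q"] by auto
  have main: "near_invariant (difference_group G (frequent G (\<delta> * real n) f V)) ((?C / \<rho>) * ?r ^ n) (nu v q G f V)"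
    if V: "finite V" and f: "f \<in> V \<rightarrow> carrier G" for n f and V :: "'i set"
  proof -
    let ?L = "frequent G (\<delta> * real n) f V"
    let ?\<eta> = "?r ^ n / \<rho>"
    have shift: "\<bar>nu v q G f V d h - nu v q G f V (d + 1) (h \<otimes> l)\<bar> <= ?\<eta>" if h: "h \<in> carrier G" and l: "l \<in> ?L" for d h l
    proof (rule nu_shift[where U = "{i \<in> V. f i = l}"])
      show lc: "l \<in> carrier G" using l by (simp add: frequent_def)
      show "l [^] q = \<one>" by (rule q(2)[OF lc])
      fix e e'
      let ?u = "card {i \<in> V. f i = l}"
      have "\<delta> * real n <= real ?u" using l by (simp add: frequent_def)
      hence "\<delta> / q * real n <= real ?u / real q" using q(1) by (simp add: field_simps)
      also have "\<dots> < real (?u div q) + 1"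
      proof -
        have "?u < (?u div q + 1) * q" using q(1) dividend_less_div_times[of q ?u] by (simp add: algebra_simps)
        hence "real ?u < real ((?u div q + 1) * q)" by (simp only: of_nat_less_iff)
        hence "real ?u < (real (?u div q) + 1) * real q" by (simp only: of_nat_mult of_nat_add of_nat_1)
        thus ?thesis using q(1) by (simp only: pos_divide_less_eq of_nat_0_less_iff)
      qed
      finally have "\<delta> / q * real n <= real (?u div q) + 1" by simp
      hence "\<rho> powr (real (?u div q) + 1) <= \<rho> powr (\<delta> / q * real n)" using \<rho> by (intro powr_mono') auto
      also have "\<dots> = ?r ^ n" using r(1) by (simp add: powr_powr flip: powr_realpow)
      finally have "\<rho> ^ (?u div q) * \<rho> <= ?r ^ n" using \<rho> by (simp add: powr_add powr_realpow)
      hence "\<rho> ^ (?u div q) <= ?\<eta>" using \<rho> by (simp add: field_simps)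
      thus "\<bar>binom_residue q v ?u e - binom_residue q v ?u e'\<bar> <= ?\<eta>" using \<rho>(3)[of ?u e e'] by linarith
    qed (use v V f h in auto)
    have \<eta>: "0 <= ?\<eta>" using \<rho> by simp
    have LP: "?L \<in> Pow (carrier G)" by (simp add: frequent_subset)
    from C[rule_format, OF LP] \<eta> shift
    have "\<forall>d. \<forall>h\<in>carrier G. \<bar>nu v q G f V d h - (\<Sum>k\<in>difference_group G ?L. nu v q G f V d (h \<otimes> k)) / real (card (difference_group G ?L))\<bar> <= C ?L * ?\<eta>"
      by blast
    hence "near_invariant (difference_group G ?L) (C ?L * ?\<eta>) (nu v q G f V)" by (simp add: near_invariant_def)
    moreover have "C ?L * ?\<eta> <= ?C / \<rho> * ?r ^ n"
      using mult_right_mono[OF CL[OF frequent_subset] \<eta>] by simp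
    ultimately show ?thesis by (rule near_invariant_mono)
  qed
  show ?thesis
    by (rule exI[of _ "?C / \<rho>"], rule exI[of _ ?r]) (use main r C0 \<rho> in auto)
qed

end

section \<open>Columns of a random arc set\<close>

definition nbrs :: "('i \<times> 'j) set => 'j => 'i set" where
  "nbrs S j = {i. (i, j) \<in> S}"

lemma sub_exp_prod_columns:
  fixes V :: "'j set" and U :: "'i set"
  assumes "finite U" "finite V"
  shows "sub_exp v (U \<times> V) (\<lambda>S. \<Prod>j\<in>V. \<phi> j (nbrs S j)) = (\<Prod>j\<in>V. sub_exp v U (\<phi> j))"
proof -
  have "sub_exp v (U \<times> V) (\<lambda>S. \<Prod>j\<in>V. \<phi> j (nbrs S j)) = sub_exp v (\<Union>j\<in>V. U \<times> {j}) (\<lambda>S. \<Prod>j\<in>V. \<phi> j (fst ` (S \<inter> U \<times> {j})))"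
  proof -
    have "(\<Union>j\<in>V. U \<times> {j}) = U \<times> V" by auto
    moreover have "sub_exp v (U \<times> V) (\<lambda>S. \<Prod>j\<in>V. \<phi> j (nbrs S j)) = sub_exp v (U \<times> V) (\<lambda>S. \<Prod>j\<in>V. \<phi> j (fst ` (S \<inter> U \<times> {j})))"
    proof (rule sub_exp_cong, rule prod.cong[OF refl])
      fix S j assume S: "S \<subseteq> U \<times> V" and j: "j \<in> V"
      have "nbrs S j = fst ` (S \<inter> U \<times> {j})" unfolding nbrs_def using S j by force
      thus "\<phi> j (nbrs S j) = \<phi> j (fst ` (S \<inter> U \<times> {j}))" by simp
    qed
    ultimately show ?thesis by simp
  qed
  also have "\<dots> = (\<Prod>j\<in>V. sub_exp v (U \<times> {j}) (\<lambda>S. \<phi> j (fst ` S)))"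
    by (rule sub_exp_prod_blocks[where \<phi> = "\<lambda>j S. \<phi> j (fst ` S)"]) (use assms in auto)
  also have "\<dots> = (\<Prod>j\<in>V. sub_exp v U (\<phi> j))"
  proof (rule prod.cong[OF refl])
    fix j :: 'j
    have "U \<times> {j} = (\<lambda>i. (i, j)) ` U" by auto
    moreover have "sub_exp v ((\<lambda>i. (i, j)) ` U) (\<lambda>S. \<phi> j (fst ` S)) = sub_exp v U (\<lambda>S. \<phi> j (fst ` (\<lambda>i. (i, j)) ` S))"
      by (rule sub_exp_reindex) (simp add: inj_on_def)
    ultimately show "sub_exp v (U \<times> {j}) (\<lambda>S. \<phi> j (fst ` S)) = sub_exp v U (\<phi> j)" by (simp add: image_image)
  qed
  finally show ?thesis .
qed

text \<open>
  The columns of \<open>S\<close> are the in-neighbourhoods of the vertices of \<open>V\<close>. The predicate \<open>Q\<close> restricts the number of vertices with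
  in-degree divisible by \<open>p\<close>; it couples the columns.
\<close>

definition columns_prob :: "real => nat => ('a, 'b) monoid_scheme => (nat => bool) => ('i => 'a) => 'i set => ('j => 'a) => 'j set => real" where
  "columns_prob v p G Q f U g V = sub_exp v (U \<times> V) (\<lambda>S. of_bool (
     (\<forall>j\<in>V. finprod G f (nbrs S j) = g j [^]\<^bsub>G\<^esub> card (nbrs S j)) \<and> Q (card {j \<in> V. p dvd card (nbrs S j)})))"

lemma columns_prob_nonneg: "0 <= v ==> v <= 1 ==> 0 <= columns_prob v p G Q f U g V"
  unfolding columns_prob_def by (rule sub_exp_nonneg) auto

lemma prod_if_one:
  assumes "finite V"
  shows "(\<Prod>j\<in>V. if P j then s else (1 :: real)) = s ^ card {j \<in> V. P j}"
  using assms by (simp add: prod.If_cases Int_def conj_commute)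

text \<open>
  An exponential bound for the indicator of \<open>Q\<close> decouples the columns, as in the Chernoff method.
\<close>

lemma columns_prob_le:
  fixes s D :: real
  assumes v: "0 <= v" "v <= 1" and fin: "finite U" "finite V" and s: "0 <= s" and Q: "\<And>z. of_bool (Q z) <= D * s ^ z"
  shows "columns_prob v p G Q f U g V <= D * (\<Prod>j\<in>V. wt v p G f U s (g j))"
proof -
  let ?c = "\<lambda>S j. finprod G f (nbrs S j) = g j [^]\<^bsub>G\<^esub> card (nbrs S j)"
  have "columns_prob v p G Q f U g V <= sub_exp v (U \<times> V) (\<lambda>S. D * (\<Prod>j\<in>V. of_bool (?c S j) * (if p dvd card (nbrs S j) then s else 1)))"
    unfolding columns_prob_def
  proof (rule sub_exp_mono[OF v])
    fix S assume "S \<subseteq> U \<times> V"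
    have "(\<Prod>j\<in>V. of_bool (?c S j) * (if p dvd card (nbrs S j) then s else 1)) = of_bool (\<forall>j\<in>V. ?c S j) * s ^ card {j \<in> V. p dvd card (nbrs S j)}"
      unfolding prod.distrib prod_if_one[OF fin(2)]
      using fin(2) by (cases "\<forall>j\<in>V. ?c S j") (auto simp: prod_zero_iff)
    thus "of_bool ((\<forall>j\<in>V. ?c S j) \<and> Q (card {j \<in> V. p dvd card (nbrs S j)})) \<le>
       D * (\<Prod>j\<in>V. of_bool (?c S j) * (if p dvd card (nbrs S j) then s else 1))"
      using Q[of "card {j \<in> V. p dvd card (nbrs S j)}"] by auto
  qed
  also have "\<dots> = D * (\<Prod>j\<in>V. wt v p G f U s (g j))"
    unfolding sub_exp_cmult wt_def
    using sub_exp_prod_columns[OF fin, of v "\<lambda>j T. of_bool (finprod G f T = g j [^]\<^bsub>G\<^esub> card T) * (if p dvd card T then s else 1)"] by simp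
  finally show ?thesis .
qed

lemma columns_prob_True:
  assumes fin: "finite U" "finite V"
  shows "columns_prob v p G (\<lambda>_. True) f U g V = (\<Prod>j\<in>V. wt v p G f U 1 (g j))"
proof -
  let ?c = "\<lambda>S j. finprod G f (nbrs S j) = g j [^]\<^bsub>G\<^esub> card (nbrs S j)"
  have "columns_prob v p G (\<lambda>_. True) f U g V = sub_exp v (U \<times> V) (\<lambda>S. \<Prod>j\<in>V. of_bool (?c S j) * (if p dvd card (nbrs S j) then 1 else 1))"
    unfolding columns_prob_def
  proof (rule sub_exp_cong)
    fix S
    show "of_bool ((\<forall>j\<in>V. ?c S j) \<and> True) = (\<Prod>j\<in>V. of_bool (?c S j) * (if p dvd card (nbrs S j) then 1 else 1 :: real))"
      using fin(2) by (cases "\<forall>j\<in>V. ?c S j") (auto simp: prod_zero_iff)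
  qed
  also have "\<dots> = (\<Prod>j\<in>V. wt v p G f U 1 (g j))"
    unfolding wt_def
    using sub_exp_prod_columns[OF fin, of v "\<lambda>j T. of_bool (finprod G f T = g j [^]\<^bsub>G\<^esub> card T) * (if p dvd card T then 1 else 1)"] by simp
  finally show ?thesis .
qed

lemma columns_prob_not:
  "columns_prob v p G (\<lambda>_. True) f U g V = columns_prob v p G Q f U g V + columns_prob v p G (\<lambda>z. \<not> Q z) f U g V"
  unfolding columns_prob_def sub_exp_add[symmetric] by (rule sub_exp_cong) auto

section \<open>Cosets and frequent values\<close>

context comm_group begin

lemma mem_translate_iff:
  assumes K: "subgroup K G" and c: "c \<in> carrier G" "y \<in> carrier G"
  shows "y \<in> (\<lambda>k. c \<otimes> k) ` K \<longleftrightarrow> c \<otimes> inv y \<in> K"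
proof
  assume "y \<in> (\<lambda>k. c \<otimes> k) ` K"
  then obtain k where k: "y = c \<otimes> k" "k \<in> K" by (rule imageE)
  have kc: "k \<in> carrier G" using subgroup.mem_carrier[OF K k(2)] .
  have "c \<otimes> inv y = inv k" unfolding k(1) using c(1) kc by (simp add: inv_mult m_assoc[symmetric])
  thus "c \<otimes> inv y \<in> K" using subgroup.m_inv_closed[OF K k(2)] by simp
next
  assume h: "c \<otimes> inv y \<in> K"
  have "y = c \<otimes> inv (c \<otimes> inv y)" using c by (simp add: inv_mult m_assoc[symmetric])
  thus "y \<in> (\<lambda>k. c \<otimes> k) ` K" using subgroup.m_inv_closed[OF K h] by (rule image_eqI)
qed

lemma card_translate_inter_le:
  assumes fin: "finite (carrier G)" and K: "subgroup K G" "subgroup K' G" and c: "c \<in> carrier G" "c' \<in> carrier G"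
  shows "card ((\<lambda>k. c \<otimes> k) ` K \<inter> (\<lambda>k. c' \<otimes> k) ` K') <= card (K \<inter> K')"
proof (cases "(\<lambda>k. c \<otimes> k) ` K \<inter> (\<lambda>k. c' \<otimes> k) ` K' = {}")
  case False
  have sub: "(\<lambda>k. c \<otimes> k) ` K \<subseteq> carrier G" if "subgroup K G" "c \<in> carrier G" for c K
    using subgroup.mem_carrier[OF that(1)] that(2) by (intro image_subsetI) simp
  have D: "subgroup (K \<inter> K') G" by (rule subgroups_Inter_pair[OF K])
  obtain z where z: "z \<in> (\<lambda>k. c \<otimes> k) ` K" "z \<in> (\<lambda>k. c' \<otimes> k) ` K'" using False by blast
  have zc: "z \<in> carrier G" using z(1) sub[OF K(1) c(1)] by (rule subsetD[rotated])
  have quot: "z \<otimes> inv y \<in> K" if "subgroup K G" "c \<in> carrier G" "y \<in> carrier G" "z \<in> (\<lambda>k. c \<otimes> k) ` K" "y \<in> (\<lambda>k. c \<otimes> k) ` K" for c y K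
  proof -
    have "c \<otimes> inv z \<in> K" "c \<otimes> inv y \<in> K"
      using mem_translate_iff[OF that(1,2) zc] mem_translate_iff[OF that(1,2,3)] that(4,5) by simp_all
    hence "inv (c \<otimes> inv z) \<otimes> (c \<otimes> inv y) \<in> K"
      by (rule subgroup.m_closed[OF that(1) subgroup.m_inv_closed[OF that(1)]])
    moreover have "inv (c \<otimes> inv z) \<otimes> (c \<otimes> inv y) = z \<otimes> inv y"
      using cancel_quotient[of "inv c" z "inv y"] that(2,3) zc by (simp add: inv_mult)
    ultimately show ?thesis by (simp only:)
  qed
  have "(\<lambda>k. c \<otimes> k) ` K \<inter> (\<lambda>k. c' \<otimes> k) ` K' \<subseteq> (\<lambda>k. z \<otimes> k) ` (K \<inter> K')"
  proof
    fix y assume y: "y \<in> (\<lambda>k. c \<otimes> k) ` K \<inter> (\<lambda>k. c' \<otimes> k) ` K'"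
    have yc: "y \<in> carrier G" using y sub[OF K(1) c(1)] by blast
    have "z \<otimes> inv y \<in> K \<inter> K'" using quot[OF K(1) c(1) yc z(1)] quot[OF K(2) c(2) yc z(2)] y by simp
    thus "y \<in> (\<lambda>k. z \<otimes> k) ` (K \<inter> K')" using mem_translate_iff[OF D zc yc] by simp
  qed
  moreover have finD: "finite (K \<inter> K')" using subgroup.subset[OF K(1)] fin finite_subset by blast
  ultimately have "card ((\<lambda>k. c \<otimes> k) ` K \<inter> (\<lambda>k. c' \<otimes> k) ` K') <= card ((\<lambda>k. z \<otimes> k) ` (K \<inter> K'))"
    by (intro card_mono finite_imageI)
  also have "\<dots> <= card (K \<inter> K')" by (rule card_image_le[OF finD])
  finally show ?thesis .
qed simp

lemma card_proper_subgroup: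
  assumes fin: "finite K" and D: "subgroup D G" "subgroup K G" "D \<subset> K"
  shows "2 * card D <= card K"
proof -
  obtain k where k: "k \<in> K" "k \<notin> D" using D(3) by blast
  have kc: "k \<in> carrier G" using subgroup.mem_carrier[OF D(2) k(1)] .
  have Dc: "d \<in> carrier G" if "d \<in> D" for d using subgroup.mem_carrier[OF D(1) that] .
  have finD: "finite D" using D(3) fin finite_subset by blast
  have disj: "D \<inter> (\<lambda>d. k \<otimes> d) ` D = {}"
  proof (rule ccontr)
    assume "D \<inter> (\<lambda>d. k \<otimes> d) ` D ~= {}"
    then obtain d where d: "d \<in> D" "k \<otimes> d \<in> D" by blast
    have "k = (k \<otimes> d) \<otimes> inv d" using kc Dc[OF d(1)] by (simp add: m_assoc)
    also have "\<dots> \<in> D" by (intro subgroup.m_closed[OF D(1)] subgroup.m_inv_closed[OF D(1)] d)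
    finally show False using k(2) by simp
  qed
  have "card ((\<lambda>d. k \<otimes> d) ` D) = card D" by (rule card_image) (use kc Dc in \<open>auto intro!: inj_onI\<close>)
  hence "2 * card D = card (D \<union> (\<lambda>d. k \<otimes> d) ` D)"
    using card_Un_disjoint[OF finD finite_imageI[OF finD] disj] by simp
  also have "\<dots> <= card K"
  proof (rule card_mono[OF fin])
    show "D \<union> (\<lambda>d. k \<otimes> d) ` D \<subseteq> K"
      using D(3) k(1) by (intro Un_least image_subsetI subgroup.m_closed[OF D(2)]) auto
  qed
  finally show ?thesis .
qed

lemma frequent_nonempty:
  fixes b :: real
  assumes fin: "finite (carrier G)" and V: "finite V" and f: "f \<in> V \<rightarrow> carrier G" and b: "order G * b < card V"
  shows "frequent G b f V ~= {}"
proof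
  assume e: "frequent G b f V = {}"
  have "V = (\<Union>l\<in>carrier G. {i \<in> V. f i = l})" using f by auto
  hence "card V <= (\<Sum>l\<in>carrier G. card {i \<in> V. f i = l})" using card_UN_le[OF fin, of "\<lambda>l. {i \<in> V. f i = l}"] by simp
  hence "real (card V) <= real (\<Sum>l\<in>carrier G. card {i \<in> V. f i = l})" by (simp only: of_nat_le_iff)
  hence "real (card V) <= (\<Sum>l\<in>carrier G. real (card {i \<in> V. f i = l}))" by (simp only: of_nat_sum)
  also have "\<dots> <= (\<Sum>l\<in>carrier G. b)"
  proof (rule sum_mono)
    fix l assume "l \<in> carrier G"
    hence "\<not> b <= real (card {i \<in> V. f i = l})" using e by (fastforce simp: frequent_def)
    thus "real (card {i \<in> V. f i = l}) <= b" by linarith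
  qed
  finally show False using b by (simp add: order_def)
qed

lemma frequent_value:
  fixes b :: real
  assumes "l \<in> frequent G b f V" "b > 0"
  obtains i where "i \<in> V" "f i = l"
proof -
  have "{i \<in> V. f i = l} ~= {}"
  proof
    assume e: "{i \<in> V. f i = l} = {}"
    have "b <= real (card {i \<in> V. f i = l})" using assms(1) by (simp add: frequent_def)
    thus False unfolding e using assms(2) by simp
  qed
  thus ?thesis using that by blast
qed

lemma few_exceptions:
  fixes b :: real
  assumes fin: "finite (carrier G)" and V: "finite V" and f: "f \<in> V \<rightarrow> carrier G" and b: "b \<ge> 0"
    and c: "c \<in> frequent G b f V"
  shows "card {i \<in> V. f i \<notin> (\<lambda>k. c \<otimes> k) ` difference_group G (frequent G b f V)} <= order G * b"
proof -
  let ?L = "frequent G b f V" and ?C = "(\<lambda>k. c \<otimes> k) ` difference_group G (frequent G b f V)"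
  have K: "subgroup (difference_group G ?L) G" by (rule subgroup_difference_group[OF frequent_subset])
  have cc: "c \<in> carrier G" using c by (simp add: frequent_def)
  have L: "l \<in> ?C" if "l \<in> ?L" for l
  proof -
    have "l \<in> carrier G" using that by (simp add: frequent_def)
    moreover have "c \<otimes> inv l \<in> difference_group G ?L" unfolding difference_group_def using c that by (intro generate.incl) blast
    ultimately show ?thesis using mem_translate_iff[OF K cc] by simp
  qed
  have "{i \<in> V. f i \<notin> ?C} \<subseteq> (\<Union>l\<in>carrier G - ?L. {i \<in> V. f i = l})"
  proof
    fix i assume i: "i \<in> {i \<in> V. f i \<notin> ?C}"
    hence "f i \<in> carrier G - ?L" using f L[of "f i"] by blast
    thus "i \<in> (\<Union>l\<in>carrier G - ?L. {i \<in> V. f i = l})" using i by (intro UN_I[of "f i"]) auto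
  qed
  hence "card {i \<in> V. f i \<notin> ?C} <= card (\<Union>l\<in>carrier G - ?L. {i \<in> V. f i = l})"
    by (rule card_mono[rotated]) (simp add: fin V)
  also have "\<dots> <= (\<Sum>l\<in>carrier G - ?L. card {i \<in> V. f i = l})" by (rule card_UN_le) (simp add: fin)
  finally have "real (card {i \<in> V. f i \<notin> ?C}) <= real (\<Sum>l\<in>carrier G - ?L. card {i \<in> V. f i = l})" by (simp only: of_nat_le_iff)
  hence "real (card {i \<in> V. f i \<notin> ?C}) <= (\<Sum>l\<in>carrier G - ?L. real (card {i \<in> V. f i = l}))" by (simp only: of_nat_sum)
  also have "\<dots> <= (\<Sum>l\<in>carrier G - ?L. b)"
  proof (rule sum_mono)
    fix l assume "l \<in> carrier G - ?L"
    hence "\<not> b <= real (card {i \<in> V. f i = l})" by (simp add: frequent_def)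
    thus "real (card {i \<in> V. f i = l}) <= b" by linarith
  qed
  also have "\<dots> <= (\<Sum>l\<in>carrier G. b)" by (rule sum_mono2[OF fin]) (use b in auto)
  finally show ?thesis by (simp add: order_def)
qed

end

section \<open>The exponential rates\<close>

text \<open>
  Here \<open>a\<close> and \<open>b\<close> are the indices of the intersection of two subgroups in the first and in the second. If \<open>a\<close> is at least 2, the gap
  between \<open>\<tau>\<close> and \<open>\<alpha>\<close> gives the decay; if \<open>a\<close> is 1, the factor \<open>\<theta>\<close> gives it.
\<close>

lemma pattern_rate:
  fixes a b \<theta> \<tau> \<alpha> :: real and n m :: nat
  assumes ab: "a = 1 \<and> 2 <= b \<or> 2 <= a \<and> 1 <= b" and \<theta>: "0 <= \<theta>" "\<theta> < 1" and \<tau>: "\<tau> < \<alpha>" "0 < \<alpha>" and m: "\<alpha> * n <= m" "m <= n"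
  shows "a powr (\<tau> * n) * (1 / b) ^ n * ((1 + \<theta> * (b - 1)) / a) ^ m <= (max (2 powr (\<tau> - \<alpha>)) (((1 + \<theta>) / 2) powr \<alpha>)) ^ n"
proof -
  have a1: "a \<ge> 1" and b1: "b \<ge> 1" using ab by auto
  let ?x = "(1 + \<theta> * (b - 1)) / b"
  have x0: "0 <= ?x" using \<theta> b1 by simp
  have x1: "?x <= 1"
  proof -
    have "\<theta> * (b - 1) <= 1 * (b - 1)" using \<theta> b1 by (intro mult_right_mono) auto
    thus ?thesis using b1 by (simp add: divide_le_eq_1)
  qed
  have "a powr (\<tau> * n) * (1 / b) ^ n * ((1 + \<theta> * (b - 1)) / a) ^ m = a powr (\<tau> * n - m) * ((1 / b) ^ n * (1 + \<theta> * (b - 1)) ^ m)"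
    using a1 by (simp add: powr_diff powr_realpow power_divide)
  also have "\<dots> <= a powr ((\<tau> - \<alpha>) * n) * ?x ^ m"
  proof (rule mult_mono)
    show "a powr (\<tau> * n - m) <= a powr ((\<tau> - \<alpha>) * n)" using a1 m by (intro powr_mono) (auto simp: algebra_simps)
    have "(1 / b) ^ n <= (1 / b) ^ m" using b1 m by (intro power_decreasing) auto
    hence "(1 / b) ^ n * (1 + \<theta> * (b - 1)) ^ m <= (1 / b) ^ m * (1 + \<theta> * (b - 1)) ^ m"
      using \<theta> b1 by (intro mult_right_mono) auto
    thus "(1 / b) ^ n * (1 + \<theta> * (b - 1)) ^ m <= ?x ^ m" by (simp add: power_divide power_one_over)
  qed (use \<theta> b1 in auto)
  also have "\<dots> <= (max (2 powr (\<tau> - \<alpha>)) (((1 + \<theta>) / 2) powr \<alpha>)) ^ n"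
  proof (cases "2 <= a")
    case True
    have "a powr ((\<tau> - \<alpha>) * n) * ?x ^ m <= 2 powr ((\<tau> - \<alpha>) * n) * 1"
    proof (rule mult_mono)
      show "a powr ((\<tau> - \<alpha>) * n) <= 2 powr ((\<tau> - \<alpha>) * n)" using True \<tau> by (intro powr_mono2') (auto intro: mult_nonpos_nonneg)
      show "?x ^ m <= 1" using x0 x1 by (rule power_le_one)
    qed (use x0 in auto)
    also have "\<dots> = (2 powr (\<tau> - \<alpha>)) ^ n" by (simp add: powr_powr flip: powr_realpow)
    also have "\<dots> <= (max (2 powr (\<tau> - \<alpha>)) (((1 + \<theta>) / 2) powr \<alpha>)) ^ n" by (intro power_mono) auto
    finally show ?thesis .
  next
    case False
    hence ab': "a = 1" "2 <= b" using ab by auto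
    have xle: "?x <= (1 + \<theta>) / 2"
    proof -
      have "(1 - \<theta>) * 2 <= (1 - \<theta>) * b" using \<theta> ab'(2) by (intro mult_left_mono) auto
      thus ?thesis using ab'(2) by (simp add: field_simps)
    qed
    have "a powr ((\<tau> - \<alpha>) * n) * ?x ^ m = ?x ^ m" using ab' by simp
    also have "\<dots> <= ((1 + \<theta>) / 2) ^ m" using xle x0 by (intro power_mono)
    also have "\<dots> = ((1 + \<theta>) / 2) powr m" using \<theta> by (simp add: powr_realpow)
    also have "\<dots> <= ((1 + \<theta>) / 2) powr (\<alpha> * n)" using \<theta> m by (intro powr_mono') auto
    also have "\<dots> = (((1 + \<theta>) / 2) powr \<alpha>) ^ n" using \<theta> by (simp add: powr_powr flip: powr_realpow)
    also have "\<dots> <= (max (2 powr (\<tau> - \<alpha>)) (((1 + \<theta>) / 2) powr \<alpha>)) ^ n" by (intro power_mono) auto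
    finally show ?thesis .
  qed
  finally show ?thesis .
qed

text \<open>
  First \<open>t\<close> is chosen close to 0 to spoil \<open>\<kappa>\<close> little; the number of exceptional values, governed by \<open>\<delta>\<close>, is then made so small
  that the cost of the tilt by \<open>t\<close> is also harmless.
\<close>

lemma rate_parameters:
  fixes \<kappa> \<alpha> M :: real
  assumes \<kappa>: "0 < \<kappa>" "\<kappa> < 1" and \<alpha>: "0 < \<alpha>" and M: "1 <= M"
  obtains t \<delta> where "0 < t" "t <= 1/2" "0 < \<delta>" "M * \<delta> < \<alpha>" "t powr (- (2 * M * \<delta>)) * (1 + 3 * M\<^sup>2 * t)\<^sup>2 * \<kappa> < 1"
proof -
  have "((\<lambda>t. (1 + 3 * M\<^sup>2 * t)\<^sup>2 * \<kappa>) \<longlongrightarrow> (1 + 3 * M\<^sup>2 * 0)\<^sup>2 * \<kappa>) (at_right 0)" by (intro tendsto_intros)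
  hence "\<forall>\<^sub>F t in at_right 0. (1 + 3 * M\<^sup>2 * t)\<^sup>2 * \<kappa> < 1" using \<kappa> by (intro order_tendstoD) auto
  moreover have "\<forall>\<^sub>F t in at_right 0. t < (1/2 :: real)" by (intro order_tendstoD[OF tendsto_ident_at]) auto
  moreover have "\<forall>\<^sub>F t in at_right 0. 0 < (t :: real)" by (simp add: eventually_at_right_less)
  ultimately have "\<forall>\<^sub>F t in at_right (0 :: real). (1 + 3 * M\<^sup>2 * t)\<^sup>2 * \<kappa> < 1 \<and> t < 1/2 \<and> 0 < t" by eventually_elim auto
  then obtain t :: real where t: "(1 + 3 * M\<^sup>2 * t)\<^sup>2 * \<kappa> < 1" "t < 1/2" "0 < t"
    using eventually_happens'[OF trivial_limit_at_right_real] by blast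
  have "((\<lambda>\<delta>. t powr (- (2 * M * \<delta>)) * ((1 + 3 * M\<^sup>2 * t)\<^sup>2 * \<kappa>)) \<longlongrightarrow> t powr (- (2 * M * 0)) * ((1 + 3 * M\<^sup>2 * t)\<^sup>2 * \<kappa>)) (at_right 0)"
    using t by (intro tendsto_intros) auto
  hence "\<forall>\<^sub>F \<delta> in at_right 0. t powr (- (2 * M * \<delta>)) * ((1 + 3 * M\<^sup>2 * t)\<^sup>2 * \<kappa>) < 1" using t by (intro order_tendstoD) auto
  moreover have "\<forall>\<^sub>F \<delta> in at_right 0. \<delta> < \<alpha> / M" using \<alpha> M by (intro order_tendstoD[OF tendsto_ident_at]) auto
  moreover have "\<forall>\<^sub>F \<delta> in at_right 0. 0 < (\<delta> :: real)" by (simp add: eventually_at_right_less)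
  ultimately have "\<forall>\<^sub>F \<delta> in at_right (0 :: real). t powr (- (2 * M * \<delta>)) * ((1 + 3 * M\<^sup>2 * t)\<^sup>2 * \<kappa>) < 1 \<and> \<delta> < \<alpha> / M \<and> 0 < \<delta>" by eventually_elim auto
  then obtain \<delta> :: real where "t powr (- (2 * M * \<delta>)) * ((1 + 3 * M\<^sup>2 * t)\<^sup>2 * \<kappa>) < 1" "\<delta> < \<alpha> / M" "0 < \<delta>"
    using eventually_happens'[OF trivial_limit_at_right_real] by blast
  thus ?thesis using t M by (intro that[of t \<delta>]) (auto simp: field_simps)
qed

section \<open>Maps whose frequent values do not generate\<close>

text \<open>
  The group \<open>G\<close> is here the target of the surjections, and \<open>q\<close> is a multiple of its exponent.
\<close>

locale moment_setup = comm_group G for G :: "('a, 'b) monoid_scheme" (structure) +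
  fixes p q e :: nat and v \<tau> \<alpha> :: real
  assumes fin: "finite (carrier G)" and p: "Factorial_Ring.prime p"
    and q: "q = p ^ e" "e > 0" "\<And>x. x \<in> carrier G ==> x [^] q = \<one>"
    and v: "0 < v" "v < 1" and \<tau>: "1 / real p < \<tau>" "\<tau> < \<alpha>" "\<alpha> <= 1"
begin

text \<open>
  The probability that the labelling given by \<open>f1\<close> and \<open>f2\<close> is a solution while at most \<open>\<tau> n\<close> vertices of the first side
  have in-degree divisible by \<open>p\<close>.
\<close>

definition few_prob :: "nat => nat set => nat set => (nat => 'a) => (nat => 'a) => real" where
  "few_prob n V1 V2 f1 f2 = columns_prob v p G (\<lambda>z. real z <= \<tau> * real n) f2 V2 f1 V1 * (\<Prod>j\<in>V2. wt v p G f1 V1 1 (f2 j))"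

text \<open>
  The larger of the two probabilities of a single arc bounds the probability that a sum stays in a prescribed coset.
\<close>

definition stay :: real where
  "stay = max v (1 - v)"

definition rate :: real where
  "rate = max (2 powr (\<tau> - \<alpha>)) (((1 + stay) / 2) powr \<alpha>)"

lemma stay: "0 < stay" "stay < 1"
  using v by (auto simp: stay_def)

lemma alpha_pos: "0 < \<alpha>"
  using \<tau> by (meson divide_nonneg_nonneg less_le_trans of_nat_0_le_iff less_imp_le order.strict_trans1 zero_le_one)

lemma rate: "0 < rate" "rate < 1"
proof -
  have "((1 + stay) / 2) powr \<alpha> < 1" using powr_less_mono'[of "(1 + stay) / 2" 0 \<alpha>] stay alpha_pos by simp
  moreover have "2 powr (\<tau> - \<alpha>) < (1 :: real)" using powr_less_mono[of "\<tau> - \<alpha>" 0 "2 :: real"] \<tau> by simp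
  ultimately show "rate < 1" by (simp add: rate_def)
  show "0 < rate" using stay by (simp add: rate_def less_max_iff_disj)
qed

lemma order_pos: "real (order G) \<ge> 1"
proof -
  have "order G > 0" unfolding order_def by (subst card_gt_0_iff) (use fin one_closed in force)
  thus ?thesis by simp
qed

lemma q_pos: "q > 0" "p dvd q"
  using q prime_gt_0_nat[OF p] by (auto simp: dvd_power)

end

text \<open>
  The value \<open>\<eta>\<close> is the error with which the law of in-neighbourhood products is invariant under the subgroup
  generated by quotients of frequent values.
\<close>

locale pattern_setup = moment_setup +
  fixes V1 V2 :: "nat set" and n m :: nat and \<delta> t \<eta> :: real
  assumes V: "finite V1" "finite V2" "card V1 = n" "card V2 = m"
    and nm: "\<alpha> * real n <= real m" "m <= n" "n > 0"
    and \<delta>: "0 < \<delta>" "order G * \<delta> < \<alpha>" and t: "0 < t" "t <= 1" and \<eta>: "0 <= \<eta>" "q * \<eta> <= t"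
    and inv1: "\<And>f. f \<in> V1 \<rightarrow> carrier G ==> near_invariant (difference_group G (frequent G (\<delta> * real n) f V1)) \<eta> (nu v q G f V1)"
    and inv2: "\<And>f. f \<in> V2 \<rightarrow> carrier G ==> near_invariant (difference_group G (frequent G (\<delta> * real n) f V2)) \<eta> (nu v q G f V2)"
begin

definition pat :: "nat set => 'a set => (nat => 'a) set" where
  "pat V \<Lambda> = {f \<in> V \<rightarrow>\<^sub>E carrier G. frequent G (\<delta> * real n) f V = \<Lambda>}"

lemma patD: "f \<in> pat V \<Lambda> ==> f \<in> V \<rightarrow>\<^sub>E carrier G" "f \<in> pat V \<Lambda> ==> f \<in> V \<rightarrow> carrier G" "f \<in> pat V \<Lambda> ==> frequent G (\<delta> * real n) f V = \<Lambda>"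
  by (auto simp: pat_def)

lemma finite_pat: "finite V ==> finite (pat V \<Lambda>)"
  unfolding pat_def by (rule finite_subset[of _ "V \<rightarrow>\<^sub>E carrier G"]) (auto intro: finite_PiE fin)

abbreviation bad_rate :: real where
  "bad_rate \<equiv> t powr (- (2 * real (order G) * \<delta>)) * (1 + 3 * (real (order G))\<^sup>2 * t)\<^sup>2 * rate"

lemma few_prob_nonneg: "0 <= few_prob n V1 V2 f1 f2"
  unfolding few_prob_def using v by (intro mult_nonneg_nonneg prod_nonneg columns_prob_nonneg ballI wt_nonneg) auto

text \<open>
  The tilt \<open>1 / a\<close> for the first side turns the bound on the number of vertices with in-degree divisible by \<open>p\<close> into the factor
  \<open>a powr (\<tau> * n)\<close>. The rest is the double sum over labellings with few values outside the cosets \<open>C1\<close> and \<open>C2\<close>.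
\<close>

lemma pattern_sum_le:
  fixes a x1 x2 :: real
  assumes F1: "\<And>f. f \<in> F1 ==> f \<in> V1 \<rightarrow>\<^sub>E carrier G \<and> real (card {j \<in> V1. f j \<notin> C1}) <= order G * (\<delta> * n)"
    and F2: "\<And>f. f \<in> F2 ==> f \<in> V2 \<rightarrow>\<^sub>E carrier G \<and> real (card {j \<in> V2. f j \<notin> C2}) <= order G * (\<delta> * n)"
    and C: "C1 \<subseteq> carrier G" "C2 \<subseteq> carrier G" and a: "a \<ge> 1"
    and g2: "\<And>y. y \<in> carrier G ==> 0 <= g2 y \<and> g2 y <= 2"
    and B: "\<And>f1 y. f1 \<in> F1 ==> y \<in> carrier G ==> wt v p G f1 V1 1 y <= g2 y"
    and s1: "\<And>f2. f2 \<in> F2 ==> (\<Sum>y\<in>C1. wt v p G f2 V2 (1 / a) y) <= x1 + q * order G * \<eta>"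
    and s2: "(\<Sum>y\<in>C2. g2 y) <= x2 + q * order G * \<eta>"
    and x: "1 <= order G * x1" "1 <= order G * x2" and r: "a powr (\<tau> * n) * x1 ^ n * x2 ^ m <= rate ^ n"
  shows "(\<Sum>f1\<in>F1. \<Sum>f2\<in>F2. few_prob n V1 V2 f1 f2) <= bad_rate ^ n"
proof -
  let ?N = "real (order G)" and ?P = "a powr (\<tau> * n)"
  let ?A = "\<lambda>f1 f2. columns_prob v p G (\<lambda>z. real z <= \<tau> * real n) f2 V2 f1 V1 / ?P"
  let ?B = "\<lambda>f1 f2. \<Prod>j\<in>V2. wt v p G f1 V1 1 (f2 j)"
  have N: "?N \<ge> 1" by (rule order_pos)
  have v': "0 <= v" "v <= 1" using v by auto
  have P: "?P > 0" using a by simp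
  have xp: "0 <= x1" "0 <= x2"
    using x N by (smt (verit) mult_nonneg_nonpos)+
  have qe: "q * ?N * \<eta> <= ?N * t" using mult_left_mono[OF \<eta>(2), of ?N] N by (simp add: mult_ac)
  have sumH: "(\<Sum>y\<in>carrier G - C. g y) <= ?N * c" if "\<And>y. y \<in> carrier G ==> g y <= c" "0 <= c" for g C and c :: real
  proof -
    have "(\<Sum>y\<in>carrier G - C. g y) <= (\<Sum>y\<in>carrier G - C. c)" using that by (intro sum_mono) auto
    also have "\<dots> <= (\<Sum>y\<in>carrier G. c)" using that fin by (intro sum_mono2) auto
    finally show ?thesis by (simp add: order_def)
  qed
  let ?T = "t powr (- (?N * (\<delta> * n)))"
  have "(\<Sum>f1\<in>F1. \<Sum>f2\<in>F2. ?A f1 f2 * ?B f1 f2) <= ?T\<^sup>2 * (x1 + 3 * ?N * t) ^ card V1 * (x2 + 3 * ?N * t) ^ card V2"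
  proof (rule double_tilted_sum_le[OF V(1,2) fin C t F1 F2])
    fix f1 f2 assume f: "f1 \<in> F1" "f2 \<in> F2"
    have "columns_prob v p G (\<lambda>z. real z <= \<tau> * real n) f2 V2 f1 V1 <= ?P * (\<Prod>j\<in>V1. wt v p G f2 V2 (1 / a) (f1 j))"
    proof (rule columns_prob_le[OF v' V(2,1)])
      fix z
      show "of_bool (real z <= \<tau> * real n) <= ?P * (1 / a) ^ z"
      proof (cases "real z <= \<tau> * real n")
        case True
        have "a powr real z <= ?P" using a True by (intro powr_mono) auto
        hence "a ^ z <= ?P" using a by (simp add: powr_realpow)
        thus ?thesis using a True by (simp add: power_one_over field_simps)
      qed (use a in simp)
    qed (use a in simp)
    thus "0 <= ?A f1 f2 \<and> ?A f1 f2 <= (\<Prod>j\<in>V1. wt v p G f2 V2 (1 / a) (f1 j))"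
      using P columns_prob_nonneg[OF v'] by (simp add: field_simps)
    have "f2 j \<in> carrier G" if "j \<in> V2" for j using PiE_mem[OF conjunct1[OF F2[OF f(2)]] that] .
    thus "0 <= ?B f1 f2 \<and> ?B f1 f2 <= (\<Prod>j\<in>V2. g2 (f2 j))"
      using B[OF f(1)] v' by (auto intro!: prod_nonneg prod_mono wt_nonneg)
  next
    fix f2 y assume "f2 \<in> F2" "y \<in> carrier G"
    show "0 <= wt v p G f2 V2 (1 / a) y" using v' a by (intro wt_nonneg) auto
  next
    fix y assume "y \<in> carrier G" thus "0 <= g2 y" using g2 by blast
  next
    fix f2 assume f2: "f2 \<in> F2"
    have "(\<Sum>y\<in>carrier G - C1. wt v p G f2 V2 (1 / a) y) <= ?N * 1"
      using a by (intro sumH wt_le_1[OF v' V(2)]) auto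
    hence "t * (\<Sum>y\<in>carrier G - C1. wt v p G f2 V2 (1 / a) y) <= t * (?N * 1)" using t by (intro mult_left_mono) auto
    moreover have "0 <= t * ?N" using t by simp
    ultimately show "(\<Sum>y\<in>C1. wt v p G f2 V2 (1 / a) y) + t * (\<Sum>y\<in>carrier G - C1. wt v p G f2 V2 (1 / a) y) <= x1 + 3 * ?N * t"
      using s1[OF f2] qe by (simp add: mult_ac)
  next
    have "(\<Sum>y\<in>carrier G - C2. g2 y) <= ?N * 2" using g2 by (intro sumH) auto
    hence "t * (\<Sum>y\<in>carrier G - C2. g2 y) <= t * (?N * 2)" using t by (intro mult_left_mono) auto
    thus "(\<Sum>y\<in>C2. g2 y) + t * (\<Sum>y\<in>carrier G - C2. g2 y) <= x2 + 3 * ?N * t"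
      using s2 qe by (simp add: mult_ac)
  next
    show "0 <= x1 + 3 * ?N * t" using xp t by simp
  qed
  also have "\<dots> <= ?T\<^sup>2 * (x1 * (1 + 3 * ?N\<^sup>2 * t)) ^ n * (x2 * (1 + 3 * ?N\<^sup>2 * t)) ^ m"
  proof -
    have le: "x + 3 * ?N * t <= x * (1 + 3 * ?N\<^sup>2 * t)" if "1 <= ?N * x" for x
      using mult_right_mono[OF that, of "3 * ?N * t"] t by (simp add: power2_eq_square algebra_simps)
    show ?thesis unfolding V(3,4) using le[OF x(1)] le[OF x(2)] xp t
      by (intro mult_mono power_mono mult_nonneg_nonneg) auto
  qed
  also have "\<dots> = ?T\<^sup>2 * (x1 ^ n * x2 ^ m) * ((1 + 3 * ?N\<^sup>2 * t) ^ n * (1 + 3 * ?N\<^sup>2 * t) ^ m)" by (simp only: power_mult_distrib mult_ac)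
  also have "\<dots> <= ?T\<^sup>2 * (x1 ^ n * x2 ^ m) * ((1 + 3 * ?N\<^sup>2 * t) ^ n * (1 + 3 * ?N\<^sup>2 * t) ^ n)"
    using xp t nm by (intro mult_left_mono power_increasing mult_nonneg_nonneg) auto
  finally have "?P * (\<Sum>f1\<in>F1. \<Sum>f2\<in>F2. ?A f1 f2 * ?B f1 f2) <= ?P * (?T\<^sup>2 * (x1 ^ n * x2 ^ m) * ((1 + 3 * ?N\<^sup>2 * t) ^ n * (1 + 3 * ?N\<^sup>2 * t) ^ n))"
    using P by (intro mult_left_mono) auto
  also have "\<dots> = (?P * x1 ^ n * x2 ^ m) * (?T\<^sup>2 * ((1 + 3 * ?N\<^sup>2 * t) ^ n * (1 + 3 * ?N\<^sup>2 * t) ^ n))" by (simp only: mult_ac)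
  also have "\<dots> <= rate ^ n * (?T\<^sup>2 * ((1 + 3 * ?N\<^sup>2 * t) ^ n * (1 + 3 * ?N\<^sup>2 * t) ^ n))"
    using t by (intro mult_right_mono r) auto
  also have "?T\<^sup>2 = (t powr (- (2 * ?N * \<delta>))) ^ n"
  proof -
    have "?T\<^sup>2 = t powr (- (2 * ?N * \<delta>) * n)" unfolding power2_eq_square powr_add[symmetric] by (simp add: mult_ac)
    also have "\<dots> = (t powr (- (2 * ?N * \<delta>))) powr n" by (simp only: powr_powr)
    also have "\<dots> = (t powr (- (2 * ?N * \<delta>))) ^ n" using t by (simp add: powr_realpow)
    finally show ?thesis .
  qed
  also have "rate ^ n * ((t powr (- (2 * ?N * \<delta>))) ^ n * ((1 + 3 * ?N\<^sup>2 * t) ^ n * (1 + 3 * ?N\<^sup>2 * t) ^ n)) = bad_rate ^ n"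
    by (simp add: power_mult_distrib power2_eq_square mult_ac)
  also have "?P * (\<Sum>f1\<in>F1. \<Sum>f2\<in>F2. ?A f1 f2 * ?B f1 f2) = (\<Sum>f1\<in>F1. \<Sum>f2\<in>F2. few_prob n V1 V2 f1 f2)"
    unfolding few_prob_def sum_distrib_left using P by (intro sum.cong refl) simp
  finally show ?thesis .
qed

lemma wt_one_le:
  assumes V': "finite V" "f \<in> V \<rightarrow> carrier G" and K: "subgroup K G" "near_invariant K \<eta> (nu v q G f V)" and y: "y \<in> carrier G"
  shows "wt v p G f V 1 y <= 1 / card K + q * \<eta>"
    and "\<And>i. i \<in> V ==> f i \<otimes> inv y \<notin> K ==> wt v p G f V 1 y <= stay / card K + q * \<eta>"
proof -
  have v': "0 <= v" "v <= 1" using v by auto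
  let ?P = "sub_exp v V (\<lambda>S. of_bool (finprod G f S \<otimes> inv (y [^] card S) \<in> K))"
  have w: "wt v p G f V 1 y <= ?P / card K + q * \<eta>" by (rule wt_le_coset_prob[OF fin v' V' q_pos q(3) K(1) y K(2)])
  have "?P <= sub_exp v V (\<lambda>S. 1)" by (rule sub_exp_mono[OF v']) auto
  hence "?P <= 1" using V'(1) by (simp add: sub_exp_const)
  hence "?P / card K <= 1 / card K" by (rule divide_right_mono) simp
  thus "wt v p G f V 1 y <= 1 / card K + q * \<eta>" using w by linarith
  fix i assume i: "i \<in> V" "f i \<otimes> inv y \<notin> K"
  have "?P <= stay" unfolding stay_def by (rule coset_prob_le_max[OF v' V' K(1) y i])
  hence "?P / card K <= stay / card K" by (rule divide_right_mono) simp
  thus "wt v p G f V 1 y <= stay / card K + q * \<eta>" using w by linarith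
qed

lemma pattern_nonempty:
  assumes "f1 \<in> pat V1 \<Lambda>1" "f2 \<in> pat V2 \<Lambda>2"
  shows "\<Lambda>1 ~= {}" "\<Lambda>2 ~= {}"
proof -
  have "order G * (\<delta> * n) < \<alpha> * n" using mult_strict_right_mono[OF \<delta>(2), of "real n"] nm(3) by (simp add: mult_ac)
  hence "order G * (\<delta> * n) < real m" using nm(1) by linarith
  moreover have "real m <= real n" using nm(2) by simp
  ultimately have b: "order G * (\<delta> * n) < card V1" "order G * (\<delta> * n) < card V2" unfolding V(3,4) by linarith+
  show "\<Lambda>1 ~= {}" using frequent_nonempty[OF fin V(1) patD(2)[OF assms(1)] b(1)] patD(3)[OF assms(1)] by simp
  show "\<Lambda>2 ~= {}" using frequent_nonempty[OF fin V(2) patD(2)[OF assms(2)] b(2)] patD(3)[OF assms(2)] by simp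
qed

lemma pattern_exceptions:
  assumes "f \<in> pat V \<Lambda>" "finite V" "c \<in> \<Lambda>"
  shows "f \<in> V \<rightarrow>\<^sub>E carrier G \<and> real (card {j \<in> V. f j \<notin> (\<lambda>k. c \<otimes> k) ` difference_group G \<Lambda>}) <= order G * (\<delta> * n)"
proof -
  have b: "0 <= \<delta> * n" using \<delta>(1) by simp
  have c: "c \<in> frequent G (\<delta> * n) f V" unfolding patD(3)[OF assms(1)] by (rule assms(3))
  show ?thesis using few_exceptions[OF fin assms(2) patD(2)[OF assms(1)] b c] patD(1)[OF assms(1)] unfolding patD(3)[OF assms(1)] by (rule conjI[rotated])
qed

lemma pattern_subset:
  assumes "f \<in> pat V \<Lambda>" shows "\<Lambda> \<subseteq> carrier G"
  using frequent_subset[of G "\<delta> * n" f V] unfolding patD(3)[OF assms] .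

lemma translate_subset: "subgroup K G ==> c \<in> carrier G ==> (\<lambda>k. c \<otimes> k) ` K \<subseteq> carrier G"
  by (intro image_subsetI) (simp add: subgroup.mem_carrier)

lemma not_in_translate:
  assumes K: "subgroup K G" and c: "c \<in> carrier G" "x \<in> carrier G" "y \<in> (\<lambda>k. c \<otimes> k) ` K" "x \<notin> (\<lambda>k. c \<otimes> k) ` K"
  shows "x \<otimes> inv y \<notin> K"
proof
  assume h: "x \<otimes> inv y \<in> K"
  have yc: "y \<in> carrier G" using translate_subset[OF K c(1)] c(3) by blast
  have "c \<otimes> inv y \<in> K" using mem_translate_iff[OF K c(1) yc] c(3) by simp
  hence "inv (x \<otimes> inv y) \<otimes> (c \<otimes> inv y) \<in> K" by (rule subgroup.m_closed[OF K subgroup.m_inv_closed[OF K h]])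
  moreover have "inv (x \<otimes> inv y) \<otimes> (c \<otimes> inv y) = c \<otimes> inv x"
  proof -
    have "y \<otimes> inv x \<otimes> (inv y \<otimes> c) = inv x \<otimes> c" by (rule cancel_quotient) (use c yc in auto)
    thus ?thesis using c yc by (simp add: inv_mult m_comm)
  qed
  ultimately have "c \<otimes> inv x \<in> K" by (simp only:)
  thus False using mem_translate_iff[OF K c(1,2)] c(4) by simp
qed

lemma card_subgroup_bounds:
  assumes "subgroup K G"
  shows "finite K" "real (card K) \<ge> 1" "real (card K) <= order G"
proof -
  show f: "finite K" using subgroup.subset[OF assms] fin by (rule finite_subset)
  have "card K > 0" by (subst card_gt_0_iff) (use f subgroup.one_closed[OF assms] in blast)
  thus "real (card K) \<ge> 1" by simp
  have "card K <= order G" unfolding order_def by (rule card_mono[OF fin subgroup.subset[OF assms]])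
  thus "real (card K) <= order G" by simp
qed

lemma sum_translate_le:
  fixes x :: real
  assumes K: "subgroup K G" and g: "\<And>y. y \<in> (\<lambda>k. c \<otimes> k) ` K ==> g y <= x / card K + q * \<eta>" and x: "0 <= x"
  shows "(\<Sum>y\<in>(\<lambda>k. c \<otimes> k) ` K. g y) <= x + q * order G * \<eta>"
proof -
  note b = card_subgroup_bounds[OF K]
  have "(\<Sum>y\<in>(\<lambda>k. c \<otimes> k) ` K. g y) <= (\<Sum>y\<in>(\<lambda>k. c \<otimes> k) ` K. x / card K + q * \<eta>)" by (rule sum_mono[OF g])
  also have "\<dots> = real (card ((\<lambda>k. c \<otimes> k) ` K)) * (x / card K + q * \<eta>)" by simp
  also have "\<dots> <= real (card K) * (x / card K + q * \<eta>)"
    using card_image_le[OF b(1), of "\<lambda>k. c \<otimes> k"] x \<eta> by (intro mult_right_mono) auto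
  also have "\<dots> = x + real (card K) * (q * \<eta>)" using b(2) by (simp add: distrib_left)
  also have "\<dots> <= x + order G * (q * \<eta>)" using b(3) \<eta> by (intro add_left_mono mult_right_mono) auto
  finally show ?thesis by (simp add: mult_ac)
qed

lemma stay_rate: "stay ^ n <= rate ^ n" "stay ^ m <= rate ^ n"
proof -
  have sr: "stay powr \<alpha> <= rate" unfolding rate_def
    using stay alpha_pos by (intro max.coboundedI2 powr_mono2) auto
  have "stay powr 1 <= stay powr \<alpha>" using stay \<tau> by (intro powr_mono') auto
  thus "stay ^ n <= rate ^ n" using sr stay by (intro power_mono) auto
  have "stay ^ m = stay powr m" using stay by (simp add: powr_realpow)
  also have "\<dots> <= stay powr (\<alpha> * n)" using stay nm by (intro powr_mono') auto
  also have "\<dots> = (stay powr \<alpha>) ^ n" using stay by (simp add: powr_powr flip: powr_realpow)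
  also have "\<dots> <= rate ^ n" using sr by (intro power_mono) auto
  finally show "stay ^ m <= rate ^ n" .
qed

lemma pattern_inv:
  shows "f \<in> pat V1 \<Lambda> ==> near_invariant (difference_group G \<Lambda>) \<eta> (nu v q G f V1)"
    and "f \<in> pat V2 \<Lambda> ==> near_invariant (difference_group G \<Lambda>) \<eta> (nu v q G f V2)"
proof -
  assume f: "f \<in> pat V1 \<Lambda>"
  show "near_invariant (difference_group G \<Lambda>) \<eta> (nu v q G f V1)"
    using inv1[OF patD(2)[OF f]] unfolding patD(3)[OF f] .
next
  assume f: "f \<in> pat V2 \<Lambda>"
  show "near_invariant (difference_group G \<Lambda>) \<eta> (nu v q G f V2)"
    using inv2[OF patD(2)[OF f]] unfolding patD(3)[OF f] .
qed

lemma qe_le: "q * \<eta> <= 1" "0 <= q * \<eta>"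
  using \<eta> t by auto

lemma inv_card_le_1: "subgroup K G ==> 0 <= x ==> x <= 1 ==> x / card K <= 1"
  using card_subgroup_bounds(2)[of K] by (simp add: divide_le_eq_1)

text \<open>
  With the tilt \<open>1 / a\<close>, both cases for the in-degree contribute equally to a vertex of the first side. On the second side a label
  outside the first coset loses a factor \<open>stay\<close>.
\<close>

lemma pattern_sum_different:
  assumes ne: "difference_group G \<Lambda>1 ~= difference_group G \<Lambda>2"
  shows "(\<Sum>f1\<in>pat V1 \<Lambda>1. \<Sum>f2\<in>pat V2 \<Lambda>2. few_prob n V1 V2 f1 f2) <= bad_rate ^ n"
proof (cases "pat V1 \<Lambda>1 = {} \<or> pat V2 \<Lambda>2 = {}")
  case True
  thus ?thesis using t rate(1) by auto
next
  case False
  then obtain h1 h2 where h: "h1 \<in> pat V1 \<Lambda>1" "h2 \<in> pat V2 \<Lambda>2" by blast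
  obtain c1 c2 where c: "c1 \<in> \<Lambda>1" "c2 \<in> \<Lambda>2" using pattern_nonempty[OF h] by blast
  let ?K1 = "difference_group G \<Lambda>1" and ?K2 = "difference_group G \<Lambda>2"
  have K: "subgroup ?K1 G" "subgroup ?K2 G" using pattern_subset[OF h(1)] pattern_subset[OF h(2)] by (auto intro: subgroup_difference_group)
  have cc: "c1 \<in> carrier G" "c2 \<in> carrier G" using c pattern_subset[OF h(1)] pattern_subset[OF h(2)] by blast+
  let ?D = "?K1 \<inter> ?K2"
  have D: "subgroup ?D G" by (rule subgroups_Inter_pair[OF K])
  note b1 = card_subgroup_bounds[OF K(1)] and b2 = card_subgroup_bounds[OF K(2)] and bD = card_subgroup_bounds[OF D]
  define k1 k2 d where "k1 = real (card ?K1)" and "k2 = real (card ?K2)" and "d = real (card ?D)"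
  have pos: "1 <= k1" "1 <= k2" "1 <= d" "k1 <= order G" "k2 <= order G" unfolding k1_def k2_def d_def using b1 b2 bD by auto
  have le: "d <= k1" "d <= k2" unfolding k1_def k2_def d_def using card_mono[OF b1(1), of ?D] card_mono[OF b2(1), of ?D] by auto
  let ?a = "k1 / d" and ?b = "k2 / d"
  have ab: "?a = 1 \<and> 2 <= ?b \<or> 2 <= ?a \<and> 1 <= ?b"
  proof (cases "?D = ?K1")
    case True
    hence "?D \<subset> ?K2" using ne by blast
    hence "2 * card ?D <= card ?K2" by (rule card_proper_subgroup[OF b2(1) D K(2)])
    hence "2 * d <= k2" unfolding d_def k2_def by linarith
    moreover have "k1 = d" unfolding k1_def d_def using True by simp
    ultimately show ?thesis using pos by (simp add: field_simps)
  next
    case False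
    hence "?D \<subset> ?K1" by blast
    hence "2 * card ?D <= card ?K1" by (rule card_proper_subgroup[OF b1(1) D K(1)])
    hence "2 * d <= k1" unfolding d_def k1_def by linarith
    thus ?thesis using pos le by (simp add: field_simps)
  qed
  let ?C1 = "(\<lambda>k. c1 \<otimes> k) ` ?K1" and ?C2 = "(\<lambda>k. c2 \<otimes> k) ` ?K2"
  let ?g = "\<lambda>y. (if y \<in> ?C1 then 1 else stay) / k1 + q * \<eta>"
  have v': "0 <= v" "v <= 1" using v by auto
  show ?thesis
  proof (rule pattern_sum_le[where ?C1.0 = ?C1 and ?C2.0 = ?C2 and a = ?a and ?g2.0 = ?g and ?x1.0 = "1 / ?b" and ?x2.0 = "(1 + stay * (?b - 1)) / ?a"])
    show "?C1 \<subseteq> carrier G" "?C2 \<subseteq> carrier G" using translate_subset K cc by auto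
    show "f \<in> V1 \<rightarrow>\<^sub>E carrier G \<and> real (card {j \<in> V1. f j \<notin> ?C1}) <= order G * (\<delta> * n)" if "f \<in> pat V1 \<Lambda>1" for f
      by (rule pattern_exceptions[OF that V(1) c(1)])
    show "f \<in> V2 \<rightarrow>\<^sub>E carrier G \<and> real (card {j \<in> V2. f j \<notin> ?C2}) <= order G * (\<delta> * n)" if "f \<in> pat V2 \<Lambda>2" for f
      by (rule pattern_exceptions[OF that V(2) c(2)])
    show a1: "1 <= ?a" using pos le by simp
    show "0 <= ?g y \<and> ?g y <= 2" for y
    proof -
      have "1 / k1 <= 1" "stay / k1 <= 1" "0 <= 1 / k1" "0 <= stay / k1" using pos stay by (simp_all add: divide_le_eq_1)
      thus ?thesis using qe_le by (cases "y \<in> ?C1") simp_all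
    qed
    show "wt v p G f1 V1 1 y <= ?g y" if f1: "f1 \<in> pat V1 \<Lambda>1" and y: "y \<in> carrier G" for f1 y
    proof (cases "y \<in> ?C1")
      case True
      thus ?thesis using wt_one_le(1)[OF V(1) patD(2)[OF f1] K(1) pattern_inv(1)[OF f1] y] unfolding k1_def by simp
    next
      case False
      have "c1 \<in> frequent G (\<delta> * n) f1 V1" using c(1) patD(3)[OF f1] by simp
      then obtain i where i: "i \<in> V1" "f1 i = c1" using \<delta>(1) nm(3) by (elim frequent_value) auto
      have "f1 i \<otimes> inv y \<notin> ?K1" using False mem_translate_iff[OF K(1) cc(1) y] i(2) by simp
      thus ?thesis using wt_one_le(2)[OF V(1) patD(2)[OF f1] K(1) pattern_inv(1)[OF f1] y i(1)] False unfolding k1_def by simp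
    qed
    show "(\<Sum>y\<in>?C1. wt v p G f2 V2 (1 / ?a) y) <= 1 / ?b + q * order G * \<eta>" if f2: "f2 \<in> pat V2 \<Lambda>2" for f2
    proof -
      have ai: "0 <= 1 / ?a" "1 / ?a <= 1" using pos le by simp_all
      have e: "1 / ?a * card ?K1 = d" "real (card (?K2 \<inter> ?K1)) = d"
        unfolding k1_def[symmetric] using pos by (simp_all add: d_def Int_commute)
      from sum_wt_coset_le[OF fin v' V(2) patD(2)[OF f2] p q K(2,1) cc(1) ai pattern_inv(2)[OF f2] \<eta>(1)]
      show ?thesis unfolding e k2_def[symmetric] by simp
    qed
    show "(\<Sum>y\<in>?C2. ?g y) <= (1 + stay * (?b - 1)) / ?a + q * order G * \<eta>"
    proof -
      have finC: "finite ?C2" using b2(1) by simp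
      define i z where "i = real (card (?C2 \<inter> ?C1))" and "z = real (card ?C2)"
      have i: "i <= d" unfolding i_def d_def using card_translate_inter_le[OF fin K cc] by (simp add: Int_commute)
      have z: "z <= k2" unfolding z_def k2_def using card_image_le[OF b2(1)] by simp
      have iz: "real (card (?C2 - ?C1)) = z - i" unfolding i_def z_def
        using card_Diff_subset_Int[of ?C2 ?C1] finC card_mono[OF finC, of "?C2 \<inter> ?C1"] by (simp add: of_nat_diff)
      have "(\<Sum>y\<in>?C2. ?g y) = (\<Sum>y\<in>?C2. if y \<in> ?C1 then 1 else stay) / k1 + z * (q * \<eta>)"
        unfolding z_def by (simp add: sum.distrib sum_divide_distrib)
      also have "(\<Sum>y\<in>?C2. if y \<in> ?C1 then 1 else stay) = i + stay * (z - i)"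
      proof -
        have sp: "?C2 \<inter> {y. y \<in> ?C1} = ?C2 \<inter> ?C1" "?C2 \<inter> - {y. y \<in> ?C1} = ?C2 - ?C1" by blast+
        have "(\<Sum>y\<in>?C2. if y \<in> ?C1 then 1 else stay) = real (card (?C2 \<inter> ?C1)) + real (card (?C2 - ?C1)) * stay"
          unfolding sum.If_cases[OF finC] sp by (simp only: sum_constant mult_1_right)
        thus ?thesis unfolding iz i_def[symmetric] by simp
      qed
      also have "\<dots> / k1 <= ((1 - stay) * d + stay * k2) / k1"
      proof (rule divide_right_mono)
        have "(1 - stay) * i <= (1 - stay) * d" "stay * z <= stay * k2" using i z stay by (auto intro!: mult_left_mono)
        thus "i + stay * (z - i) <= (1 - stay) * d + stay * k2" by (simp add: algebra_simps)
      qed (use pos in simp)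
      also have "((1 - stay) * d + stay * k2) / k1 = (1 + stay * (?b - 1)) / ?a" using pos by (simp add: field_simps)
      also have "z * (q * \<eta>) <= order G * (q * \<eta>)" using z pos qe_le by (intro mult_right_mono) auto
      finally show ?thesis by (simp add: mult_ac)
    qed
    show "1 <= order G * (1 / ?b)"
    proof -
      have "k2 * 1 <= order G * d" using pos by (intro mult_mono) auto
      thus ?thesis using pos by (simp add: field_simps)
    qed
    show "1 <= order G * ((1 + stay * (?b - 1)) / ?a)"
    proof -
      have "0 <= stay * (?b - 1)" using stay le pos by simp
      hence "order G * d * 1 <= order G * d * (1 + stay * (?b - 1))" using pos by (intro mult_left_mono) auto
      moreover have "k1 * 1 <= order G * d" using pos by (intro mult_mono) auto
      ultimately have "k1 <= order G * d * (1 + stay * (?b - 1))" by linarith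
      thus ?thesis using pos by (simp add: pos_le_divide_eq mult_ac)
    qed
    show "?a powr (\<tau> * n) * (1 / ?b) ^ n * ((1 + stay * (?b - 1)) / ?a) ^ m <= rate ^ n"
      unfolding rate_def by (rule pattern_rate[OF ab]) (use stay \<tau> alpha_pos nm in auto)
  qed
qed

text \<open>
  When both subgroups equal a proper subgroup \<open>K\<close>, all counts balance exactly and nothing decays by itself. A single vertex
  with a label outside the coset \<open>C1\<close> helps: it multiplies the solution probability of every vertex on the other side with
  label in \<open>C1\<close> by \<open>stay\<close>.
\<close>

lemma pattern_sum_same:
  assumes K: "difference_group G \<Lambda>1 = K" "difference_group G \<Lambda>2 = K" "K ~= carrier G" and c1: "c1 \<in> \<Lambda>1"
  defines "C1 \<equiv> (\<lambda>k. c1 \<otimes> k) ` K"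
  shows "(\<Sum>f1\<in>pat V1 \<Lambda>1. \<Sum>f2\<in>{f \<in> pat V2 \<Lambda>2. \<exists>i\<in>V2. f i \<notin> C1}. few_prob n V1 V2 f1 f2) <= bad_rate ^ n" (is ?one)
    and "(\<Sum>f1\<in>{f \<in> pat V1 \<Lambda>1. \<exists>i\<in>V1. f i \<notin> C1}. \<Sum>f2\<in>{f \<in> pat V2 \<Lambda>2. \<forall>i\<in>V2. f i \<in> C1}. few_prob n V1 V2 f1 f2) <= bad_rate ^ n" (is ?two)
proof -
  have "?one \<and> ?two"
  proof (cases "pat V1 \<Lambda>1 = {} \<or> pat V2 \<Lambda>2 = {}")
    case True
    thus ?thesis using t rate(1) by auto
  next
    case False
    then obtain h1 h2 where h: "h1 \<in> pat V1 \<Lambda>1" "h2 \<in> pat V2 \<Lambda>2" by blast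
    obtain c2 where c2: "c2 \<in> \<Lambda>2" using pattern_nonempty[OF h] by blast
    have sK: "subgroup K G" using subgroup_difference_group[OF pattern_subset[OF h(1)]] unfolding K(1) .
    have cc: "c1 \<in> carrier G" "c2 \<in> carrier G" using c1 c2 pattern_subset[OF h(1)] pattern_subset[OF h(2)] by blast+
    let ?C2 = "(\<lambda>k. c2 \<otimes> k) ` K"
    note b = card_subgroup_bounds[OF sK]
    have C: "C1 \<subseteq> carrier G" "?C2 \<subseteq> carrier G" unfolding C1_def using translate_subset[OF sK] cc by auto
    have N2: "2 <= real (order G)"
    proof -
      have "2 * card K <= card (carrier G)"
        by (rule card_proper_subgroup[OF fin sK]) (use subgroup.subset[OF sK] K(3) subgroup_self in auto)
      thus ?thesis using b(2) unfolding order_def by linarith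
    qed
    have "1/2 <= stay" unfolding stay_def by linarith
    hence Ns: "1 <= order G * stay" using mult_mono[of 2 "real (order G)" "1/2" stay] N2 by simp
    have P1: "f \<in> V1 \<rightarrow>\<^sub>E carrier G \<and> real (card {j \<in> V1. f j \<notin> C1}) <= order G * (\<delta> * n)" if "f \<in> pat V1 \<Lambda>1" for f
      using pattern_exceptions[OF that V(1) c1] unfolding K(1) C1_def .
    have P2: "f \<in> V2 \<rightarrow>\<^sub>E carrier G \<and> real (card {j \<in> V2. f j \<notin> ?C2}) <= order G * (\<delta> * n)" if "f \<in> pat V2 \<Lambda>2" for f
      using pattern_exceptions[OF that V(2) c2] unfolding K(2) .
    have w1: "wt v p G f V1 1 y <= 1 / card K + q * \<eta>" "\<And>i. i \<in> V1 ==> f i \<otimes> inv y \<notin> K ==> wt v p G f V1 1 y <= stay / card K + q * \<eta>"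
      if "f \<in> pat V1 \<Lambda>1" "y \<in> carrier G" for f y
      using wt_one_le[OF V(1) patD(2)[OF that(1)] sK pattern_inv(1)[OF that(1), unfolded K(1)] that(2)] by blast+
    have w2: "wt v p G f V2 1 y <= 1 / card K + q * \<eta>" "\<And>i. i \<in> V2 ==> f i \<otimes> inv y \<notin> K ==> wt v p G f V2 1 y <= stay / card K + q * \<eta>"
      if "f \<in> pat V2 \<Lambda>2" "y \<in> carrier G" for f y
      using wt_one_le[OF V(2) patD(2)[OF that(1)] sK pattern_inv(2)[OF that(1), unfolded K(2)] that(2)] by blast+
    have qp: "0 <= q * \<eta>" "1 / card K + q * \<eta> <= 2" "stay / card K + q * \<eta> <= 2" "0 <= stay / card K" "0 <= 1 / real (card K)"
      using inv_card_le_1[OF sK, of 1] inv_card_le_1[OF sK, of stay] stay qe_le by auto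
    have ?one
    proof (rule pattern_sum_le[where ?C1.0 = C1 and ?C2.0 = ?C2 and a = 1 and ?g2.0 = "\<lambda>_. 1 / card K + q * \<eta>" and ?x1.0 = stay and ?x2.0 = 1])
      show "(\<Sum>y\<in>C1. wt v p G f2 V2 (1 / 1) y) <= stay + q * order G * \<eta>" if f2: "f2 \<in> {f \<in> pat V2 \<Lambda>2. \<exists>i\<in>V2. f i \<notin> C1}" for f2
        unfolding C1_def
      proof (rule sum_translate_le[OF sK])
        fix y assume y: "y \<in> (\<lambda>k. c1 \<otimes> k) ` K"
        hence yc: "y \<in> carrier G" using C(1) unfolding C1_def by blast
        obtain i where i: "i \<in> V2" "f2 i \<notin> C1" "f2 \<in> pat V2 \<Lambda>2" using f2 by blast
        have "f2 i \<in> carrier G" using patD(2)[OF i(3)] i(1) by blast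
        from not_in_translate[OF sK cc(1) this y i(2)[unfolded C1_def]]
        show "wt v p G f2 V2 (1 / 1) y <= stay / card K + q * \<eta>" using w2(2)[OF i(3) yc i(1)] by simp
      qed (use stay in simp)
      show "(\<Sum>y\<in>?C2. 1 / card K + q * \<eta>) <= 1 + q * order G * \<eta>" by (rule sum_translate_le[OF sK]) auto
    qed (use P1 P2 C w1(1) qp Ns N2 stay_rate in auto)
    moreover have ?two
    proof (rule pattern_sum_le[where ?C1.0 = C1 and ?C2.0 = C1 and a = 1 and ?g2.0 = "\<lambda>y. (if y \<in> C1 then stay else 1) / card K + q * \<eta>" and ?x1.0 = 1 and ?x2.0 = stay])
      show "(\<Sum>y\<in>C1. wt v p G f2 V2 (1 / 1) y) <= 1 + q * order G * \<eta>" if f2: "f2 \<in> {f \<in> pat V2 \<Lambda>2. \<forall>i\<in>V2. f i \<in> C1}" for f2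
        unfolding C1_def
      proof (rule sum_translate_le[OF sK])
        fix y assume y: "y \<in> (\<lambda>k. c1 \<otimes> k) ` K"
        hence yc: "y \<in> carrier G" using C(1) unfolding C1_def by blast
        show "wt v p G f2 V2 (1 / 1) y <= 1 / card K + q * \<eta>" using w2(1)[OF _ yc] f2 by simp
      qed simp
      show "(\<Sum>y\<in>C1. (if y \<in> C1 then stay else 1) / card K + q * \<eta>) <= stay + q * order G * \<eta>"
        unfolding C1_def by (rule sum_translate_le[OF sK]) (use stay in auto)
      show "f \<in> V2 \<rightarrow>\<^sub>E carrier G \<and> real (card {j \<in> V2. f j \<notin> C1}) <= order G * (\<delta> * n)" if f: "f \<in> {f \<in> pat V2 \<Lambda>2. \<forall>i\<in>V2. f i \<in> C1}" for f
      proof -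
        have "{j \<in> V2. f j \<notin> C1} = {}" using f by blast
        hence "real (card {j \<in> V2. f j \<notin> C1}) = 0" by (simp only: card.empty of_nat_0)
        thus ?thesis using f patD(1) \<delta>(1) by auto
      qed
      show "wt v p G f1 V1 1 y <= (if y \<in> C1 then stay else 1) / card K + q * \<eta>" if f1: "f1 \<in> {f \<in> pat V1 \<Lambda>1. \<exists>i\<in>V1. f i \<notin> C1}" and yc: "y \<in> carrier G" for f1 y
      proof (cases "y \<in> C1")
        case True
        obtain i where i: "i \<in> V1" "f1 i \<notin> C1" "f1 \<in> pat V1 \<Lambda>1" using f1 by blast
        have "f1 i \<in> carrier G" using patD(2)[OF i(3)] i(1) by blast
        from not_in_translate[OF sK cc(1) this True[unfolded C1_def] i(2)[unfolded C1_def]]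
        show ?thesis using w1(2)[OF i(3) yc i(1)] True by simp
      next
        case False
        thus ?thesis using w1(1)[OF _ yc] f1 by simp
      qed
    qed (use P1 C qp Ns N2 stay_rate in auto)
    ultimately show ?thesis by blast
  qed
  thus ?one ?two by blast+
qed

end

lemma sum_of_bool_filter:
  assumes "finite A"
  shows "(\<Sum>x\<in>A. of_bool (P x) * g x) = (\<Sum>x\<in>{x \<in> A. P x}. g x :: real)"
  unfolding sum.inter_filter[OF assms] by (rule sum.cong) auto

lemma (in group) difference_group_carrier: "difference_group G (carrier G) = carrier G"
proof
  show "difference_group G (carrier G) \<subseteq> carrier G" using subgroup.subset[OF subgroup_difference_group[OF subset_refl]] .
  show "carrier G \<subseteq> difference_group G (carrier G)"
  proof
    fix x assume x: "x \<in> carrier G"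
    have "x \<otimes> inv \<one> \<in> difference_group G (carrier G)" unfolding difference_group_def using x by (intro generate.incl) blast
    thus "x \<in> difference_group G (carrier G)" using x by simp
  qed
qed

context comm_group begin

text \<open>
  For a labelling that takes the value 1 this means that its values generate the group.
\<close>

definition spread :: "'i set => 'i set => ('i => 'a) => ('i => 'a) => bool" where
  "spread V1 V2 f1 f2 \<longleftrightarrow> (\<forall>K c. subgroup K G --> c \<in> carrier G --> f1 ` V1 \<union> f2 ` V2 \<subseteq> (\<lambda>k. c \<otimes> k) ` K --> K = carrier G)"

end

context pattern_setup
begin

definition balanced :: "(nat => 'a) => (nat => 'a) => bool" where
  "balanced f1 f2 \<longleftrightarrow> difference_group G (frequent G (\<delta> * real n) f1 V1) = carrier G \<and>
     difference_group G (frequent G (\<delta> * real n) f2 V2) = carrier G"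

lemma finite_PiE_carrier: "finite V ==> finite (V \<rightarrow>\<^sub>E carrier G)"
  using fin by (auto intro: finite_PiE)

lemma sum_pat:
  assumes "finite V"
  shows "(\<Sum>f\<in>V \<rightarrow>\<^sub>E carrier G. h f) = (\<Sum>\<Lambda>\<in>Pow (carrier G). \<Sum>f\<in>pat V \<Lambda>. (h f :: real))"
proof -
  have "(\<lambda>f. frequent G (\<delta> * real n) f V) ` (V \<rightarrow>\<^sub>E carrier G) \<subseteq> Pow (carrier G)"
    by (intro image_subsetI PowI frequent_subset)
  from sum.group[OF finite_PiE_carrier[OF assms] _ this, of h] show ?thesis using fin by (simp add: pat_def)
qed

lemma bad_rate_nonneg: "0 <= bad_rate"
  using t rate(1) by simp

text \<open>
  A spread pair cannot lie in one coset of a proper subgroup, so in the case of equal subgroups some vertex on one of the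
  two sides has a label outside \<open>C1\<close>.
\<close>

lemma unbalanced_pattern_sum:
  "(\<Sum>f1\<in>pat V1 \<Lambda>1. \<Sum>f2\<in>pat V2 \<Lambda>2. of_bool (spread V1 V2 f1 f2 \<and> \<not> balanced f1 f2) * few_prob n V1 V2 f1 f2) <= 2 * bad_rate ^ n"
proof -
  let ?b = "\<lambda>f1 f2. of_bool (spread V1 V2 f1 f2 \<and> \<not> balanced f1 f2) :: real" and ?w = "few_prob n V1 V2"
  have R: "0 <= bad_rate ^ n" using bad_rate_nonneg by (rule zero_le_power)
  have fp: "finite (pat V1 \<Lambda>1)" "finite (pat V2 \<Lambda>2)" using finite_pat V by auto
  consider "difference_group G \<Lambda>1 ~= difference_group G \<Lambda>2"
    | "difference_group G \<Lambda>1 = carrier G" "difference_group G \<Lambda>2 = carrier G"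
    | "difference_group G \<Lambda>1 = difference_group G \<Lambda>2" "difference_group G \<Lambda>1 ~= carrier G" by metis
  thus ?thesis
  proof cases
    case 1
    have "(\<Sum>f1\<in>pat V1 \<Lambda>1. \<Sum>f2\<in>pat V2 \<Lambda>2. ?b f1 f2 * ?w f1 f2) <= (\<Sum>f1\<in>pat V1 \<Lambda>1. \<Sum>f2\<in>pat V2 \<Lambda>2. ?w f1 f2)"
      by (intro sum_mono) (simp add: few_prob_nonneg)
    thus ?thesis using pattern_sum_different[OF 1] R by linarith
  next
    case 2
    have "?b f1 f2 * ?w f1 f2 = 0" if "f1 \<in> pat V1 \<Lambda>1" "f2 \<in> pat V2 \<Lambda>2" for f1 f2
      using 2 patD(3)[OF that(1)] patD(3)[OF that(2)] by (simp add: balanced_def)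
    hence "(\<Sum>f1\<in>pat V1 \<Lambda>1. \<Sum>f2\<in>pat V2 \<Lambda>2. ?b f1 f2 * ?w f1 f2) = 0" by (intro sum.neutral ballI) blast
    thus ?thesis using R by linarith
  next
    case 3
    show ?thesis
    proof (cases "pat V1 \<Lambda>1 = {} \<or> pat V2 \<Lambda>2 = {}")
      case True
      thus ?thesis using R by auto
    next
      case False
      then obtain h1 h2 where h: "h1 \<in> pat V1 \<Lambda>1" "h2 \<in> pat V2 \<Lambda>2" by blast
      obtain c1 where c: "c1 \<in> \<Lambda>1" using pattern_nonempty[OF h] by blast
      let ?K = "difference_group G \<Lambda>1"
      have sK: "subgroup ?K G" by (rule subgroup_difference_group[OF pattern_subset[OF h(1)]])
      have cc: "c1 \<in> carrier G" using c pattern_subset[OF h(1)] by blast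
      let ?C = "(\<lambda>k. c1 \<otimes> k) ` ?K"
      let ?P = "\<lambda>f2. \<exists>i\<in>V2. f2 i \<notin> ?C" and ?Q = "\<lambda>f1. \<exists>i\<in>V1. f1 i \<notin> ?C" and ?R = "\<lambda>f2. \<forall>i\<in>V2. f2 i \<in> ?C"
      have "(\<Sum>f1\<in>pat V1 \<Lambda>1. \<Sum>f2\<in>pat V2 \<Lambda>2. ?b f1 f2 * ?w f1 f2) \<le>
        (\<Sum>f1\<in>pat V1 \<Lambda>1. \<Sum>f2\<in>pat V2 \<Lambda>2. of_bool (?P f2) * ?w f1 f2 + of_bool (?Q f1) * (of_bool (?R f2) * ?w f1 f2))"
      proof (intro sum_mono)
        fix f1 f2
        have "spread V1 V2 f1 f2 ==> ?P f2 \<or> (?Q f1 \<and> ?R f2)"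
        proof (rule ccontr)
          assume s: "spread V1 V2 f1 f2" "\<not> (?P f2 \<or> (?Q f1 \<and> ?R f2))"
          hence "f1 ` V1 \<union> f2 ` V2 \<subseteq> ?C" by blast
          thus False using s(1) sK cc 3(2) unfolding spread_def by blast
        qed
        thus "?b f1 f2 * ?w f1 f2 <= of_bool (?P f2) * ?w f1 f2 + of_bool (?Q f1) * (of_bool (?R f2) * ?w f1 f2)"
          using few_prob_nonneg[of f1 f2] by (cases "spread V1 V2 f1 f2"; cases "?P f2"; cases "?Q f1"; cases "?R f2") simp_all
      qed
      also have "\<dots> = (\<Sum>f1\<in>pat V1 \<Lambda>1. \<Sum>f2\<in>pat V2 \<Lambda>2. of_bool (?P f2) * ?w f1 f2) +
          (\<Sum>f1\<in>pat V1 \<Lambda>1. of_bool (?Q f1) * (\<Sum>f2\<in>pat V2 \<Lambda>2. of_bool (?R f2) * ?w f1 f2))"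
        by (simp only: sum.distrib sum_distrib_left)
      also have "\<dots> <= bad_rate ^ n + bad_rate ^ n"
        unfolding sum_of_bool_filter[OF fp(1)] sum_of_bool_filter[OF fp(2)]
        by (rule add_mono[OF pattern_sum_same[OF refl 3(1)[symmetric] 3(2) c]])
      finally show ?thesis by simp
    qed
  qed
qed

lemma unbalanced_sum:
  "(\<Sum>f1\<in>V1 \<rightarrow>\<^sub>E carrier G. \<Sum>f2\<in>V2 \<rightarrow>\<^sub>E carrier G. of_bool (spread V1 V2 f1 f2 \<and> \<not> balanced f1 f2) * few_prob n V1 V2 f1 f2)
     <= 2 * 4 ^ order G * bad_rate ^ n"
proof -
  let ?h = "\<lambda>f1 f2. of_bool (spread V1 V2 f1 f2 \<and> \<not> balanced f1 f2) * few_prob n V1 V2 f1 f2"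
  let ?Pw = "Pow (carrier G)"
  have "(\<Sum>f1\<in>V1 \<rightarrow>\<^sub>E carrier G. \<Sum>f2\<in>V2 \<rightarrow>\<^sub>E carrier G. ?h f1 f2) =
     (\<Sum>\<Lambda>1\<in>?Pw. \<Sum>f1\<in>pat V1 \<Lambda>1. \<Sum>\<Lambda>2\<in>?Pw. \<Sum>f2\<in>pat V2 \<Lambda>2. ?h f1 f2)"
    by (simp only: sum_pat[OF V(1)] sum_pat[OF V(2)])
  also have "\<dots> = (\<Sum>\<Lambda>1\<in>?Pw. \<Sum>\<Lambda>2\<in>?Pw. \<Sum>f1\<in>pat V1 \<Lambda>1. \<Sum>f2\<in>pat V2 \<Lambda>2. ?h f1 f2)"
    by (rule sum.cong[OF refl], rule sum.swap)
  also have "\<dots> <= (\<Sum>\<Lambda>1\<in>?Pw. \<Sum>\<Lambda>2\<in>?Pw. 2 * bad_rate ^ n)" by (intro sum_mono unbalanced_pattern_sum)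
  also have "\<dots> = real (card ?Pw) * (real (card ?Pw) * (2 * bad_rate ^ n))" by (simp only: sum_constant)
  also have "real (card ?Pw) = 2 ^ order G" using fin by (simp add: card_Pow order_def)
  also have "(2 :: real) ^ order G * (2 ^ order G * (2 * bad_rate ^ n)) = 2 * 4 ^ order G * bad_rate ^ n"
  proof -
    have "(4 :: real) ^ order G = 2 ^ order G * 2 ^ order G" by (simp flip: power_mult_distrib)
    thus ?thesis by (simp only: mult_ac)
  qed
  finally show ?thesis .
qed

lemma infrequent_count:
  assumes V': "finite V" and y: "y \<in> carrier G"
  shows "real (card {f \<in> V \<rightarrow>\<^sub>E carrier G. y \<notin> frequent G (\<delta> * n) f V}) <= t powr (- (\<delta> * n)) * (real (order G) - 1 + t) ^ card V"
proof -
  let ?A = "{f. f \<in> V \<rightarrow>\<^sub>E carrier G \<and> real (card {j \<in> V. f j \<notin> carrier G - {y}}) <= \<delta> * n}"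
  have finA: "finite ?A" by (rule finite_subset[OF _ finite_PiE_carrier[OF V']]) blast
  have "{f \<in> V \<rightarrow>\<^sub>E carrier G. y \<notin> frequent G (\<delta> * n) f V} \<subseteq> ?A"
  proof (intro subsetI CollectI conjI)
    fix f assume f: "f \<in> {f \<in> V \<rightarrow>\<^sub>E carrier G. y \<notin> frequent G (\<delta> * n) f V}"
    thus "f \<in> V \<rightarrow>\<^sub>E carrier G" by blast
    have "{j \<in> V. f j \<notin> carrier G - {y}} = {j \<in> V. f j = y}" using f y by (auto simp: PiE_iff)
    thus "real (card {j \<in> V. f j \<notin> carrier G - {y}}) <= \<delta> * n" using f y by (simp add: frequent_def)
  qed
  hence "card {f \<in> V \<rightarrow>\<^sub>E carrier G. y \<notin> frequent G (\<delta> * n) f V} <= card ?A" by (rule card_mono[OF finA])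
  hence "real (card {f \<in> V \<rightarrow>\<^sub>E carrier G. y \<notin> frequent G (\<delta> * n) f V}) <= real (card ?A)" by simp
  also have "real (card ?A) = (\<Sum>f\<in>?A. \<Prod>j\<in>V. 1)" by simp
  also have "\<dots> <= t powr (- (\<delta> * n)) * ((\<Sum>z\<in>carrier G - {y}. 1) + t * (\<Sum>z\<in>carrier G - (carrier G - {y}). 1)) ^ card V"
    by (rule tilted_sum_le[OF V' fin _ _ t, of _ "\<lambda>_. 1" "\<delta> * n"]) auto
  also have "(\<Sum>z\<in>carrier G - {y}. (1::real)) = real (order G) - 1"
    using y fin order_pos by (simp add: order_def card_Diff_singleton of_nat_diff)
  also have "carrier G - (carrier G - {y}) = {y}" using y by blast
  finally show ?thesis by simp
qed

lemma unbalanced_count: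
  assumes t2: "t <= 1/2"
  shows "real (card {(f1, f2) \<in> (V1 \<rightarrow>\<^sub>E carrier G) \<times> (V2 \<rightarrow>\<^sub>E carrier G). \<not> balanced f1 f2})
     <= real (order G) ^ (n + m) * (2 * real (order G) * (t powr (- \<delta>) * (1 - 1 / (2 * real (order G))) powr \<alpha>) ^ n)"
proof -
  let ?N = "real (order G)" and ?E1 = "V1 \<rightarrow>\<^sub>E carrier G" and ?E2 = "V2 \<rightarrow>\<^sub>E carrier G"
  let ?w = "1 - 1 / (2 * ?N)" and ?T = "t powr (- (\<delta> * n))"
  let ?I = "\<lambda>V y. {f \<in> V \<rightarrow>\<^sub>E carrier G. y \<notin> frequent G (\<delta> * n) f V}"
  have N: "?N \<ge> 1" by (rule order_pos)
  have w: "0 < ?w" "?w < 1" using N by (auto simp: divide_less_eq)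
  have c1: "real (card ?E1) = ?N ^ n" "real (card ?E2) = ?N ^ m" using V by (simp_all add: card_PiE order_def)
  have cI: "real (card (?I V y)) <= ?T * (?N * ?w) ^ card V" if V': "finite V" and "y \<in> carrier G" for V y
  proof -
    have "real (card (?I V y)) <= ?T * (real (order G) - 1 + t) ^ card V" by (rule infrequent_count[OF that])
    also have "\<dots> <= ?T * (?N * ?w) ^ card V"
    proof (intro mult_left_mono power_mono)
      have "?N * ?w = ?N - 1 / 2" using N by (simp add: right_diff_distrib)
      thus "?N - 1 + t <= ?N * ?w" using t2 by linarith
    qed (use N t in auto)
    finally show ?thesis .
  qed
  have sub: "{(f1, f2) \<in> ?E1 \<times> ?E2. \<not> balanced f1 f2} \<subseteq> (\<Union>y\<in>carrier G. ?I V1 y \<times> ?E2 \<union> ?E1 \<times> ?I V2 y)"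
  proof
    fix x assume x: "x \<in> {(f1, f2) \<in> ?E1 \<times> ?E2. \<not> balanced f1 f2}"
    obtain f1 f2 where f: "x = (f1, f2)" "f1 \<in> ?E1" "f2 \<in> ?E2" "\<not> balanced f1 f2" using x by blast
    have "frequent G (\<delta> * n) f1 V1 ~= carrier G \<or> frequent G (\<delta> * n) f2 V2 ~= carrier G"
      using f(4) difference_group_carrier unfolding balanced_def by metis
    moreover have "frequent G (\<delta> * n) f1 V1 \<subseteq> carrier G" "frequent G (\<delta> * n) f2 V2 \<subseteq> carrier G" by (rule frequent_subset)+
    ultimately obtain y where "y \<in> carrier G" "y \<notin> frequent G (\<delta> * n) f1 V1 \<or> y \<notin> frequent G (\<delta> * n) f2 V2" by blast
    thus "x \<in> (\<Union>y\<in>carrier G. ?I V1 y \<times> ?E2 \<union> ?E1 \<times> ?I V2 y)" using f by (intro UN_I[of y]) auto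
  qed
  have fI: "finite (?I V y)" if "finite V" for V y by (rule finite_subset[OF _ finite_PiE_carrier[OF that]]) blast
  have "card {(f1, f2) \<in> ?E1 \<times> ?E2. \<not> balanced f1 f2} <= card (\<Union>y\<in>carrier G. ?I V1 y \<times> ?E2 \<union> ?E1 \<times> ?I V2 y)"
    by (intro card_mono[OF _ sub] finite_UN_I[OF fin] finite_UnI finite_cartesian_product fI finite_PiE_carrier V)
  also have "\<dots> <= (\<Sum>y\<in>carrier G. card (?I V1 y \<times> ?E2 \<union> ?E1 \<times> ?I V2 y))" by (rule card_UN_le[OF fin])
  also have "\<dots> <= (\<Sum>y\<in>carrier G. card (?I V1 y \<times> ?E2) + card (?E1 \<times> ?I V2 y))" by (rule sum_mono, rule card_Un_le)
  finally have "real (card {(f1, f2) \<in> ?E1 \<times> ?E2. \<not> balanced f1 f2}) <= real (\<Sum>y\<in>carrier G. card (?I V1 y \<times> ?E2) + card (?E1 \<times> ?I V2 y))"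
    by (simp only: of_nat_le_iff)
  also have "\<dots> = (\<Sum>y\<in>carrier G. real (card (?I V1 y)) * ?N ^ m + ?N ^ n * real (card (?I V2 y)))"
    by (simp only: of_nat_sum of_nat_add of_nat_mult card_cartesian_product c1)
  also have "\<dots> <= (\<Sum>y\<in>carrier G. ?T * (?N * ?w) ^ n * ?N ^ m + ?N ^ n * (?T * (?N * ?w) ^ m))"
  proof (intro sum_mono add_mono mult_right_mono mult_left_mono)
    fix y assume "y \<in> carrier G"
    thus "real (card (?I V1 y)) <= ?T * (?N * ?w) ^ n" "real (card (?I V2 y)) <= ?T * (?N * ?w) ^ m"
      using cI[OF V(1), of y] cI[OF V(2), of y] unfolding V(3,4) by blast+
  qed (use N in auto)
  also have "\<dots> = ?N * (?N ^ (n + m) * (?T * (?w ^ n + ?w ^ m)))"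
  proof -
    have "c * (T * (b * w) ^ n * b ^ m + b ^ n * (T * (b * w) ^ m)) = c * (b ^ (n + m) * (T * (w ^ n + w ^ m)))" for b c T w :: real
      by (simp add: power_add power_mult_distrib algebra_simps)
    thus ?thesis by (simp only: sum_constant order_def[symmetric])
  qed
  also have "\<dots> <= ?N * (?N ^ (n + m) * (?T * (2 * (?w powr \<alpha>) ^ n)))"
  proof (intro mult_left_mono)
    have "?w ^ m = ?w powr m" using w by (simp only: powr_realpow)
    also have "\<dots> <= ?w powr (\<alpha> * n)" using w nm by (intro powr_mono') auto
    also have "\<dots> = (?w powr \<alpha>) powr n" by (simp only: powr_powr)
    also have "\<dots> = (?w powr \<alpha>) ^ n" by (rule powr_realpow) (use w in simp)
    finally have "?w ^ m <= (?w powr \<alpha>) ^ n" .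
    moreover have "?w ^ n <= ?w ^ m" using w nm by (intro power_decreasing) auto
    ultimately show "?w ^ n + ?w ^ m <= 2 * (?w powr \<alpha>) ^ n" by linarith
  qed (use N in auto)
  also have "?T = (t powr (- \<delta>)) ^ n"
  proof -
    have "?T = t powr (- \<delta> * n)" by simp
    also have "\<dots> = (t powr (- \<delta>)) powr n" by (simp only: powr_powr)
    also have "\<dots> = (t powr (- \<delta>)) ^ n" by (rule powr_realpow) (use t in simp)
    finally show ?thesis .
  qed
  finally show ?thesis by (simp add: power_mult_distrib mult_ac)
qed

end

section \<open>Maps whose frequent values generate\<close>

lemma prod_near_bounds:
  fixes w :: "'i => real"
  assumes "finite V" "\<And>j. j \<in> V ==> lo <= w j \<and> w j <= hi" "0 <= lo"
  shows "lo ^ card V <= (\<Prod>j\<in>V. w j)" "(\<Prod>j\<in>V. w j) <= hi ^ card V"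
proof -
  have "(\<Prod>j\<in>V. lo) <= (\<Prod>j\<in>V. w j)" by (rule prod_mono) (use assms in auto)
  thus "lo ^ card V <= (\<Prod>j\<in>V. w j)" by simp
  have "(\<Prod>j\<in>V. w j) <= (\<Prod>j\<in>V. hi)" by (rule prod_mono) (use assms in force)
  thus "(\<Prod>j\<in>V. w j) <= hi ^ card V" by simp
qed

definition tilted_degree :: "real => nat => 'i set => real => real" where
  "tilted_degree v p V s = sub_exp v V (\<lambda>S. if p dvd card S then s else 1)"

lemma many_tilt:
  fixes s \<tau> :: real
  assumes s: "1 <= s"
  shows "of_bool (\<not> real z <= \<tau> * real n) <= s powr (- (\<tau> * n)) * s ^ z"
proof (cases "real z <= \<tau> * real n")
  case False
  have "s powr (\<tau> * n) <= s powr real z" using s False by (intro powr_mono) auto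
  hence "s powr (\<tau> * n) <= s ^ z" using s by (simp add: powr_realpow)
  thus ?thesis using s False by (simp add: powr_minus field_simps)
qed (use s in simp)

context pattern_setup
begin

lemma v01: "0 <= v" "v <= 1"
  using v by auto

lemma balanced_spread:
  assumes f: "f1 \<in> V1 \<rightarrow>\<^sub>E carrier G" "f2 \<in> V2 \<rightarrow>\<^sub>E carrier G" and b: "balanced f1 f2"
  shows "spread V1 V2 f1 f2"
  unfolding spread_def
proof (intro allI impI)
  fix K c assume K: "subgroup K G" and c: "c \<in> carrier G" and s: "f1 ` V1 \<union> f2 ` V2 \<subseteq> (\<lambda>k. c \<otimes> k) ` K"
  let ?L = "frequent G (\<delta> * real n) f1 V1"
  have pos: "0 < \<delta> * real n" using \<delta>(1) nm(3) by simp
  have "{l \<otimes> inv l' |l l'. l \<in> ?L \<and> l' \<in> ?L} \<subseteq> K"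
  proof
    fix x assume "x \<in> {l \<otimes> inv l' |l l'. l \<in> ?L \<and> l' \<in> ?L}"
    then obtain l l' where x: "x = l \<otimes> inv l'" "l \<in> ?L" "l' \<in> ?L" by blast
    have lc: "l \<in> carrier G" "l' \<in> carrier G" using x(2,3) by (auto simp: frequent_def)
    have "z \<in> (\<lambda>k. c \<otimes> k) ` K" if zL: "z \<in> ?L" for z
    proof -
      obtain i where i: "i \<in> V1" "f1 i = z" by (rule frequent_value[OF zL pos])
      have "f1 i \<in> f1 ` V1 \<union> f2 ` V2" by (rule UnI1, rule imageI[OF i(1)])
      from subsetD[OF s this] show ?thesis unfolding i(2) .
    qed
    from this[OF x(2)] this[OF x(3)] have "l \<in> (\<lambda>k. c \<otimes> k) ` K" "l' \<in> (\<lambda>k. c \<otimes> k) ` K" .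
    hence "c \<otimes> inv l \<in> K" "c \<otimes> inv l' \<in> K" using mem_translate_iff[OF K c] lc by simp_all
    hence "inv (c \<otimes> inv l) \<otimes> (c \<otimes> inv l') \<in> K" by (rule subgroup.m_closed[OF K subgroup.m_inv_closed[OF K]])
    moreover have "inv (c \<otimes> inv l) \<otimes> (c \<otimes> inv l') = l \<otimes> inv l'"
      using cancel_quotient[of "inv c" l "inv l'"] c lc by (simp add: inv_mult)
    ultimately show "x \<in> K" unfolding x(1) by (simp only:)
  qed
  hence "difference_group G ?L \<subseteq> K" unfolding difference_group_def by (rule generate_subgroup_incl[OF _ K])
  hence "carrier G \<subseteq> K" using b unfolding balanced_def by simp
  thus "K = carrier G" using subgroup.subset[OF K] by blast
qed

lemma balanced_wt:
  fixes s :: real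
  assumes V': "finite V" "f \<in> V \<rightarrow> carrier G" "near_invariant (carrier G) \<eta> (nu v q G f V)" and y: "y \<in> carrier G" and s: "1 <= s"
  shows "\<bar>wt v p G f V s y - tilted_degree v p V s / real (order G)\<bar> <= q * s * \<eta>"
  using wt_near_uniform[OF fin v01 V'(1,2) q_pos q(3) y _ V'(3), of s] s unfolding tilted_degree_def by (simp add: max_absorb2)

lemma balanced_inv:
  assumes f: "f1 \<in> V1 \<rightarrow>\<^sub>E carrier G" "f2 \<in> V2 \<rightarrow>\<^sub>E carrier G" and b: "balanced f1 f2"
  shows "f1 \<in> V1 \<rightarrow> carrier G" "f2 \<in> V2 \<rightarrow> carrier G"
    "near_invariant (carrier G) \<eta> (nu v q G f1 V1)" "near_invariant (carrier G) \<eta> (nu v q G f2 V2)"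
proof -
  show c: "f1 \<in> V1 \<rightarrow> carrier G" "f2 \<in> V2 \<rightarrow> carrier G" using f by (auto simp: PiE_def)
  show "near_invariant (carrier G) \<eta> (nu v q G f1 V1)" "near_invariant (carrier G) \<eta> (nu v q G f2 V2)"
    using inv1[OF c(1)] inv2[OF c(2)] b unfolding balanced_def by simp_all
qed

text \<open>
  Each factor is \<open>1 / |G|\<close> up to the error \<open>\<eta>\<close>. The part with too many vertices of in-degree divisible by \<open>p\<close> is subtracted
  by a Chernoff bound with parameter \<open>s\<close>.
\<close>

lemma balanced_bounds:
  fixes s :: real
  assumes f: "f1 \<in> V1 \<rightarrow>\<^sub>E carrier G" "f2 \<in> V2 \<rightarrow>\<^sub>E carrier G" and b: "balanced f1 f2" and small: "real q * real (order G) * \<eta> <= 1" and s: "1 <= s"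
  defines "x \<equiv> real q * real (order G) * \<eta>"
  shows "real (order G) ^ (n + m) * few_prob n V1 V2 f1 f2 <= (1 + x) ^ (2 * n)"
    and "(1 - x) ^ (2 * n) - s powr (- (\<tau> * n)) * (tilted_degree v p V2 s + s * x) ^ n * (1 + x) ^ n <= real (order G) ^ (n + m) * few_prob n V1 V2 f1 f2"
proof -
  let ?N = "real (order G)"
  have N: "?N \<ge> 1" by (rule order_pos)
  note bi = balanced_inv[OF f b]
  have x0: "0 <= x" "x <= 1" using small \<eta> N by (auto simp: x_def)
  have td1: "tilted_degree v p V 1 = 1" if "finite V" for V :: "nat set"
    unfolding tilted_degree_def using sub_exp_const[OF that, of v 1] by simp
  have near: "(1 - x) / ?N <= wt v p G f V 1 y \<and> wt v p G f V 1 y <= (1 + x) / ?N"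
    if "finite V" "f \<in> V \<rightarrow> carrier G" "near_invariant (carrier G) \<eta> (nu v q G f V)" "y \<in> carrier G" for f y and V :: "nat set"
  proof -
    have "\<bar>wt v p G f V 1 y - 1 / ?N\<bar> <= q * \<eta>" using balanced_wt[OF that, of 1] td1[OF that(1)] by simp
    moreover have "x / ?N = q * \<eta>" using N by (simp add: x_def)
    ultimately show ?thesis unfolding add_divide_distrib diff_divide_distrib by linarith
  qed
  have fc: "f1 j \<in> carrier G" if "j \<in> V1" for j using bi(1) that by blast
  have fc2: "f2 j \<in> carrier G" if "j \<in> V2" for j using bi(2) that by blast
  define A where "A = columns_prob v p G (\<lambda>z. real z <= \<tau> * real n) f2 V2 f1 V1"
  define A' where "A' = columns_prob v p G (\<lambda>z. \<not> real z <= \<tau> * real n) f2 V2 f1 V1"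
  define P where "P = (\<Prod>j\<in>V1. wt v p G f2 V2 1 (f1 j))"
  define Q where "Q = (\<Prod>j\<in>V2. wt v p G f1 V1 1 (f2 j))"
  have AA: "A + A' = P"
    unfolding A_def A'_def P_def columns_prob_True[OF V(2,1), symmetric] by (rule columns_prob_not[symmetric])
  have A0: "0 <= A" "0 <= A'" unfolding A_def A'_def by (rule columns_prob_nonneg[OF v01])+
  have few: "few_prob n V1 V2 f1 f2 = A * Q" unfolding few_prob_def A_def Q_def ..
  have lo0: "0 <= (1 - x) / ?N" using x0 N by simp
  have Pb: "((1 - x) / ?N) ^ n <= P" "P <= ((1 + x) / ?N) ^ n"
    using prod_near_bounds[OF V(1) near[OF V(2) bi(2,4) fc] lo0] unfolding P_def V(3) by auto
  have Qb: "((1 - x) / ?N) ^ m <= Q" "Q <= ((1 + x) / ?N) ^ m"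
    using prod_near_bounds[OF V(2) near[OF V(1) bi(1,3) fc2] lo0] unfolding Q_def V(4) by auto
  have Q0: "0 <= Q" using Qb(1) zero_le_power[OF lo0, of m] by linarith
  have P0: "0 <= P" using Pb(1) zero_le_power[OF lo0, of n] by linarith
  have scale: "?N ^ (n + m) * ((a / ?N) ^ n * (b / ?N) ^ m) = a ^ n * b ^ m" for a b
    using N by (simp add: power_add power_divide)
  have "?N ^ (n + m) * (A * Q) <= ?N ^ (n + m) * (((1 + x) / ?N) ^ n * ((1 + x) / ?N) ^ m)"
    using AA A0 Pb Qb Q0 P0 N x0 by (intro mult_left_mono mult_mono) auto
  also have "\<dots> = (1 + x) ^ (n + m)" unfolding scale by (simp add: power_add)
  also have "\<dots> <= (1 + x) ^ (2 * n)" using x0 nm by (intro power_increasing) auto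
  finally show "?N ^ (n + m) * few_prob n V1 V2 f1 f2 <= (1 + x) ^ (2 * n)" unfolding few .
  let ?S = "s powr (- (\<tau> * n))" and ?E = "tilted_degree v p V2 s"
  have E0: "0 <= ?E" unfolding tilted_degree_def using s by (intro sub_exp_nonneg[OF v01]) auto
  have "A' <= ?S * (\<Prod>j\<in>V1. wt v p G f2 V2 s (f1 j))"
    unfolding A'_def by (rule columns_prob_le[OF v01 V(2,1) _ many_tilt[OF s]]) (use s in simp)
  also have "\<dots> <= ?S * ((?E + s * x) / ?N) ^ n"
  proof (rule mult_left_mono)
    have "(\<Prod>j\<in>V1. wt v p G f2 V2 s (f1 j)) <= (\<Prod>j\<in>V1. (?E + s * x) / ?N)"
    proof (rule prod_mono)
      fix j assume j: "j \<in> V1"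
      have "\<bar>wt v p G f2 V2 s (f1 j) - ?E / ?N\<bar> <= q * s * \<eta>" by (rule balanced_wt[OF V(2) bi(2,4) fc[OF j] s])
      moreover have "s * x / ?N = q * s * \<eta>" using N by (simp add: x_def)
      moreover have "0 <= wt v p G f2 V2 s (f1 j)" using s by (intro wt_nonneg[OF v01]) simp
      ultimately show "0 <= wt v p G f2 V2 s (f1 j) \<and> wt v p G f2 V2 s (f1 j) <= (?E + s * x) / ?N"
        unfolding add_divide_distrib by linarith
    qed
    thus "(\<Prod>j\<in>V1. wt v p G f2 V2 s (f1 j)) <= ((?E + s * x) / ?N) ^ n" using V(3) by simp
  qed simp
  finally have A'b: "A' <= ?S * ((?E + s * x) / ?N) ^ n" .
  have "?N ^ (n + m) * (A' * Q) <= ?N ^ (n + m) * ((?S * ((?E + s * x) / ?N) ^ n) * ((1 + x) / ?N) ^ m)"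
    using A'b A0 Qb Q0 N E0 x0 s by (intro mult_left_mono mult_mono) auto
  also have "\<dots> = ?S * (?N ^ (n + m) * (((?E + s * x) / ?N) ^ n * ((1 + x) / ?N) ^ m))" by (simp only: mult_ac)
  also have "\<dots> = ?S * ((?E + s * x) ^ n * (1 + x) ^ m)" unfolding scale ..
  also have "\<dots> <= ?S * ((?E + s * x) ^ n * (1 + x) ^ n)"
    using E0 x0 s nm by (intro mult_left_mono power_increasing) auto
  finally have many: "?N ^ (n + m) * (A' * Q) <= ?S * (?E + s * x) ^ n * (1 + x) ^ n" by (simp only: mult.assoc)
  have "(1 - x) ^ (2 * n) <= (1 - x) ^ (n + m)" using x0 nm by (intro power_decreasing) auto
  also have "\<dots> = ?N ^ (n + m) * (((1 - x) / ?N) ^ n * ((1 - x) / ?N) ^ m)" unfolding scale by (simp add: power_add)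
  also have "\<dots> <= ?N ^ (n + m) * (P * Q)" using Pb Qb P0 lo0 N by (intro mult_left_mono mult_mono) auto
  also have "P * Q = A * Q + A' * Q" unfolding AA[symmetric] by (rule distrib_right)
  finally show "(1 - x) ^ (2 * n) - ?S * (?E + s * x) ^ n * (1 + x) ^ n <= ?N ^ (n + m) * few_prob n V1 V2 f1 f2"
    using many unfolding few distrib_left by linarith
qed

abbreviation "normalized1 \<equiv> {f \<in> V1 \<rightarrow>\<^sub>E carrier G. f 0 = \<one>}"

lemma card_normalized1:
  assumes "0 \<in> V1"
  shows "real (order G) * real (card normalized1) = real (order G) ^ n"
proof -
  have "normalized1 = (\<Pi>\<^sub>E i\<in>V1. if i = 0 then {\<one>} else carrier G)" (is "?L = ?R")
  proof (intro equalityI subsetI)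
    fix f assume f: "f \<in> ?L"
    show "f \<in> ?R" by (rule PiE_I) (use f in \<open>auto simp: PiE_def extensional_def\<close>)
  next
    fix f assume f: "f \<in> ?R"
    have v: "f i \<in> (if i = 0 then {\<one>} else carrier G)" if "i \<in> V1" for i using PiE_mem[OF f that] .
    have "f \<in> V1 \<rightarrow>\<^sub>E carrier G"
    proof (rule PiE_I)
      fix i assume "i \<in> V1" thus "f i \<in> carrier G" using v[of i] by (cases "i = 0") auto
    next
      fix i assume "i \<notin> V1" thus "f i = undefined" using PiE_arb[OF f] by simp
    qed
    moreover have "f 0 = \<one>" using v[OF assms] by simp
    ultimately show "f \<in> ?L" by blast
  qed
  hence "card normalized1 = (\<Prod>i\<in>V1. card (if i = 0 then {\<one>} else carrier G))" using card_PiE[OF V(1)] by simp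
  also have "\<dots> = card {\<one>} * (\<Prod>i\<in>V1 - {0}. card (carrier G))"
    unfolding prod.remove[OF V(1) assms] by (intro arg_cong2[of _ _ _ _ "(*)"] prod.cong) auto
  also have "\<dots> = order G ^ (n - 1)" using V(1,3) assms by (simp add: order_def)
  finally have "card normalized1 = order G ^ (n - 1)" .
  moreover have "n = Suc (n - 1)" using nm(3) by simp
  ultimately show ?thesis by (metis of_nat_power power_Suc)
qed

text \<open>
  There are \<open>|G| ^ (n + m - 1)\<close> normalised labellings, almost all of them balanced, and each balanced one has probability
  close to \<open>|G| powr (- (n + m))\<close>.
\<close>

lemma spread_sum_bounds:
  fixes s :: real
  assumes z: "0 \<in> V1" and small: "real q * real (order G) * \<eta> <= 1" and s: "1 <= s" and t2: "t <= 1/2"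
  defines "x \<equiv> real q * real (order G) * \<eta>"
  defines "S \<equiv> (\<Sum>f1\<in>normalized1. \<Sum>f2\<in>V2 \<rightarrow>\<^sub>E carrier G. of_bool (spread V1 V2 f1 f2) * few_prob n V1 V2 f1 f2)"
  shows "S <= (1 + x) ^ (2 * n) / real (order G) + 2 * 4 ^ order G * bad_rate ^ n"
    and "((1 - x) ^ (2 * n) - s powr (- (\<tau> * n)) * (tilted_degree v p V2 s + s * x) ^ n * (1 + x) ^ n) / real (order G)
       - 2 * real (order G) * (t powr (- \<delta>) * (1 - 1 / (2 * real (order G))) powr \<alpha>) ^ n <= S"
proof -
  let ?N = "real (order G)" and ?E1 = "V1 \<rightarrow>\<^sub>E carrier G" and ?E2 = "V2 \<rightarrow>\<^sub>E carrier G" and ?w = "few_prob n V1 V2"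
  have N: "?N \<ge> 1" by (rule order_pos)
  have x0: "0 <= x" "x <= 1" using small \<eta> N by (auto simp: x_def)
  have finE: "finite ?E1" "finite ?E2" by (rule finite_PiE_carrier[OF V(1)], rule finite_PiE_carrier[OF V(2)])
  have finN: "finite normalized1" by (rule finite_subset[OF _ finE(1)]) blast
  have finNE: "finite (normalized1 \<times> ?E2)" using finN finE(2) by (rule finite_cartesian_product)
  have finEE: "finite (?E1 \<times> ?E2)" using finE by (rule finite_cartesian_product)
  let ?B = "{(f1, f2) \<in> normalized1 \<times> ?E2. balanced f1 f2}" and ?U = "{(f1, f2) \<in> normalized1 \<times> ?E2. \<not> balanced f1 f2}"
  have finB: "finite ?B" "finite ?U" by (rule finite_subset[OF _ finNE]; blast)+
  define T where "T = (\<Sum>(f1, f2)\<in>?B. ?w f1 f2)"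
  define R where "R = (\<Sum>(f1, f2)\<in>normalized1 \<times> ?E2. of_bool (spread V1 V2 f1 f2 \<and> \<not> balanced f1 f2) * ?w f1 f2)"
  have "S = (\<Sum>(f1, f2)\<in>normalized1 \<times> ?E2. of_bool (spread V1 V2 f1 f2) * ?w f1 f2)"
    unfolding S_def by (rule sum.cartesian_product)
  also have "\<dots> = (\<Sum>(f1, f2)\<in>normalized1 \<times> ?E2. of_bool (balanced f1 f2) * ?w f1 f2 + of_bool (spread V1 V2 f1 f2 \<and> \<not> balanced f1 f2) * ?w f1 f2)"
  proof (rule sum.cong[OF refl], clarify)
    fix f1 f2 assume f: "f1 \<in> ?E1" "f2 \<in> ?E2"
    show "of_bool (spread V1 V2 f1 f2) * ?w f1 f2 = of_bool (balanced f1 f2) * ?w f1 f2 + of_bool (spread V1 V2 f1 f2 \<and> \<not> balanced f1 f2) * ?w f1 f2"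
      using balanced_spread[OF f] by (cases "balanced f1 f2") auto
  qed
  also have "\<dots> = (\<Sum>x\<in>normalized1 \<times> ?E2. of_bool (balanced (fst x) (snd x)) * ?w (fst x) (snd x)) + R"
    unfolding R_def by (simp add: sum.distrib case_prod_beta)
  also have "(\<Sum>x\<in>normalized1 \<times> ?E2. of_bool (balanced (fst x) (snd x)) * ?w (fst x) (snd x)) = T"
    unfolding T_def sum_of_bool_filter[OF finNE] by (rule sum.cong) (auto simp: case_prod_beta)
  finally have ST: "S = T + R" .
  have R0: "0 <= R" unfolding R_def by (intro sum_nonneg) (auto simp: few_prob_nonneg)
  have RU: "R <= 2 * 4 ^ order G * bad_rate ^ n"
  proof -
    have "R <= (\<Sum>(f1, f2)\<in>?E1 \<times> ?E2. of_bool (spread V1 V2 f1 f2 \<and> \<not> balanced f1 f2) * ?w f1 f2)"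
      unfolding R_def by (rule sum_mono2[OF finEE]) (auto simp: few_prob_nonneg)
    also have "\<dots> = (\<Sum>f1\<in>?E1. \<Sum>f2\<in>?E2. of_bool (spread V1 V2 f1 f2 \<and> \<not> balanced f1 f2) * ?w f1 f2)"
      by (rule sum.cartesian_product[symmetric])
    also have "\<dots> <= 2 * 4 ^ order G * bad_rate ^ n" by (rule unbalanced_sum)
    finally show ?thesis .
  qed
  have cBU: "?N * (real (card ?B) + real (card ?U)) = ?N ^ (n + m)"
  proof -
    have "?B \<union> ?U = normalized1 \<times> ?E2" "?B \<inter> ?U = {}" by blast+
    hence "card (normalized1 \<times> ?E2) = card ?B + card ?U" using card_Un_disjoint[OF finB] by (simp only:)
    hence "real (card normalized1 * card ?E2) = real (card ?B + card ?U)" by (simp only: card_cartesian_product)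
    hence "real (card ?B) + real (card ?U) = real (card normalized1) * real (card ?E2)" by (simp only: of_nat_add of_nat_mult)
    moreover have "real (card ?E2) = ?N ^ m" using V by (simp add: card_PiE order_def)
    ultimately show ?thesis using card_normalized1[OF z] by (simp add: power_add mult.assoc[symmetric])
  qed
  have Np: "?N ^ (n + m) > 0" using N by simp
  have bB: "?N ^ (n + m) * T = (\<Sum>(f1, f2)\<in>?B. ?N ^ (n + m) * ?w f1 f2)" unfolding T_def sum_distrib_left by (simp add: case_prod_beta)
  have "?N ^ (n + m) * T <= (\<Sum>(f1, f2)\<in>?B. (1 + x) ^ (2 * n))"
    unfolding bB
  proof (rule sum_mono, clarify)
    fix f1 f2 assume f: "f1 \<in> ?E1" "f2 \<in> ?E2" "balanced f1 f2"
    show "?N ^ (n + m) * ?w f1 f2 <= (1 + x) ^ (2 * n)" unfolding x_def by (rule balanced_bounds(1)[OF f small order.refl])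
  qed
  also have "\<dots> = real (card ?B) * (1 + x) ^ (2 * n)" by (simp add: case_prod_beta)
  finally have "?N * (?N ^ (n + m) * T) <= ?N * (real (card ?B) * (1 + x) ^ (2 * n))" using N by (intro mult_left_mono) auto
  also have "\<dots> <= ?N ^ (n + m) * (1 + x) ^ (2 * n)"
    unfolding mult.assoc[symmetric] cBU[symmetric] using N x0 by (intro mult_right_mono) (auto simp: distrib_left)
  finally have "?N ^ (n + m) * (?N * T) <= ?N ^ (n + m) * (1 + x) ^ (2 * n)" by (simp only: mult_ac)
  hence "?N * T <= (1 + x) ^ (2 * n)" using Np by simp
  hence "T <= (1 + x) ^ (2 * n) / ?N" using N by (simp add: pos_le_divide_eq mult.commute)
  thus "S <= (1 + x) ^ (2 * n) / real (order G) + 2 * 4 ^ order G * bad_rate ^ n" using ST RU by linarith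
  let ?M = "s powr (- (\<tau> * n)) * (tilted_degree v p V2 s + s * x) ^ n * (1 + x) ^ n"
  let ?L = "(1 - x) ^ (2 * n) - ?M" and ?D = "2 * ?N * (t powr (- \<delta>) * (1 - 1 / (2 * ?N)) powr \<alpha>) ^ n"
  have L1: "?L <= 1"
  proof -
    have "(1 - x) ^ (2 * n) <= 1" using x0 by (intro power_le_one) auto
    moreover have "0 <= ?M" using x0 s by (intro mult_nonneg_nonneg zero_le_power add_nonneg_nonneg) (auto simp: tilted_degree_def intro!: sub_exp_nonneg[OF v01])
    ultimately show ?thesis by linarith
  qed
  have cU: "real (card ?U) <= ?N ^ (n + m) * ?D"
  proof -
    have "card ?U <= card {(f1, f2) \<in> ?E1 \<times> ?E2. \<not> balanced f1 f2}"
      by (rule card_mono[OF finite_subset[OF _ finEE]]) blast+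
    thus ?thesis using unbalanced_count[OF t2] by linarith
  qed
  have "real (card ?B) * ?L = (\<Sum>(f1, f2)\<in>?B. ?L)" by (simp add: case_prod_beta)
  also have "\<dots> <= ?N ^ (n + m) * T"
    unfolding bB
  proof (rule sum_mono, clarify)
    fix f1 f2 assume f: "f1 \<in> ?E1" "f2 \<in> ?E2" "balanced f1 f2"
    show "?L <= ?N ^ (n + m) * ?w f1 f2" unfolding x_def by (rule balanced_bounds(2)[OF f small s])
  qed
  finally have 1: "real (card ?B) * ?L <= ?N ^ (n + m) * T" .
  have "?N ^ (n + m) * (?L / ?N) = real (card ?B) * ?L + real (card ?U) * ?L"
  proof -
    have "c * (b + u) * (l / c) = b * l + u * l" if "c > 0" for b c l u :: real
      using that by (simp add: field_simps)
    moreover have "?N > 0" using N by linarith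
    ultimately show ?thesis unfolding cBU[symmetric] by blast
  qed
  also have "real (card ?U) * ?L <= real (card ?U) * 1" by (rule mult_left_mono[OF L1]) simp
  finally have "?N ^ (n + m) * (?L / ?N) <= ?N ^ (n + m) * T + ?N ^ (n + m) * ?D" using 1 cU by linarith
  hence "?N ^ (n + m) * (?L / ?N - ?D) <= ?N ^ (n + m) * T" by (simp only: right_diff_distrib diff_le_eq)
  hence "?L / ?N - ?D <= T" using Np by (simp only: mult_le_cancel_left_pos)
  thus "?L / ?N - ?D <= S" using ST R0 by linarith
qed

end

section \<open>The limiting moment\<close>

lemma power_div_tendsto_0:
  fixes \<rho> \<alpha> :: real
  assumes \<rho>: "0 < \<rho>" "\<rho> < 1" and p: "p > 0" and \<alpha>: "0 < \<alpha>" and m: "\<And>n. \<alpha> * real n <= real (m n)"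
  shows "(\<lambda>n. \<rho> ^ (m n div p)) \<longlonglongrightarrow> 0"
proof (rule tendsto_sandwich[of "\<lambda>_. 0"])
  let ?r = "\<rho> powr (\<alpha> / p)"
  have r: "0 < ?r" "?r < 1" using \<rho> \<alpha> p powr_less_mono'[of \<rho> 0 "\<alpha> / p"] by auto
  show "\<forall>\<^sub>F n in sequentially. \<rho> ^ (m n div p) <= ?r ^ n / \<rho>"
  proof (rule always_eventually, rule allI)
    fix n
    have "m n < (m n div p + 1) * p" using p dividend_less_div_times[of p "m n"] by (simp add: algebra_simps)
    hence "real (m n) < real ((m n div p + 1) * p)" by (simp only: of_nat_less_iff)
    hence "real (m n) < (real (m n div p) + 1) * real p" by (simp only: of_nat_mult of_nat_add of_nat_1)
    hence "\<alpha> * real n <= (real (m n div p) + 1) * real p" using m[of n] by linarith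
    hence "\<alpha> * real n / real p <= real (m n div p) + 1" using p by (simp only: pos_divide_le_eq of_nat_0_less_iff)
    hence "\<alpha> / p * real n <= real (m n div p) + 1" by simp
    hence "\<rho> powr (real (m n div p) + 1) <= \<rho> powr (\<alpha> / p * real n)" using \<rho> by (intro powr_mono') auto
    also have "\<dots> = ?r powr n" by (simp only: powr_powr)
    also have "\<dots> = ?r ^ n" using r(1) by (rule powr_realpow)
    also have "\<rho> powr (real (m n div p) + 1) = \<rho> ^ (m n div p) * \<rho>" using \<rho> by (simp add: powr_add powr_realpow)
    finally show "\<rho> ^ (m n div p) <= ?r ^ n / \<rho>" using \<rho> by (simp add: pos_le_divide_eq)
  qed
  have "(\<lambda>n. ?r ^ n / \<rho>) \<longlonglongrightarrow> 0 / \<rho>" using r \<rho> by (intro tendsto_divide LIMSEQ_power_zero tendsto_const) auto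
  thus "(\<lambda>n. ?r ^ n / \<rho>) \<longlonglongrightarrow> 0" by simp
  show "\<forall>\<^sub>F n in sequentially. 0 <= \<rho> ^ (m n div p)" using \<rho> by simp
qed simp

lemma tilted_degree_bound:
  fixes v :: real
  assumes v: "0 < v" "v < 1" and p: "p > 0"
  shows "\<exists>\<rho>. 0 < \<rho> \<and> \<rho> < 1 \<and> (\<forall>(V :: 'i set) s. finite V --> 1 <= s -->
    tilted_degree v p V s <= 1 + (s - 1) * (1 / p + \<rho> ^ (card V div p)))"
proof -
  obtain \<rho> where \<rho>: "0 < \<rho>" "\<rho> < 1" "\<And>m e e'. \<bar>binom_residue p v m e - binom_residue p v m e'\<bar> <= \<rho> ^ (m div p)"
    using binom_residue_osc[OF v p] by blast
  have "tilted_degree v p V s <= 1 + (s - 1) * (1 / p + \<rho> ^ (card V div p))" if V: "finite V" and s: "1 <= s" for V :: "'i set" and s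
  proof -
    let ?b = "binom_residue p v (card V)" and ?e = "\<rho> ^ (card V div p)"
    have "tilted_degree v p V s = sub_exp v V (\<lambda>S. 1 + (s - 1) * of_bool ([int (card S) = 0] (mod int p)))"
      unfolding tilted_degree_def
    proof (rule sub_exp_cong)
      fix S
      have "[int (card S) = 0] (mod int p) \<longleftrightarrow> p dvd card S" by (simp add: cong_0_iff)
      thus "(if p dvd card S then s else 1) = 1 + (s - 1) * of_bool ([int (card S) = 0] (mod int p))" by simp
    qed
    also have "\<dots> = 1 + (s - 1) * ?b 0"
      unfolding sub_exp_add sub_exp_cmult sub_exp_const[OF V] sub_exp_card_residue[OF V] ..
    finally have td: "tilted_degree v p V s = 1 + (s - 1) * ?b 0" .
    have "(\<Sum>e<p. ?b (int e)) = (\<Sum>e<p. sub_exp v V (\<lambda>S. of_bool ([int (card S) = int e] (mod int p))))"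
      by (simp only: sub_exp_card_residue[OF V])
    also have "\<dots> = sub_exp v V (\<lambda>S. \<Sum>e<p. of_bool ([int (card S) = int e] (mod int p)))" by (rule sub_exp_sum[symmetric])
    also have "\<dots> = sub_exp v V (\<lambda>S. 1)"
      using sum_residues[OF p, of _ "\<lambda>_. 1"] by (intro sub_exp_cong) simp
    finally have "(\<Sum>e<p. ?b (int e)) = 1" by (simp only: sub_exp_const[OF V])
    moreover have "(\<Sum>e<p. ?b 0) <= (\<Sum>e<p. ?b (int e) + ?e)"
    proof (rule sum_mono)
      fix e show "?b 0 <= ?b (int e) + ?e" using \<rho>(3)[of "card V" 0 "int e"] by linarith
    qed
    ultimately have "real p * ?b 0 <= 1 + real p * ?e" by (simp add: sum.distrib)
    hence "?b 0 <= 1 / p + ?e" using p by (simp add: field_simps)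
    thus ?thesis unfolding td using s by (intro add_left_mono mult_left_mono) auto
  qed
  thus ?thesis using \<rho>(1,2) by blast
qed

lemma times_power_tendsto_0:
  fixes r :: real
  assumes "0 < r" "r < 1"
  shows "(\<lambda>n. real n * r ^ n) \<longlonglongrightarrow> 0"
  using powser_times_n_limit_0[of r] assms by simp

text \<open>
  By \<open>ln s \<ge> 1 - 1 / s\<close> the logarithm is at most \<open>(s - 1) * (1 / p - \<tau> / s)\<close>, negative for \<open>1 < s < \<tau> * p\<close>; the chosen
  \<open>s\<close> is the midpoint.
\<close>

lemma tilt_less_1:
  fixes \<tau> :: real and p :: nat
  assumes p: "p > 0" and \<tau>: "1 / real p < \<tau>"
  defines "s \<equiv> (1 + \<tau> * real p) / 2"
  shows "1 < s" "s powr (- \<tau>) * (1 + (s - 1) / p) < 1"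
proof -
  have tp: "1 < \<tau> * p" using \<tau> p by (simp add: field_simps)
  show s: "1 < s" using tp by (simp add: s_def)
  have st: "s < \<tau> * p" using tp by (simp add: s_def)
  have "ln (1 / s) <= 1 / s - 1" using s by (intro ln_le_minus_one) simp
  hence ls: "1 - 1 / s <= ln s" using s by (simp add: ln_div)
  have \<tau>0: "0 < \<tau>" using \<tau> p by (meson divide_nonneg_nonneg of_nat_0_le_iff order.strict_trans1 zero_le_one)
  have "s powr (- \<tau>) * (1 + (s - 1) / p) <= exp (- \<tau> * ln s) * exp ((s - 1) / p)"
    using s by (intro mult_mono exp_ge_add_one_self) (auto simp: powr_def)
  also have "\<dots> = exp ((s - 1) / p - \<tau> * ln s)" by (simp flip: exp_add)
  also have "\<dots> < exp 0"
  proof -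
    have "\<tau> * (1 - 1 / s) <= \<tau> * ln s" using ls \<tau>0 by (intro mult_left_mono) auto
    moreover have "(s - 1) / p < \<tau> * (1 - 1 / s)"
    proof -
      have "(s - 1) * s < (s - 1) * (\<tau> * p)" using s st by (intro mult_strict_left_mono) auto
      hence "(s - 1) / p < (s - 1) * \<tau> / s" using s p by (simp add: field_simps)
      also have "\<dots> = \<tau> * (1 - 1 / s)" using s by (simp add: field_simps)
      finally show ?thesis .
    qed
    ultimately show ?thesis by simp
  qed
  finally show "s powr (- \<tau>) * (1 + (s - 1) / p) < 1" by simp
qed

lemma many_rate:
  fixes v \<tau> \<alpha> :: real and x :: "nat => real" and V :: "nat => 'i set"
  assumes v: "0 < v" "v < 1" and p: "p > 0" and \<tau>: "1 / real p < \<tau>" and \<alpha>: "0 < \<alpha>"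
    and V: "\<And>n. finite (V n)" "\<And>n. \<alpha> * real n <= real (card (V n))" and x: "\<And>n. 0 <= x n" "x \<longlonglongrightarrow> 0"
  defines "s \<equiv> (1 + \<tau> * real p) / 2"
  shows "(\<lambda>n. s powr (- (\<tau> * n)) * (tilted_degree v p (V n) s + s * x n) ^ n * (1 + x n) ^ n) \<longlonglongrightarrow> 0"
proof -
  have s: "1 < s" "s powr (- \<tau>) * (1 + (s - 1) / p) < 1" unfolding s_def using tilt_less_1[OF p \<tau>] by auto
  obtain \<rho> where \<rho>: "0 < \<rho>" "\<rho> < 1" "\<And>(V :: 'i set) s. finite V ==> 1 <= s ==>
      tilted_degree v p V s <= 1 + (s - 1) * (1 / p + \<rho> ^ (card V div p))"
    using tilted_degree_bound[OF v p] by blast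
  let ?y = "\<lambda>n. s powr (- \<tau>) * (1 + (s - 1) * (1 / p + \<rho> ^ (card (V n) div p)) + s * x n) * (1 + x n)"
  have td0: "0 <= tilted_degree v p (V n) s" for n
    unfolding tilted_degree_def using s v by (intro sub_exp_nonneg) auto
  have e1: "(\<lambda>n. \<rho> ^ (card (V n) div p)) \<longlonglongrightarrow> 0" by (rule power_div_tendsto_0[OF \<rho>(1,2) p \<alpha> V(2)])
  have "?y \<longlonglongrightarrow> s powr (- \<tau>) * (1 + (s - 1) * (1 / p + 0) + s * 0) * (1 + 0)"
    by (intro tendsto_mult tendsto_add tendsto_const e1 x(2))
  hence yl: "?y \<longlonglongrightarrow> s powr (- \<tau>) * (1 + (s - 1) / p)" by simp
  obtain \<kappa> where \<kappa>: "s powr (- \<tau>) * (1 + (s - 1) / p) < \<kappa>" "\<kappa> < 1" using dense[OF s(2)] by blast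
  have "0 < s powr (- \<tau>) * (1 + (s - 1) / p)" using s(1) by (intro mult_pos_pos add_pos_nonneg) auto
  hence \<kappa>0: "0 < \<kappa>" using \<kappa>(1) by linarith
  show ?thesis
  proof (rule tendsto_sandwich[of "\<lambda>_. 0"])
    show "\<forall>\<^sub>F n in sequentially. s powr (- (\<tau> * n)) * (tilted_degree v p (V n) s + s * x n) ^ n * (1 + x n) ^ n <= \<kappa> ^ n"
      using order_tendstoD(2)[OF yl \<kappa>(1)]
    proof eventually_elim
      case (elim n)
      have "s powr (- (\<tau> * n)) = (s powr (- \<tau>)) ^ n"
      proof -
        have "s powr (- (\<tau> * n)) = s powr (- \<tau> * n)" by simp
        also have "\<dots> = (s powr (- \<tau>)) powr n" by (simp only: powr_powr)
        also have "\<dots> = (s powr (- \<tau>)) ^ n" by (rule powr_realpow) (use s in simp)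
        finally show ?thesis .
      qed
      hence "s powr (- (\<tau> * n)) * (tilted_degree v p (V n) s + s * x n) ^ n * (1 + x n) ^ n = (s powr (- \<tau>) * (tilted_degree v p (V n) s + s * x n) * (1 + x n)) ^ n"
        by (simp only: power_mult_distrib)
      also have "\<dots> <= \<kappa> ^ n"
      proof (rule power_mono)
        have "s powr (- \<tau>) * (tilted_degree v p (V n) s + s * x n) * (1 + x n) <= ?y n"
          using \<rho>(3)[OF V(1), of s n] s x(1)[of n] by (intro mult_right_mono mult_left_mono add_right_mono) auto
        thus "s powr (- \<tau>) * (tilted_degree v p (V n) s + s * x n) * (1 + x n) <= \<kappa>" using elim by linarith
        show "0 <= s powr (- \<tau>) * (tilted_degree v p (V n) s + s * x n) * (1 + x n)"
          using td0[of n] s x(1)[of n] by (intro mult_nonneg_nonneg) auto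
      qed
      finally show ?case .
    qed
    show "\<forall>\<^sub>F n in sequentially. 0 <= s powr (- (\<tau> * n)) * (tilted_degree v p (V n) s + s * x n) ^ n * (1 + x n) ^ n"
      using td0 s x(1) by (intro always_eventually allI mult_nonneg_nonneg zero_le_power add_nonneg_nonneg) auto
    show "(\<lambda>n. \<kappa> ^ n) \<longlonglongrightarrow> 0" using \<kappa> \<kappa>0 by (intro LIMSEQ_power_zero) simp
  qed simp
qed

lemma many_prob_tendsto_0:
  fixes v \<tau> \<alpha> :: real and V W :: "nat => 'i set"
  assumes v: "0 < v" "v < 1" and p: "p > 0" and \<tau>: "1 / real p < \<tau>" and \<alpha>: "0 < \<alpha>"
    and V: "\<And>n. finite (V n)" "\<And>n. \<alpha> * real n <= real (card (V n))" and W: "\<And>n. finite (W n)" "\<And>n. card (W n) = n"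
  shows "(\<lambda>n. sub_exp v (V n \<times> W n) (\<lambda>S. of_bool (\<not> real (card {j \<in> W n. p dvd card (nbrs S j)}) <= \<tau> * real n))) \<longlonglongrightarrow> 0"
proof (rule tendsto_sandwich[of "\<lambda>_. 0"])
  let ?s = "(1 + \<tau> * real p) / 2"
  have s: "1 < ?s" by (rule tilt_less_1[OF p \<tau>])
  have v': "0 <= v" "v <= 1" using v by auto
  show "\<forall>\<^sub>F n in sequentially. sub_exp v (V n \<times> W n) (\<lambda>S. of_bool (\<not> real (card {j \<in> W n. p dvd card (nbrs S j)}) <= \<tau> * real n))
    <= ?s powr (- (\<tau> * n)) * (tilted_degree v p (V n) ?s + ?s * 0) ^ n * (1 + 0) ^ n"
  proof (rule always_eventually, rule allI)
    fix n
    have "sub_exp v (V n \<times> W n) (\<lambda>S. of_bool (\<not> real (card {j \<in> W n. p dvd card (nbrs S j)}) <= \<tau> * real n))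
      <= sub_exp v (V n \<times> W n) (\<lambda>S. ?s powr (- (\<tau> * n)) * (\<Prod>j\<in>W n. if p dvd card (nbrs S j) then ?s else 1))"
      unfolding prod_if_one[OF W(1)] by (rule sub_exp_mono[OF v' many_tilt]) (use s in simp)
    also have "\<dots> = ?s powr (- (\<tau> * n)) * (\<Prod>j\<in>W n. tilted_degree v p (V n) ?s)"
      unfolding sub_exp_cmult tilted_degree_def
      using sub_exp_prod_columns[OF V(1) W(1), of v n n "\<lambda>_ T. if p dvd card T then ?s else 1"] by simp
    finally show "sub_exp v (V n \<times> W n) (\<lambda>S. of_bool (\<not> real (card {j \<in> W n. p dvd card (nbrs S j)}) <= \<tau> * real n))
      <= ?s powr (- (\<tau> * n)) * (tilted_degree v p (V n) ?s + ?s * 0) ^ n * (1 + 0) ^ n" by (simp add: W(2))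
  qed
  show "\<forall>\<^sub>F n in sequentially. 0 <= sub_exp v (V n \<times> W n) (\<lambda>S. of_bool (\<not> real (card {j \<in> W n. p dvd card (nbrs S j)}) <= \<tau> * real n))"
    using v' by (intro always_eventually allI sub_exp_nonneg) auto
  show "(\<lambda>n. ?s powr (- (\<tau> * n)) * (tilted_degree v p (V n) ?s + ?s * 0) ^ n * (1 + 0) ^ n) \<longlonglongrightarrow> 0"
    by (rule many_rate[OF v p \<tau> \<alpha> V, where x = "\<lambda>_. 0"]) auto
qed simp

context moment_setup
begin

text \<open>
  The parameters are chosen in the order \<open>t\<close>, \<open>\<delta>\<close>, and then \<open>r\<close>, which depends on \<open>\<delta>\<close>. All errors are exponentially
  small in \<open>n\<close>, hence remain small after raising \<open>1 + x n\<close> to the power \<open>2 * n\<close>.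
\<close>

lemma spread_sum_limit:
  assumes m: "\<And>n. \<alpha> * real n <= real (m n)" "\<And>n. m n <= n"
  shows "(\<lambda>n. \<Sum>f1\<in>{f \<in> {..<n} \<rightarrow>\<^sub>E carrier G. f 0 = \<one>}. \<Sum>f2\<in>{n..<n + m n} \<rightarrow>\<^sub>E carrier G.
    of_bool (spread {..<n} {n..<n + m n} f1 f2) * few_prob n {..<n} {n..<n + m n} f1 f2) \<longlonglongrightarrow> 1 / real (order G)"
    (is "?S \<longlonglongrightarrow> _")
proof -
  let ?N = "real (order G)"
  have N: "?N \<ge> 1" by (rule order_pos)
  let ?w = "1 - 1 / (2 * ?N)"
  have w: "0 < ?w" "?w < 1" using N by (auto simp: divide_less_eq)
  \<comment> \<open>one rate governs both the unbalanced labellings and their number\<close>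
  define \<kappa> where "\<kappa> = max rate (?w powr \<alpha>)"
  have \<kappa>: "0 < \<kappa>" "\<kappa> < 1"
    using rate w alpha_pos powr_less_mono'[of ?w 0 \<alpha>] unfolding \<kappa>_def by (auto simp: less_max_iff_disj)
  obtain t \<delta> where t: "0 < t" "t <= 1/2" and \<delta>: "0 < \<delta>" "?N * \<delta> < \<alpha>" and R: "t powr (- (2 * ?N * \<delta>)) * (1 + 3 * ?N\<^sup>2 * t)\<^sup>2 * \<kappa> < 1"
    by (rule rate_parameters[OF \<kappa> alpha_pos N])
  obtain C r where C: "0 <= C" and r: "0 < r" "r < 1" and inv: "\<And>n (V :: nat set) f. finite V ==> f \<in> V \<rightarrow> carrier G ==>
     near_invariant (difference_group G (frequent G (\<delta> * real n) f V)) (C * r ^ n) (nu v q G f V)"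
    using near_invariant_frequent[where 'i = nat, OF fin v q_pos(1) q(3) \<delta>(1)] by blast
  define x where "x n = real q * ?N * (C * r ^ n)" for n
  define bad where "bad = t powr (- (2 * ?N * \<delta>)) * (1 + 3 * ?N\<^sup>2 * t)\<^sup>2 * rate"
  define cnt where "cnt = t powr (- \<delta>) * ?w powr \<alpha>"
  have T: "1 <= (1 + 3 * ?N\<^sup>2 * t)\<^sup>2" using t by (intro one_le_power) simp
  have bad: "0 <= bad" "bad < 1"
  proof -
    show "0 <= bad" unfolding bad_def using rate by (intro mult_nonneg_nonneg) auto
    have "bad <= t powr (- (2 * ?N * \<delta>)) * (1 + 3 * ?N\<^sup>2 * t)\<^sup>2 * \<kappa>" unfolding bad_def \<kappa>_def by (intro mult_left_mono mult_nonneg_nonneg) auto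
    thus "bad < 1" using R by linarith
  qed
  have cnt: "0 <= cnt" "cnt < 1"
  proof -
    show "0 <= cnt" unfolding cnt_def by simp
    have "1 * \<delta> <= 2 * ?N * \<delta>" using N \<delta> by (intro mult_right_mono) auto
    hence "t powr (- \<delta>) <= t powr (- (2 * ?N * \<delta>))" using t by (intro powr_mono') auto
    hence "t powr (- \<delta>) * 1 <= t powr (- (2 * ?N * \<delta>)) * (1 + 3 * ?N\<^sup>2 * t)\<^sup>2" using T by (intro mult_mono) auto
    hence "cnt <= t powr (- (2 * ?N * \<delta>)) * (1 + 3 * ?N\<^sup>2 * t)\<^sup>2 * \<kappa>" unfolding cnt_def \<kappa>_def by (intro mult_mono) auto
    thus "cnt < 1" using R by linarith
  qed
  have rl: "(\<lambda>n. r ^ n) \<longlonglongrightarrow> 0" using r by (intro LIMSEQ_power_zero) simp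
  have x0: "0 <= x n" for n unfolding x_def using C r N by simp
  have "(\<lambda>n. real q * ?N * (C * r ^ n)) \<longlonglongrightarrow> real q * ?N * (C * 0)" by (intro tendsto_intros rl)
  hence xl: "x \<longlonglongrightarrow> 0" unfolding x_def by simp
  have "(\<lambda>n. 2 * (real q * ?N * C) * (real n * r ^ n)) \<longlonglongrightarrow> 2 * (real q * ?N * C) * 0"
    by (intro tendsto_mult tendsto_const times_power_tendsto_0 r)
  moreover have "2 * (real q * ?N * C) * (real n * r ^ n) = real (2 * n) * x n" for n by (simp add: x_def)
  ultimately have nxl: "(\<lambda>n. real (2 * n) * x n) \<longlonglongrightarrow> 0" by simp
  let ?s = "(1 + \<tau> * real p) / 2"
  have p0: "p > 0" using prime_gt_0_nat[OF p] .
  have s: "1 < ?s" by (rule tilt_less_1[OF p0 \<tau>(1)])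
  let ?M = "\<lambda>n. ?s powr (- (\<tau> * n)) * (tilted_degree v p {n..<n + m n} ?s + ?s * x n) ^ n * (1 + x n) ^ n"
  have Ml: "?M \<longlonglongrightarrow> 0"
    by (rule many_rate[where V = "\<lambda>n. {n..<n + m n}", OF v p0 \<tau>(1) alpha_pos _ _ x0 xl]) (use m in auto)
  let ?lo = "\<lambda>n. ((1 - real (2 * n) * x n) - ?M n) / ?N - 2 * ?N * cnt ^ n"
  let ?hi = "\<lambda>n. exp (real (2 * n) * x n) / ?N + 2 * 4 ^ order G * bad ^ n"
  have "(\<lambda>n. real q * (C * r ^ n)) \<longlonglongrightarrow> real q * (C * 0)" by (intro tendsto_intros rl)
  hence "\<forall>\<^sub>F n in sequentially. real q * (C * r ^ n) < t" using t by (intro order_tendstoD) auto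
  moreover have "\<forall>\<^sub>F n in sequentially. x n < 1" by (intro order_tendstoD[OF xl]) simp
  moreover have "\<forall>\<^sub>F n :: nat in sequentially. 0 < n" by (rule eventually_gt_at_top)
  ultimately have ev: "\<forall>\<^sub>F n in sequentially. ?lo n <= ?S n \<and> ?S n <= ?hi n"
  proof eventually_elim
    case (elim n)
    have ps: "pattern_setup G p q e v \<tau> \<alpha> {..<n} {n..<n + m n} n (m n) \<delta> t (C * r ^ n)"
      using moment_setup_axioms elim m[of n] \<delta> t C r inv
      by (intro pattern_setup.intro pattern_setup_axioms.intro) auto
    have small: "real q * ?N * (C * r ^ n) <= 1" using elim(2) unfolding x_def by linarith
    have z: "0 \<in> {..<n}" using elim(3) by simp
    note b = pattern_setup.spread_sum_bounds[OF ps z small less_imp_le[OF s] t(2), folded x_def bad_def cnt_def]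
    have "(1 + x n) ^ (2 * n) <= exp (x n) ^ (2 * n)" using x0[of n] by (intro power_mono exp_ge_add_one_self) auto
    also have "\<dots> = exp (real (2 * n) * x n)" by (simp only: exp_of_nat_mult)
    finally have "(1 + x n) ^ (2 * n) / ?N <= exp (real (2 * n) * x n) / ?N" using N by (intro divide_right_mono) auto
    hence hi: "?S n <= ?hi n" using b(1) by linarith
    have "1 + real (2 * n) * (- x n) <= (1 + - x n) ^ (2 * n)" by (rule Bernoulli_inequality) (use elim(2) in simp)
    hence "1 - real (2 * n) * x n <= (1 - x n) ^ (2 * n)" by simp
    hence "((1 - real (2 * n) * x n) - ?M n) / ?N <= ((1 - x n) ^ (2 * n) - ?M n) / ?N" using N by (intro divide_right_mono) auto
    hence "?lo n <= ?S n" using b(2) by linarith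
    thus ?case using hi by simp
  qed
  show ?thesis
  proof (rule tendsto_sandwich)
    show "\<forall>\<^sub>F n in sequentially. ?lo n <= ?S n" "\<forall>\<^sub>F n in sequentially. ?S n <= ?hi n" using ev by (auto elim: eventually_mono)
    have "?lo \<longlonglongrightarrow> ((1 - 0) - 0) / ?N - 2 * ?N * 0"
      using N cnt by (intro tendsto_intros nxl Ml LIMSEQ_power_zero) auto
    thus "?lo \<longlonglongrightarrow> 1 / ?N" by simp
    have "?hi \<longlonglongrightarrow> exp 0 / ?N + 2 * 4 ^ order G * 0"
      using N bad by (intro tendsto_intros nxl LIMSEQ_power_zero) auto
    thus "?hi \<longlonglongrightarrow> 1 / ?N" by simp
  qed
qed

end

section \<open>Moments of the random sandpile group\<close>

definition few_even :: "nat => real => nat => (nat \<times> nat) set => bool" where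
  "few_even p \<tau> n S \<longleftrightarrow> real (card {j \<in> {..<n}. p dvd card (nbrs S j)}) <= \<tau> * real n"

lemma card_filter_of_bool:
  assumes "finite A"
  shows "real (card {x \<in> A. P x}) = (\<Sum>x\<in>A. of_bool (P x))"
  using sum_of_bool_filter[OF assms, of P "\<lambda>_. 1"] by (simp only: mult_1_right sum_constant)

lemma bipartite_arcs_eq: "bipartite_arcs n m = {n..<n + m} \<times> {..<n} \<union> {..<n} \<times> {n..<n + m}"
  by (auto simp: bipartite_arcs_def)

lemma bipartite_arcs_subset: "bipartite_arcs n m \<subseteq> {..<n + m} \<times> {..<n + m}"
  by (auto simp: bipartite_arcs_def)

lemma bipartite_arcs_loopless: "(i, i) \<notin> bipartite_arcs n m"
  by (simp add: bipartite_arcs_def)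

lemma finite_bipartite_arcs: "finite (bipartite_arcs n m)"
  by (simp add: bipartite_arcs_def)

lemma prob_random_bipartite_digraph:
  assumes "0 <= v" "v <= 1"
  shows "measure_pmf.prob (random_bipartite_digraph n m v) {D. P D} =
    sub_exp v (bipartite_arcs n m) (\<lambda>S. of_bool (P (bip_digraph (n + m) S)))"
proof -
  have "measure_pmf.prob (random_bipartite_digraph n m v) {D. P D} =
    measure_pmf.prob (Pi_pmf (bipartite_arcs n m) False (\<lambda>_. bernoulli_pmf v)) {b. P (bip_digraph (n + m) {e \<in> bipartite_arcs n m. b e})}"
    unfolding random_bipartite_digraph_def measure_map_pmf bip_digraph_def by (simp add: vimage_def)
  also have "\<dots> = sub_exp v (bipartite_arcs n m) (\<lambda>S. of_bool (P (bip_digraph (n + m) S)))"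
    by (rule prob_Pi_pmf_bernoulli[OF finite_bipartite_arcs assms])
  finally show ?thesis .
qed

context comm_group begin

lemma spread_iff_generates:
  assumes f1: "0 \<in> V1" "f 0 = \<one>"
  shows "spread V1 V2 (restrict f V1) (restrict f V2) \<longleftrightarrow> generates G (f ` (V1 \<union> V2))"
proof -
  have im: "restrict f V1 ` V1 \<union> restrict f V2 ` V2 = f ` (V1 \<union> V2)" by (auto simp: image_Un)
  show ?thesis
    unfolding spread_def generates_def im
  proof (intro iffI allI impI)
    fix K assume h: "\<forall>K c. subgroup K G --> c \<in> carrier G --> f ` (V1 \<union> V2) \<subseteq> (\<lambda>k. c \<otimes> k) ` K --> K = carrier G"
      and K: "subgroup K G \<and> f ` (V1 \<union> V2) \<subseteq> K"
    have "x \<in> (\<lambda>k. \<one> \<otimes> k) ` K" if "x \<in> K" for x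
      by (rule image_eqI[OF _ that]) (use subgroup.mem_carrier[OF conjunct1[OF K] that] in simp)
    hence "f ` (V1 \<union> V2) \<subseteq> (\<lambda>k. \<one> \<otimes> k) ` K" using K by (meson subset_iff)
    thus "K = carrier G" using h K one_closed by blast
  next
    fix K c assume h: "\<forall>K. subgroup K G \<and> f ` (V1 \<union> V2) \<subseteq> K --> K = carrier G"
      and K: "subgroup K G" and c: "c \<in> carrier G" and s: "f ` (V1 \<union> V2) \<subseteq> (\<lambda>k. c \<otimes> k) ` K"
    have "f 0 \<in> f ` (V1 \<union> V2)" using f1(1) by blast
    hence "\<one> \<in> (\<lambda>k. c \<otimes> k) ` K" using subsetD[OF s] f1(2) by simp
    hence "c \<in> K" using mem_translate_iff[OF K c one_closed] c by simp
    hence "(\<lambda>k. c \<otimes> k) ` K \<subseteq> K" by (intro image_subsetI subgroup.m_closed[OF K])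
    thus "K = carrier G" using h K s by (meson order.trans)
  qed
qed

end

lemma sum_PiE_split:
  fixes h :: "(nat => 'a) => (nat => 'a) => real"
  assumes n: "0 < n"
  shows "(\<Sum>f\<in>{f \<in> {..<n + m} \<rightarrow>\<^sub>E H. f 0 = z}. h (restrict f {..<n}) (restrict f {n..<n + m})) =
    (\<Sum>f1\<in>{f \<in> {..<n} \<rightarrow>\<^sub>E H. f 0 = z}. \<Sum>f2\<in>{n..<n + m} \<rightarrow>\<^sub>E H. h f1 f2)"
proof -
  let ?j = "\<lambda>(f1, f2). \<lambda>x\<in>{..<n + m}. if x < n then f1 x else f2 x"
  have "(\<Sum>f\<in>{f \<in> {..<n + m} \<rightarrow>\<^sub>E H. f 0 = z}. h (restrict f {..<n}) (restrict f {n..<n + m})) =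
    (\<Sum>(f1, f2)\<in>{f \<in> {..<n} \<rightarrow>\<^sub>E H. f 0 = z} \<times> ({n..<n + m} \<rightarrow>\<^sub>E H). h f1 f2)"
  proof (rule sum.reindex_bij_witness[where i = ?j and j = "\<lambda>f. (restrict f {..<n}, restrict f {n..<n + m})"])
    fix f assume f: "f \<in> {f \<in> {..<n + m} \<rightarrow>\<^sub>E H. f 0 = z}"
    have v: "f i \<in> H" if "i < n + m" for i using f that by (auto simp: PiE_iff)
    show "?j (restrict f {..<n}, restrict f {n..<n + m}) = f"
    proof
      fix x show "?j (restrict f {..<n}, restrict f {n..<n + m}) x = f x"
        using f by (cases "x < n + m") (auto simp: PiE_iff extensional_def)
    qed
    show "(restrict f {..<n}, restrict f {n..<n + m}) \<in> {f \<in> {..<n} \<rightarrow>\<^sub>E H. f 0 = z} \<times> ({n..<n + m} \<rightarrow>\<^sub>E H)"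
      using f v n by simp
    show "(case (restrict f {..<n}, restrict f {n..<n + m}) of (f1, f2) => h f1 f2) = h (restrict f {..<n}) (restrict f {n..<n + m})" by simp
  next
    fix y assume y: "y \<in> {f \<in> {..<n} \<rightarrow>\<^sub>E H. f 0 = z} \<times> ({n..<n + m} \<rightarrow>\<^sub>E H)"
    obtain f1 f2 where f: "y = (f1, f2)" "f1 \<in> {..<n} \<rightarrow>\<^sub>E H" "f1 0 = z" "f2 \<in> {n..<n + m} \<rightarrow>\<^sub>E H" using y by blast
    have v: "f1 i \<in> H" if "i < n" for i using f(2) that by (auto simp: PiE_iff)
    have v2: "f2 i \<in> H" if "n <= i" "i < n + m" for i using f(4) that by (auto simp: PiE_iff)
    have e1: "restrict (?j y) {..<n} = f1"
    proof
      fix x show "restrict (?j y) {..<n} x = f1 x" using f(2) by (cases "x < n") (auto simp: f(1) PiE_iff extensional_def)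
    qed
    have e2: "restrict (?j y) {n..<n + m} = f2"
    proof
      fix x show "restrict (?j y) {n..<n + m} x = f2 x" using f(4) by (cases "x \<in> {n..<n + m}") (auto simp: f(1) PiE_iff extensional_def)
    qed
    show "(restrict (?j y) {..<n}, restrict (?j y) {n..<n + m}) = y" unfolding e1 e2 by (rule f(1)[symmetric])
    show "?j y \<in> {f \<in> {..<n + m} \<rightarrow>\<^sub>E H. f 0 = z}" using v v2 n f(3) by (auto simp: f(1))
  qed
  thus ?thesis by (simp add: sum.cartesian_product)
qed

context moment_setup
begin

text \<open>
  The arcs into the first side and those into the second side are disjoint sets, and the truncation concerns only the former.
\<close>

lemma solution_prob:
  assumes f: "f \<in> {..<n + m} \<rightarrow> carrier G"
  shows "sub_exp v (bipartite_arcs n m) (\<lambda>S. of_bool ((\<forall>j<n + m. finprod G f {i. (i, j) \<in> S} = f j [^] card {i. (i, j) \<in> S}) \<and> few_even p \<tau> n S)) =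
    few_prob n {..<n} {n..<n + m} (restrict f {..<n}) (restrict f {n..<n + m})"
proof -
  let ?V1 = "{..<n}" and ?V2 = "{n..<n + m}"
  let ?f1 = "restrict f ?V1" and ?f2 = "restrict f ?V2"
  let ?A = "?V2 \<times> ?V1" and ?B = "?V1 \<times> ?V2"
  let ?\<phi> = "\<lambda>S. of_bool ((\<forall>j\<in>?V1. finprod G ?f2 (nbrs S j) = ?f1 j [^] card (nbrs S j)) \<and> real (card {j \<in> ?V1. p dvd card (nbrs S j)}) <= \<tau> * real n) :: real"
  let ?\<psi> = "\<lambda>S. of_bool ((\<forall>j\<in>?V2. finprod G ?f1 (nbrs S j) = ?f2 j [^] card (nbrs S j)) \<and> True) :: real"
  have "sub_exp v (bipartite_arcs n m) (\<lambda>S. of_bool ((\<forall>j<n + m. finprod G f {i. (i, j) \<in> S} = f j [^] card {i. (i, j) \<in> S}) \<and> few_even p \<tau> n S)) =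
    sub_exp v (?A \<union> ?B) (\<lambda>S. ?\<phi> (S \<inter> ?A) * ?\<psi> (S \<inter> ?B))"
    unfolding bipartite_arcs_eq
  proof (rule sub_exp_cong)
    fix S assume S: "S \<subseteq> ?A \<union> ?B"
    have nA: "nbrs (S \<inter> ?A) j = {i. (i, j) \<in> S}" "{i. (i, j) \<in> S} \<subseteq> ?V2" if "j \<in> ?V1" for j
      using S that by (fastforce simp: nbrs_def)+
    have nB: "nbrs (S \<inter> ?B) j = {i. (i, j) \<in> S}" "{i. (i, j) \<in> S} \<subseteq> ?V1" if "j \<in> ?V2" for j
      using S that by (fastforce simp: nbrs_def)+
    have fV1: "?f1 i \<in> carrier G" "f i = ?f1 i" if "i \<in> ?V1" for i
      using funcset_mem[OF f, of i] that by simp_all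
    have fV2: "?f2 i \<in> carrier G" "f i = ?f2 i" if "i \<in> ?V2" for i
      using funcset_mem[OF f, of i] that by simp_all
    have cA: "finprod G f {i. (i, j) \<in> S} = finprod G ?f2 (nbrs (S \<inter> ?A) j)" if "j \<in> ?V1" for j
      unfolding nA(1)[OF that] by (rule finprod_cong'[OF refl]) (use nA(2)[OF that] fV2 in blast)+
    have cB: "finprod G f {i. (i, j) \<in> S} = finprod G ?f1 (nbrs (S \<inter> ?B) j)" if "j \<in> ?V2" for j
      unfolding nB(1)[OF that] by (rule finprod_cong'[OF refl]) (use nB(2)[OF that] fV1 in blast)+
    have gen: "of_bool ((P1 \<and> P2) \<and> T) = of_bool (P1 \<and> T) * (of_bool (P2 \<and> True) :: real)" for P1 P2 T
      by (cases P1; cases P2; cases T) simp_all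
    have split: "(\<forall>j<n + m. P j) \<longleftrightarrow> (\<forall>j\<in>?V1. P j) \<and> (\<forall>j\<in>?V2. P j)" for P by (auto simp: not_less)
    have e1: "(\<forall>j\<in>?V1. finprod G f {i. (i, j) \<in> S} = f j [^] card {i. (i, j) \<in> S}) \<longleftrightarrow>
        (\<forall>j\<in>?V1. finprod G ?f2 (nbrs (S \<inter> ?A) j) = ?f1 j [^] card (nbrs (S \<inter> ?A) j))"
      by (rule ball_cong[OF refl]) (simp only: cA nA(1) restrict_apply if_True)
    have e2: "(\<forall>j\<in>?V2. finprod G f {i. (i, j) \<in> S} = f j [^] card {i. (i, j) \<in> S}) \<longleftrightarrow>
        (\<forall>j\<in>?V2. finprod G ?f1 (nbrs (S \<inter> ?B) j) = ?f2 j [^] card (nbrs (S \<inter> ?B) j))"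
      by (rule ball_cong[OF refl]) (simp only: cB nB(1) restrict_apply if_True)
    have e3: "{j \<in> ?V1. p dvd card (nbrs S j)} = {j \<in> ?V1. p dvd card (nbrs (S \<inter> ?A) j)}"
      using nA(1) by (auto simp: nbrs_def)
    show "of_bool ((\<forall>j<n + m. finprod G f {i. (i, j) \<in> S} = f j [^] card {i. (i, j) \<in> S}) \<and> few_even p \<tau> n S) = ?\<phi> (S \<inter> ?A) * ?\<psi> (S \<inter> ?B)"
      unfolding split e1 e2 few_even_def e3 by (rule gen)
  qed
  also have "\<dots> = sub_exp v ?A ?\<phi> * sub_exp v ?B ?\<psi>" by (rule sub_exp_Un_mult) auto
  also have "\<dots> = columns_prob v p G (\<lambda>z. real z <= \<tau> * real n) ?f2 ?V2 ?f1 ?V1 * columns_prob v p G (\<lambda>_. True) ?f1 ?V1 ?f2 ?V2"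
    unfolding columns_prob_def ..
  also have "columns_prob v p G (\<lambda>_. True) ?f1 ?V1 ?f2 ?V2 = (\<Prod>j\<in>?V2. wt v p G ?f1 ?V1 1 (?f2 j))"
    by (rule columns_prob_True) auto
  finally show ?thesis unfolding few_prob_def .
qed

text \<open>
  Linearity of expectation over the labellings that represent surjections.
\<close>

lemma moment_limit:
  assumes m: "\<And>n. \<alpha> * real n <= real (m n)" "\<And>n. m n <= n"
  shows "(\<lambda>n. sub_exp v (bipartite_arcs n (m n)) (\<lambda>S.
      real (card (surs (power_quotient (sandpile_group (bip_digraph (n + m n) S)) q) G)) * of_bool (few_even p \<tau> n S))) \<longlonglongrightarrow> 1 / real (order G)"
proof (rule Lim_transform_eventually[OF spread_sum_limit[OF m]])
  have "(\<Sum>f1\<in>{f \<in> {..<n} \<rightarrow>\<^sub>E carrier G. f 0 = \<one>}. \<Sum>f2\<in>{n..<n + m n} \<rightarrow>\<^sub>E carrier G.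
      of_bool (spread {..<n} {n..<n + m n} f1 f2) * few_prob n {..<n} {n..<n + m n} f1 f2) =
    sub_exp v (bipartite_arcs n (m n)) (\<lambda>S.
      real (card (surs (power_quotient (sandpile_group (bip_digraph (n + m n) S)) q) G)) * of_bool (few_even p \<tau> n S))"
    if n: "0 < n" for n
  proof -
    let ?N = "n + m n" and ?F = "normalized_maps G (n + m n)"
    let ?c = "\<lambda>f S. \<forall>j<?N. finprod G f {i. (i, j) \<in> S} = f j [^] card {i. (i, j) \<in> S}"
    have finF: "finite ?F" by (rule finite_normalized_maps[OF fin])
    have un: "{..<n} \<union> {n..<?N} = {..<?N}" by auto
    have "sub_exp v (bipartite_arcs n (m n)) (\<lambda>S.
        real (card (surs (power_quotient (sandpile_group (bip_digraph ?N S)) q) G)) * of_bool (few_even p \<tau> n S)) =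
      sub_exp v (bipartite_arcs n (m n)) (\<lambda>S. \<Sum>f\<in>?F. of_bool (generates G (f ` {..<?N})) * of_bool (?c f S \<and> few_even p \<tau> n S))"
    proof (rule sub_exp_cong)
      fix S assume S: "S \<subseteq> bipartite_arcs n (m n)"
      have gen: "of_bool (a \<and> b) * of_bool c = of_bool a * (of_bool (b \<and> c) :: real)" for a b c
        by (cases a; cases b; cases c) simp_all
      have "card (surs (power_quotient (sandpile_group (bip_digraph ?N S)) q) G) = card {f \<in> ?F. generates G (f ` {..<?N}) \<and> ?c f S}"
      proof (rule card_surs_sandpile[OF comm_group_axioms q(3)])
        show "0 < ?N" using n by simp
        show "S \<subseteq> {..<?N} \<times> {..<?N}" using S bipartite_arcs_subset by (rule order.trans)
        show "(i, i) \<notin> S" for i using S bipartite_arcs_loopless by (rule contra_subsetD)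
      qed
      hence "real (card (surs (power_quotient (sandpile_group (bip_digraph ?N S)) q) G)) = real (card {f \<in> ?F. generates G (f ` {..<?N}) \<and> ?c f S})"
        by (rule arg_cong)
      also have "real (card {f \<in> ?F. generates G (f ` {..<?N}) \<and> ?c f S}) = (\<Sum>f\<in>?F. of_bool (generates G (f ` {..<?N}) \<and> ?c f S))"
        by (rule card_filter_of_bool[OF finF])
      finally have E: "real (card (surs (power_quotient (sandpile_group (bip_digraph ?N S)) q) G)) =
        (\<Sum>f\<in>?F. of_bool (generates G (f ` {..<?N}) \<and> ?c f S))" .
      have "real (card (surs (power_quotient (sandpile_group (bip_digraph ?N S)) q) G)) * of_bool (few_even p \<tau> n S) =
        (\<Sum>f\<in>?F. of_bool (generates G (f ` {..<?N}) \<and> ?c f S)) * of_bool (few_even p \<tau> n S)" by (rule arg_cong[OF E, of "\<lambda>x. x * of_bool (few_even p \<tau> n S)"])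
      also have "\<dots> = (\<Sum>f\<in>?F. of_bool (generates G (f ` {..<?N})) * of_bool (?c f S \<and> few_even p \<tau> n S))"
        unfolding sum_distrib_right by (rule sum.cong[OF refl]) (rule gen)
      finally show "real (card (surs (power_quotient (sandpile_group (bip_digraph ?N S)) q) G)) * of_bool (few_even p \<tau> n S) =
        (\<Sum>f\<in>?F. of_bool (generates G (f ` {..<?N})) * of_bool (?c f S \<and> few_even p \<tau> n S))" .
    qed
    also have "\<dots> = (\<Sum>f\<in>?F. of_bool (generates G (f ` {..<?N})) * sub_exp v (bipartite_arcs n (m n)) (\<lambda>S. of_bool (?c f S \<and> few_even p \<tau> n S)))"
      by (simp only: sub_exp_sum sub_exp_cmult)
    also have "\<dots> = (\<Sum>f\<in>?F. of_bool (spread {..<n} {n..<?N} (restrict f {..<n}) (restrict f {n..<?N})) *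
        few_prob n {..<n} {n..<?N} (restrict f {..<n}) (restrict f {n..<?N}))"
    proof (rule sum.cong[OF refl])
      fix f assume f: "f \<in> ?F"
      have fc: "f \<in> {..<?N} \<rightarrow> carrier G" and f0: "f 0 = \<one>" using f by (auto simp: normalized_maps_def PiE_iff)
      have g: "generates G (f ` {..<?N}) \<longleftrightarrow> spread {..<n} {n..<?N} (restrict f {..<n}) (restrict f {n..<?N})"
        using spread_iff_generates[of "{..<n}" f "{n..<?N}"] n f0 unfolding un by simp
      show "of_bool (generates G (f ` {..<?N})) * sub_exp v (bipartite_arcs n (m n)) (\<lambda>S. of_bool (?c f S \<and> few_even p \<tau> n S)) =
        of_bool (spread {..<n} {n..<?N} (restrict f {..<n}) (restrict f {n..<?N})) * few_prob n {..<n} {n..<?N} (restrict f {..<n}) (restrict f {n..<?N})"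
        unfolding g solution_prob[OF fc] ..
    qed
    also have "\<dots> = (\<Sum>f1\<in>{f \<in> {..<n} \<rightarrow>\<^sub>E carrier G. f 0 = \<one>}. \<Sum>f2\<in>{n..<?N} \<rightarrow>\<^sub>E carrier G.
      of_bool (spread {..<n} {n..<?N} f1 f2) * few_prob n {..<n} {n..<?N} f1 f2)"
      unfolding normalized_maps_def by (rule sum_PiE_split[OF n])
    finally show ?thesis ..
  qed
  thus "\<forall>\<^sub>F n in sequentially. (\<Sum>f1\<in>{f \<in> {..<n} \<rightarrow>\<^sub>E carrier G. f 0 = \<one>}. \<Sum>f2\<in>{n..<n + m n} \<rightarrow>\<^sub>E carrier G.
      of_bool (spread {..<n} {n..<n + m n} f1 f2) * few_prob n {..<n} {n..<n + m n} f1 f2) =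
    sub_exp v (bipartite_arcs n (m n)) (\<lambda>S.
      real (card (surs (power_quotient (sandpile_group (bip_digraph (n + m n) S)) q) G)) * of_bool (few_even p \<tau> n S))"
    using eventually_gt_at_top[of 0] by (rule eventually_mono[rotated])
qed

end

section \<open>From moments to the distribution\<close>

text \<open>
  The truncation order \<open>k\<close> is fixed while \<open>n\<close> grows, so convergence in \<open>n\<close> need not be uniform in \<open>k\<close>.
\<close>

lemma tendsto_if_alternating_bounds:
  fixes u :: "nat => real" and F :: "nat => nat => real"
  assumes up: "\<And>k n. even k ==> u n <= F k n" and lo: "\<And>k n. odd k ==> F k n <= u n"
    and F: "\<And>k. F k \<longlonglongrightarrow> B k" and B: "B \<longlonglongrightarrow> L"
  shows "u \<longlonglongrightarrow> L"
proof (rule order_tendstoI)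
  fix a assume "a < L"
  hence "\<forall>\<^sub>F k in sequentially. a < B k" by (rule order_tendstoD(1)[OF B])
  then obtain K where "\<And>k. k \<ge> K ==> a < B k" unfolding eventually_sequentially by blast
  hence "a < B (2 * K + 1)" by simp
  hence "\<forall>\<^sub>F n in sequentially. a < F (2 * K + 1) n" by (rule order_tendstoD(1)[OF F])
  thus "\<forall>\<^sub>F n in sequentially. a < u n"
  proof eventually_elim
    case (elim n) thus ?case using lo[of "2 * K + 1" n] by simp
  qed
next
  fix a assume "L < a"
  hence "\<forall>\<^sub>F k in sequentially. B k < a" by (rule order_tendstoD(2)[OF B])
  then obtain K where "\<And>k. k \<ge> K ==> B k < a" unfolding eventually_sequentially by blast
  hence "B (2 * K) < a" by simp
  hence "\<forall>\<^sub>F n in sequentially. F (2 * K) n < a" by (rule order_tendstoD(2)[OF F])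
  thus "\<forall>\<^sub>F n in sequentially. u n < a"
  proof eventually_elim
    case (elim n) thus ?case using up[of "2 * K" n] by simp
  qed
qed

lemma order_AutoGroup_pos:
  assumes "group G" "finite (carrier G)"
  shows "Coset.order (AutoGroup G) > 0"
proof -
  interpret A: group "AutoGroup G" by (rule group.AutoGroup[OF assms(1)])
  have c: "carrier (AutoGroup G) = surs G G" unfolding surs_self_eq_auto[OF assms] by (simp add: AutoGroup_def)
  have "finite (carrier (AutoGroup G))" unfolding c by (rule finite_surs[OF assms(2,2)])
  moreover have "carrier (AutoGroup G) ~= {}" using A.one_closed by (rule ex_in_conv[THEN iffD1, OF exI])
  ultimately show ?thesis unfolding order_def card_gt_0_iff by (rule conjI[rotated])
qed

lemma P_infinity_one_over:
  assumes p: "Factorial_Ring.prime p" and G: "Coset.order G > 0"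
  shows "P_infinity p (1 / real p) G =
        1 / (real (Coset.order G) * real (Coset.order (AutoGroup G))) * prodinf (\<lambda>j. 1 - real p powi (- 2 - int j))"
proof -
  have p1: "real p > 1" using prime_gt_1_nat[OF p] by simp
  have l: "log (real p) (1 / real p) = - 1" using p1 by (simp add: log_divide)
  have "1 / real p / real p * real p powi (- int j) = real p powi (- 2 - int j)" for j
    using p1 by (simp add: power_int_diff power_int_minus power2_eq_square field_simps)
  moreover have "real (Coset.order G) powr (- 1) = 1 / real (Coset.order G)" using G by (simp add: powr_minus_divide)
  ultimately show ?thesis unfolding P_infinity_def l by simp
qed

theorem theorem1p4:
  fixes p :: nat and v \<alpha> :: real and G :: "'a monoid"
  assumes "Factorial_Ring.prime p"
    and "0 < v" and "v < 1"
    and "1 / real p < \<alpha>" and "\<alpha> <= 1"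
    and "finite_abelian_p_group p G"
  shows "((\<lambda>n. measure_pmf.prob (random_bipartite_digraph n (nat \<lceil>\<alpha> * real n\<rceil>) v)
              {D. sylow_part_iso p (sandpile_group D) G})
            \<longlonglongrightarrow> P_infinity p (1 / real p) G)
    \<and> P_infinity p (1 / real p) G =
        1 / (real (Coset.order G) * real (Coset.order (AutoGroup G)))
          * prodinf (\<lambda>j. 1 - real p powi (- 2 - int j))"
proof -
  note p = assms(1)
  have p1: "p > 1" "p > 0" using prime_gt_1_nat[OF p] by auto
  obtain k where G: "comm_group G" "finite (carrier G)" "Coset.order G = p ^ k"
    using assms(6) by (auto simp: finite_abelian_p_group_def)
  have gG: "group G" using G(1) by (rule comm_group.axioms(2))
  define m where "m n = nat \<lceil>\<alpha> * real n\<rceil>" for n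
  \<comment> \<open>any threshold strictly between the expected density and \<open>\<alpha>\<close> would do\<close>
  define \<tau> where "\<tau> = (1 / real p + \<alpha>) / 2"
  have \<tau>: "1 / real p < \<tau>" "\<tau> < \<alpha>" using assms(4) by (simp_all add: \<tau>_def)
  have \<alpha>0: "0 < \<alpha>" using assms(4) p1 by (meson divide_nonneg_nonneg of_nat_0_le_iff order.strict_trans1 zero_le_one)
  have m: "\<alpha> * real n <= real (m n)" "m n <= n" for n
  proof -
    show "\<alpha> * real n <= real (m n)" unfolding m_def using \<alpha>0 by (simp add: of_nat_ceiling)
    have "\<alpha> * real n <= 1 * real n" using assms(5) by (intro mult_right_mono) auto
    thus "m n <= n" unfolding m_def by (simp add: nat_le_iff ceiling_le_iff)
  qed
  have v: "0 <= v" "v <= 1" using assms(2,3) by auto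
  let ?q = "p ^ Suc k"
  let ?A = "\<lambda>n. bipartite_arcs n (m n)"
  define Quo where "Quo n S = power_quotient (sandpile_group (bip_digraph (n + m n) S)) ?q" for n S
  let ?T = "few_even p \<tau>"
  let ?h = "\<lambda>i. card (carrier G) * card (carrier (Elem p i))"
  have hi: "?h i = p ^ k * p ^ i" "?h i > 0" for i
    using G(3) card_Elem[OF p1(2), of i] p1 by (simp_all add: order_def)
  define mom where "mom M n = sub_exp v (?A n) (\<lambda>S. real (card (surs (Quo n S) M)) * of_bool (?T n S))" for M :: "nat monoid" and n
  have mom: "mom M \<longlonglongrightarrow> 1 / real (?h i)" if M: "M \<in> labelled_groups (?h i)" "ext_pairs G (Elem p i) M ~= {}" for M i
  proof -
    note L = labelled_groups_D[OF M(1)]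
    have "moment_setup M p ?q (Suc k) v \<tau> \<alpha>"
      using L(1) p assms(2,3,5) \<tau> labelled_group_exponent[OF G p M]
      by (intro moment_setup.intro moment_setup_axioms.intro) (auto simp: L(2))
    from moment_setup.moment_limit[OF this m] show ?thesis
      unfolding mom_def[abs_def] Quo_def by (simp only: order_def L(2) card_lessThan)
  qed
  have gens: "basis_image \<in> {..<n + m n} \<rightarrow> carrier (sandpile_group (bip_digraph (n + m n) S))"
      "x \<in> carrier (sandpile_group (bip_digraph (n + m n) S)) ==> \<exists>c. x = finprod (sandpile_group (bip_digraph (n + m n) S)) (\<lambda>i. basis_image i [^]\<^bsub>sandpile_group (bip_digraph (n + m n) S)\<^esub> (c i :: int)) {..<n + m n}"
    if nz: "0 < n" and bi: "basis_image = (\<lambda>i. laplacian_image (bip_digraph (n + m n) S) #>\<^bsub>sum_zero_group (n + m n)\<^esub> basis_diff (n + m n) i)" for n S basis_image x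
  proof -
    have N: "0 < n + m n" using nz by linarith
    have V: "card (verts (bip_digraph (n + m n) S)) = n + m n" by (simp add: bip_digraph_simps)
    show "basis_image \<in> {..<n + m n} \<rightarrow> carrier (sandpile_group (bip_digraph (n + m n) S))"
      unfolding bi by (rule sandpile_generators(1)[OF N V])
    show "x \<in> carrier (sandpile_group (bip_digraph (n + m n) S)) ==> \<exists>c. x = finprod (sandpile_group (bip_digraph (n + m n) S)) (\<lambda>i. basis_image i [^]\<^bsub>sandpile_group (bip_digraph (n + m n) S)\<^esub> (c i :: int)) {..<n + m n}"
      unfolding bi by (rule sandpile_generators(2)[OF N V])
  qed
  have Y1: "comm_group (Quo n S)" for n S
    unfolding Quo_def by (rule comm_group.comm_group_power_quotient[OF comm_group_sandpile_group])
  have Y2: "finite (carrier (Quo n S))" if nz: "0 < n" for n S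
    unfolding Quo_def
    by (rule comm_group.finite_power_quotient[OF comm_group_sandpile_group gens(2)[OF nz refl] gens(1)[OF nz refl]]) (use p1 in auto)
  have Y3: "y [^]\<^bsub>Quo n S\<^esub> ?q = \<one>\<^bsub>Quo n S\<^esub>" if "y \<in> carrier (Quo n S)" for n S y
    using that unfolding Quo_def by (rule comm_group.power_quotient_exponent[OF comm_group_sandpile_group])
  have iso: "sylow_part_iso p (sandpile_group (bip_digraph (n + m n) S)) G \<longleftrightarrow> Quo n S \<cong> G" if nz: "0 < n" for n S
    unfolding Quo_def
    by (rule comm_group.sylow_part_iso_iff_power_quotient[OF comm_group_sandpile_group gens(2)[OF nz refl] gens(1)[OF nz refl] p gG G(2,3)])
  let ?a = "real (Coset.order (AutoGroup G))"
  have a: "?a > 0" using order_AutoGroup_pos[OF gG G(2)] by simp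
  define B where "B K n S = (\<Sum>i\<le>K. sgn_coeff (real p) i * real (card (ext_pairs G (Elem p i) (Quo n S))))" for K n S
  define F where "F K n = sub_exp v (?A n) (\<lambda>S. B K n S * of_bool (?T n S))" for K n
  define u where "u n = sub_exp v (?A n) (\<lambda>S. ?a * of_bool (Quo n S \<cong> G) * of_bool (?T n S))" for n
  have inj: "real (card {\<pi> \<in> surs (Quo n S) G. kernel (Quo n S) G \<pi> = {\<one>\<^bsub>Quo n S\<^esub>}}) = ?a * of_bool (Quo n S \<cong> G)" if n: "0 < n" for n S
    using card_injective_surs[OF comm_group.axioms(2)[OF Y1] Y2[OF n] gG G(2), of S] by simp
  have Fu: "even K ==> u n <= F K n" "odd K ==> F K n <= u n" if n: "0 < n" for K n
  proof -
    note bon = surjection_bonferroni[OF Y1 Y2[OF n] G(1,2) p Y3, folded B_def, unfolded inj[OF n]]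
    show "even K ==> u n <= F K n" unfolding u_def F_def by (intro sub_exp_mono[OF v] mult_right_mono bon(1)) auto
    show "odd K ==> F K n <= u n" unfolding u_def F_def by (intro sub_exp_mono[OF v] mult_right_mono bon(2)) auto
  qed
  let ?B = "\<lambda>K. (\<Sum>i\<le>K. sgn_coeff (real p) i * (1 / real p) ^ i) / real (Coset.order G)"
  have FB: "F K \<longlonglongrightarrow> ?B K" for K
  proof -
    let ?c = "\<lambda>i M. real (card (ext_pairs G (Elem p i) M))"
    let ?F = "\<lambda>n. \<Sum>i\<le>K. sgn_coeff (real p) i * ((\<Sum>M\<in>labelled_groups (?h i). ?c i M * mom M n) / fact (?h i))"
    have FE: "F K n = ?F n" if n: "0 < n" for n
    proof -
      have e: "?c i (Quo n S) = (\<Sum>M\<in>labelled_groups (?h i). ?c i M * real (card (surs (Quo n S) M))) / fact (?h i)" for i S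
      proof -
        have "(\<Sum>M\<in>labelled_groups (?h i). card (ext_pairs G (Elem p i) M) * card (surs (Quo n S) M)) = fact (?h i) * card (ext_pairs G (Elem p i) (Quo n S))"
          by (rule card_labelled_quotients[OF Y1 Y2[OF n] G(1,2) comm_group_Elem finite_Elem[OF p1(2)]])
        hence "real (\<Sum>M\<in>labelled_groups (?h i). card (ext_pairs G (Elem p i) M) * card (surs (Quo n S) M)) = real (fact (?h i) * card (ext_pairs G (Elem p i) (Quo n S)))" by (simp only:)
        hence "(\<Sum>M\<in>labelled_groups (?h i). ?c i M * real (card (surs (Quo n S) M))) = fact (?h i) * ?c i (Quo n S)" by (simp only: of_nat_sum of_nat_mult of_nat_fact)
        thus ?thesis by simp
      qed
      have "F K n = sub_exp v (?A n) (\<lambda>S. \<Sum>i\<le>K. \<Sum>M\<in>labelled_groups (?h i). sgn_coeff (real p) i / fact (?h i) * ?c i M * (real (card (surs (Quo n S) M)) * of_bool (?T n S)))"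
        unfolding F_def B_def e by (simp only: sum_distrib_left sum_distrib_right sum_divide_distrib times_divide_eq_right times_divide_eq_left mult_ac)
      also have "\<dots> = (\<Sum>i\<le>K. \<Sum>M\<in>labelled_groups (?h i). sgn_coeff (real p) i / fact (?h i) * ?c i M * mom M n)"
        unfolding mom_def by (simp only: sub_exp_sum sub_exp_cmult)
      also have "\<dots> = ?F n"
        by (simp only: sum_distrib_left sum_divide_distrib times_divide_eq_right times_divide_eq_left mult_ac)
      finally show ?thesis .
    qed
    have ev: "\<forall>\<^sub>F n in sequentially. ?F n = F K n"
      by (rule eventually_mono[OF eventually_gt_at_top[of 0]], rule FE[symmetric])
    have "?F \<longlonglongrightarrow> (\<Sum>i\<le>K. sgn_coeff (real p) i * ((\<Sum>M\<in>labelled_groups (?h i). ?c i M * (1 / real (?h i))) / fact (?h i)))"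
    proof (rule tendsto_sum, rule tendsto_mult[OF tendsto_const], rule tendsto_divide[OF _ tendsto_const], rule tendsto_sum)
      fix i M assume M: "M \<in> labelled_groups (?h i)"
      show "(\<lambda>n. ?c i M * mom M n) \<longlonglongrightarrow> ?c i M * (1 / real (?h i))"
      proof (cases "ext_pairs G (Elem p i) M = {}")
        case False
        show ?thesis by (rule tendsto_mult[OF tendsto_const mom[OF M False]])
      qed simp
    qed simp
    also have "(\<Sum>i\<le>K. sgn_coeff (real p) i * ((\<Sum>M\<in>labelled_groups (?h i). ?c i M * (1 / real (?h i))) / fact (?h i))) = ?B K"
      unfolding sum_divide_distrib
    proof (rule sum.cong[OF refl])
      fix i
      have "real (\<Sum>M\<in>labelled_groups (?h i). card (ext_pairs G (Elem p i) M)) = real (fact (?h i))" by (simp only: sum_card_ext_pairs[OF G p])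
      hence s: "(\<Sum>M\<in>labelled_groups (?h i). ?c i M) = fact (?h i)" by (simp only: of_nat_sum of_nat_fact)
      have "(\<Sum>M\<in>labelled_groups (?h i). ?c i M * (1 / real (?h i)) / fact (?h i)) = (\<Sum>M\<in>labelled_groups (?h i). ?c i M) * (1 / real (?h i)) / fact (?h i)"
        by (simp only: sum_distrib_right sum_divide_distrib)
      also have "\<dots> = 1 / real (?h i)" unfolding s by simp
      also have "\<dots> = (1 / real p) ^ i / real (Coset.order G)" unfolding hi(1) G(3) using p1 by (simp add: power_one_over field_simps)
      finally show "sgn_coeff (real p) i * (\<Sum>M\<in>labelled_groups (?h i). ?c i M * (1 / real (?h i)) / fact (?h i)) = sgn_coeff (real p) i * (1 / real p) ^ i / real (Coset.order G)" by simp
    qed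
    finally show ?thesis using ev by (rule Lim_transform_eventually)
  qed
  let ?L = "prodinf (\<lambda>j. 1 - real p powi (- 2 - int j))"
  have Bl: "?B \<longlonglongrightarrow> ?L / real (Coset.order G)"
    by (intro tendsto_divide euler_product tendsto_const) (use p1 G(3) in auto)
  have ul: "u \<longlonglongrightarrow> ?L / real (Coset.order G)"
  proof (rule LIMSEQ_imp_Suc)
    show "(\<lambda>n. u (Suc n)) \<longlonglongrightarrow> ?L / real (Coset.order G)"
      by (rule tendsto_if_alternating_bounds[where F = "\<lambda>K n. F K (Suc n)", OF _ _ LIMSEQ_Suc[OF FB] Bl])
         (auto intro: Fu(1)[OF zero_less_Suc] Fu(2)[OF zero_less_Suc])
  qed
  define P where "P n = measure_pmf.prob (random_bipartite_digraph n (m n) v) {D. sylow_part_iso p (sandpile_group D) G}" for n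
  define R where "R n = sub_exp v ({n..<n + m n} \<times> {..<n}) (\<lambda>S. of_bool (\<not> ?T n S))" for n
  have Rl: "R \<longlonglongrightarrow> 0"
    unfolding R_def few_even_def
    by (rule many_prob_tendsto_0[where V = "\<lambda>n. {n..<n + m n}" and W = "\<lambda>n. {..<n}", OF assms(2,3) p1(2) \<tau>(1) \<alpha>0]) (use m in auto)
  have PR: "u n / ?a <= P n \<and> P n <= u n / ?a + R n" if n: "0 < n" for n
  proof -
    have Pn: "P n = sub_exp v (?A n) (\<lambda>S. of_bool (Quo n S \<cong> G))"
      unfolding P_def prob_random_bipartite_digraph[OF v] iso[OF n] ..
    have un: "u n / ?a = sub_exp v (?A n) (\<lambda>S. of_bool (Quo n S \<cong> G) * of_bool (?T n S))"
      unfolding u_def mult.assoc sub_exp_cmult using a by simp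
    have Rn: "R n = sub_exp v (?A n) (\<lambda>S. of_bool (\<not> ?T n S))"
    proof -
      let ?A1 = "{n..<n + m n} \<times> {..<n}" and ?A2 = "{..<n} \<times> {n..<n + m n}"
      have "sub_exp v (?A n) (\<lambda>S. of_bool (\<not> ?T n S)) = sub_exp v (?A1 \<union> ?A2) (\<lambda>S. of_bool (\<not> ?T n (S \<inter> ?A1)) * 1)"
        unfolding bipartite_arcs_eq
      proof (rule sub_exp_cong)
        fix S assume S: "S \<subseteq> ?A1 \<union> ?A2"
        have "nbrs S j = nbrs (S \<inter> ?A1) j" if "j < n" for j using S that by (fastforce simp: nbrs_def)
        hence "{j \<in> {..<n}. p dvd card (nbrs S j)} = {j \<in> {..<n}. p dvd card (nbrs (S \<inter> ?A1) j)}" by (auto cong: conj_cong)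
        thus "of_bool (\<not> ?T n S) = of_bool (\<not> ?T n (S \<inter> ?A1)) * (1 :: real)" by (simp add: few_even_def)
      qed
      also have "\<dots> = sub_exp v ?A1 (\<lambda>S. of_bool (\<not> ?T n S)) * sub_exp v ?A2 (\<lambda>_. 1)"
        by (rule sub_exp_Un_mult[where \<psi> = "\<lambda>_. 1"]) auto
      finally show ?thesis unfolding R_def by (simp add: sub_exp_const)
    qed
    have "sub_exp v (?A n) (\<lambda>S. of_bool (Quo n S \<cong> G) * of_bool (?T n S)) <= P n"
      unfolding Pn by (rule sub_exp_mono[OF v]) simp
    moreover have "P n <= sub_exp v (?A n) (\<lambda>S. of_bool (Quo n S \<cong> G) * of_bool (?T n S) + of_bool (\<not> ?T n S))"
      unfolding Pn by (rule sub_exp_mono[OF v]) simp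
    ultimately show ?thesis unfolding un Rn sub_exp_add by blast
  qed
  have ua: "(\<lambda>n. u n / ?a) \<longlonglongrightarrow> ?L / real (Coset.order G) / ?a" using a by (intro tendsto_divide ul tendsto_const) auto
  have Pl: "P \<longlonglongrightarrow> ?L / real (Coset.order G) / ?a"
  proof (rule tendsto_sandwich[OF _ _ ua])
    show "(\<lambda>n. u n / ?a + R n) \<longlonglongrightarrow> ?L / real (Coset.order G) / ?a" using tendsto_add[OF ua Rl] by simp
    show "\<forall>\<^sub>F n in sequentially. u n / ?a <= P n"
      by (rule eventually_mono[OF eventually_gt_at_top[of 0]], rule PR[THEN conjunct1])
    show "\<forall>\<^sub>F n in sequentially. P n <= u n / ?a + R n"
      by (rule eventually_mono[OF eventually_gt_at_top[of 0]], rule PR[THEN conjunct2])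
  qed
  have "Coset.order G > 0" using G(3) p1 by simp
  note PI = P_infinity_one_over[OF p this]
  have "?L / real (Coset.order G) / ?a = P_infinity p (1 / real p) G" unfolding PI by simp
  thus ?thesis using Pl PI unfolding P_def m_def by simp
qed

end
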